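(* Let $f\in\mathbb{Z}[t_1,t_2,t_3]$ be a positive definite ternary quadratic form. Let $U$ be the set of primes $p\equiv 3\pmod 4$ such that $f$ is isotropic over $\mathbb{Z}_p$. Suppose that $f$ over $\mathbb{Z}_p$ is ADC for $p=2$ and for every $p\in U$. Then $v_2(\delta(f))<0$.
   Context: $f$ over $\mathbb{Z}_p$ is ADC if every $x\in\mathbb{Z}_p$ of the form $f(w)$ with $w\in\mathbb{Q}_p^3$ is of the form $f(w')$ with $w'\in\mathbb{Z}_p^3$. $D_f\coloneqq f(\mathbb{Z}^3)\setminus\{0\}$ (a set of positive integers) and $\delta(f)\coloneqq\lim_{N\to\infty}\#(D_f\cap[1,N])/N$. $v_2$ is the $2$-adic valuation on $\mathbb{Q}$. *)

theory Defs
  imports Complex_Main "HOL-Algebra.QuotRing" "HOL-Number_Theory.Cong"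
    "HOL-Computational_Algebra.Primes"
begin

text \<open>With \<open>multiplicity p 0 = 0\<close> we get \<open>padic_val p 0 = 0\<close> instead of \<open>\<infinity>\<close>;
  in particular \<open>padic_val p x < 0\<close> still forces \<open>x \<noteq> 0\<close>.\<close>

definition padic_val :: "nat \<Rightarrow> rat \<Rightarrow> int" where
  "padic_val p x = int (multiplicity (int p) (fst (quotient_of x)))
                 - int (multiplicity (int p) (snd (quotient_of x)))"

definition padic_abs :: "nat \<Rightarrow> rat \<Rightarrow> real" where
  "padic_abs p x = (if x = 0 then 0 else real p powi (- padic_val p x))"

definition padic_Cauchy :: "nat \<Rightarrow> (nat \<Rightarrow> rat) \<Rightarrow> bool" where
  "padic_Cauchy p s \<longleftrightarrow> (\<forall>e>0. \<exists>N. \<forall>m\<ge>N. \<forall>n\<ge>N. padic_abs p (s m - s n) < e)"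

definition padic_null :: "nat \<Rightarrow> (nat \<Rightarrow> rat) \<Rightarrow> bool" where
  "padic_null p s \<longleftrightarrow> (\<lambda>n. padic_abs p (s n)) \<longlonglongrightarrow> 0"

definition padic_Cauchy_ring :: "nat \<Rightarrow> (nat \<Rightarrow> rat) ring" where
  "padic_Cauchy_ring p =
     \<lparr>carrier = {s. padic_Cauchy p s}, monoid.mult = (\<lambda>s t n. s n * t n), one = (\<lambda>n. 1),
      zero = (\<lambda>n. 0), add = (\<lambda>s t n. s n + t n)\<rparr>"

text \<open>\<open>\<rat>\<^sub>p\<close> is the completion of \<open>\<rat>\<close> for the \<open>p\<close>-adic absolute value: Cauchy sequences
  modulo null sequences. \<open>\<int>\<^sub>p\<close> is the closure of \<open>\<int>\<close> in it, as a subset of the carrier. Both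
  are meant for prime \<open>p\<close> only.\<close>

definition Qp :: "nat \<Rightarrow> (nat \<Rightarrow> rat) set ring" where
  "Qp p = padic_Cauchy_ring p Quot {s. padic_null p s}"

definition Zp :: "nat \<Rightarrow> (nat \<Rightarrow> rat) set set" where
  "Zp p = {X \<in> carrier (Qp p). \<exists>s\<in>X. \<forall>n. s n \<in> \<int>}"

text \<open>An integral ternary quadratic form is given by its six coefficients: \<open>coeff_ij\<close> is the
  coefficient of \<open>t\<^sub>i t\<^sub>j\<close>. The mixed coefficients may be odd.\<close>

datatype ternary_form =
  Ternary_Form (coeff_11: int) (coeff_22: int) (coeff_33: int)
               (coeff_12: int) (coeff_13: int) (coeff_23: int)

definition form_eval :: "ternary_form \<Rightarrow> 'a::comm_ring_1 \<times> 'a \<times> 'a \<Rightarrow> 'a" where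
  "form_eval f = (\<lambda>(x, y, z).
     of_int (coeff_11 f) * (x * x) + of_int (coeff_22 f) * (y * y) + of_int (coeff_33 f) * (z * z)
     + of_int (coeff_12 f) * (x * y) + of_int (coeff_13 f) * (x * z) + of_int (coeff_23 f) * (y * z))"

text \<open>The same polynomial evaluated in a ring given by a carrier; \<open>\<rat>\<^sub>p\<close> is such a ring, since
  a type cannot depend on \<open>p\<close>.\<close>

definition form_eval_in :: "('a, 'm) ring_scheme \<Rightarrow> ternary_form \<Rightarrow> 'a \<times> 'a \<times> 'a \<Rightarrow> 'a" where
  "form_eval_in R f = (\<lambda>(x, y, z).
     [coeff_11 f] \<cdot>\<^bsub>R\<^esub> (x \<otimes>\<^bsub>R\<^esub> x) \<oplus>\<^bsub>R\<^esub> [coeff_22 f] \<cdot>\<^bsub>R\<^esub> (y \<otimes>\<^bsub>R\<^esub> y)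
     \<oplus>\<^bsub>R\<^esub> [coeff_33 f] \<cdot>\<^bsub>R\<^esub> (z \<otimes>\<^bsub>R\<^esub> z) \<oplus>\<^bsub>R\<^esub> [coeff_12 f] \<cdot>\<^bsub>R\<^esub> (x \<otimes>\<^bsub>R\<^esub> y)
     \<oplus>\<^bsub>R\<^esub> [coeff_13 f] \<cdot>\<^bsub>R\<^esub> (x \<otimes>\<^bsub>R\<^esub> z) \<oplus>\<^bsub>R\<^esub> [coeff_23 f] \<cdot>\<^bsub>R\<^esub> (y \<otimes>\<^bsub>R\<^esub> z))"

definition positive_definite :: "ternary_form \<Rightarrow> bool" where
  "positive_definite f \<longleftrightarrow> (\<forall>w :: real \<times> real \<times> real. w \<noteq> (0, 0, 0) \<longrightarrow> form_eval f w > 0)"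

definition isotropic_Zp :: "nat \<Rightarrow> ternary_form \<Rightarrow> bool" where
  "isotropic_Zp p f \<longleftrightarrow>
     (\<exists>w \<in> Zp p \<times> Zp p \<times> Zp p. w \<noteq> (\<zero>\<^bsub>Qp p\<^esub>, \<zero>\<^bsub>Qp p\<^esub>, \<zero>\<^bsub>Qp p\<^esub>)
        \<and> form_eval_in (Qp p) f w = \<zero>\<^bsub>Qp p\<^esub>)"

definition ADC_Zp :: "nat \<Rightarrow> ternary_form \<Rightarrow> bool" where
  "ADC_Zp p f \<longleftrightarrow>
     (\<forall>x \<in> Zp p.
        (\<exists>w \<in> carrier (Qp p) \<times> carrier (Qp p) \<times> carrier (Qp p). x = form_eval_in (Qp p) f w)
        \<longrightarrow> (\<exists>w' \<in> Zp p \<times> Zp p \<times> Zp p. x = form_eval_in (Qp p) f w'))"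

definition represented :: "ternary_form \<Rightarrow> int set" where
  "represented f = range (form_eval f) - {0}"

definition density_seq :: "ternary_form \<Rightarrow> nat \<Rightarrow> real" where
  "density_seq f N = real (card (represented f \<inter> {1..int N})) / real N"

definition density :: "ternary_form \<Rightarrow> real" where
  "density f = lim (density_seq f)"

end

theory Submission
  imports Defs "HOL-Analysis.Analysis" "HOL-Number_Theory.Number_Theory" "HOL-Real_Asymp.Real_Asymp"
    "HOL-Computational_Algebra.Squarefree"
begin

text \<open>Let \<open>r(n)\<close> count the representations of \<open>n\<close> by vectors in a large cube. A circle method argument
  (Weyl differencing, Parseval) bounds the mean square of the difference between \<open>r(n)\<close> and its average
  over a short progression \<open>n + j M\<close> with highly divisible \<open>M\<close>. That average is bounded below as soon as
  \<open>n\<close> is represented modulo suitable powers of the primes dividing the determinant, so almost all locally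
  represented integers are represented, and the density is the product over these primes of the
  measures of \<open>f(\<int>\<^sub>p\<^sup>3)\<close>.

  These measures are computed from the square classes represented by \<open>f\<close> over \<open>\<rat>\<^sub>p\<close>. If \<open>f\<close> is
  anisotropic, then \<open>f(\<int>\<^sub>p\<^sup>3)\<close> contains, far from the units, all square classes but one; for
  odd \<open>p\<close> this puts \<open>2 (p + 1)\<close> into the denominator, and for \<open>p = 2\<close> the ADC property leaves only the
  measures \<open>5/6\<close> and \<open>11/12\<close>. If \<open>f\<close> is isotropic and ADC, the measure is 1. If \<open>f\<close> is isotropic and
  \<open>p\<close> is \<open>1\<close> modulo \<open>4\<close>, then \<open>-1\<close> is a square, nonzero residue classes pair off under negation, and
  the measure has odd numerator and denominator. Finally some prime is anisotropic: otherwise a Legendre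
  type descent on the diagonal form \<open>x\<^sup>2 + A y\<^sup>2 + B z\<^sup>2\<close> would end at \<open>x\<^sup>2 + y\<^sup>2 + z\<^sup>2\<close>, which is
  anisotropic at 2.\<close>

hide_const (open) Nonnegative_Lebesgue_Integration.density

text \<open>Three variables are too few for the plain circle method to reach every integer, so only
  mean squares are estimated. A second obstacle is the singular series: the lower bound for the
  average count carries the product of \<open>1 - 1/p\<close> over the primes up to
  \<open>Q\<close>, which tends to 0, while the mean square error contains \<open>1/Q\<close>. The
  argument closes because the square of that product times \<open>Q\<close> still tends to infinity.
  This dictates the order of the choices: \<open>Q\<close>, then the length of the window of values,
  then \<open>M\<close>, then the size of the cube.

  The 2-adic conclusion rests on signs. Under the hypotheses every local measure is a nonzero
  rational of valuation at most 0, so nothing can cancel the negative valuation that an anisotropic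
  prime contributes.

  Representability over the p-adic integers is treated as solvability modulo every power of
  \<open>p\<close>, and over the p-adic field as representability of the product with some nonzero
  square. The completions themselves appear only where the hypotheses are translated.\<close>

fun gradient :: "ternary_form \<Rightarrow> int \<times> int \<times> int \<Rightarrow> int \<times> int \<times> int" where
  "gradient f (x, y, z) =
     (2 * coeff_11 f * x + coeff_12 f * y + coeff_13 f * z,
      coeff_12 f * x + 2 * coeff_22 f * y + coeff_23 f * z,
      coeff_13 f * x + coeff_23 f * y + 2 * coeff_33 f * z)"

text \<open>The determinant of the matrix of \<open>gradient f\<close>, whose diagonal entries are
  doubled coefficients. In this normalisation it is integral for odd mixed coefficients as
  well.\<close>

definition gram_det :: "ternary_form \<Rightarrow> int" where
  "gram_det f = 8 * coeff_11 f * coeff_22 f * coeff_33 f + 2 * coeff_12 f * coeff_13 f * coeff_23 f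
     - 2 * coeff_11 f * (coeff_23 f)\<^sup>2 - 2 * coeff_22 f * (coeff_13 f)\<^sup>2 - 2 * coeff_33 f * (coeff_12 f)\<^sup>2"

fun dot3 :: "int \<times> int \<times> int \<Rightarrow> int \<times> int \<times> int \<Rightarrow> int" where
  "dot3 (x, y, z) (x', y', z') = x * x' + y * y' + z * z'"

lemma form_eval_add:
  "form_eval f (x + u, y + v, z + w) =
     form_eval f (x, y, z) + dot3 (gradient f (u, v, w)) (x, y, z) + form_eval f (u, v, w)"
  for x :: int
  by (simp add: form_eval_def algebra_simps)

text \<open>Cramer's rule: the coefficients on the right are the entries of the adjugate of the
  gradient matrix. It yields injectivity of the gradient, and later the fact that a common divisor
  of the gradient divides the vector up to the factor \<open>gram_det f\<close>.\<close>

lemma gram_det_adjugate: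
  fixes x y z :: int
  assumes "gradient f (x, y, z) = (r, s, t)"
  shows "gram_det f * x = (4 * coeff_22 f * coeff_33 f - (coeff_23 f)\<^sup>2) * r
          + (coeff_13 f * coeff_23 f - 2 * coeff_12 f * coeff_33 f) * s
          + (coeff_12 f * coeff_23 f - 2 * coeff_13 f * coeff_22 f) * t"
    and "gram_det f * y = (coeff_13 f * coeff_23 f - 2 * coeff_12 f * coeff_33 f) * r
          + (4 * coeff_11 f * coeff_33 f - (coeff_13 f)\<^sup>2) * s
          + (coeff_12 f * coeff_13 f - 2 * coeff_23 f * coeff_11 f) * t"
    and "gram_det f * z = (coeff_12 f * coeff_23 f - 2 * coeff_13 f * coeff_22 f) * r
          + (coeff_12 f * coeff_13 f - 2 * coeff_23 f * coeff_11 f) * s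
          + (4 * coeff_11 f * coeff_22 f - (coeff_12 f)\<^sup>2) * t"
  using assms by (auto simp: gram_det_def power2_eq_square algebra_simps)

lemma gradient_inj:
  assumes "gram_det f \<noteq> 0" shows "inj (gradient f)"
proof (rule injI)
  fix v w assume eq: "gradient f v = gradient f w"
  obtain x y z x' y' z' where v: "v = (x,y,z)" and w: "w = (x',y',z')" by (metis prod_cases3)
  obtain r s t where r: "gradient f v = (r,s,t)" by (metis prod_cases3)
  note 1 = gram_det_adjugate[OF r[unfolded v]]
  note 2 = gram_det_adjugate[OF r[unfolded eq w]]
  show "v = w" using 1 2 assms v w by (metis mult_cancel_left)
qed

section \<open>Deviation from the mean over residue classes\<close>

definition ee :: "real \<Rightarrow> complex" where "ee t = cis (2 * pi * t)"

lemma ee_add: "ee (s + t) = ee s * ee t" by (simp add: ee_def cis_mult distrib_left)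
lemma ee_diff: "ee (s - t) = ee s * cnj (ee t)"
  by (simp add: ee_def cis_cnj cis_mult right_diff_distrib)
lemma norm_ee [simp]: "norm (ee t) = 1" by (simp add: ee_def)
lemma ee_of_int [simp]: "ee (of_int n) = 1"
  using cis_multiple_2pi[of "of_int n"] by (simp add: ee_def Ints_of_int)
lemma ee_0 [simp]: "ee 0 = 1" by (simp add: ee_def)

definition nint_dist :: "real \<Rightarrow> real" where "nint_dist t = \<bar>t - of_int (round t)\<bar>"

lemma nint_dist_le_half: "nint_dist t \<le> 1/2"
  unfolding nint_dist_def using of_int_round_abs_le[of t] by (simp add: abs_minus_commute)

lemma nint_dist_nonneg: "nint_dist t \<ge> 0" by (simp add: nint_dist_def)

lemma nint_dist_eq:
  assumes "\<bar>t - of_int n\<bar> \<le> 1/2" shows "nint_dist t = \<bar>t - of_int n\<bar>"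
proof (cases "n = round t")
  case True then show ?thesis by (simp add: nint_dist_def)
next
  case False
  then have "\<bar>n - round t\<bar> \<ge> 1" by linarith
  then have "\<bar>real_of_int n - of_int (round t)\<bar> \<ge> 1" by linarith
  then show ?thesis using assms nint_dist_le_half[of t] unfolding nint_dist_def by linarith
qed

lemma norm_one_minus_cis: "norm (1 - cis x) = 2 * \<bar>sin (x/2)\<bar>"
proof -
  have "(norm (1 - cis x))\<^sup>2 = (1 - cos x)\<^sup>2 + (sin x)\<^sup>2"
    by (simp add: cmod_power2)
  also have "\<dots> = 2 - 2 * cos x" using sin_cos_squared_add[of x] by (simp add: power2_eq_square algebra_simps)
  also have "\<dots> = (2 * \<bar>sin (x/2)\<bar>)\<^sup>2"
    using cos_double_sin[of "x/2"] by (simp add: power_mult_distrib)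
  finally show ?thesis by (subst (asm) power2_eq_iff_nonneg) auto
qed

text \<open>A weak form of Jordan's inequality; any linear lower bound serves the purpose. The
  Taylor bound of order 3 gives sin x \<ge> x/2 up to x = 1.6, and 3 < pi < 3.2 does the
  rest.\<close>

lemma sin_pi_ge:
  assumes "0 \<le> t" "t \<le> 1/2" shows "sin (pi * t) \<ge> t"
proof -
  define x where "x = pi * t"
  have x0: "0 \<le> x" using assms by (simp add: x_def)
  have "\<bar>sin x - (\<Sum>m<3. sin_coeff m * x ^ m)\<bar> \<le> inverse (fact 3) * \<bar>x\<bar> ^ 3"
    by (rule Maclaurin_sin_bound)
  moreover have "(\<Sum>m<3. sin_coeff m * x ^ m) = x"
    by (simp add: sin_coeff_def eval_nat_numeral)
  ultimately have "\<bar>sin x - x\<bar> \<le> x^3/6" using x0 by (simp add: fact_numeral)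
  then have 1: "sin x \<ge> x - x^3/6" by linarith
  have "pi < 32/10" using pi_approx by simp
  moreover have "x \<le> pi * (1/2)" unfolding x_def using assms by (intro mult_left_mono) auto
  ultimately have "x \<le> 16/10" by simp
  then have "x^2 \<le> (16/10)^2" using x0 by (intro power_mono) auto
  then have "x * x^2 \<le> x * (16/10)^2" using x0 by (intro mult_left_mono) auto
  then have "x^3 / 6 \<le> x / 2" using x0 by (simp add: power2_eq_square power3_eq_cube)
  with 1 have "sin x \<ge> x/2" by simp
  moreover have "pi > 3" using pi_approx by simp
  then have "x \<ge> 3 * t" unfolding x_def using assms by (intro mult_right_mono) auto
  ultimately show ?thesis using assms by (simp add: x_def)
qed

lemma norm_one_minus_ee: "norm (1 - ee t) \<ge> 2 * nint_dist t"
proof -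
  have "ee t = ee (t - of_int (round t))"
    using ee_add[of "t - of_int (round t)" "of_int (round t)"] by simp
  then have "norm (1 - ee t) = 2 * \<bar>sin (pi * (t - of_int (round t)))\<bar>"
    by (simp add: ee_def norm_one_minus_cis mult.assoc)
  also have "\<bar>sin (pi * (t - of_int (round t)))\<bar> = \<bar>sin (pi * nint_dist t)\<bar>"
    unfolding nint_dist_def by (smt (verit) mult_minus_right sin_minus)
  finally have "norm (1 - ee t) = 2 * \<bar>sin (pi * nint_dist t)\<bar>" .
  then show ?thesis using sin_pi_ge[OF nint_dist_nonneg nint_dist_le_half, of t] by linarith
qed

lemma norm_one_minus_ee_le: "norm (1 - ee t) \<le> 2 * pi * \<bar>t\<bar>"
proof -
  have "norm (1 - ee t) = 2 * \<bar>sin (pi * t)\<bar>"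
    by (simp add: ee_def norm_one_minus_cis mult.assoc)
  also have "\<bar>sin (pi * t)\<bar> \<le> \<bar>pi * t\<bar>" by (rule abs_sin_x_le_abs_x)
  finally show ?thesis by (simp add: abs_mult)
qed

text \<open>At integers the reciprocal would be the junk value \<open>1 / 0 = 0\<close>.\<close>

definition weyl_kernel :: "nat \<Rightarrow> real \<Rightarrow> real" where
  "weyl_kernel X t = (if nint_dist t = 0 then real X else min (real X) (1 / nint_dist t))"

lemma weyl_kernel_nonneg: "weyl_kernel X t \<ge> 0"
  by (simp add: weyl_kernel_def nint_dist_nonneg)

lemma weyl_kernel_le: "weyl_kernel X t \<le> real X"
  by (simp add: weyl_kernel_def)

lemma weyl_kernel_le': "nint_dist t \<noteq> 0 \<Longrightarrow> weyl_kernel X t \<le> 1 / nint_dist t"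
  by (simp add: weyl_kernel_def)

text \<open>The bound depends on the interval only through its length, because differencing a cube
  produces a different interval for every shift. Multiplication by \<open>1 - ee t\<close> makes the
  sum telescope.\<close>

lemma norm_geometric_sum_le:
  fixes l u :: int
  assumes "u - l \<le> int X"
  shows "norm (\<Sum>n\<in>{l..<u}. ee (t * of_int n)) \<le> weyl_kernel X t"
proof (cases "l \<le> u")
  case False then show ?thesis by (simp add: weyl_kernel_nonneg)
next
  case True
  have "norm (\<Sum>n\<in>{l..<u}. ee (t * of_int n)) \<le> (\<Sum>n\<in>{l..<u}. norm (ee (t * of_int n)))"
    by (rule norm_sum)
  also have "\<dots> \<le> real X" using assms True by simp
  finally have 1: "norm (\<Sum>n\<in>{l..<u}. ee (t * of_int n)) \<le> real X" .
  have "(1 - ee t) * (\<Sum>n\<in>{l..<u}. ee (t * of_int n)) = ee (t * of_int l) - ee (t * of_int u)"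
    using True
  proof (induction u rule: int_ge_induct)
    case base then show ?case by simp
  next
    case (step i)
    then have "{l..<i+1} = insert i {l..<i}" by auto
    then have "(1 - ee t) * (\<Sum>n\<in>{l..<i+1}. ee (t * of_int n)) =
        (1 - ee t) * ee (t * of_int i) + (ee (t * of_int l) - ee (t * of_int i))"
      using step by (simp add: distrib_left)
    also have "\<dots> = ee (t * of_int l) - ee t * ee (t * of_int i)" by (simp add: algebra_simps)
    also have "ee t * ee (t * of_int i) = ee (t * of_int (i + 1))"
      by (simp add: ee_add[symmetric] algebra_simps)
    finally show ?case .
  qed
  then have "norm (1 - ee t) * norm (\<Sum>n\<in>{l..<u}. ee (t * of_int n)) = norm (ee (t * of_int l) - ee (t * of_int u))"
    by (metis norm_mult)
  also have "\<dots> \<le> 2" using norm_triangle_ineq4[of "ee (t * of_int l)" "ee (t * of_int u)"] by simp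
  finally have 2: "norm (1 - ee t) * norm (\<Sum>n\<in>{l..<u}. ee (t * of_int n)) \<le> 2" .
  show ?thesis
  proof (cases "nint_dist t = 0")
    case True then show ?thesis using 1 by (simp add: weyl_kernel_def)
  next
    case False
    then have pos: "nint_dist t > 0" using nint_dist_nonneg[of t] by linarith
    have "(2 * nint_dist t) * norm (\<Sum>n\<in>{l..<u}. ee (t * of_int n)) \<le> 2"
      using 2 norm_one_minus_ee[of t] by (smt (verit) mult_right_mono norm_ge_zero)
    then have "norm (\<Sum>n\<in>{l..<u}. ee (t * of_int n)) \<le> 1 / nint_dist t"
      using pos by (simp add: field_simps)
    then show ?thesis using 1 False by (simp add: weyl_kernel_def)
  qed
qed

section \<open>Weyl differencing for the exponential sum of the form\<close>

definition int_box :: "nat \<Rightarrow> (int \<times> int \<times> int) set" where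
  "int_box X = {0..<int X} \<times> {0..<int X} \<times> {0..<int X}"

lemma finite_box [simp]: "finite (int_box X)" by (simp add: int_box_def)

definition form_sum :: "ternary_form \<Rightarrow> nat \<Rightarrow> real \<Rightarrow> complex" where
  "form_sum f X t = (\<Sum>w\<in>int_box X. ee (t * of_int (form_eval f w)))"

text \<open>The factor 2 makes this dominate the row sums of the gradient matrix with its doubled
  diagonal; the summand 1 keeps it positive for every form.\<close>

definition coeff_bound :: "ternary_form \<Rightarrow> nat" where
  "coeff_bound f = nat (2 * (\<bar>coeff_11 f\<bar> + \<bar>coeff_22 f\<bar> + \<bar>coeff_33 f\<bar> + \<bar>coeff_12 f\<bar> + \<bar>coeff_13 f\<bar> + \<bar>coeff_23 f\<bar>) + 1)"

lemma coeff_bound_pos: "coeff_bound f \<ge> 1" by (simp add: coeff_bound_def)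

lemma gradient_bounded:
  assumes "\<bar>x\<bar> \<le> int X" "\<bar>y\<bar> \<le> int X" "\<bar>z\<bar> \<le> int X"
  shows "gradient f (x,y,z) \<in> {-int (coeff_bound f * X)..int (coeff_bound f * X)} \<times>
     {-int (coeff_bound f * X)..int (coeff_bound f * X)} \<times> {-int (coeff_bound f * X)..int (coeff_bound f * X)}"
proof -
  have ab: "\<bar>a * x + b * y + c * z\<bar> \<le> int (coeff_bound f) * int X"
    if "\<bar>a\<bar> + \<bar>b\<bar> + \<bar>c\<bar> \<le> int (coeff_bound f)" for a b c :: int
  proof -
    have "\<bar>a * x + b * y + c * z\<bar> \<le> \<bar>a\<bar> * \<bar>x\<bar> + \<bar>b\<bar> * \<bar>y\<bar> + \<bar>c\<bar> * \<bar>z\<bar>"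
      by (metis (no_types, opaque_lifting) abs_mult abs_triangle_ineq add_mono_thms_linordered_semiring(3) order_trans)
    also have "\<dots> \<le> \<bar>a\<bar> * int X + \<bar>b\<bar> * int X + \<bar>c\<bar> * int X"
      using assms by (intro add_mono mult_left_mono) auto
    also have "\<dots> = (\<bar>a\<bar> + \<bar>b\<bar> + \<bar>c\<bar>) * int X" by (simp add: algebra_simps)
    also have "\<dots> \<le> int (coeff_bound f) * int X" using that by (intro mult_right_mono) auto
    finally show ?thesis .
  qed
  have c: "\<bar>2 * coeff_11 f\<bar> + \<bar>coeff_12 f\<bar> + \<bar>coeff_13 f\<bar> \<le> int (coeff_bound f)"
    "\<bar>coeff_12 f\<bar> + \<bar>2 * coeff_22 f\<bar> + \<bar>coeff_23 f\<bar> \<le> int (coeff_bound f)"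
    "\<bar>coeff_13 f\<bar> + \<bar>coeff_23 f\<bar> + \<bar>2 * coeff_33 f\<bar> \<le> int (coeff_bound f)"
    by (simp_all add: coeff_bound_def abs_mult)
  show ?thesis
    using ab[of "2 * coeff_11 f" "coeff_12 f" "coeff_13 f", OF c(1)]
      ab[of "coeff_12 f" "2 * coeff_22 f" "coeff_23 f", OF c(2)]
      ab[of "coeff_13 f" "coeff_23 f" "2 * coeff_33 f", OF c(3)]
    by (simp add: abs_le_iff)
qed

lemma sum_prod3:
  fixes g1 g2 g3 :: "'a \<Rightarrow> 'c::comm_semiring_1"
  shows "(\<Sum>(x,y,z)\<in>A\<times>B\<times>C. g1 x * g2 y * g3 z) = sum g1 A * sum g2 B * sum g3 C"
proof -
  have "(\<Sum>(x,y,z)\<in>A\<times>B\<times>C. g1 x * g2 y * g3 z) = (\<Sum>x\<in>A. \<Sum>y\<in>B. \<Sum>z\<in>C. g1 x * g2 y * g3 z)"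
    by (simp add: sum.cartesian_product)
  also have "\<dots> = sum g1 A * sum g2 B * sum g3 C"
    by (simp add: sum_distrib_left[symmetric] sum_distrib_right[symmetric] mult.assoc)
  finally show ?thesis .
qed

text \<open>Weyl differencing: the linear forms in \<open>w\<close> left after differencing by \<open>u\<close> have coefficient
  vector \<open>gradient f u\<close>, and distinct \<open>u\<close> give distinct coefficient vectors.\<close>

lemma norm_form_sum_le:
  fixes X :: nat
  assumes "gram_det f \<noteq> 0"
  defines "H \<equiv> int (coeff_bound f * X)"
  shows "(norm (form_sum f X t))\<^sup>2 \<le> (\<Sum>h\<in>{-H..H}. weyl_kernel X (t * of_int h)) ^ 3"
proof -
  let ?U = "{-int X..int X} \<times> {-int X..int X} \<times> {-int X..int X}"
  \<comment> \<open>For a shift \<open>u\<close> of one coordinate, these are the \<open>v\<close>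
    for which both \<open>v\<close> and \<open>v + u\<close> lie in the interval from 0 to
    \<open>X\<close>.\<close>
  let ?I = "\<lambda>u::int. {max 0 (-u)..<min (int X) (int X - u)}"
  let ?B = "\<lambda>(u1,u2,u3). ?I u1 \<times> ?I u2 \<times> ?I u3"
  let ?k = "\<lambda>h. weyl_kernel X (t * of_int h)"
  define F where "F w = t * of_int (form_eval f w)" for w :: "int \<times> int \<times> int"
  have "complex_of_real ((norm (form_sum f X t))\<^sup>2) = form_sum f X t * cnj (form_sum f X t)"
    by (rule complex_norm_square)
  also have "\<dots> = (\<Sum>w\<in>int_box X. \<Sum>v\<in>int_box X. ee (F w - F v))"
    by (simp add: form_sum_def sum_product F_def ee_diff)
  also have "\<dots> = (\<Sum>(w,v)\<in>int_box X \<times> int_box X. ee (F w - F v))"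
    by (simp add: sum.cartesian_product)
  also have "\<dots> = (\<Sum>(u,v)\<in>Sigma ?U ?B. ee (F (fst v + fst u, fst (snd v) + fst (snd u), snd (snd v) + snd (snd u)) - F v))"
    by (rule sum.reindex_bij_witness[where
          i = "\<lambda>((u1,u2,u3),(v1,v2,v3)). ((v1+u1,v2+u2,v3+u3),(v1,v2,v3))" and
          j = "\<lambda>((w1,w2,w3),(v1,v2,v3)). ((w1-v1,w2-v2,w3-v3),(v1,v2,v3))"])
       (auto simp: int_box_def)
  also have "\<dots> = (\<Sum>u\<in>?U. \<Sum>v\<in>?B u. ee (F (fst v + fst u, fst (snd v) + fst (snd u), snd (snd v) + snd (snd u)) - F v))"
    by (rule sum.Sigma[symmetric]) auto
  finally have eq: "(norm (form_sum f X t))\<^sup>2 = norm (\<Sum>u\<in>?U. \<Sum>v\<in>?B u. ee (F (fst v + fst u, fst (snd v) + fst (snd u), snd (snd v) + snd (snd u)) - F v))"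
    by (metis abs_of_nonneg norm_of_real zero_le_power2)
  let ?K = "\<lambda>(h1,h2,h3). ?k h1 * ?k h2 * ?k h3"
  have inner: "norm (\<Sum>v\<in>?B u. ee (F (fst v + fst u, fst (snd v) + fst (snd u), snd (snd v) + snd (snd u)) - F v)) \<le> ?K (gradient f u)"
    (is "norm ?L \<le> _") for u
  proof -
    obtain u1 u2 u3 where u: "u = (u1,u2,u3)" by (metis prod_cases3)
    obtain h1 h2 h3 where h: "gradient f u = (h1,h2,h3)" by (metis prod_cases3)
    have "?L = (\<Sum>v\<in>?B u. ee (F u) * (case v of (v1,v2,v3) \<Rightarrow>
       ee (t * of_int h1 * of_int v1) * ee (t * of_int h2 * of_int v2) * ee (t * of_int h3 * of_int v3)))"
    proof (rule sum.cong[OF refl])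
      fix v assume "v \<in> ?B u"
      obtain v1 v2 v3 where v: "v = (v1,v2,v3)" by (metis prod_cases3)
      have "F (v1+u1,v2+u2,v3+u3) - F v = F u + (t * of_int h1 * of_int v1 + t * of_int h2 * of_int v2 + t * of_int h3 * of_int v3)"
        unfolding F_def form_eval_add v u using h[unfolded u] by (simp add: algebra_simps)
      then show "ee (F (fst v + fst u, fst (snd v) + fst (snd u), snd (snd v) + snd (snd u)) - F v) =
         ee (F u) * (case v of (v1,v2,v3) \<Rightarrow> ee (t * of_int h1 * of_int v1) * ee (t * of_int h2 * of_int v2) * ee (t * of_int h3 * of_int v3))"
        by (simp add: v u ee_add)
    qed
    also have "\<dots> = ee (F u) * ((\<Sum>v\<in>?I u1. ee (t * of_int h1 * of_int v)) * (\<Sum>v\<in>?I u2. ee (t * of_int h2 * of_int v)) * (\<Sum>v\<in>?I u3. ee (t * of_int h3 * of_int v)))"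
      by (simp only: sum_distrib_left[symmetric] u prod.case sum_prod3)
    finally have "norm ?L = norm (\<Sum>v\<in>?I u1. ee (t * of_int h1 * of_int v)) * norm (\<Sum>v\<in>?I u2. ee (t * of_int h2 * of_int v)) * norm (\<Sum>v\<in>?I u3. ee (t * of_int h3 * of_int v))"
      by (simp add: norm_mult)
    also have "\<dots> \<le> ?k h1 * ?k h2 * ?k h3"
      by (intro mult_mono norm_geometric_sum_le mult_nonneg_nonneg weyl_kernel_nonneg norm_ge_zero) auto
    finally show ?thesis by (simp add: h)
  qed
  have "(norm (form_sum f X t))\<^sup>2 \<le> (\<Sum>u\<in>?U. ?K (gradient f u))"
    unfolding eq by (rule order_trans[OF norm_sum sum_mono]) (rule inner)
  also have "\<dots> = (\<Sum>h\<in>gradient f ` ?U. ?K h)"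
    by (subst sum.reindex) (auto intro: inj_on_subset[OF gradient_inj[OF assms(1)]])
  \<comment> \<open>All terms are nonnegative, so the image of the gradient may be enlarged to a
    full cube, over which the product of kernels factors.\<close>
  also have "\<dots> \<le> (\<Sum>h\<in>{-H..H}\<times>{-H..H}\<times>{-H..H}. ?K h)"
  proof (rule sum_mono2)
    show "gradient f ` ?U \<subseteq> {-H..H} \<times> {-H..H} \<times> {-H..H}"
      unfolding H_def using gradient_bounded[of _ X _ _ f] by (fastforce simp: abs_le_iff simp del: gradient.simps)
  qed (auto simp: weyl_kernel_nonneg)
  also have "\<dots> = (\<Sum>h\<in>{-H..H}. ?k h) ^ 3"
    by (simp add: sum_prod3 power3_eq_cube)
  finally show ?thesis .
qed

section \<open>Linear exponential sums near a rational number\<close>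

lemma sum_inverse_le_ln: "n \<ge> 1 \<Longrightarrow> (\<Sum>r\<in>{1..n}. 1 / real r) \<le> 1 + ln (real n)"
proof (induction n rule: nat_induct_at_least)
  case base then show ?case by simp
next
  case (Suc n)
  have "ln (real n / real (Suc n)) \<le> real n / real (Suc n) - 1"
    using Suc by (intro ln_le_minus_one) auto
  then have "1 / real (Suc n) \<le> ln (real (Suc n)) - ln (real n)"
    using Suc by (simp add: ln_div field_simps)
  then show ?case using Suc by simp
qed

lemma sum_inverse_sqrt_le: "(\<Sum>j\<in>{1..n}. 1 / sqrt (real j)) \<le> 2 * sqrt (real n)"
proof (induction n)
  case 0 then show ?case by simp
next
  case (Suc n)
  have "1 / sqrt (real (Suc n)) \<le> 2 * sqrt (real (Suc n)) - 2 * sqrt (real n)"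
  proof -
    have "0 \<le> (sqrt (real (Suc n)) - sqrt (real n))\<^sup>2" by simp
    then have "2 * (sqrt (real (Suc n)) * sqrt (real n)) \<le> 2 * real n + 1"
      by (simp add: power2_diff)
    then have "1 \<le> (2 * sqrt (real (Suc n)) - 2 * sqrt (real n)) * sqrt (real (Suc n))"
      by (simp add: left_diff_distrib mult.assoc del: of_nat_Suc) (simp add: mult.commute)
    then show ?thesis by (simp add: divide_le_eq)
  qed
  then show ?case using Suc by simp
qed

lemma card_residue_interval:
  fixes l q r :: int
  assumes "q > 0"
  shows "card {h\<in>{l..<l + int N}. h mod q = r} \<le> N div nat q + 1"
proof -
  let ?g = "\<lambda>h. (h - l) div q"
  have inj: "inj_on ?g {h\<in>{l..<l + int N}. h mod q = r}"
  proof (rule inj_onI)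
    fix h h' assume *: "h \<in> {h\<in>{l..<l + int N}. h mod q = r}" "h' \<in> {h\<in>{l..<l + int N}. h mod q = r}"
      "?g h = ?g h'"
    have "(h - l) mod q = (h' - l) mod q" using * by (metis (mono_tags, lifting) mem_Collect_eq mod_diff_left_eq)
    then have "h - l = h' - l" using *(3) by (metis div_mult_mod_eq)
    then show "h = h'" by simp
  qed
  have "?g ` {h\<in>{l..<l + int N}. h mod q = r} \<subseteq> {0..int N div q}"
    using assms by (auto simp: pos_imp_zdiv_nonneg_iff intro!: zdiv_mono1)
  then have "card {h\<in>{l..<l + int N}. h mod q = r} \<le> card {0..int N div q}"
    by (intro card_inj_on_le[OF inj]) auto
  also have "\<dots> = N div nat q + 1"
    using assms by (simp add: nat_add_distrib pos_imp_zdiv_nonneg_iff nat_div_distrib)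
  finally show ?thesis .
qed

lemma sum_residues_le:
  fixes l q :: int and g :: "int \<Rightarrow> real"
  assumes "q > 0" "\<And>r. 0 \<le> r \<Longrightarrow> r < q \<Longrightarrow> g r \<ge> 0"
  shows "(\<Sum>h\<in>{l..<l + int N}. g (h mod q)) \<le> real (N div nat q + 1) * (\<Sum>r\<in>{0..<q}. g r)"
proof -
  have "(\<Sum>h\<in>{l..<l + int N}. g (h mod q)) =
      (\<Sum>r\<in>{0..<q}. \<Sum>h\<in>{h\<in>{l..<l + int N}. h mod q = r}. g (h mod q))"
    using assms by (intro sum.group[symmetric]) auto
  also have "\<dots> = (\<Sum>r\<in>{0..<q}. real (card {h\<in>{l..<l + int N}. h mod q = r}) * g r)"
    by (intro sum.cong refl) simp
  also have "\<dots> \<le> (\<Sum>r\<in>{0..<q}. real (N div nat q + 1) * g r)"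
    using assms(2) card_residue_interval[OF assms(1), of l N]
    by (intro sum_mono mult_right_mono of_nat_mono) auto
  also have "\<dots> = real (N div nat q + 1) * (\<Sum>r\<in>{0..<q}. g r)"
    by (simp add: sum_distrib_left)
  finally show ?thesis .
qed

lemma bij_betw_mult_mod:
  fixes a q :: int
  assumes "coprime a q" "q > 0"
  shows "bij_betw (\<lambda>r. r * a mod q) {0..<q} {0..<q}"
proof -
  have "inj_on (\<lambda>r. r * a mod q) {0..<q}"
  proof (rule inj_onI)
    fix x y assume *: "x \<in> {0..<q}" "y \<in> {0..<q}" "x * a mod q = y * a mod q"
    then have "[x * a = y * a] (mod q)" by (simp add: unique_euclidean_semiring_class.cong_def)
    then have "[x = y] (mod q)" using cong_mult_rcancel[OF assms(1)] by blast
    then show "x = y" using * by (simp add: unique_euclidean_semiring_class.cong_def)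
  qed
  moreover have "(\<lambda>r. r * a mod q) ` {0..<q} \<subseteq> {0..<q}" using assms by auto
  ultimately show ?thesis by (simp add: bij_betw_def endo_inj_surj)
qed

text \<open>Up to the perturbation \<open>h * (q * \<theta> - a)\<close>, the number
  \<open>q * \<theta> * h\<close> is the integer \<open>h * a\<close>, which is at least min(r, q -
  r) \<ge> 1 away from the multiples of \<open>q\<close>. The denominator \<open>4 * H\<close> in
  the approximation keeps the perturbation below 1/4, so three quarters of that distance
  survive.\<close>

lemma nint_dist_ge:
  fixes a q h :: int
  assumes "q > 0" "\<bar>h\<bar> \<le> int H" "H > 0" "\<bar>of_int q * \<theta> - of_int a\<bar> \<le> 1 / (4 * real H)"
    and r: "h * a mod q = r" "r \<noteq> 0"
  shows "nint_dist (\<theta> * of_int h) \<ge> 3/4 * min (real_of_int r) (of_int (q - r)) / of_int q"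
proof -
  define n where "n = round (\<theta> * of_int h)"
  define m where "m = min r (q - r)"
  have r': "0 < r" "r < q" using r assms(1) by (smt (verit, best) pos_mod_sign, smt (verit, best) pos_mod_bound)
  have m1: "m \<ge> 1" using r' by (simp add: m_def)
  obtain k where k: "h * a = k * q + r" using r by (metis div_mult_mod_eq)
  have "\<bar>h * a - n * q\<bar> \<ge> m"
  proof (cases "k \<ge> n")
    case True
    then have "(k - n) * q \<ge> 0" using assms(1) by simp
    then have "h * a - n * q \<ge> r" using k by (simp add: left_diff_distrib)
    then show ?thesis by (simp add: m_def)
  next
    case False
    then have "(n - k) * q \<ge> 1 * q" using assms(1) by (intro mult_right_mono) auto
    then have "h * a - n * q \<le> r - q" using k by (simp add: left_diff_distrib)
    then show ?thesis by (simp add: m_def)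
  qed
  then have 1: "\<bar>real_of_int (h * a - n * q)\<bar> \<ge> real_of_int m" by (metis of_int_abs of_int_le_iff)
  have "\<bar>of_int h * (of_int q * \<theta> - of_int a)\<bar> \<le> real H * (1 / (4 * real H))"
    unfolding abs_mult using assms by (intro mult_mono) (auto simp flip: of_int_abs)
  then have 2: "\<bar>of_int h * (of_int q * \<theta> - of_int a)\<bar> \<le> 1/4" using assms(3) by simp
  have "real_of_int q * (\<theta> * of_int h - of_int n) = of_int h * (of_int q * \<theta> - of_int a) + of_int (h * a - n * q)"
    by (simp add: algebra_simps)
  then have "\<bar>real_of_int q * (\<theta> * of_int h - of_int n)\<bar> \<ge> real_of_int m - 1/4" using 1 2 by linarith
  also have "\<bar>real_of_int q * (\<theta> * of_int h - of_int n)\<bar> = of_int q * nint_dist (\<theta> * of_int h)"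
    using assms(1) by (simp add: abs_mult nint_dist_def n_def)
  finally have "3/4 * real_of_int m \<le> of_int q * nint_dist (\<theta> * of_int h)" using m1 by linarith
  then show ?thesis using assms(1) by (simp add: m_def field_simps of_int_min)
qed

text \<open>Over a period of \<open>h\<close> the residues \<open>h * a mod q\<close> run through
  all classes once, so a period contributes a harmonic sum of order q log q, and there are about H/q
  + 1 periods. As \<open>q\<close> is at most \<open>4 * H\<close>, the total is of order H log H
  whatever the size of \<open>q\<close>.\<close>

lemma weyl_sum_nonmultiples:
  fixes a q :: int
  assumes "q > 0" "q \<le> 4 * int H" "H > 0" "coprime a q"
    and "\<bar>of_int q * \<theta> - of_int a\<bar> \<le> 1 / (4 * real H)"
  shows "(\<Sum>h\<in>{h\<in>{-int H..int H}. \<not> q dvd h}. weyl_kernel X (\<theta> * of_int h)) \<le> 19 * real H * (1 + ln (4 * real H))"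
proof -
  \<comment> \<open>Adding the two reciprocals bounds the reciprocal of the minimum of
    \<open>r\<close> and \<open>q - r\<close> and splits the later sum into two equal harmonic sums.
    The value at 0 is set to 0 because multiples of \<open>q\<close> are treated separately.\<close>
  define g where "g r = (if r = 0 then 0 else 4/3 * of_int q * (1 / real_of_int r + 1 / of_int (q - r)))" for r :: int
  have g0: "g r \<ge> 0" if "0 \<le> r" "r < q" for r
    using that assms(1) by (auto simp: g_def intro!: mult_nonneg_nonneg add_nonneg_nonneg)
  have mr: "r * a mod q \<in> {0..<q}" for r using assms(1) by simp
  have le: "weyl_kernel X (\<theta> * of_int h) \<le> g (h * a mod q)" if "h \<in> {-int H..int H}" "\<not> q dvd h" for h
  proof -
    define r where "r = h * a mod q"
    have r0: "r \<noteq> 0" using that(2) assms(4) unfolding r_def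
      by (metis coprime_dvd_mult_left_iff coprime_commute dvd_eq_mod_eq_0)
    have r': "0 < r" "r < q" using mr[of h] r0 by (auto simp: r_def)
    define m where "m = min (real_of_int r) (of_int (q - r))"
    have m: "m > 0" using r' by (simp add: m_def)
    have nd: "nint_dist (\<theta> * of_int h) \<ge> 3/4 * m / of_int q"
      unfolding m_def by (rule nint_dist_ge[OF assms(1) _ assms(3,5)]) (use that r0 in \<open>auto simp: r_def\<close>)
    moreover have p: "3/4 * m / of_int q > 0" using m assms(1) by simp
    ultimately have nd0: "nint_dist (\<theta> * of_int h) \<noteq> 0" by linarith
    have "weyl_kernel X (\<theta> * of_int h) \<le> 1 / nint_dist (\<theta> * of_int h)" by (rule weyl_kernel_le'[OF nd0])
    also have "\<dots> \<le> 1 / (3/4 * m / of_int q)" using nd p by (intro divide_left_mono mult_pos_pos) linarith+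
    also have "\<dots> = 4/3 * of_int q * (1 / m)" using assms(1) m by (simp add: field_simps)
    also have "\<dots> \<le> 4/3 * of_int q * (1 / real_of_int r + 1 / of_int (q - r))"
      using assms(1) r' by (intro mult_left_mono) (auto simp: m_def min_def)
    finally show ?thesis using r0 by (simp add: g_def r_def)
  qed
  have "(\<Sum>h\<in>{h\<in>{-int H..int H}. \<not> q dvd h}. weyl_kernel X (\<theta> * of_int h)) \<le>
      (\<Sum>h\<in>{h\<in>{-int H..int H}. \<not> q dvd h}. g (h * a mod q))"
    by (intro sum_mono le) auto
  also have "\<dots> \<le> (\<Sum>h\<in>{-int H..int H}. g (h * a mod q))"
    by (intro sum_mono2) (use mr g0 g0[of 0] assms(1) in auto)
  also have "{-int H..int H} = {-int H..<-int H + int (2 * H + 1)}" by auto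
  also have "(\<Sum>h\<in>{-int H..<-int H + int (2 * H + 1)}. g (h * a mod q)) =
     (\<Sum>h\<in>{-int H..<-int H + int (2 * H + 1)}. g ((h mod q) * a mod q))"
    by (simp add: mod_mult_left_eq)
  also have "\<dots> \<le> real ((2 * H + 1) div nat q + 1) * (\<Sum>r\<in>{0..<q}. g (r * a mod q))"
    by (rule sum_residues_le[OF assms(1), where g="\<lambda>r. g (r * a mod q)"]) (use mr g0 in auto)
  also have "(\<Sum>r\<in>{0..<q}. g (r * a mod q)) = (\<Sum>r\<in>{0..<q}. g r)"
    by (rule sum.reindex_bij_betw[OF bij_betw_mult_mod[OF assms(4,1)]])
  also have "(\<Sum>r\<in>{0..<q}. g r) \<le> 8/3 * of_int q * (1 + ln (of_int q))"
  proof -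
    have "(\<Sum>r\<in>{0..<q}. g r) = (\<Sum>r\<in>{1..<q}. g r)"
      using assms(1) by (intro sum.mono_neutral_right) (auto simp: g_def)
    also have "\<dots> = (\<Sum>r\<in>{1..<q}. 4/3 * of_int q * (1 / real_of_int r + 1 / of_int (q - r)))"
      by (intro sum.cong refl) (auto simp: g_def)
    also have "\<dots> = 4/3 * of_int q * ((\<Sum>r\<in>{1..<q}. 1 / real_of_int r) + (\<Sum>r\<in>{1..<q}. 1 / of_int (q - r)))"
      by (simp add: sum_distrib_left sum.distrib distrib_left)
    also have "(\<Sum>r\<in>{1..<q}. 1 / real_of_int (q - r)) = (\<Sum>r\<in>{1..<q}. 1 / real_of_int r)"
      by (rule sum.reindex_bij_witness[where i="\<lambda>r. q - r" and j="\<lambda>r. q - r"]) auto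
    also have "(\<Sum>r\<in>{1..<q}. 1 / real_of_int r) = (\<Sum>r\<in>{1..<nat q}. 1 / real r)"
      by (rule sum.reindex_bij_witness[where i="int" and j="nat"]) auto
    also have "\<dots> \<le> (\<Sum>r\<in>{1..nat q}. 1 / real r)" by (intro sum_mono2) auto
    also have "\<dots> \<le> 1 + ln (real (nat q))" using assms(1) by (intro sum_inverse_le_ln) auto
    also have "real (nat q) = of_int q" using assms(1) by simp
    finally show ?thesis using assms(1) by (simp add: mult_left_mono algebra_simps)
  qed
  also have "real ((2 * H + 1) div nat q + 1) * (8/3 * of_int q * (1 + ln (of_int q))) =
     (real ((2 * H + 1) div nat q + 1) * of_int q) * (8/3 * (1 + ln (of_int q)))" by simp
  \<comment> \<open>With \<open>q\<close> at most \<open>4 * H\<close>, the periods cover at most 2H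
    + 1 + q \<le> 7H integers; then 7 * 8/3 is rounded up to 19.\<close>
  also have "\<dots> \<le> (7 * real H) * (8/3 * (1 + ln (4 * real H)))"
  proof (rule mult_mono)
    have "((2 * H + 1) div nat q + 1) * nat q \<le> 2 * H + 1 + nat q" by simp
    also have "\<dots> \<le> 7 * H" using assms(2,3) by linarith
    finally have "real (((2 * H + 1) div nat q + 1) * nat q) \<le> real (7 * H)" by (simp only: of_nat_le_iff)
    then show "real ((2 * H + 1) div nat q + 1) * of_int q \<le> 7 * real H" using assms(1) by (simp add: distrib_right)
    have "real_of_int q \<le> 4 * real H" using assms(2) by linarith
    then show "8/3 * (1 + ln (of_int q)) \<le> 8/3 * (1 + ln (4 * real H))" using assms(1) by simp
    show "0 \<le> 8/3 * (1 + ln (real_of_int q))" using assms(1) by simp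
  qed simp
  also have "\<dots> \<le> 19 * real H * (1 + ln (4 * real H))"
  proof -
    have "ln (4 * real H) \<ge> 0" using assms(3) by simp
    then have "0 \<le> real H * (1 + ln (4 * real H))" by (intro mult_nonneg_nonneg) auto
    then have "56/3 * (real H * (1 + ln (4 * real H))) \<le> 19 * (real H * (1 + ln (4 * real H)))" by linarith
    then show ?thesis by (simp add: algebra_simps)
  qed
  finally show ?thesis by (simp add: mult_left_mono)
qed

text \<open>For \<open>h = q * j\<close> the nearest integer to \<open>\<theta> * h\<close> is
  \<open>j * a\<close>, at distance j q t, so the terms are bounded both by \<open>X\<close> and by
  1/(j q t). What matters is the decay like the inverse square root of H^2 t: after cubing it
  becomes the exponent 3/2, which is integrable in \<open>\<theta>\<close>.\<close>

lemma weyl_sum_multiples: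
  fixes a q :: int
  assumes "q > 0" "H > 0" "X \<le> H"
    and "\<bar>of_int q * \<theta> - of_int a\<bar> \<le> 1 / (4 * real H)"
  defines "t \<equiv> \<bar>\<theta> - of_int a / of_int q\<bar>"
  shows "(\<Sum>j\<in>{1..H div nat q}. weyl_kernel X (\<theta> * of_int (q * int j))) \<le>
     3 * (real H ^ 2 / of_int q) / sqrt (1 + real H ^ 2 * t)"
    and "(\<Sum>j\<in>{1..H div nat q}. weyl_kernel X (\<theta> * of_int (- (q * int j)))) \<le>
     3 * (real H ^ 2 / of_int q) / sqrt (1 + real H ^ 2 * t)"
proof -
  define J where "J = H div nat q"
  define E where "E = real H ^ 2 / of_int q"
  have qt: "\<bar>of_int q * \<theta> - of_int a\<bar> = of_int q * t"
  proof -
    have "of_int q * \<theta> - of_int a = of_int q * (\<theta> - of_int a / of_int q)"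
      using assms(1) by (simp add: right_diff_distrib)
    then show ?thesis using assms(1) by (simp add: t_def abs_mult)
  qed
  have Jq: "real J * of_int q \<le> real H"
  proof -
    have "J * nat q \<le> H" by (simp add: J_def)
    then have "real (J * nat q) \<le> real H" by (simp only: of_nat_le_iff)
    then show ?thesis using assms(1) by simp
  qed
  have t0: "t \<ge> 0" by (simp add: t_def)
  have E0: "E \<ge> 0" using assms(1) by (simp add: E_def)
  have main: "(\<Sum>j\<in>{1..J}. k j) \<le> 3 * E / sqrt (1 + real H ^ 2 * t)"
    if k1: "\<And>j. k j \<le> real X" and k2: "\<And>j. 1 \<le> j \<Longrightarrow> j \<le> J \<Longrightarrow> t \<noteq> 0 \<Longrightarrow> k j \<le> 1 / (real j * of_int q * t)" for k
  proof -
    have XH: "real X \<le> real H" using assms(3) by simp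
    have "(\<Sum>j\<in>{1..J}. k j) \<le> real J * real X" using sum_bounded_above[of "{1..J}" k "real X"] k1 by simp
    also have "\<dots> \<le> (real H / of_int q) * real H"
      using Jq XH assms(1) by (intro mult_mono) (auto simp: field_simps)
    finally have b1: "(\<Sum>j\<in>{1..J}. k j) \<le> E" by (simp add: E_def power2_eq_square)
    show ?thesis
    proof (cases "real H ^ 2 * t \<le> 1")
      case True
      then have "sqrt (1 + real H ^ 2 * t) \<le> sqrt (3\<^sup>2)" by (intro real_sqrt_le_mono) simp
      then have s3: "sqrt (1 + real H ^ 2 * t) \<le> 3" by simp
      have sp: "sqrt (1 + real H ^ 2 * t) > 0" using t0 by (simp add: add_pos_nonneg)
      have "E * sqrt (1 + real H ^ 2 * t) \<le> 3 * E" using s3 E0 by (simp add: mult.commute mult_left_mono)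
      then have "E \<le> 3 * E / sqrt (1 + real H ^ 2 * t)" using sp by (simp add: pos_le_divide_eq)
      then show ?thesis using b1 by linarith
    next
      case False
      then have tp: "t > 0" using t0 by (metis le_less mult_zero_right zero_le_one)
      \<comment> \<open>The geometric mean of the two bounds \<open>H\<close> and 1/(j q t); its sum
        over \<open>j\<close> has the order of a square root and carries no logarithm.\<close>
      have kj: "k j \<le> sqrt (real H / (of_int q * t)) * (1 / sqrt (real j))" if "j \<in> {1..J}" for j
      proof (cases "k j \<le> 0")
        case True
        have "0 \<le> sqrt (real H / (of_int q * t)) * (1 / sqrt (real j))"
          using tp assms(1) by simp
        then show ?thesis using True by linarith
      next
        case False
        have "k j * k j \<le> real H * (1 / (real j * of_int q * t))"
          using False k1[of j] XH k2[of j] that tp by (intro mult_mono) auto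
        then have "sqrt (k j * k j) \<le> sqrt (real H * (1 / (real j * of_int q * t)))"
          by (rule real_sqrt_le_mono)
        moreover have "sqrt (k j * k j) = k j" using False by simp
        moreover have "real H * (1 / (real j * of_int q * t)) = real H / (of_int q * t) * (1 / real j)" by simp
        ultimately show ?thesis by (simp add: real_sqrt_mult real_sqrt_divide mult_ac)
      qed
      have "(\<Sum>j\<in>{1..J}. k j) \<le> (\<Sum>j\<in>{1..J}. sqrt (real H / (of_int q * t)) * (1 / sqrt (real j)))"
        by (intro sum_mono kj)
      also have "\<dots> = sqrt (real H / (of_int q * t)) * (\<Sum>j\<in>{1..J}. 1 / sqrt (real j))"
        by (simp add: sum_distrib_left)
      also have "\<dots> \<le> sqrt (real H / (of_int q * t)) * (2 * sqrt (real H / of_int q))"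
      proof -
        have "real J \<le> real H / of_int q" using Jq assms(1) by (simp add: field_simps)
        then have "sqrt (real J) \<le> sqrt (real H / of_int q)" by simp
        then have "(\<Sum>j\<in>{1..J}. 1 / sqrt (real j)) \<le> 2 * sqrt (real H / of_int q)"
          using sum_inverse_sqrt_le[of J] by linarith
        then show ?thesis using tp assms(1) by (intro mult_left_mono) auto
      qed
      also have "\<dots> = 2 * E / sqrt (real H ^ 2 * t)"
      proof -
        have "sqrt (real H / (of_int q * t)) * sqrt (real H / of_int q) = real H / (of_int q * sqrt t)"
          using assms(1) by (simp add: real_sqrt_mult real_sqrt_divide)
        then show ?thesis using assms(2) by (simp add: E_def real_sqrt_mult power2_eq_square)
      qed
      also have "\<dots> \<le> 3 * E / sqrt (1 + real H ^ 2 * t)"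
      proof -
        define s where "s = real H ^ 2 * t"
        have s: "s > 1" using False by (simp add: s_def)
        have "2 * sqrt (1 + s) \<le> 3 * sqrt s"
        proof -
          have "sqrt (4 * (1 + s)) \<le> sqrt (9 * s)" using s by (intro real_sqrt_le_mono) simp
          moreover have "sqrt (4 * (1 + s)) = 2 * sqrt (1 + s)" "sqrt (9 * s) = 3 * sqrt s"
            using real_sqrt_mult[of 4 "1 + s"] real_sqrt_mult[of 9 s] by simp_all
          ultimately show ?thesis by simp
        qed
        then have "E * (2 * sqrt (1 + s)) \<le> E * (3 * sqrt s)" using E0 by (rule mult_left_mono)
        moreover have "sqrt s > 0" "sqrt (1 + s) > 0" using s by auto
        ultimately have "2 * E / sqrt s \<le> 3 * E / sqrt (1 + s)" by (simp add: field_simps)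
        then show ?thesis by (simp add: s_def)
      qed
      finally show ?thesis .
    qed
  qed
  have nd: "nint_dist (\<theta> * of_int (\<sigma> * (q * int j))) = real j * of_int q * t"
    if "1 \<le> j" "j \<le> J" "\<sigma> = 1 \<or> \<sigma> = -1" for j and \<sigma> :: int
  proof -
    have J: "real j \<le> real H" using that(2) by (simp add: J_def) (metis div_le_dividend le_trans)
    have eq: "\<theta> * of_int (\<sigma> * (q * int j)) - of_int (\<sigma> * int j * a) = of_int \<sigma> * (real j * (of_int q * \<theta> - of_int a))"
      by (simp add: algebra_simps)
    have ab: "\<bar>\<theta> * of_int (\<sigma> * (q * int j)) - of_int (\<sigma> * int j * a)\<bar> = real j * of_int q * t"
      unfolding eq using that(3) qt by (auto simp: abs_mult)
    have "real j * of_int q * t \<le> real H * (1 / (4 * real H))"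
      using assms(4) J t0 assms(1) unfolding qt mult.assoc by (intro mult_mono) auto
    also have "\<dots> \<le> 1/2" by simp
    finally show ?thesis using nint_dist_eq[of "\<theta> * of_int (\<sigma> * (q * int j))" "\<sigma> * int j * a"] ab by simp
  qed
  have K: "weyl_kernel X (\<theta> * of_int (\<sigma> * (q * int j))) \<le> 1 / (real j * of_int q * t)"
    if "1 \<le> j" "j \<le> J" "\<sigma> = 1 \<or> \<sigma> = -1" "t \<noteq> 0" for j and \<sigma> :: int
    using weyl_kernel_le'[of "\<theta> * of_int (\<sigma> * (q * int j))" X] nd[OF that(1-3)] that(1,4) assms(1) by auto
  show "(\<Sum>j\<in>{1..H div nat q}. weyl_kernel X (\<theta> * of_int (q * int j))) \<le>
     3 * (real H ^ 2 / of_int q) / sqrt (1 + real H ^ 2 * t)"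
    using main[of "\<lambda>j. weyl_kernel X (\<theta> * of_int (q * int j))"] weyl_kernel_le K[of _ 1] by (simp add: J_def E_def)
  show "(\<Sum>j\<in>{1..H div nat q}. weyl_kernel X (\<theta> * of_int (- (q * int j)))) \<le>
     3 * (real H ^ 2 / of_int q) / sqrt (1 + real H ^ 2 * t)"
    using main[of "\<lambda>j. weyl_kernel X (\<theta> * of_int (- (q * int j)))"] weyl_kernel_le K[of _ "-1"] by (simp add: J_def E_def)
qed

text \<open>Multiples and nonmultiples of \<open>q\<close> are combined. The term at 0 is absorbed
  by raising 19 to 20, and the two signs of the multiples turn 3 into 6.\<close>

lemma weyl_sum_le:
  fixes a q :: int
  assumes "q > 0" "q \<le> 4 * int H" "H > 0" "X \<le> H" "coprime a q"
    and "\<bar>of_int q * \<theta> - of_int a\<bar> \<le> 1 / (4 * real H)"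
  shows "(\<Sum>h\<in>{-int H..int H}. weyl_kernel X (\<theta> * of_int h)) \<le> 20 * real H * (1 + ln (4 * real H))
     + 6 * (real H ^ 2 / of_int q) / sqrt (1 + real H ^ 2 * \<bar>\<theta> - of_int a / of_int q\<bar>)"
proof -
  let ?k = "\<lambda>h. weyl_kernel X (\<theta> * of_int h)"
  let ?P = "(\<lambda>j. q * int j) ` {1..H div nat q}" and ?N = "(\<lambda>j. - (q * int j)) ` {1..H div nat q}"
  have sub: "{-int H..int H} \<subseteq> {h\<in>{-int H..int H}. \<not> q dvd h} \<union> ({0} \<union> (?P \<union> ?N))"
  proof
    fix h assume h: "h \<in> {-int H..int H}"
    show "h \<in> {h\<in>{-int H..int H}. \<not> q dvd h} \<union> ({0} \<union> (?P \<union> ?N))"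
    proof (cases "q dvd h")
      case False then show ?thesis using h by simp
    next
      case True
      then obtain j where j: "h = q * j" by auto
      have "nat q * nat \<bar>j\<bar> \<le> H" using h j assms(1)
        by (metis abs_le_iff abs_mult abs_of_pos atLeastAtMost_iff minus_le_iff nat_abs_mult_distrib nat_le_iff)
      then have jl: "nat \<bar>j\<bar> \<le> H div nat q" using assms(1)
        by (metis less_eq_div_iff_mult_less_eq mult.commute zero_less_nat_eq)
      consider "j = 0" | "j > 0" | "j < 0" by linarith
      then show ?thesis
      proof cases
        case 1 then show ?thesis using j by simp
      next
        case 2 then have "h \<in> ?P" using jl j by (intro image_eqI[of _ _ "nat j"]) auto
        then show ?thesis by simp
      next
        case 3 then have "h \<in> ?N" using jl j by (intro image_eqI[of _ _ "nat (-j)"]) auto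
        then show ?thesis by simp
      qed
    qed
  qed
  have fin: "finite {h\<in>{-int H..int H}. \<not> q dvd h}" by (rule finite_subset[of _ "{-int H..int H}"]) auto
  have un: "sum ?k (A \<union> B) \<le> sum ?k A + sum ?k B" if "finite A" "finite B" for A B
    using sum.union_inter[OF that, of ?k] sum_nonneg[of "A \<inter> B" ?k] weyl_kernel_nonneg by (metis (no_types, lifting) add_increasing2 order_refl)
  have injP: "inj_on (\<lambda>j. q * int j) {1..H div nat q}" "inj_on (\<lambda>j. - (q * int j)) {1..H div nat q}"
    using assms(1) by (auto simp: inj_on_def)
  have "sum ?k {-int H..int H} \<le> sum ?k ({h\<in>{-int H..int H}. \<not> q dvd h} \<union> ({0} \<union> (?P \<union> ?N)))"
    using fin by (intro sum_mono2 sub) (auto simp: weyl_kernel_nonneg)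
  also have "\<dots> \<le> sum ?k {h\<in>{-int H..int H}. \<not> q dvd h} + (sum ?k {0} + (sum ?k ?P + sum ?k ?N))"
    using fin by (intro order_trans[OF un] add_left_mono) auto
  also have "sum ?k ?P = (\<Sum>j\<in>{1..H div nat q}. ?k (q * int j))" by (subst sum.reindex[OF injP(1)]) (simp add: o_def)
  also have "sum ?k ?N = (\<Sum>j\<in>{1..H div nat q}. ?k (-(q * int j)))" by (subst sum.reindex[OF injP(2)]) (simp add: o_def)
  finally have 1: "sum ?k {-int H..int H} \<le> sum ?k {h\<in>{-int H..int H}. \<not> q dvd h} + (sum ?k {0} +
    ((\<Sum>j\<in>{1..H div nat q}. ?k (q * int j)) + (\<Sum>j\<in>{1..H div nat q}. ?k (-(q * int j)))))" .
  have "sum ?k {0} \<le> real H" using weyl_kernel_le[of X 0] assms(4) by simp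
  moreover have "ln (4 * real H) \<ge> 0" using assms(3) by simp
  then have "real H * ln (4 * real H) \<ge> 0" by (intro mult_nonneg_nonneg) auto
  then have "19 * real H * (1 + ln (4 * real H)) + real H \<le> 20 * real H * (1 + ln (4 * real H))"
    by (simp add: algebra_simps)
  ultimately show ?thesis
    using 1 weyl_sum_nonmultiples[OF assms(1,2,3,5,6), of X] weyl_sum_multiples[OF assms(1,3,4,6)] by linarith
qed

section \<open>Parseval's identity and the averaging kernel\<close>

lemma has_integral_cos_multiple:
  "((\<lambda>\<theta>. cos (2 * pi * of_int k * \<theta>)) has_integral (if k = 0 then 1 else 0)) {0..1::real}"
proof (cases "k = 0")
  case True then show ?thesis using has_integral_const_real[of "1::real" 0 1] by simp
next
  case False
  define c where "c = 2 * pi * real_of_int k"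
  have c0: "c \<noteq> 0" using False by (simp add: c_def)
  have "((\<lambda>\<theta>. cos (c * \<theta>)) has_integral (sin (c * 1) / c - sin (c * 0) / c)) {0..1}"
    by (rule fundamental_theorem_of_calculus)
       (auto intro!: derivative_eq_intros simp: c0 simp flip: has_real_derivative_iff_has_vector_derivative)
  moreover have "sin c = 0" unfolding c_def by (metis mult.commute mult.left_commute sin_int_2pin)
  ultimately show ?thesis using False by (simp add: c_def)
qed

lemma trig_poly_parseval:
  fixes g :: "int \<Rightarrow> real"
  assumes "finite A"
  shows "((\<lambda>\<theta>. (norm (\<Sum>n\<in>A. of_real (g n) * ee (\<theta> * of_int n)))\<^sup>2) has_integral (\<Sum>n\<in>A. (g n)\<^sup>2)) {0..1}"
proof -
  have eq: "(norm (\<Sum>n\<in>A. of_real (g n) * ee (\<theta> * of_int n)))\<^sup>2 =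
      (\<Sum>n\<in>A. \<Sum>m\<in>A. g n * g m * cos (2 * pi * of_int (n - m) * \<theta>))" for \<theta>
  proof -
    let ?S = "\<Sum>n\<in>A. of_real (g n) * ee (\<theta> * of_int n)"
    have "(norm ?S)\<^sup>2 = Re (?S * cnj ?S)" by (metis Re_complex_of_real complex_norm_square)
    also have "?S * cnj ?S = (\<Sum>n\<in>A. \<Sum>m\<in>A. of_real (g n * g m) * ee (\<theta> * of_int n - \<theta> * of_int m))"
      by (simp add: sum_product ee_diff mult_ac)
    also have "Re \<dots> = (\<Sum>n\<in>A. \<Sum>m\<in>A. g n * g m * cos (2 * pi * of_int (n - m) * \<theta>))"
      by (simp add: ee_def algebra_simps)
    finally show ?thesis .
  qed
  have "((\<lambda>\<theta>. \<Sum>n\<in>A. \<Sum>m\<in>A. g n * g m * cos (2 * pi * of_int (n - m) * \<theta>)) has_integral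
     (\<Sum>n\<in>A. \<Sum>m\<in>A. g n * g m * (if n - m = 0 then 1 else 0))) {0..1}"
    by (intro has_integral_sum assms has_integral_mult_right has_integral_cos_multiple)
  moreover have "(\<Sum>n\<in>A. \<Sum>m\<in>A. g n * g m * (if n - m = 0 then 1 else 0)) = (\<Sum>n\<in>A. (g n)\<^sup>2)"
  proof (intro sum.cong refl)
    fix n assume "n \<in> A"
    have "(\<Sum>m\<in>A. g n * g m * (if n - m = 0 then 1 else 0)) = (\<Sum>m\<in>A. if n = m then g n * g m else 0)"
      by (intro sum.cong) auto
    then show "(\<Sum>m\<in>A. g n * g m * (if n - m = 0 then 1 else 0)) = (g n)\<^sup>2"
      using assms \<open>n \<in> A\<close> by (simp add: power2_eq_square)
  qed
  ultimately show ?thesis by (simp add: eq)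
qed

definition rep_count :: "ternary_form \<Rightarrow> nat \<Rightarrow> int \<Rightarrow> real" where
  "rep_count f X n = real (card {w\<in>int_box X. form_eval f w = n})"

definition rep_average :: "ternary_form \<Rightarrow> nat \<Rightarrow> nat \<Rightarrow> nat \<Rightarrow> int \<Rightarrow> real" where
  "rep_average f X K M n = (\<Sum>j<K. rep_count f X (n + int (j * M))) / real K"

text \<open>The multiplier by which averaging over the shifts \<open>j * M\<close> acts on Fourier
  series; the conjugate arises because \<open>n\<close> is shifted upwards. It equals 1 at fractions
  whose denominator divides \<open>M\<close>, so the deviation from the average is suppressed
  exactly where the exponential sum is large.\<close>

definition average_kernel :: "nat \<Rightarrow> nat \<Rightarrow> real \<Rightarrow> complex" where
  "average_kernel K M \<theta> = (\<Sum>j<K. cnj (ee (\<theta> * real (j * M)))) / of_nat K"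

lemma rep_count_fourier:
  assumes "finite A" "\<And>w. w \<in> int_box X \<Longrightarrow> form_eval f w - c \<in> A"
  shows "(\<Sum>n\<in>A. of_real (rep_count f X (n + c)) * ee (\<theta> * of_int n)) = form_sum f X \<theta> * cnj (ee (\<theta> * of_int c))"
proof -
  have "of_real (rep_count f X (n + c)) = (\<Sum>w\<in>int_box X. if form_eval f w - c = n then 1 else (0::complex))" for n
  proof -
    have "{w\<in>int_box X. form_eval f w = n + c} = {w\<in>int_box X. form_eval f w - c = n}" by auto
    then show ?thesis by (simp add: rep_count_def sum.If_cases Int_def)
  qed
  then have "(\<Sum>n\<in>A. of_real (rep_count f X (n + c)) * ee (\<theta> * of_int n)) =
      (\<Sum>n\<in>A. \<Sum>w\<in>int_box X. (if form_eval f w - c = n then 1 else 0) * ee (\<theta> * of_int n))"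
    by (simp add: sum_distrib_right)
  also have "\<dots> = (\<Sum>w\<in>int_box X. \<Sum>n\<in>A. (if form_eval f w - c = n then 1 else 0) * ee (\<theta> * of_int n))"
    by (rule sum.swap)
  also have "\<dots> = (\<Sum>w\<in>int_box X. ee (\<theta> * of_int (form_eval f w - c)))"
  proof (intro sum.cong refl)
    fix w assume w: "w \<in> int_box X"
    have "(\<Sum>n\<in>A. (if form_eval f w - c = n then 1 else 0) * ee (\<theta> * of_int n)) =
       (\<Sum>n\<in>A. if form_eval f w - c = n then ee (\<theta> * of_int n) else 0)"
      by (intro sum.cong) auto
    then show "(\<Sum>n\<in>A. (if form_eval f w - c = n then 1 else 0) * ee (\<theta> * of_int n)) = ee (\<theta> * of_int (form_eval f w - c))"
      using assms(1) assms(2)[OF w] by simp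
  qed
  also have "\<dots> = form_sum f X \<theta> * cnj (ee (\<theta> * of_int c))"
    by (simp add: form_sum_def sum_distrib_right right_diff_distrib ee_diff)
  finally show ?thesis .
qed

lemma deviation_parseval:
  assumes "K \<ge> 1" "finite B"
  shows "(\<lambda>\<theta>. (norm (form_sum f X \<theta>))\<^sup>2 * (norm (1 - average_kernel K M \<theta>))\<^sup>2) integrable_on {0..1}"
    and "(\<Sum>n\<in>B. (rep_count f X n - rep_average f X K M n)\<^sup>2) \<le>
      integral {0..1} (\<lambda>\<theta>. (norm (form_sum f X \<theta>))\<^sup>2 * (norm (1 - average_kernel K M \<theta>))\<^sup>2)"
proof -
  \<comment> \<open>A finite set containing the support of the count and of all its shifts, so that
    the Fourier series are finite sums. Outside it the deviation vanishes, which allows an arbitrary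
    finite \<open>B\<close> at the end.\<close>
  define A where "A = (\<lambda>(w,j). form_eval f w - int (j * M)) ` (int_box X \<times> {..<K})"
  have fA: "finite A" by (simp add: A_def)
  have inA: "form_eval f w - int (j * M) \<in> A" if "w \<in> int_box X" "j < K" for w j
    using that unfolding A_def by (intro image_eqI[of _ _ "(w,j)"]) auto
  let ?d = "\<lambda>n. rep_count f X n - rep_average f X K M n"
  have "(\<Sum>n\<in>A. of_real (?d n) * ee (\<theta> * of_int n)) = form_sum f X \<theta> * (1 - average_kernel K M \<theta>)" for \<theta>
  proof -
    have "(\<Sum>n\<in>A. of_real (?d n) * ee (\<theta> * of_int n)) = (\<Sum>n\<in>A. of_real (rep_count f X (n + 0)) * ee (\<theta> * of_int n))
       - (\<Sum>n\<in>A. \<Sum>j<K. of_real (rep_count f X (n + int (j * M))) * ee (\<theta> * of_int n)) / of_nat K"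
      by (simp add: rep_average_def left_diff_distrib sum_subtractf sum_divide_distrib sum_distrib_right)
    also have "(\<Sum>n\<in>A. of_real (rep_count f X (n + 0)) * ee (\<theta> * of_int n)) = form_sum f X \<theta>"
      using rep_count_fourier[OF fA, of X f 0 \<theta>] inA[of _ 0] assms(1) by simp
    also have "(\<Sum>n\<in>A. \<Sum>j<K. of_real (rep_count f X (n + int (j * M))) * ee (\<theta> * of_int n)) =
       (\<Sum>j<K. \<Sum>n\<in>A. of_real (rep_count f X (n + int (j * M))) * ee (\<theta> * of_int n))"
      by (rule sum.swap)
    also have "\<dots> = (\<Sum>j<K. form_sum f X \<theta> * cnj (ee (\<theta> * of_int (int (j * M)))))"
      by (intro sum.cong refl rep_count_fourier fA inA) auto
    finally show ?thesis
      by (simp add: average_kernel_def right_diff_distrib sum_distrib_left)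
  qed
  then have int: "((\<lambda>\<theta>. (norm (form_sum f X \<theta>))\<^sup>2 * (norm (1 - average_kernel K M \<theta>))\<^sup>2) has_integral (\<Sum>n\<in>A. (?d n)\<^sup>2)) {0..1}"
    using trig_poly_parseval[OF fA, of ?d] by (simp add: norm_mult power_mult_distrib)
  then show "(\<lambda>\<theta>. (norm (form_sum f X \<theta>))\<^sup>2 * (norm (1 - average_kernel K M \<theta>))\<^sup>2) integrable_on {0..1}" by blast
  have zero: "?d n = 0" if "n \<notin> A" for n
  proof -
    have r0: "rep_count f X (n + int (j * M)) = 0" if "j < K" for j
      using inA[OF _ that] \<open>n \<notin> A\<close> by (auto simp: rep_count_def card_eq_0_iff) (metis add_diff_cancel_right')
    have "rep_count f X n = 0" using r0[of 0] assms(1) by simp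
    moreover have "rep_average f X K M n = 0" using r0 by (simp add: rep_average_def)
    ultimately show ?thesis by simp
  qed
  have "(\<Sum>n\<in>B. (?d n)\<^sup>2) = (\<Sum>n\<in>B \<inter> A. (?d n)\<^sup>2)"
    using assms(2) zero by (intro sum.mono_neutral_right) auto
  also have "\<dots> \<le> (\<Sum>n\<in>A. (?d n)\<^sup>2)" by (intro sum_mono2 fA) auto
  finally show "(\<Sum>n\<in>B. (?d n)\<^sup>2) \<le> integral {0..1} (\<lambda>\<theta>. (norm (form_sum f X \<theta>))\<^sup>2 * (norm (1 - average_kernel K M \<theta>))\<^sup>2)"
    using int by (simp add: integral_unique)
qed

section \<open>Integration over neighbourhoods of the fractions\<close>

text \<open>The exponent 5/4 is 3/2, from the cube of an inverse square root, less the 1/4 spent on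
  the averaging kernel. It exceeds 1, so each side of \<open>c\<close> contributes at most
  4/h.\<close>

lemma integral_bump_le:
  fixes h c :: real
  assumes "h > 0" "0 \<le> c" "c \<le> 1"
  shows "(\<lambda>\<theta>. (1 + h * \<bar>\<theta> - c\<bar>) powr (-5/4)) integrable_on {0..1}"
    and "integral {0..1} (\<lambda>\<theta>. (1 + h * \<bar>\<theta> - c\<bar>) powr (-5/4)) \<le> 8 / h"
proof -
  let ?b = "\<lambda>\<theta>. (1 + h * \<bar>\<theta> - c\<bar>) powr (-5/4)"
  have pos: "1 + h * \<bar>\<theta> - c\<bar> > 0" for \<theta> using assms(1) by (simp add: add_pos_nonneg)
  let ?F = "\<lambda>\<theta>. - (4/h) * (1 + h * (\<theta> - c)) powr (-1/4)"
  let ?G = "\<lambda>\<theta>. (4/h) * (1 + h * (c - \<theta>)) powr (-1/4)"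
  have 1: "(?b has_integral (?F 1 - ?F c)) {c..1}"
  proof (rule fundamental_theorem_of_calculus[OF assms(3)])
    fix \<theta> assume "\<theta> \<in> {c..1}"
    then have p: "1 + h * (\<theta> - c) > 0" "\<bar>\<theta> - c\<bar> = \<theta> - c" using pos[of \<theta>] by auto
    have "(?F has_real_derivative (1 + h * (\<theta> - c)) powr (-1/4 - 1)) (at \<theta> within {c..1})"
      using p(1) assms(1) by (auto intro!: derivative_eq_intros simp: field_simps)
    then show "(?F has_vector_derivative ?b \<theta>) (at \<theta> within {c..1})"
      using p(2) by (simp add: has_real_derivative_iff_has_vector_derivative)
  qed
  have 2: "(?b has_integral (?G c - ?G 0)) {0..c}"
  proof (rule fundamental_theorem_of_calculus[OF assms(2)])
    fix \<theta> assume "\<theta> \<in> {0..c}"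
    then have p: "1 + h * (c - \<theta>) > 0" "\<bar>\<theta> - c\<bar> = c - \<theta>" using pos[of \<theta>] by auto
    have "(?G has_real_derivative (1 + h * (c - \<theta>)) powr (-1/4 - 1)) (at \<theta> within {0..c})"
      using p(1) assms(1) by (auto intro!: derivative_eq_intros simp: field_simps)
    then show "(?G has_vector_derivative ?b \<theta>) (at \<theta> within {0..c})"
      using p(2) by (simp add: has_real_derivative_iff_has_vector_derivative)
  qed
  have 3: "(?b has_integral ((?G c - ?G 0) + (?F 1 - ?F c))) {0..1}"
    by (rule has_integral_combine[OF assms(2,3) 2 1])
  then show "?b integrable_on {0..1}" by blast
  have "(?G c - ?G 0) + (?F 1 - ?F c) \<le> 8 / h"
    using assms(1) by (simp add: field_simps)
  then show "integral {0..1} ?b \<le> 8 / h" using 3 by (simp add: integral_unique)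
qed

text \<open>At a fraction \<open>a / q\<close> with \<open>q\<close> dividing \<open>M\<close>,
  every shift \<open>j * M\<close> contributes an integer phase, so the kernel sees only the
  distance of \<open>\<theta>\<close> from the fraction.\<close>

lemma average_kernel_bounds:
  fixes a q :: int
  assumes "K \<ge> 1"
  shows "norm (1 - average_kernel K M \<theta>) \<le> 2"
    and "q > 0 \<Longrightarrow> q dvd int M \<Longrightarrow> norm (1 - average_kernel K M \<theta>) \<le> 2 * (pi * real K * real M * \<bar>\<theta> - of_int a / of_int q\<bar>)"
proof -
  have eq: "1 - average_kernel K M \<theta> = (\<Sum>j<K. 1 - cnj (ee (\<theta> * real (j * M)))) / of_nat K"
    using assms by (simp add: average_kernel_def sum_subtractf diff_divide_distrib)
  have bd: "norm (1 - average_kernel K M \<theta>) \<le> c" if "\<And>j. j < K \<Longrightarrow> norm (1 - cnj (ee (\<theta> * real (j * M)))) \<le> c" for c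
  proof -
    have "norm (\<Sum>j<K. 1 - cnj (ee (\<theta> * real (j * M)))) \<le> real K * c"
      using norm_sum[of "\<lambda>j. 1 - cnj (ee (\<theta> * real (j * M)))" "{..<K}"] sum_bounded_above[of "{..<K}" "\<lambda>j. norm (1 - cnj (ee (\<theta> * real (j * M))))" c] that
      by fastforce
    then show ?thesis unfolding eq norm_divide using assms by (simp add: divide_le_eq mult.commute)
  qed
  show "norm (1 - average_kernel K M \<theta>) \<le> 2"
  proof (rule bd)
    fix j show "norm (1 - cnj (ee (\<theta> * real (j * M)))) \<le> 2"
      using norm_triangle_ineq4[of 1 "cnj (ee (\<theta> * real (j * M)))"] by simp
  qed
  assume q: "q > 0" "q dvd int M"
  then obtain m where m: "int M = q * m" by auto
  show "norm (1 - average_kernel K M \<theta>) \<le> 2 * (pi * real K * real M * \<bar>\<theta> - of_int a / of_int q\<bar>)"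
  proof (rule bd)
    fix j assume j: "j < K"
    have Mq: "real M = of_int q * of_int m" using m by (metis of_int_mult of_int_of_nat_eq)
    have "\<theta> * real (j * M) = real (j * M) * (\<theta> - of_int a / of_int q) + of_int (int j * m * a)"
      using q(1) by (simp add: Mq field_simps)
    then have "ee (\<theta> * real (j * M)) = ee (real (j * M) * (\<theta> - of_int a / of_int q))"
      using ee_add ee_of_int by (metis mult.right_neutral)
    moreover have "norm (1 - cnj (ee x)) = norm (1 - ee x)" for x
      by (metis complex_cnj_diff complex_cnj_one complex_mod_cnj)
    ultimately have "norm (1 - cnj (ee (\<theta> * real (j * M)))) \<le> 2 * pi * \<bar>real (j * M) * (\<theta> - of_int a / of_int q)\<bar>"
      using norm_one_minus_ee_le by simp
    also have "\<dots> = 2 * pi * (real M * \<bar>\<theta> - of_int a / of_int q\<bar>) * real j" by (simp add: abs_mult)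
    also have "\<dots> \<le> 2 * pi * (real M * \<bar>\<theta> - of_int a / of_int q\<bar>) * real K"
      using j by (intro mult_left_mono) auto
    finally show "norm (1 - cnj (ee (\<theta> * real (j * M)))) \<le> 2 * (pi * real K * real M * \<bar>\<theta> - of_int a / of_int q\<bar>)"
      by (simp add: mult_ac)
  qed
qed

lemma cube_add_le: "(x + y) ^ 3 \<le> 4 * (x ^ 3 + y ^ 3)" if "x \<ge> 0" "y \<ge> 0" for x y :: real
proof -
  have "4 * (x ^ 3 + y ^ 3) - (x + y) ^ 3 = 3 * (x + y) * (x - y)\<^sup>2"
    by (simp add: power2_eq_square power3_eq_cube algebra_simps)
  moreover have "3 * (x + y) * (x - y)\<^sup>2 \<ge> 0" using that by simp
  ultimately show ?thesis by linarith
qed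

text \<open>Dirichlet approximation with denominators up to \<open>4 * H\<close> places every
  \<open>\<theta>\<close> near a fraction, so one estimate covers major and minor arcs alike: the
  first summand is the logarithmic error of the nonmultiples, the second the peak at the fraction,
  damped if \<open>q\<close> divides \<open>M\<close>.\<close>

lemma integrand_bound:
  fixes X K M :: nat and \<theta> :: real
  assumes "gram_det f \<noteq> 0" "X \<ge> 1" "K \<ge> 1" "0 \<le> \<theta>" "\<theta> \<le> 1"
  defines "H \<equiv> coeff_bound f * X"
  defines "\<kappa> \<equiv> pi * real K * real M / real H ^ 2"
  obtains q a :: nat where "1 \<le> q" "q \<le> 4 * H" "a \<le> q"
    "(norm (form_sum f X \<theta>))\<^sup>2 * (norm (1 - average_kernel K M \<theta>))\<^sup>2 \<le>
       128000 * (real H ^ 3 * (1 + ln (4 * real H)) ^ 3)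
       + 3456 * (if q dvd M then \<kappa> powr (1/4) else 1) * (real H ^ 2 / real q) ^ 3
         * (1 + real H ^ 2 * \<bar>\<theta> - real a / real q\<bar>) powr (-5/4)"
proof -
  have H: "H \<ge> 1" "X \<le> H" using coeff_bound_pos[of f] assms(2) by (auto simp: H_def)
  have "4 * H > 0" using H by simp
  then obtain a' q' where aq: "coprime a' q'" "0 < q'" "q' \<le> int (4 * H)" "\<bar>of_int q' * \<theta> - of_int a'\<bar> < 1 / real (4 * H)"
    by (rule Dirichlet_approx_coprime)
  have lt1: "\<bar>of_int q' * \<theta> - of_int a'\<bar> < 1"
  proof -
    have "1 / real (4 * H) \<le> 1" using H by simp
    then show ?thesis using aq(4) by linarith
  qed
  have "of_int q' * \<theta> \<ge> 0" "of_int q' * \<theta> \<le> of_int q'"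
    using aq(2) assms(4,5) by (auto simp: mult_left_le)
  then have "real_of_int a' > -1" "real_of_int a' < of_int q' + 1" using lt1 by linarith+
  then have a': "0 \<le> a'" "a' \<le> q'" by linarith+
  define a q where "a = nat a'" and "q = nat q'"
  have aq': "int a = a'" "int q = q'" using a' aq(2) by (auto simp: a_def q_def)
  then have raq: "real_of_int a' = real a" "real_of_int q' = real q" by auto
  have q1: "1 \<le> q" "q \<le> 4 * H" "a \<le> q" using aq aq' a' by linarith+
  define t where "t = \<bar>\<theta> - real a / real q\<bar>"
  define u where "u = real H ^ 2 * t"
  define L where "L = 1 + ln (4 * real H)"
  define E where "E = real H ^ 2 / real q"
  have t0: "t \<ge> 0" "u \<ge> 0" by (auto simp: t_def u_def)
  have L0: "L \<ge> 0" using H by (simp add: L_def)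
  have E0: "E \<ge> 0" by (simp add: E_def)
  define W where "W = (\<Sum>h\<in>{-int H..int H}. weyl_kernel X (\<theta> * of_int h))"
  have W0: "W \<ge> 0" by (simp add: W_def sum_nonneg weyl_kernel_nonneg)
  have W: "W \<le> 20 * real H * L + 6 * E / sqrt (1 + u)"
    using weyl_sum_le[OF aq(2) _ _ H(2) aq(1), of \<theta>] aq H
    by (simp add: W_def L_def E_def u_def t_def raq)
  have S: "(norm (form_sum f X \<theta>))\<^sup>2 \<le> W ^ 3"
    using norm_form_sum_le[OF assms(1), of X \<theta>] by (simp add: W_def H_def)
  define N where "N = (norm (1 - average_kernel K M \<theta>))\<^sup>2"
  have N0: "N \<ge> 0" by (simp add: N_def)
  have N4: "N \<le> 4" unfolding N_def using power_mono[OF average_kernel_bounds(1)[OF assms(3), of M \<theta>], of 2] by simp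
  define c where "c = (if q dvd M then \<kappa> powr (1/4) else 1)"
  have c0: "c \<ge> 0" by (simp add: c_def)
  \<comment> \<open>Interpolation between the trivial bound 4 and the quadratic bound near the
    fraction. Only a quarter power is kept, so that the product with
    \<open>(1 + u) powr (-3/2)\<close> remains integrable.\<close>
  have Nc: "N \<le> 4 * c * (1 + u) powr (1/4)"
  proof (cases "q dvd M")
    case False
    then show ?thesis using N4 t0 ge_one_powr_ge_zero[of "1+u" "1/4"] by (simp add: c_def)
  next
    case True
    define y where "y = \<kappa> * u"
    have k0: "\<kappa> \<ge> 0" by (simp add: \<kappa>_def)
    have y0: "y \<ge> 0" using k0 t0 by (simp add: y_def)
    have yeq: "y = pi * real K * real M * t" using H by (simp add: y_def \<kappa>_def u_def)
    have "norm (1 - average_kernel K M \<theta>) \<le> 2 * y"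
      using average_kernel_bounds(2)[OF assms(3) aq(2), of M \<theta> a'] True aq' by (simp add: yeq t_def raq) (metis aq'(2) int_dvd_int_iff)
    then have "N \<le> (2 * y)\<^sup>2" unfolding N_def by (intro power_mono) auto
    then have Ny: "N \<le> 4 * y\<^sup>2" by (simp add: power_mult_distrib)
    have "N \<le> 4 * y powr (1/4)"
    proof (cases "y \<le> 1")
      case True
      have "y\<^sup>2 \<le> y powr (1/4)"
      proof (cases "y = 0")
        case False
        then have "y powr 2 \<le> y powr (1/4)" using True y0 by (intro powr_mono') auto
        then show ?thesis using False y0 by (simp add: powr_numeral)
      qed simp
      then show ?thesis using Ny by linarith
    next
      case False
      then have "y powr (1/4) \<ge> 1" by (intro ge_one_powr_ge_zero) auto
      then show ?thesis using N4 by linarith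
    qed
    also have "y powr (1/4) = \<kappa> powr (1/4) * u powr (1/4)" using k0 t0 by (simp add: y_def powr_mult)
    also have "\<dots> \<le> \<kappa> powr (1/4) * (1 + u) powr (1/4)" using t0 by (intro mult_left_mono powr_mono2) auto
    finally show ?thesis using True by (simp add: c_def)
  qed
  have s: "(1 / sqrt (1 + u)) ^ 3 = (1 + u) powr (-3/2)"
  proof -
    have "1 / sqrt (1 + u) = (1 + u) powr (-1/2)" using t0 by (simp add: powr_minus_divide powr_half_sqrt[symmetric])
    then have "(1 / sqrt (1 + u)) ^ 3 = ((1 + u) powr (-1/2)) powr 3" using t0 by (simp add: powr_numeral)
    then show ?thesis by (simp add: powr_powr)
  qed
  have "W ^ 3 \<le> (20 * real H * L + 6 * E / sqrt (1 + u)) ^ 3" using W W0 by (intro power_mono)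
  also have "\<dots> \<le> 4 * ((20 * real H * L) ^ 3 + (6 * E / sqrt (1 + u)) ^ 3)"
    using L0 E0 t0 by (intro cube_add_le) auto
  also have "(6 * E / sqrt (1 + u)) ^ 3 = 216 * E ^ 3 * (1 + u) powr (-3/2)"
  proof -
    have "(6 * E / sqrt (1 + u)) ^ 3 = 216 * E ^ 3 * (1 / sqrt (1 + u)) ^ 3"
      by (simp add: power_divide power_mult_distrib)
    then show ?thesis by (simp only: s)
  qed
  also have "(20 * real H * L) ^ 3 = 8000 * (real H ^ 3 * L ^ 3)" by (simp add: power_mult_distrib)
  finally have W3: "W ^ 3 \<le> 32000 * (real H ^ 3 * L ^ 3) + 864 * E ^ 3 * (1 + u) powr (-3/2)" by simp
  have "(norm (form_sum f X \<theta>))\<^sup>2 * N \<le> (32000 * (real H ^ 3 * L ^ 3) + 864 * E ^ 3 * (1 + u) powr (-3/2)) * N"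
    using S W3 N0 by (intro mult_right_mono) auto
  also have "\<dots> = 32000 * (real H ^ 3 * L ^ 3) * N + 864 * E ^ 3 * (1 + u) powr (-3/2) * N"
    by (simp add: distrib_right)
  also have "\<dots> \<le> 32000 * (real H ^ 3 * L ^ 3) * 4 + 864 * E ^ 3 * (1 + u) powr (-3/2) * (4 * c * (1 + u) powr (1/4))"
    using N4 Nc L0 E0 by (intro add_mono mult_left_mono) auto
  also have "864 * E ^ 3 * (1 + u) powr (-3/2) * (4 * c * (1 + u) powr (1/4)) = 3456 * c * E ^ 3 * ((1 + u) powr (-3/2) * (1 + u) powr (1/4))"
    by simp
  also have "(1 + u) powr (-3/2) * (1 + u) powr (1/4) = (1 + u) powr (-5/4)"
    by (simp add: powr_add[symmetric])
  finally have "(norm (form_sum f X \<theta>))\<^sup>2 * N \<le> 128000 * (real H ^ 3 * L ^ 3) + 3456 * c * E ^ 3 * (1 + u) powr (-5/4)" by simp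
  then show ?thesis using that[OF q1] by (simp add: N_def L_def c_def E_def u_def t_def)
qed

lemma sum_inverse_squares_tail:
  assumes "Q \<ge> 1" shows "(\<Sum>q\<in>{Q<..N}. 1 / real q ^ 2) \<le> 1 / real Q"
proof -
  have "(\<Sum>q\<in>{Q<..N}. 1 / real q ^ 2) \<le> 1 / real Q - 1 / real N" if "Q \<le> N" for N
    using that
  proof (induction N rule: dec_induct)
    case base then show ?case by simp
  next
    case (step n)
    have "{Q<..Suc n} = insert (Suc n) {Q<..n}" using step by auto
    moreover have "1 / real (Suc n) ^ 2 \<le> 1 / real n - 1 / real (Suc n)"
    proof -
      have n: "real n > 0" using step assms by simp
      have "1 / real (Suc n) ^ 2 \<le> 1 / (real n * real (Suc n))"
        using n by (intro divide_left_mono) (auto simp: power2_eq_square)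
      also have "\<dots> = 1 / real n - 1 / real (Suc n)" using n by (simp add: field_simps)
      finally show ?thesis .
    qed
    ultimately show ?case using step by simp
  qed
  then show ?thesis by (cases "Q \<le> N") (smt (verit) divide_nonneg_nonneg of_nat_0_le_iff, simp)
qed

text \<open>A denominator \<open>q\<close> comes with q + 1 fractions, each contributing H^6/q^3
  times an integral of order 1/H^2, in total H^4/q^2. Denominators up to \<open>Q\<close> divide
  \<open>M\<close> and carry the small factor \<open>\<kappa> powr (1/4)\<close>; the others leave
  the tail 1/Q. The comparison is with about X^2 integers and counts of size \<open>X\<close>, so
  every summand in the bracket has to be made small.\<close>

theorem deviation_bound:
  fixes X K M Q :: nat
  assumes "gram_det f \<noteq> 0" "X \<ge> 1" "K \<ge> 1" "Q \<ge> 1" "\<And>q. 1 \<le> q \<Longrightarrow> q \<le> Q \<Longrightarrow> q dvd M" "finite B"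
  defines "H \<equiv> coeff_bound f * X"
  defines "\<kappa> \<equiv> pi * real K * real M / real H ^ 2"
  shows "(\<Sum>n\<in>B. (rep_count f X n - rep_average f X K M n)\<^sup>2) \<le>
     128000 * real H ^ 4 * ((1 + ln (4 * real H)) ^ 3 / real H + \<kappa> powr (1/4) + 1 / real Q)"
proof -
  have H: "H \<ge> 1" using coeff_bound_pos[of f] assms(2) by (simp add: H_def)
  define c where "c q = (if q dvd M then \<kappa> powr (1/4) else 1)" for q
  define b where "b q a \<theta> = (1 + real H ^ 2 * \<bar>\<theta> - real a / real q\<bar>) powr (-5/4)" for q a :: nat and \<theta> :: real
  define Z where "Z = 128000 * (real H ^ 3 * (1 + ln (4 * real H)) ^ 3)"
  let ?C = "\<lambda>q. 3456 * c q * (real H ^ 2 / real q) ^ 3"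
  \<comment> \<open>The fraction near \<open>\<theta>\<close> depends on \<open>\<theta>\<close>;
    summing the peaks of all fractions gives a majorant that is visibly integrable.\<close>
  let ?F = "\<lambda>\<theta>. Z + (\<Sum>q\<in>{1..4*H}. \<Sum>a\<in>{0..q}. ?C q * b q a \<theta>)"
  have c0: "c q \<ge> 0" for q by (simp add: c_def)
  have C0: "?C q \<ge> 0" for q using c0 by simp
  have b0: "b q a \<theta> \<ge> 0" for q a \<theta> by (simp add: b_def)
  have bi: "b q a integrable_on {0..1}" "integral {0..1} (b q a) \<le> 8 / real H ^ 2" if "q \<in> {1..4*H}" "a \<in> {0..q}" for q a
    using integral_bump_le[of "real H ^ 2" "real a / real q"] that H unfolding b_def by auto
  have ib: "((\<lambda>\<theta>. \<Sum>q\<in>{1..4*H}. \<Sum>a\<in>{0..q}. ?C q * b q a \<theta>) has_integral (\<Sum>q\<in>{1..4*H}. \<Sum>a\<in>{0..q}. ?C q * integral {0..1} (b q a))) {0..1}"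
    using bi(1) by (intro has_integral_sum has_integral_mult_right finite_atLeastAtMost integrable_integral)
  have iF: "(?F has_integral (Z + (\<Sum>q\<in>{1..4*H}. \<Sum>a\<in>{0..q}. ?C q * integral {0..1} (b q a)))) {0..1}"
    using has_integral_add[OF has_integral_const_real[of Z 0 1] ib] by simp
  have "(\<Sum>n\<in>B. (rep_count f X n - rep_average f X K M n)\<^sup>2) \<le>
      integral {0..1} (\<lambda>\<theta>. (norm (form_sum f X \<theta>))\<^sup>2 * (norm (1 - average_kernel K M \<theta>))\<^sup>2)"
    by (rule deviation_parseval(2)[OF assms(3,6)])
  also have "\<dots> \<le> integral {0..1} ?F"
  proof (rule integral_le[OF deviation_parseval(1)[OF assms(3,6)]])
    show "?F integrable_on {0..1}" using iF by blast
    fix \<theta> :: real assume "\<theta> \<in> {0..1}"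
    then have t: "0 \<le> \<theta>" "\<theta> \<le> 1" by auto
    obtain q a where qa: "1 \<le> q" "q \<le> 4 * H" "a \<le> q"
      "(norm (form_sum f X \<theta>))\<^sup>2 * (norm (1 - average_kernel K M \<theta>))\<^sup>2 \<le> Z + ?C q * b q a \<theta>"
      using integrand_bound[OF assms(1-3) t, of M] unfolding Z_def c_def b_def \<kappa>_def H_def by metis
    have "?C q * b q a \<theta> \<le> (\<Sum>a\<in>{0..q}. ?C q * b q a \<theta>)"
      using qa C0 b0 by (intro member_le_sum[of a "{0..q}" "\<lambda>a. ?C q * b q a \<theta>"]) auto
    also have "\<dots> \<le> (\<Sum>q\<in>{1..4*H}. \<Sum>a\<in>{0..q}. ?C q * b q a \<theta>)"
      using qa C0 b0 by (intro member_le_sum[of q "{1..4*H}" "\<lambda>q. \<Sum>a\<in>{0..q}. ?C q * b q a \<theta>"]) (auto intro!: sum_nonneg)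
    finally show "(norm (form_sum f X \<theta>))\<^sup>2 * (norm (1 - average_kernel K M \<theta>))\<^sup>2 \<le> ?F \<theta>" using qa(4) by linarith
  qed
  also have "integral {0..1} ?F = Z + (\<Sum>q\<in>{1..4*H}. \<Sum>a\<in>{0..q}. ?C q * integral {0..1} (b q a))"
    using iF by (simp add: integral_unique)
  also have "(\<Sum>q\<in>{1..4*H}. \<Sum>a\<in>{0..q}. ?C q * integral {0..1} (b q a)) \<le> (\<Sum>q\<in>{1..4*H}. \<Sum>a\<in>{0..q}. ?C q * (8 / real H ^ 2))"
    using C0 bi by (intro sum_mono mult_left_mono) auto
  also have "\<dots> = (\<Sum>q\<in>{1..4*H}. 27648 * real H ^ 4 * (c q * ((real q + 1) / real q ^ 3)))"
    using H by (intro sum.cong refl) (simp add: power_divide field_simps eval_nat_numeral)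
  also have "\<dots> = 27648 * real H ^ 4 * (\<Sum>q\<in>{1..4*H}. c q * ((real q + 1) / real q ^ 3))"
    by (simp add: sum_distrib_left)
  also have "(\<Sum>q\<in>{1..4*H}. c q * ((real q + 1) / real q ^ 3)) \<le> 4 * \<kappa> powr (1/4) + 2 / real Q"
  proof -
    have *: "c q * ((real q + 1) / real q ^ 3) \<le> 2 * \<kappa> powr (1/4) * (1 / real q ^ 2) + 2 * (if q > Q then 1 / real q ^ 2 else 0)"
      if "q \<in> {1..4*H}" for q
    proof -
      have "(real q + 1) / real q ^ 3 \<le> (2 * real q) / real q ^ 3" using that by (intro divide_right_mono) auto
      also have "\<dots> = 2 * (1 / real q ^ 2)" using that by (simp add: power2_eq_square power3_eq_cube)
      finally have "c q * ((real q + 1) / real q ^ 3) \<le> c q * (2 * (1 / real q ^ 2))" using c0 by (intro mult_left_mono)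
      also have "\<dots> \<le> 2 * \<kappa> powr (1/4) * (1 / real q ^ 2) + 2 * (if q > Q then 1 / real q ^ 2 else 0)"
      proof (cases "q dvd M")
        case True
        then have "c q = \<kappa> powr (1/4)" by (simp add: c_def)
        then show ?thesis by (simp add: mult.commute)
      next
        case False
        moreover have "q > Q" by (rule ccontr) (use assms(5)[of q] that False in auto)
        ultimately have "c q = 1" "q > Q" by (auto simp: c_def)
        then show ?thesis by simp
      qed
      finally show ?thesis .
    qed
    have "(\<Sum>q\<in>{1..4*H}. c q * ((real q + 1) / real q ^ 3)) \<le>
       (\<Sum>q\<in>{1..4*H}. 2 * \<kappa> powr (1/4) * (1 / real q ^ 2) + 2 * (if q > Q then 1 / real q ^ 2 else 0))"
      by (intro sum_mono *)
    also have "\<dots> = 2 * \<kappa> powr (1/4) * (\<Sum>q\<in>{1..4*H}. 1 / real q ^ 2) + 2 * (\<Sum>q\<in>{1..4*H}. if q > Q then 1 / real q ^ 2 else 0)"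
      by (simp add: sum.distrib sum_distrib_left)
    also have "(\<Sum>q\<in>{1..4*H}. if q > Q then 1 / real q ^ 2 else 0) = (\<Sum>q\<in>{Q<..4*H}. 1 / real q ^ 2)"
    proof -
      have "(\<Sum>q\<in>{1..4*H}. if q > Q then 1 / real q ^ 2 else 0) = (\<Sum>q\<in>{q\<in>{1..4*H}. q > Q}. 1 / real q ^ 2)"
        by (rule sum.inter_filter[symmetric]) simp
      also have "{q\<in>{1..4*H}. q > Q} = {Q<..4*H}" by auto
      finally show ?thesis .
    qed
    also have "(\<Sum>q\<in>{1..4*H}. 1 / real q ^ 2) \<le> 2"
    proof -
      have "{1..4*H} = insert 1 {1<..4*H}" using H by auto
      then show ?thesis using sum_inverse_squares_tail[of 1 "4*H"] by simp
    qed
    finally show ?thesis using sum_inverse_squares_tail[OF assms(4), of "4*H"] by (simp add: mult_left_mono)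
  qed
  finally have "(\<Sum>n\<in>B. (rep_count f X n - rep_average f X K M n)\<^sup>2) \<le> Z + 27648 * real H ^ 4 * (4 * \<kappa> powr (1/4) + 2 / real Q)"
    by (simp add: mult_left_mono)
  also have "\<dots> \<le> Z + 128000 * real H ^ 4 * (\<kappa> powr (1/4) + 1 / real Q)"
  proof -
    define r where "r = 1 / real Q"
    have r: "r \<ge> 0" "\<kappa> powr (1/4) \<ge> 0" "2 / real Q = 2 * r" by (auto simp: r_def)
    have "real H ^ 4 * (27648 * (4 * \<kappa> powr (1/4) + 2 * r)) \<le> real H ^ 4 * (128000 * (\<kappa> powr (1/4) + r))"
      using r by (intro mult_left_mono) auto
    then show ?thesis unfolding r(3) r_def[symmetric] by (simp add: algebra_simps)
  qed
  also have "Z = 128000 * real H ^ 4 * ((1 + ln (4 * real H)) ^ 3 / real H)"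
    using H by (simp add: Z_def eval_nat_numeral)
  finally show ?thesis by (simp add: distrib_left)
qed

section \<open>Solutions modulo prime powers\<close>

lemmas cong_iff = unique_euclidean_semiring_class.cong_def

section \<open>Arithmetic of vectors and solution counts\<close>

fun smul :: "int \<Rightarrow> int \<times> int \<times> int \<Rightarrow> int \<times> int \<times> int" where
  "smul k (x, y, z) = (k * x, k * y, k * z)"

fun vmod :: "int \<times> int \<times> int \<Rightarrow> int \<Rightarrow> int \<times> int \<times> int" where
  "vmod (x, y, z) m = (x mod m, y mod m, z mod m)"

fun vdvd :: "int \<Rightarrow> int \<times> int \<times> int \<Rightarrow> bool" where
  "vdvd m (x, y, z) \<longleftrightarrow> m dvd x \<and> m dvd y \<and> m dvd z"

lemma form_eval_plus: "form_eval f (v + w) = form_eval f v + dot3 (gradient f v) w + form_eval f w"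
  for v w :: "int \<times> int \<times> int"
  by (cases v; cases w) (simp add: form_eval_def algebra_simps)

lemma form_eval_smul: "form_eval f (smul k v) = k\<^sup>2 * form_eval f v"
  by (cases v) (simp add: form_eval_def power2_eq_square algebra_simps)

lemma dot3_add: "dot3 g (v + w) = dot3 g v + dot3 g w"
  by (cases g; cases v; cases w) (simp add: algebra_simps)

lemma dot3_smul: "dot3 g (smul k v) = k * dot3 g v" "dot3 (smul k g) v = k * dot3 g v"
  by (cases g; cases v; simp add: algebra_simps)+

lemma dot3_gradient_self: "dot3 (gradient f v) v = 2 * form_eval f v"
  by (cases v) (simp add: form_eval_def algebra_simps)

lemma dot3_gradient_sym: "dot3 (gradient f v) w = dot3 (gradient f w) v"
  by (cases v; cases w) (simp add: algebra_simps)

lemma vmod_eq_iff: "vmod v m = vmod w m \<longleftrightarrow> vdvd m (v - w)"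
  by (cases v; cases w) (auto simp: mod_eq_dvd_iff)

lemma vdvd_smul [simp]: "vdvd m (smul m u)" by (cases u) simp

lemma vdvd_iff_smul: "vdvd m v \<longleftrightarrow> (\<exists>u. v = smul m u)"
proof
  assume "vdvd m v"
  moreover obtain x y z where v: "v = (x, y, z)" by (metis prod_cases3)
  ultimately obtain a b c where "x = m * a" "y = m * b" "z = m * c" by (auto elim!: dvdE)
  then have "v = smul m (a, b, c)" by (simp add: v)
  then show "\<exists>u. v = smul m u" by blast
qed auto

lemma dot3_dvd: "vdvd m v \<Longrightarrow> m dvd dot3 g v" "vdvd m g \<Longrightarrow> m dvd dot3 g v"
  by (cases g; cases v; simp)+

lemma form_eval_cong:
  assumes "vmod v m = vmod w m"
  shows "[form_eval f v = form_eval f w] (mod m)"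
proof -
  obtain u where "v - w = smul m u" using assms unfolding vmod_eq_iff vdvd_iff_smul by blast
  then have v: "v = w + smul m u" by (metis add_diff_cancel_left' diff_add_cancel add.commute)
  show ?thesis unfolding v form_eval_plus form_eval_smul dot3_smul
    by (simp add: cong_iff_dvd_diff power2_eq_square)
qed

lemma vmod_in_box: "m > 0 \<Longrightarrow> vmod v (int m) \<in> int_box m"
  by (cases v) (simp add: int_box_def)

lemma vmod_box: "v \<in> int_box m \<Longrightarrow> vmod v (int m) = v"
  by (cases v) (simp add: int_box_def)

lemma vmod_vmod [simp]: "vmod (vmod v m) m = vmod v m"
  by (cases v) simp

definition solutions :: "ternary_form \<Rightarrow> nat \<Rightarrow> int \<Rightarrow> (int \<times> int \<times> int) set" where
  "solutions f m n = {w\<in>int_box m. [form_eval f w = n] (mod int m)}"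

definition sol_count :: "ternary_form \<Rightarrow> nat \<Rightarrow> int \<Rightarrow> nat" where
  "sol_count f m n = card (solutions f m n)"

lemma finite_solutions [simp]: "finite (solutions f m n)"
  by (simp add: solutions_def)

lemma vmod_solutions:
  assumes "m > 0" "[form_eval f w = n] (mod int m)"
  shows "vmod w (int m) \<in> solutions f m n"
  using assms vmod_in_box form_eval_cong[of "vmod w (int m)" "int m" w f]
  by (auto simp: solutions_def intro: cong_trans)

lemma sol_count_mult:
  assumes "coprime m1 m2" "m1 > 0" "m2 > 0"
  shows "sol_count f m1 n * sol_count f m2 n \<le> sol_count f (m1 * m2) n"
proof -
  have "coprime (int m1) (int m2)" using assms by simp
  then obtain u' v' where uv: "u' * int m1 + v' * int m2 = 1" using bezout_int[of "int m1" "int m2"] by auto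
  define \<phi> where "\<phi> = (\<lambda>(r, s). vmod (smul (v' * int m2) r + smul (u' * int m1) s) (int (m1 * m2)))"
  have a: "vmod (smul (v' * int m2) r + smul (u' * int m1) s) (int m1) = vmod r (int m1)" for r s
  proof -
    have e: "v' * int m2 = 1 - u' * int m1" using uv by simp
    show ?thesis unfolding vmod_eq_iff e by (cases r; cases s) (simp add: algebra_simps)
  qed
  have b: "vmod (smul (v' * int m2) r + smul (u' * int m1) s) (int m2) = vmod s (int m2)" for r s
  proof -
    have e: "u' * int m1 = 1 - v' * int m2" using uv by simp
    show ?thesis unfolding vmod_eq_iff e by (cases r; cases s) (simp add: algebra_simps)
  qed
  have vv: "vmod (vmod w (int (m1 * m2))) (int m1) = vmod w (int m1)" "vmod (vmod w (int (m1 * m2))) (int m2) = vmod w (int m2)" for w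
    by (cases w; simp add: mod_mod_cancel)+
  have "card (solutions f m1 n \<times> solutions f m2 n) \<le> card (solutions f (m1 * m2) n)"
  proof (rule card_inj_on_le[of \<phi>])
    show "inj_on \<phi> (solutions f m1 n \<times> solutions f m2 n)"
    proof (rule inj_onI)
      fix x y
      assume *: "x \<in> solutions f m1 n \<times> solutions f m2 n" "y \<in> solutions f m1 n \<times> solutions f m2 n"
        and eq: "\<phi> x = \<phi> y"
      obtain r s r' s' where x: "x = (r, s)" and y: "y = (r', s')" by (metis surj_pair)
      have "vmod r (int m1) = vmod r' (int m1)" "vmod s (int m2) = vmod s' (int m2)"
        using eq a[of r s] a[of r' s'] b[of r s] b[of r' s'] vv unfolding \<phi>_def x y case_prod_conv by metis+
      then show "x = y" using * by (auto simp: x y solutions_def vmod_box)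
    qed
    show "\<phi> ` (solutions f m1 n \<times> solutions f m2 n) \<subseteq> solutions f (m1 * m2) n"
    proof (rule image_subsetI)
      fix x assume "x \<in> solutions f m1 n \<times> solutions f m2 n"
      then obtain r s where x: "x = (r, s)" and rs: "r \<in> solutions f m1 n" "s \<in> solutions f m2 n" by auto
      let ?w = "smul (v' * int m2) r + smul (u' * int m1) s"
      have "[form_eval f ?w = n] (mod int m1)" "[form_eval f ?w = n] (mod int m2)"
        using rs form_eval_cong[OF a[of r s], of f] form_eval_cong[OF b[of r s], of f]
        by (auto simp: solutions_def intro: cong_trans)
      then have "[form_eval f ?w = n] (mod int (m1 * m2))"
        using assms(1) by (simp add: coprime_cong_mult)
      then have "vmod ?w (int (m1 * m2)) \<in> solutions f (m1 * m2) n"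
        using assms by (intro vmod_solutions) auto
      then show "\<phi> x \<in> solutions f (m1 * m2) n" by (simp add: \<phi>_def x)
    qed
  qed simp
  then show ?thesis by (simp add: sol_count_def card_cartesian_product)
qed

section \<open>Primes not dividing the determinant\<close>

lemma gradient_vdvd:
  assumes "vdvd m (gradient f v)" shows "vdvd m (smul (gram_det f) v)"
proof -
  obtain x y z where v: "v = (x,y,z)" by (metis prod_cases3)
  obtain r s t where g: "gradient f v = (r,s,t)" by (metis prod_cases3)
  have d: "m dvd r" "m dvd s" "m dvd t" using assms g by auto
  note * = gram_det_adjugate[OF g[unfolded v]]
  show ?thesis unfolding v using d by (simp add: *)
qed

lemma gram_det_even: "even (gram_det f)" by (simp add: gram_det_def)

text \<open>Pigeonhole: the values \<alpha> x^2 and the values c - \<beta> y^2 each occupy (p + 1)/2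
  residue classes, so the two sets meet.\<close>

lemma binary_diagonal_surj_mod_prime:
  fixes p :: nat and \<alpha> \<beta> c :: int
  assumes p: "prime p" "odd p" and "\<not> int p dvd \<alpha>" "\<not> int p dvd \<beta>"
  shows "\<exists>x y. int p dvd \<alpha> * x\<^sup>2 + \<beta> * y\<^sup>2 - c"
proof -
  define h where "h = int ((p - 1) div 2)"
  have ph: "int p = 2 * h + 1" using p(2) by (auto simp: h_def elim!: oddE)
  have pp: "prime (int p)" using p by simp
  let ?I = "{0..h}"
  have inj: "inj_on (\<lambda>x. (\<gamma> * x\<^sup>2 + d) mod int p) ?I" if "\<not> int p dvd \<gamma>" for \<gamma> d
  proof (rule inj_onI)
    fix x y assume xy: "x \<in> ?I" "y \<in> ?I" "(\<gamma> * x\<^sup>2 + d) mod int p = (\<gamma> * y\<^sup>2 + d) mod int p"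
    have "int p dvd (\<gamma> * x\<^sup>2 + d) - (\<gamma> * y\<^sup>2 + d)" using xy(3) by (simp add: mod_eq_dvd_iff)
    also have "(\<gamma> * x\<^sup>2 + d) - (\<gamma> * y\<^sup>2 + d) = \<gamma> * ((x - y) * (x + y))" by (simp add: power2_eq_square algebra_simps)
    finally have "int p dvd x - y \<or> int p dvd x + y" using that pp by (simp add: prime_dvd_mult_iff)
    then show "x = y"
    proof
      assume "int p dvd x - y"
      then show ?thesis using xy ph zdvd_not_zless[of "x - y" "int p"] zdvd_not_zless[of "y - x" "int p"]
        by (smt (verit) atLeastAtMost_iff dvd_diff_commute)
    next
      assume "int p dvd x + y"
      then show ?thesis using xy ph zdvd_not_zless[of "x + y" "int p"] by (smt (verit) atLeastAtMost_iff)
    qed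
  qed
  let ?A = "(\<lambda>x. (\<alpha> * x\<^sup>2 + 0) mod int p) ` ?I" and ?B = "(\<lambda>y. ((-\<beta>) * y\<^sup>2 + c) mod int p) ` ?I"
  have h0: "h \<ge> 0" by (simp add: h_def)
  have cA: "card ?A = nat (h + 1)" using inj[OF assms(3), of 0] h0 by (subst card_image) auto
  have cB: "card ?B = nat (h + 1)" using inj[of "-\<beta>" c] assms(4) h0 by (subst card_image) auto
  have "?A \<inter> ?B \<noteq> {}"
  proof
    assume e: "?A \<inter> ?B = {}"
    have "card (?A \<union> ?B) = card ?A + card ?B" by (rule card_Un_disjoint) (use e in auto)
    moreover have "?A \<union> ?B \<subseteq> {0..<int p}" using p(1) prime_gt_0_nat by auto
    then have "card (?A \<union> ?B) \<le> card {0..<int p}" by (intro card_mono) auto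
    ultimately show False using cA cB ph h0 by simp
  qed
  then obtain x y where "(\<alpha> * x\<^sup>2 + 0) mod int p = ((-\<beta>) * y\<^sup>2 + c) mod int p" by blast
  then have "int p dvd \<alpha> * x\<^sup>2 + \<beta> * y\<^sup>2 - c" by (simp add: mod_eq_dvd_iff algebra_simps)
  then show ?thesis by blast
qed

definition minor_12 :: "ternary_form \<Rightarrow> int" where
  "minor_12 f = 4 * coeff_11 f * coeff_22 f - (coeff_12 f)\<^sup>2"

text \<open>Twice the minor of the gradient matrix in rows 1, 2 and columns 1, 3. It is the cross
  coefficient left over when the first square has been completed.\<close>

definition mixed_23 :: "ternary_form \<Rightarrow> int" where
  "mixed_23 f = 4 * coeff_11 f * coeff_23 f - 2 * coeff_12 f * coeff_13 f"

text \<open>Completing the square twice, with denominators cleared; the leading minors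
  \<open>coeff_11 f\<close>, \<open>minor_12 f\<close> and \<open>gram_det f\<close> appear as in
  Jacobi's diagonalisation.\<close>

lemma form_eval_diagonalize:
  fixes x y z :: int
  shows "16 * coeff_11 f * minor_12 f * form_eval f (x, y, z) =
     (2 * minor_12 f * y + mixed_23 f * z)\<^sup>2
     + minor_12 f * (2 * (2 * coeff_11 f * x + coeff_12 f * y + coeff_13 f * z))\<^sup>2
     + 8 * coeff_11 f * gram_det f * z\<^sup>2"
  by (simp add: minor_12_def mixed_23_def gram_det_def form_eval_def power2_eq_square algebra_simps)

lemma exists_inverse_mod:
  fixes a m :: int assumes "coprime a m" shows "\<exists>x. m dvd a * x - b"
proof -
  obtain u v where "u * a + v * m = 1" using bezout_int[of a m] assms by auto
  then have "(u * a + v * m) * b = b" by simp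
  then have "a * (u * b) - b = m * (- v * b)" by (simp add: algebra_simps)
  then show ?thesis by (metis dvd_triv_left)
qed

text \<open>If one of the first two leading minors vanishes modulo \<open>p\<close>, there is an
  explicit zero. Otherwise the diagonalised form can be solved with \<open>z = 1\<close>, since its
  two remaining squares attain every residue, and the linear substitution is invertible modulo
  \<open>p\<close>.\<close>

lemma good_prime_zero_mod_prime:
  fixes p :: nat
  assumes p: "prime p" "\<not> int p dvd gram_det f"
  shows "\<exists>v. \<not> vdvd (int p) v \<and> int p dvd form_eval f v"
proof -
  have pp: "prime (int p)" using p by simp
  have p2: "p \<noteq> 2" using p gram_det_even by (metis even_numeral int_ops(3) of_nat_numeral)
  then have odd: "odd p" using p prime_odd_nat prime_ge_2_nat by (metis le_neq_implies_less)
  have n2: "\<not> int p dvd 2" using p2 p(1) by (metis int_dvd_int_iff int_ops(3) of_nat_numeral primes_dvd_imp_eq two_is_prime_nat)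
  have n16: "\<not> int p dvd 16" using n2 pp prime_dvd_power[of "int p" 2 4] by auto
  have n4: "\<not> int p dvd 4" using n2 pp prime_dvd_power[of "int p" 2 2] by auto
  have n8: "\<not> int p dvd 8" using n2 pp prime_dvd_power[of "int p" 2 3] by auto
  consider "int p dvd coeff_11 f" | "\<not> int p dvd coeff_11 f" "int p dvd minor_12 f"
    | "\<not> int p dvd coeff_11 f" "\<not> int p dvd minor_12 f" by blast
  then show ?thesis
  proof cases
    case 1
    have "\<not> int p dvd 1" using pp by (simp add: prime_int_iff)
    then show ?thesis using 1 by (intro exI[of _ "(1,0,0)"]) (simp add: form_eval_def)
  next
    case 2
    have "form_eval f (- coeff_12 f, 2 * coeff_11 f, 0) = coeff_11 f * minor_12 f"
      by (simp add: form_eval_def minor_12_def power2_eq_square algebra_simps)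
    then show ?thesis using 2 n2 pp
      by (intro exI[of _ "(- coeff_12 f, 2 * coeff_11 f, 0)"]) (simp add: prime_dvd_mult_iff)
  next
    case 3
    have n1: "\<not> int p dvd 1" using pp by (simp add: prime_int_iff)
    obtain Y X where XY: "int p dvd 1 * Y\<^sup>2 + minor_12 f * X\<^sup>2 - (- (8 * coeff_11 f * gram_det f))"
      using binary_diagonal_surj_mod_prime[OF p(1) odd n1 3(2)] by blast
    have "coprime (2 * minor_12 f) (int p)" "coprime (4 * coeff_11 f) (int p)"
      using 3 n2 n4 pp by (metis coprime_commute prime_dvd_mult_iff prime_imp_coprime)+
    then obtain y where y: "int p dvd 2 * minor_12 f * y - (Y - mixed_23 f)"
      using exists_inverse_mod by blast
    obtain x where x: "int p dvd 4 * coeff_11 f * x - (X - 2 * coeff_12 f * y - 2 * coeff_13 f)"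
      using exists_inverse_mod \<open>coprime (4 * coeff_11 f) (int p)\<close> by blast
    obtain k l where k: "2 * minor_12 f * y - (Y - mixed_23 f) = int p * k" and
      l: "4 * coeff_11 f * x - (X - 2 * coeff_12 f * y - 2 * coeff_13 f) = int p * l"
      using x y by (auto elim!: dvdE)
    have e1: "2 * minor_12 f * y + mixed_23 f * 1 = Y + int p * k" using k by simp
    have e2: "2 * (2 * coeff_11 f * x + coeff_12 f * y + coeff_13 f * 1) = X + int p * l" using l by simp
    have "16 * coeff_11 f * minor_12 f * form_eval f (x, y, 1) =
      (1 * Y\<^sup>2 + minor_12 f * X\<^sup>2 - (- (8 * coeff_11 f * gram_det f))) + int p * (2 * Y * k + int p * k\<^sup>2 + minor_12 f * (2 * X * l + int p * l\<^sup>2))"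
      unfolding form_eval_diagonalize e1 e2 by (simp add: power2_eq_square algebra_simps)
    then have "int p dvd 16 * coeff_11 f * minor_12 f * form_eval f (x, y, 1)"
      using XY by (metis dvd_add dvd_triv_left)
    then have "int p dvd form_eval f (x, y, 1)" using 3 n16 pp by (simp add: prime_dvd_mult_iff)
    then show ?thesis using n1 by (intro exI[of _ "(x, y, 1)"]) simp
  qed
qed

lemma not_vdvd_dot3_unit:
  assumes "\<not> vdvd m g"
  obtains e where "e \<in> {(1,0,0), (0,1,0), (0,0,1)}" "\<not> m dvd dot3 g e"
proof -
  obtain a b c where g: "g = (a, b, c)" by (metis prod_cases3)
  then consider "\<not> m dvd a" | "\<not> m dvd b" | "\<not> m dvd c" using assms by auto
  then show ?thesis
    using that[of "(1,0,0)"] that[of "(0,1,0)"] that[of "(0,0,1)"] by cases (simp_all add: g)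
qed

text \<open>Newton's step along a coordinate in which the gradient is a unit. The point changes only
  by multiples of \<open>p\<close>, so the same coordinate serves at every stage.\<close>

lemma nonsingular_zero_lift:
  fixes p :: nat
  assumes p: "prime p" and v: "int p dvd form_eval f v - n" "\<not> vdvd (int p) (gradient f v)" and "k \<ge> 1"
  shows "\<exists>w. vmod w (int p) = vmod v (int p) \<and> int p ^ k dvd form_eval f w - n"
  using \<open>k \<ge> 1\<close>
proof (induction k rule: nat_induct_at_least)
  case base then show ?case using v by (intro exI[of _ v]) simp
next
  case (Suc k)
  then obtain w where w: "vmod w (int p) = vmod v (int p)" "int p ^ k dvd form_eval f w - n" by blast
  obtain u where u: "w - v = smul (int p) u" using w(1) unfolding vmod_eq_iff vdvd_iff_smul by blast
  obtain e where e: "e \<in> {(1,0,0), (0,1,0), (0,0,1)}" "\<not> int p dvd dot3 (gradient f v) e"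
    using not_vdvd_dot3_unit[OF v(2)] by blast
  have "dot3 (gradient f w) e = dot3 (gradient f v) e + int p * dot3 (gradient f u) e"
  proof -
    have "w = v + smul (int p) u" using u by (metis add_diff_cancel_left' diff_add_cancel add.commute)
    then show ?thesis unfolding dot3_gradient_sym[of f _ e] by (simp add: dot3_add dot3_smul)
  qed
  then have "\<not> int p dvd dot3 (gradient f w) e" using e(2) by (simp add: dvd_add_left_iff)
  then have "coprime (dot3 (gradient f w) e) (int p)"
    using p by (metis coprime_commute prime_imp_coprime prime_nat_int_transfer)
  obtain c where c: "form_eval f w - n = int p ^ k * c" using w(2) by (auto elim!: dvdE)
  obtain t where t: "int p dvd dot3 (gradient f w) e * t - (- c)"
    using exists_inverse_mod[OF \<open>coprime _ _\<close>] by blast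
  let ?w = "w + smul (int p ^ k * t) e"
  have "form_eval f ?w - n = int p ^ k * (dot3 (gradient f w) e * t - (- c)) + int p ^ k * int p ^ k * t\<^sup>2 * form_eval f e"
    unfolding form_eval_plus form_eval_smul dot3_smul using c by (simp add: power2_eq_square power_mult_distrib algebra_simps)
  moreover have "int p ^ Suc k dvd int p ^ k * (dot3 (gradient f w) e * t - (- c))"
    using t by (simp add: mult_dvd_mono)
  moreover have "int p ^ Suc k dvd int p ^ k * int p ^ k * t\<^sup>2 * form_eval f e"
    using Suc unfolding power_add[symmetric] by (intro dvd_mult2 le_imp_power_dvd) auto
  ultimately have "int p ^ Suc k dvd form_eval f ?w - n" by (simp only: dvd_add)
  moreover have "vmod ?w (int p) = vmod w (int p)"
    unfolding vmod_eq_iff using Suc by (cases w; cases e) (auto simp: dvd_power)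
  ultimately show ?case using w(1) by metis
qed

lemma good_prime_zero_mod_power:
  fixes p :: nat
  assumes p: "prime p" "\<not> int p dvd gram_det f"
  shows "\<exists>v. \<not> vdvd (int p) v \<and> int p ^ k dvd form_eval f v"
proof (cases "k = 0")
  case True
  then show ?thesis using good_prime_zero_mod_prime[OF p] by auto
next
  case False
  obtain v where v: "\<not> vdvd (int p) v" "int p dvd form_eval f v" using good_prime_zero_mod_prime[OF p] by blast
  have pp: "prime (int p)" using p by simp
  have "\<not> vdvd (int p) (gradient f v)"
  proof
    assume "vdvd (int p) (gradient f v)"
    then have "vdvd (int p) (smul (gram_det f) v)" by (rule gradient_vdvd)
    then show False using v(1) p(2) pp by (cases v) (auto simp: prime_dvd_mult_iff)
  qed
  then obtain w where "vmod w (int p) = vmod v (int p)" "int p ^ k dvd form_eval f w"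
    using nonsingular_zero_lift[OF p(1), of f v 0 k] v False by auto
  moreover have "\<not> vdvd (int p) w"
    using calculation(1) v(1) by (cases w; cases v) (auto simp: mod_eq_0_iff_dvd[symmetric])
  ultimately show ?thesis by blast
qed

text \<open>The isotropic line through a point off the hyperplane orthogonal to \<open>v\<close> meets every level
  set of \<open>f\<close> exactly once, because \<open>f\<close> is affine linear along it.\<close>

lemma sol_count_good_prime:
  fixes p k :: nat
  assumes p: "prime p" "\<not> int p dvd gram_det f" and "k \<ge> 1"
  shows "real (sol_count f (p ^ k) n) \<ge> real (p ^ k) ^ 2 * (1 - 1 / real p)"
proof -
  define m where "m = p ^ k"
  have pp: "prime (int p)" using p by simp
  have m0: "m > 0" using p by (simp add: m_def prime_gt_0_nat)
  have pm: "int p dvd int m" using assms(3) by (simp add: m_def dvd_power)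
  obtain v where v: "\<not> vdvd (int p) v" "int m dvd form_eval f v"
    using good_prime_zero_mod_power[OF p, of k] unfolding m_def by (metis of_nat_power)
  define g where "g = gradient f v"
  have g: "\<not> vdvd (int p) g"
  proof
    assume "vdvd (int p) g"
    then have "vdvd (int p) (smul (gram_det f) v)" unfolding g_def by (rule gradient_vdvd)
    then show False using v(1) p(2) pp by (cases v) (auto simp: prime_dvd_mult_iff)
  qed
  obtain e where e: "e \<in> {(1,0,0), (0,1,0), (0,0,1)}" "\<not> int p dvd dot3 g e"
    using not_vdvd_dot3_unit[OF g] by blast
  have dm: "int p dvd dot3 g w - dot3 g w'" if "vmod w (int m) = vmod w' (int m)" for w w'
  proof -
    have "vdvd (int m) (w - w')" using that by (simp add: vmod_eq_iff)
    then have "int m dvd dot3 g (w - w')" by (rule dot3_dvd)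
    moreover have "dot3 g (w - w') = dot3 g w - dot3 g w'" by (cases g; cases w; cases w') (simp add: algebra_simps)
    ultimately show ?thesis using pm by (metis dvd_trans)
  qed
  define C where "C = {w\<in>int_box m. int p dvd dot3 g w}"
  define G where "G = {w\<in>int_box m. \<not> int p dvd dot3 g w}"
  \<comment> \<open>Moving a point of the hyperplane by \<open>i\<close> times \<open>e\<close> with
    i < p changes the residue of the linear form each time, so the translates are distinct and
    \<open>C\<close> fills at most the proportion 1/p of the cube.\<close>
  have "card (C \<times> {0..<int p}) \<le> card (int_box m)"
  proof (rule card_inj_on_le[of "\<lambda>(w,i). vmod (w + smul i e) (int m)"])
    show "inj_on (\<lambda>(w,i). vmod (w + smul i e) (int m)) (C \<times> {0..<int p})"
    proof (rule inj_onI)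
      fix X Y assume XY: "X \<in> C \<times> {0..<int p}" "Y \<in> C \<times> {0..<int p}"
        "(\<lambda>(w,i). vmod (w + smul i e) (int m)) X = (\<lambda>(w,i). vmod (w + smul i e) (int m)) Y"
      obtain w i w' i' where X: "X = (w,i)" and Y: "Y = (w',i')" by (metis surj_pair)
      have eq: "vmod (w + smul i e) (int m) = vmod (w' + smul i' e) (int m)" using XY(3) by (simp add: X Y)
      have "int p dvd (dot3 g w + i * dot3 g e) - (dot3 g w' + i' * dot3 g e)"
        using dm[OF eq] by (simp add: dot3_add dot3_smul)
      moreover have "int p dvd dot3 g w - dot3 g w'" using XY by (simp add: X Y C_def)
      ultimately have "int p dvd ((dot3 g w + i * dot3 g e) - (dot3 g w' + i' * dot3 g e)) - (dot3 g w - dot3 g w')" by (rule dvd_diff)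
      then have "int p dvd (i - i') * dot3 g e" by (simp add: algebra_simps)
      then have "int p dvd i - i'" using e(2) pp by (simp add: prime_dvd_mult_iff)
      then have ii: "i = i'" using XY(1,2) by (auto simp: X Y mod_eq_dvd_iff[symmetric])
      have "vmod w (int m) = vmod w' (int m)" using eq ii by (simp add: vmod_eq_iff)
      then show "X = Y" using XY ii by (auto simp: X Y C_def vmod_box)
    qed
    show "(\<lambda>(w,i). vmod (w + smul i e) (int m)) ` (C \<times> {0..<int p}) \<subseteq> int_box m"
      by (simp add: image_subset_iff split_beta vmod_in_box[OF m0])
  qed simp
  then have C: "card C * p \<le> m ^ 3" by (simp add: card_cartesian_product int_box_def power3_eq_cube mult.assoc)
  have "card (int_box m) = card C + card G"
    unfolding C_def G_def by (subst card_Un_disjoint[symmetric]) (auto intro: arg_cong[where f=card])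
  then have CG: "m ^ 3 = card C + card G" by (simp add: card_cartesian_product int_box_def power3_eq_cube mult.assoc)
  have "\<exists>l. [form_eval f (w + smul l v) = n] (mod int m)" if "w \<in> G" for w
  proof -
    have "\<not> int p dvd dot3 g w" using that by (simp add: G_def)
    then have "coprime (dot3 g w) (int m)"
      using pp by (metis coprime_commute coprime_power_left_iff m_def of_nat_power prime_imp_coprime)
    then obtain l where l: "int m dvd dot3 g w * l - (n - form_eval f w)" using exists_inverse_mod by blast
    have "form_eval f (w + smul l v) - n = (dot3 g w * l - (n - form_eval f w)) + l\<^sup>2 * form_eval f v"
      by (simp add: form_eval_plus form_eval_smul dot3_smul g_def dot3_gradient_sym[of f w v])
    then have "int m dvd form_eval f (w + smul l v) - n" using l v(2) by (simp only: dvd_add dvd_mult)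
    then show ?thesis by (auto simp: cong_iff_dvd_diff)
  qed
  then obtain l where l: "\<And>w. w \<in> G \<Longrightarrow> [form_eval f (w + smul (l w) v) = n] (mod int m)" by metis
  \<comment> \<open>Recording the parameter along with the solution makes the map injective: the
    solution minus that multiple of \<open>v\<close> returns \<open>w\<close>. Hence each solution
    is reached from at most \<open>m\<close> points.\<close>
  define \<Phi> where "\<Phi> w = (vmod (w + smul (l w) v) (int m), l w mod int m)" for w
  have "card G \<le> card (solutions f m n \<times> {0..<int m})"
  proof (rule card_inj_on_le[of \<Phi>])
    show "\<Phi> ` G \<subseteq> solutions f m n \<times> {0..<int m}"
    proof (rule image_subsetI)
      fix w assume "w \<in> G"
      then show "\<Phi> w \<in> solutions f m n \<times> {0..<int m}"
        unfolding \<Phi>_def using vmod_solutions[OF m0 l] m0 by simp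
    qed
    show "inj_on \<Phi> G"
    proof (rule inj_onI)
      fix w w' assume w: "w \<in> G" "w' \<in> G" "\<Phi> w = \<Phi> w'"
      then have 1: "vdvd (int m) (w + smul (l w) v - (w' + smul (l w') v))" "int m dvd l w - l w'"
        by (auto simp: \<Phi>_def vmod_eq_iff mod_eq_dvd_iff)
      obtain d where d: "l w = l w' + int m * d" using 1(2) by (metis dvdE diff_add_cancel add.commute)
      have "vdvd (int m) (w - w')"
      proof -
        have "w - w' = (w + smul (l w) v - (w' + smul (l w') v)) - smul (int m) (smul d v)"
        proof -
          have "w - w' = (w + smul L v - (w' + smul L' v)) - smul (int m) (smul d v)" if "L = L' + int m * d" for L L'
            by (cases w; cases w'; cases v) (simp add: that algebra_simps)
          then show ?thesis using d by blast
        qed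
        moreover have "vdvd (int m) (smul (int m) (smul d v))" by (cases v) simp
        ultimately show ?thesis using 1(1)
          by (cases "w + smul (l w) v - (w' + smul (l w') v)"; cases "smul (int m) (smul d v)") simp
      qed
      then show "w = w'" using w(1,2) vmod_box by (auto simp: G_def vmod_eq_iff[symmetric])
    qed
  qed simp
  then have "card G \<le> sol_count f m n * m" by (simp add: card_cartesian_product sol_count_def)
  then have 1: "m ^ 3 \<le> card C + sol_count f m n * m" using CG by simp
  have p0: "real p > 0" "real m > 0" using p m0 by (auto simp: prime_gt_0_nat)
  have "real (card C * p) \<le> real (m ^ 3)" using C by (simp only: of_nat_le_iff)
  then have "real (card C) \<le> real m ^ 3 / real p" using p0 by (simp add: field_simps)
  moreover have "real (m ^ 3) \<le> real (card C + sol_count f m n * m)" using 1 by (simp only: of_nat_le_iff)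
  ultimately have "real m ^ 3 - real m ^ 3 / real p \<le> real (sol_count f m n) * real m" by simp
  moreover have "real m ^ 3 - real m ^ 3 / real p = (real m ^ 2 * (1 - 1 / real p)) * real m"
    by (simp add: power2_eq_square power3_eq_cube algebra_simps)
  ultimately have "real m ^ 2 * (1 - 1 / real p) \<le> real (sol_count f m n)" using p0 by (metis mult_le_cancel_right_pos)
  then show ?thesis by (simp add: m_def)
qed

section \<open>Primes dividing the determinant\<close>

text \<open>Since \<open>p\<close> divides \<open>\<gamma>\<close>, the derivative
  \<open>\<beta> + 2 * \<gamma> * \<tau>\<close> is a unit at every \<open>\<tau>\<close>. Thus any
  starting point works, and \<open>p = 2\<close> causes no exception.\<close>

lemma quadratic_hensel:
  fixes p :: nat and \<alpha> \<beta> \<gamma> :: int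
  assumes p: "prime p" and "\<not> int p dvd \<beta>" "int p dvd \<gamma>"
  shows "\<exists>\<tau>. int p ^ N dvd \<alpha> + \<beta> * \<tau> + \<gamma> * \<tau>\<^sup>2"
proof (induction N)
  case 0 then show ?case by simp
next
  case (Suc N)
  then obtain \<tau> where "int p ^ N dvd \<alpha> + \<beta> * \<tau> + \<gamma> * \<tau>\<^sup>2" by blast
  then obtain c where c: "\<alpha> + \<beta> * \<tau> + \<gamma> * \<tau>\<^sup>2 = int p ^ N * c" by (auto elim!: dvdE)
  obtain g where g: "\<gamma> = int p * g" using assms(3) by (auto elim!: dvdE)
  have "\<not> int p dvd \<beta> + 2 * \<gamma> * \<tau>" using assms(2) by (simp add: g dvd_add_left_iff)
  then have "coprime (\<beta> + 2 * \<gamma> * \<tau>) (int p)"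
    using p by (metis coprime_commute prime_imp_coprime prime_nat_int_transfer)
  then obtain s where "int p dvd (\<beta> + 2 * \<gamma> * \<tau>) * s - (- c)" using exists_inverse_mod by blast
  then obtain d where d: "(\<beta> + 2 * \<gamma> * \<tau>) * s + c = int p * d" by (auto elim!: dvdE)
  have "\<alpha> + \<beta> * (\<tau> + int p ^ N * s) + \<gamma> * (\<tau> + int p ^ N * s)\<^sup>2 =
    (\<alpha> + \<beta> * \<tau> + \<gamma> * \<tau>\<^sup>2) + int p ^ N * ((\<beta> + 2 * \<gamma> * \<tau>) * s) + \<gamma> * (int p ^ N * s)\<^sup>2"
    by (simp add: power2_eq_square algebra_simps)
  also have "\<dots> = int p ^ N * ((\<beta> + 2 * \<gamma> * \<tau>) * s + c) + int p * g * (int p ^ N * s)\<^sup>2"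
    unfolding c by (simp add: g algebra_simps)
  also have "\<dots> = int p ^ Suc N * (d + g * int p ^ N * s\<^sup>2)"
    unfolding d by (simp add: power2_eq_square algebra_simps)
  finally show ?case by (metis dvd_triv_left)
qed

lemma max_power_dividing_vector:
  assumes "\<not> vdvd (p ^ Suc N) g"
  obtains e where "e \<le> N" "vdvd (p ^ e) g" "\<not> vdvd (p ^ Suc e) g"
proof -
  define e where "e = (LEAST i. \<not> vdvd (p ^ Suc i) g)"
  have 1: "\<not> vdvd (p ^ Suc e) g" unfolding e_def using assms by (rule LeastI)
  have 2: "e \<le> N" unfolding e_def using assms by (rule Least_le)
  have "vdvd (p ^ e) g"
  proof (cases e)
    case 0 then show ?thesis by (cases g) simp
  next
    case (Suc i)
    then show ?thesis using not_less_Least[of i "\<lambda>i. \<not> vdvd (p ^ Suc i) g"] unfolding e_def by auto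
  qed
  then show ?thesis using that 1 2 by blast
qed

text \<open>Euler's identity, by which the gradient at \<open>w0\<close> paired with
  \<open>w0\<close> is twice the value, bounds the content of the gradient: if p^(V+2) divided it,
  then p^(V+2) would divide 2n and so p^(V+1) would divide \<open>n\<close>, even for p = 2. With e
  \<le> V + 1, the exponent 2V + 4 covers the precision V + 2 + e that Hensel's lemma uses.\<close>

lemma hensel_data:
  fixes p V :: nat
  assumes p: "prime p" and n: "\<not> int p ^ Suc V dvd n" and w0: "int p ^ (2 * V + 4) dvd form_eval f w0 - n"
  obtains e g E c where "e \<le> V + 1" "gradient f w0 = smul (int p ^ e) g"
    "E \<in> {(1,0,0), (0,1,0), (0,0,1)}" "\<not> int p dvd dot3 g E" "form_eval f w0 - n = int p ^ (V + 2 + e) * c"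
proof -
  have "\<not> vdvd (int p ^ Suc (V + 1)) (gradient f w0)"
  proof
    assume "vdvd (int p ^ Suc (V + 1)) (gradient f w0)"
    then have "int p ^ (V + 2) dvd 2 * form_eval f w0" using dot3_dvd(2)[of _ "gradient f w0" w0] by (simp add: dot3_gradient_self)
    moreover have "int p ^ (V + 2) dvd int p ^ (2 * V + 4)" by (rule le_imp_power_dvd) simp
    then have "int p ^ (V + 2) dvd 2 * (form_eval f w0 - n)" using w0 dvd_trans dvd_mult by blast
    ultimately have "int p ^ (V + 2) dvd 2 * form_eval f w0 - 2 * (form_eval f w0 - n)" by (rule dvd_diff)
    then have d: "int p ^ (V + 2) dvd 2 * n" by simp
    show False
    proof (cases "p = 2")
      case True
      then have "2 * 2 ^ Suc V dvd 2 * n" using d by simp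
      then show False using n True by (metis dvd_mult_cancel_left of_nat_numeral zero_neq_numeral)
    next
      case False
      then have "coprime (int p) 2" using p
        by (metis coprime_commute primes_coprime two_is_prime_nat of_nat_numeral coprime_int_iff)
      then have "int p ^ (V + 2) dvd n" using d by (simp add: coprime_dvd_mult_right_iff)
      then have "int p ^ Suc V dvd n" by (rule dvd_trans[rotated]) (simp add: le_imp_power_dvd)
      then show False using n by blast
    qed
  qed
  then obtain e where e: "e \<le> V + 1" "vdvd (int p ^ e) (gradient f w0)" "\<not> vdvd (int p ^ Suc e) (gradient f w0)"
    by (rule max_power_dividing_vector)
  then obtain g where g: "gradient f w0 = smul (int p ^ e) g" unfolding vdvd_iff_smul by blast
  have "\<not> vdvd (int p) g"
  proof
    assume "vdvd (int p) g"
    then obtain u where "g = smul (int p) u" unfolding vdvd_iff_smul by blast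
    then have "gradient f w0 = smul (int p ^ Suc e) u" using g by (cases u) (simp add: mult_ac)
    then show False using e(3) unfolding vdvd_iff_smul by blast
  qed
  then obtain E where E: "E \<in> {(1,0,0), (0,1,0), (0,0,1)}" "\<not> int p dvd dot3 g E" by (rule not_vdvd_dot3_unit)
  have "int p ^ (V + 2 + e) dvd form_eval f w0 - n"
    using e(1) by (intro dvd_trans[OF le_imp_power_dvd w0]) simp
  then obtain c where "form_eval f w0 - n = int p ^ (V + 2 + e) * c" by (auto elim!: dvdE)
  then show ?thesis using that e(1) g E by blast
qed

text \<open>Solutions are sought in the form w0 + p^(V+2) t. Two coordinates of \<open>t\<close> are
  free and the third is determined by Hensel's lemma, which gives a fixed proportion of the p^(2k)
  expected solutions, uniformly in \<open>k\<close>.\<close>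

lemma sol_count_bad_prime:
  fixes p V k :: nat
  assumes p: "prime p" and n: "\<not> int p ^ Suc V dvd n" and w0: "int p ^ (2 * V + 4) dvd form_eval f w0 - n"
    and k: "k \<ge> 2 * V + 4"
  shows "p ^ (2 * (k - (V + 2))) \<le> sol_count f (p ^ k) n"
proof -
  define j where "j = V + 2"
  obtain e g E c where e: "e \<le> V + 1" and g: "gradient f w0 = smul (int p ^ e) g"
    and E: "E \<in> {(1,0,0), (0,1,0), (0,0,1)}" "\<not> int p dvd dot3 g E" and c: "form_eval f w0 - n = int p ^ (j + e) * c"
    unfolding j_def by (rule hensel_data[OF p n w0])
  have p0: "int p > 0" using p by (simp add: prime_gt_0_nat)
  \<comment> \<open>Places the two free parameters in the coordinates other than that of
    \<open>E\<close>, in which the Hensel correction is made.\<close>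
  define \<iota> where "\<iota> = (\<lambda>(a, b). if E = (1,0,0) then (0, a, b) else if E = (0,1,0) then (a, 0, b) else (a, b, 0 :: int))"
  have "\<exists>\<tau>. int p ^ k dvd form_eval f (w0 + smul (int p ^ j) (t0 + smul \<tau> E)) - n" for t0
  proof -
    \<comment> \<open>A positive power of \<open>p\<close>, because e < j. It is what remains with
      the quadratic terms after division by p^(j+e), and so makes the leading coefficient
      \<open>\<gamma>\<close> divisible by \<open>p\<close>.\<close>
    define P where "P = int p ^ (j - e)"
    have pP: "int p dvd P" using e by (simp add: P_def j_def dvd_power)
    have jP: "int p ^ j = int p ^ e * P" using e by (simp add: P_def j_def flip: power_add)
    define \<alpha> where "\<alpha> = c + dot3 g t0 + P * form_eval f t0"
    define \<beta> where "\<beta> = dot3 g E + P * dot3 (gradient f t0) E"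
    define \<gamma> where "\<gamma> = P * form_eval f E"
    have "\<not> int p dvd \<beta>" using E(2) pP by (simp add: \<beta>_def dvd_add_left_iff)
    moreover have "int p dvd \<gamma>" using pP by (simp add: \<gamma>_def)
    ultimately obtain \<tau> where \<tau>: "int p ^ (k - (j + e)) dvd \<alpha> + \<beta> * \<tau> + \<gamma> * \<tau>\<^sup>2"
      using quadratic_hensel[OF p] by blast
    have "form_eval f (w0 + smul (int p ^ j) (t0 + smul \<tau> E)) - n =
      int p ^ (j + e) * c + int p ^ j * (int p ^ e * (dot3 g t0 + \<tau> * dot3 g E))
       + int p ^ j * int p ^ j * (form_eval f t0 + \<tau> * dot3 (gradient f t0) E + \<tau>\<^sup>2 * form_eval f E)"
      using c by (simp add: form_eval_plus form_eval_smul dot3_add dot3_smul g power2_eq_square algebra_simps)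
    also have "\<dots> = int p ^ (j + e) * (\<alpha> + \<beta> * \<tau> + \<gamma> * \<tau>\<^sup>2)"
      unfolding \<alpha>_def \<beta>_def \<gamma>_def power_add jP by (simp add: algebra_simps)
    finally have "int p ^ (j + e) * int p ^ (k - (j + e)) dvd form_eval f (w0 + smul (int p ^ j) (t0 + smul \<tau> E)) - n"
      using \<tau> by (simp add: mult_dvd_mono)
    moreover have "j + e + (k - (j + e)) = k" using e k by (simp add: j_def)
    ultimately show ?thesis by (metis power_add)
  qed
  then obtain \<tau> where \<tau>: "\<And>t0. int p ^ k dvd form_eval f (w0 + smul (int p ^ j) (t0 + smul (\<tau> t0) E)) - n" by metis
  define \<Phi> where "\<Phi> s = vmod (w0 + smul (int p ^ j) (\<iota> s + smul (\<tau> (\<iota> s)) E)) (int (p ^ k))" for s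
  define m where "m = int p ^ (k - j)"
  have m0: "m > 0" using p0 by (simp add: m_def)
  have "j + (k - j) = k" using k by (simp add: j_def)
  then have kj: "int p ^ k = int p ^ j * m" by (metis m_def power_add)
  have "card ({0..<m} \<times> {0..<m}) \<le> card (solutions f (p ^ k) n)"
  proof (rule card_inj_on_le[of \<Phi>])
    show "\<Phi> ` ({0..<m} \<times> {0..<m}) \<subseteq> solutions f (p ^ k) n"
    proof (rule image_subsetI)
      fix s show "\<Phi> s \<in> solutions f (p ^ k) n"
        unfolding \<Phi>_def using p0 \<tau> by (intro vmod_solutions) (auto simp: cong_iff_dvd_diff)
    qed
    show "inj_on \<Phi> ({0..<m} \<times> {0..<m})"
    proof (rule inj_onI)
      fix s s' assume s: "s \<in> {0..<m} \<times> {0..<m}" "s' \<in> {0..<m} \<times> {0..<m}" "\<Phi> s = \<Phi> s'"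
      obtain a b a' b' where ab: "s = (a, b)" "s' = (a', b')" by (metis surj_pair)
      define d where "d = (\<iota> s + smul (\<tau> (\<iota> s)) E) - (\<iota> s' + smul (\<tau> (\<iota> s')) E)"
      have "vdvd (int (p ^ k)) (smul (int p ^ j) d)"
      proof -
        have "vdvd (int (p ^ k)) ((w0 + smul (int p ^ j) (\<iota> s + smul (\<tau> (\<iota> s)) E)) - (w0 + smul (int p ^ j) (\<iota> s' + smul (\<tau> (\<iota> s')) E)))"
          using s(3) by (simp add: \<Phi>_def vmod_eq_iff)
        moreover have "(w0 + smul q x) - (w0 + smul q y) = smul q (x - y)" for q x y
          by (cases w0; cases x; cases y) (simp add: algebra_simps)
        ultimately show ?thesis by (simp add: d_def)
      qed
      then have "vdvd m d" using p0 by (cases d) (simp add: kj)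
      then have "m dvd a - a' \<and> m dvd b - b'"
        using E(1) by (auto simp: d_def \<iota>_def ab)
      then have "a mod m = a' mod m" "b mod m = b' mod m" by (simp_all add: mod_eq_dvd_iff)
      then show "s = s'" using s(1,2) by (simp add: ab)
    qed
  qed simp
  moreover have "card ({0..<m} \<times> {0..<m}) = p ^ (2 * (k - (V + 2)))"
    using m0 by (simp add: card_cartesian_product m_def j_def nat_power_eq power_mult power2_eq_square mult_2 power_add)
  ultimately show ?thesis by (simp add: sol_count_def)
qed

section \<open>Products of local factors over small primes\<close>

lemma sol_count_prod:
  fixes S :: "nat set"
  assumes "finite S" "\<And>p. p \<in> S \<Longrightarrow> prime p"
  shows "(\<Prod>p\<in>S. sol_count f (p ^ k) n) \<le> sol_count f (\<Prod>p\<in>S. p ^ k) n"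
  using assms
proof (induction S rule: finite_induct)
  case empty
  have "(0,0,0) \<in> solutions f 1 n" by (simp add: solutions_def int_box_def)
  then show ?case by (simp add: sol_count_def) (metis One_nat_def Suc_leI card_gt_0_iff empty_iff finite_solutions)
next
  case (insert p S)
  have "coprime (p ^ k) (\<Prod>p\<in>S. p ^ k)"
    using insert by (intro prod_coprime_right) (metis coprime_power_left_iff coprime_power_right_iff insertCI primes_coprime)
  moreover have "p ^ k > 0" "(\<Prod>p\<in>S. p ^ k) > 0" using insert by (auto simp: prime_gt_0_nat intro!: prod_pos)
  ultimately have "sol_count f (p ^ k) n * sol_count f (\<Prod>p\<in>S. p ^ k) n \<le> sol_count f (p ^ k * (\<Prod>p\<in>S. p ^ k)) n"
    by (rule sol_count_mult)
  moreover have "sol_count f (p ^ k) n * (\<Prod>p\<in>S. sol_count f (p ^ k) n) \<le> sol_count f (p ^ k) n * sol_count f (\<Prod>p\<in>S. p ^ k) n"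
    using insert by (intro mult_left_mono) auto
  ultimately have "sol_count f (p ^ k) n * (\<Prod>p\<in>S. sol_count f (p ^ k) n) \<le> sol_count f (p ^ k * (\<Prod>p\<in>S. p ^ k)) n"
    by linarith
  then show ?case using insert(1,2) by simp
qed

text \<open>The true order is 1/log Q by Mertens; a power saving of \<open>Q\<close> below the
  exponent 1/2 is enough here. All primes above 3 have the form 6i - 1 or 6i + 1, such a pair
  contributes at least 1 - 1/(3i), and the product of these factors decays like the inverse cube
  root. The cube in the statement avoids fractional powers.\<close>

lemma prod_one_minus_inverse_primes:
  fixes Q :: nat
  assumes "Q \<ge> 1"
  shows "(\<Prod>p\<in>{p. prime p \<and> p \<le> Q}. 1 - 1 / real p) ^ 3 \<ge> 1 / (100 * real Q)"
proof -
  let ?g = "\<lambda>m::nat. 1 - 1 / real m"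
  let ?P = "{p. prime p \<and> p \<le> Q}"
  have fin: "finite ?P" by simp
  have g01: "0 \<le> ?g m" "?g m \<le> 1" for m :: nat by (cases m; simp)+
  let ?T = "{2, 3} \<union> ((\<lambda>i. 6 * i - 1) ` {1..Q} \<union> (\<lambda>i. 6 * i + 1) ` {1..Q})"
  have sub: "?P \<subseteq> ?T"
  proof
    fix p assume "p \<in> ?P"
    then have p: "prime p" "p \<le> Q" by auto
    show "p \<in> ?T"
    proof (cases "p = 2 \<or> p = 3")
      case False
      moreover have "prime (2::nat)" "prime (3::nat)" by simp_all
      ultimately have "\<not> 2 dvd p" "\<not> 3 dvd p" using p(1) primes_dvd_imp_eq by blast+
      then have "p mod 6 = 1 \<or> p mod 6 = 5" by presburger
      then show ?thesis
      proof
        assume "p mod 6 = 1"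
        define i where "i = p div 6"
        have i: "p = 6 * i + 1" using \<open>p mod 6 = 1\<close> unfolding i_def by presburger
        have "i \<noteq> 0" using p(1) i by (metis add_0 mult_0_right not_prime_1)
        then have "i \<in> {1..Q}" using p(2) i by simp
        then show ?thesis unfolding i by blast
      next
        assume "p mod 6 = 5"
        define i where "i = p div 6 + 1"
        have i: "p = 6 * i - 1" using \<open>p mod 6 = 5\<close> unfolding i_def by presburger
        have "i \<ge> 1" by (simp add: i_def)
        then have "i \<in> {1..Q}" using p(2) i by simp
        then show ?thesis unfolding i by blast
      qed
    qed auto
  qed
  have mono: "prod ?g B \<le> prod ?g A" if "A \<subseteq> B" "finite B" for A B
  proof -
    have "prod ?g B = prod ?g (B - A) * prod ?g A" using that by (intro prod.subset_diff)
    moreover have "prod ?g (B - A) \<le> 1" using g01 by (intro prod_le_1) auto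
    moreover have "prod ?g A \<ge> 0" using g01 by (intro prod_nonneg) auto
    ultimately show ?thesis using mult_right_mono[of "prod ?g (B - A)" 1 "prod ?g A"] by simp
  qed
  have un: "prod ?g (A \<union> B) \<ge> prod ?g A * prod ?g B" if "finite A" "finite B" for A B
  proof -
    have "prod ?g (A \<union> B) = prod ?g A * prod ?g (B - A)" using prod.union_disjoint[of A "B - A" ?g] that by simp
    moreover have "prod ?g B \<le> prod ?g (B - A)" using that by (intro mono) auto
    moreover have "prod ?g A \<ge> 0" using g01 by (intro prod_nonneg) auto
    ultimately show ?thesis by (simp add: mult_left_mono)
  qed
  have inj1: "inj_on (\<lambda>i::nat. 6 * i - 1) {1..Q}" by (auto simp: inj_on_def)
  have inj2: "inj_on (\<lambda>i::nat. 6 * i + 1) {1..Q}" by (auto simp: inj_on_def)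
  have pr: "prod ?g ((\<lambda>i. 6 * i - 1) ` {1..Q}) * prod ?g ((\<lambda>i. 6 * i + 1) ` {1..Q}) = (\<Prod>i\<in>{1..Q}. ?g (6 * i - 1) * ?g (6 * i + 1))"
    by (subst prod.reindex[OF inj1], subst prod.reindex[OF inj2]) (simp add: prod.distrib)
  have ge: "1 - 1 / (3 * real i) \<le> ?g (6 * i - 1) * ?g (6 * i + 1)" if "i \<in> {1..Q}" for i
  proof -
    define x where "x = real i"
    have x: "x \<ge> 1" using that by (simp add: x_def)
    have e: "real (6 * i - 1) = 6 * x - 1" "real (6 * i + 1) = 6 * x + 1" using that by (auto simp: x_def of_nat_diff)
    have l1: "(1 - 1 / (6 * x - 1)) * (1 - 1 / (6 * x + 1)) = (36 * x\<^sup>2 - 12 * x) / (36 * x\<^sup>2 - 1)"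
      using x by (simp add: field_simps power2_eq_square)
    have l2: "(36 * x\<^sup>2 - 12 * x) / (36 * x\<^sup>2) \<le> (36 * x\<^sup>2 - 12 * x) / (36 * x\<^sup>2 - 1)"
    proof (rule divide_left_mono)
      have "x\<^sup>2 \<ge> 1" using x by simp
      then show "0 < 36 * x\<^sup>2 * (36 * x\<^sup>2 - 1)" by (intro mult_pos_pos) auto
      show "0 \<le> 36 * x\<^sup>2 - 12 * x" using x by (simp add: power2_eq_square)
    qed simp
    have "(36 * x\<^sup>2 - 12 * x) / (36 * x\<^sup>2) = 1 - 1 / (3 * x)" using x by (simp add: field_simps power2_eq_square)
    then show ?thesis using l1 l2 unfolding e by (simp add: x_def)
  qed
  have lower: "(\<Prod>i\<in>{1..N}. 1 - 1 / (3 * real i)) ^ 3 \<ge> 8 / (27 * real N)" if "N \<ge> 1" for N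
    using that
  proof (induction N rule: nat_induct_at_least)
    case base then show ?case by (simp add: power3_eq_cube)
  next
    case (Suc N)
    define y where "y = 1 / real (Suc N)"
    have y: "0 \<le> y" "y \<le> 1" by (auto simp: y_def)
    have "(1 - 1 / (3 * real (Suc N))) ^ 3 = (1 - y / 3) ^ 3" by (simp add: y_def mult.commute)
    also have "\<dots> = 1 - y + y\<^sup>2 / 27 * (9 - y)" by (simp add: power2_eq_square power3_eq_cube field_simps)
    finally have e: "(1 - 1 / (3 * real (Suc N))) ^ 3 = 1 - y + y\<^sup>2 / 27 * (9 - y)" .
    have "y\<^sup>2 / 27 * (9 - y) \<ge> 0" using y by (intro mult_nonneg_nonneg) auto
    then have 1: "(1 - 1 / (3 * real (Suc N))) ^ 3 \<ge> 1 - y" using e by linarith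
    have "1 - y = real N / real (Suc N)" by (simp add: y_def field_simps)
    then have "8 / (27 * real (Suc N)) = 8 / (27 * real N) * (1 - y)" using Suc by simp
    also have "\<dots> \<le> (\<Prod>i\<in>{1..N}. 1 - 1 / (3 * real i)) ^ 3 * (1 - 1 / (3 * real (Suc N))) ^ 3"
    proof (rule mult_mono[OF Suc(2) 1])
      show "0 \<le> (\<Prod>i\<in>{1..N}. 1 - 1 / (3 * real i)) ^ 3"
        by (rule order_trans[OF _ Suc(2)]) simp
    qed (use y in simp)
    finally show ?case by (simp add: power_mult_distrib mult.commute)
  qed
  have "(\<Prod>i\<in>{1..Q}. 1 - 1 / (3 * real i)) \<le> (\<Prod>i\<in>{1..Q}. ?g (6 * i - 1) * ?g (6 * i + 1))"
  proof (rule prod_mono, intro conjI ge)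
    fix i assume "i \<in> {1..Q}"
    then show "0 \<le> 1 - 1 / (3 * real i)" by (simp add: field_simps)
  qed
  also have "\<dots> \<le> prod ?g ((\<lambda>i. 6 * i - 1) ` {1..Q} \<union> (\<lambda>i. 6 * i + 1) ` {1..Q})"
    unfolding pr[symmetric] by (rule un) auto
  finally have "1/3 * (\<Prod>i\<in>{1..Q}. 1 - 1 / (3 * real i)) \<le> prod ?g {2, 3} * prod ?g ((\<lambda>i. 6 * i - 1) ` {1..Q} \<union> (\<lambda>i. 6 * i + 1) ` {1..Q})"
    by simp
  also have "\<dots> \<le> prod ?g ?T" by (rule un) auto
  also have "\<dots> \<le> prod ?g ?P" by (rule mono[OF sub]) auto
  finally have a: "1/3 * (\<Prod>i\<in>{1..Q}. 1 - 1 / (3 * real i)) \<le> prod ?g ?P" .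
  have nn: "0 \<le> (\<Prod>i\<in>{1..Q}. 1 - 1 / (3 * real i))"
    by (rule prod_nonneg) (auto simp: field_simps)
  \<comment> \<open>The factor 1/3 is the contribution of the primes 2 and 3; its cube times 8/27 is
    8/729, slightly more than 1/100.\<close>
  have "1 / (100 * real Q) \<le> (1/3) ^ 3 * (8 / (27 * real Q))" using assms by (simp add: field_simps power3_eq_cube)
  also have "\<dots> \<le> (1/3) ^ 3 * (\<Prod>i\<in>{1..Q}. 1 - 1 / (3 * real i)) ^ 3" using lower[OF assms] by (intro mult_left_mono) auto
  also have "\<dots> = (1/3 * (\<Prod>i\<in>{1..Q}. 1 - 1 / (3 * real i))) ^ 3" by (simp only: power_mult_distrib)
  also have "\<dots> \<le> (prod ?g ?P) ^ 3" using a nn by (intro power_mono) auto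
  finally show ?thesis .
qed

section \<open>A lower bound for the average count\<close>

lemma rep_average_ge:
  assumes "K \<ge> 1" "M \<ge> 1" "finite T"
    and T: "\<And>w. w \<in> T \<Longrightarrow> w \<in> int_box X \<and> n \<le> form_eval f w \<and> form_eval f w < n + int (K * M) \<and> [form_eval f w = n] (mod int M)"
  shows "rep_average f X K M n \<ge> real (card T) / real K"
proof -
  have "T \<subseteq> (\<Union>j\<in>{..<K}. {w\<in>int_box X. form_eval f w = n + int (j * M)})"
  proof
    fix w assume "w \<in> T"
    note w = T[OF this]
    have "int M dvd form_eval f w - n" using w by (simp add: cong_iff_dvd_diff)
    then obtain j where j: "form_eval f w - n = int M * j" by (auto elim!: dvdE)
    have j0: "j \<ge> 0" using j w assms(2) by (smt (verit, ccfv_SIG) mult_pos_neg of_nat_0_less_iff less_le_trans zero_less_one)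
    have "int M * j < int M * int K" using j w by (simp add: mult.commute)
    then have "j < int K" using assms(2) by simp
    then have "nat j < K" "form_eval f w = n + int (nat j * M)" using j j0 by (auto simp: mult.commute)
    then show "w \<in> (\<Union>j\<in>{..<K}. {w\<in>int_box X. form_eval f w = n + int (j * M)})" using w by blast
  qed
  then have "card T \<le> card (\<Union>j\<in>{..<K}. {w\<in>int_box X. form_eval f w = n + int (j * M)})"
    by (intro card_mono) auto
  also have "\<dots> \<le> (\<Sum>j<K. card {w\<in>int_box X. form_eval f w = n + int (j * M)})" by (intro card_UN_le) auto
  finally have "real (card T) \<le> real (\<Sum>j<K. card {w\<in>int_box X. form_eval f w = n + int (j * M)})"
    by (simp only: of_nat_le_iff)
  then have "real (card T) \<le> (\<Sum>j<K. rep_count f X (n + int (j * M)))" by (simp add: rep_count_def)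
  then show ?thesis unfolding rep_average_def by (rule divide_right_mono) simp
qed

text \<open>Every translate of the cube of side \<open>s * M\<close> contains \<open>s ^ 3\<close> points of each residue class
  modulo \<open>M\<close>.\<close>

lemma card_cubes_ge:
  fixes M s J :: nat and P :: "nat \<Rightarrow> nat \<Rightarrow> int"
  assumes M: "M \<ge> 1" and T: "finite T"
    "\<And>i j h1 h2 h3. i < J \<Longrightarrow> j < J \<Longrightarrow> (h1, h2, h3) \<in> int_box (s * M) \<Longrightarrow>
       [form_eval f (P i j + h1, int (i * (s * M)) + h2, int (j * (s * M)) + h3) = n] (mod int M) \<Longrightarrow>
       (P i j + h1, int (i * (s * M)) + h2, int (j * (s * M)) + h3) \<in> T"
  shows "J ^ 2 * s ^ 3 * sol_count f M n \<le> card T"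
proof -
  define L where "L = s * M"
  \<comment> \<open>\<open>b + h b r t\<close> is the integer number \<open>t\<close>, counted from
    0, among those from \<open>b\<close> on that are congruent to \<open>r\<close>.\<close>
  define h where "h b r t = (r - b) mod int M + int M * t" for b r t :: int
  have hb: "0 \<le> h b r t \<and> h b r t < int L" if "0 \<le> t" "t < int s" for b r t
  proof -
    have "int M * t \<le> int M * (int s - 1)" using that by (intro mult_left_mono) auto
    moreover have "(r - b) mod int M < int M" "(r - b) mod int M \<ge> 0" using M by auto
    ultimately show ?thesis using that by (simp add: h_def L_def algebra_simps)
  qed
  define \<Phi> where "\<Phi> = (\<lambda>((i, j), (t1, t2, t3), (r1, r2, r3)).
     (P i j + h (P i j) r1 t1, int (i * L) + h (int (i * L)) r2 t2, int (j * L) + h (int (j * L)) r3 t3))"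
  let ?D = "({..<J} \<times> {..<J}) \<times> int_box s \<times> solutions f M n"
  have "card ?D \<le> card T"
  proof (rule card_inj_on_le[of \<Phi>])
    show "\<Phi> ` ?D \<subseteq> T"
    proof (rule image_subsetI)
      fix x assume x: "x \<in> ?D"
      obtain i j t1 t2 t3 r1 r2 r3 where xe: "x = ((i, j), (t1, t2, t3), (r1, r2, r3))" by (metis surj_pair)
      let ?w = "(P i j + h (P i j) r1 t1, int (i * L) + h (int (i * L)) r2 t2, int (j * L) + h (int (j * L)) r3 t3)"
      have m: "(b + h b r t) mod int M = r mod int M" for b r t
      proof -
        have "(r - b) mod int M = (r - b) - int M * ((r - b) div int M)" by (simp add: minus_mult_div_eq_mod)
        then have "b + h b r t - r = int M * (t - (r - b) div int M)" by (simp add: h_def algebra_simps)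
        then show ?thesis by (simp add: mod_eq_dvd_iff)
      qed
      have "[form_eval f ?w = form_eval f (r1, r2, r3)] (mod int M)" by (rule form_eval_cong) (simp add: m)
      then have "[form_eval f ?w = n] (mod int M)" using x by (auto simp: xe solutions_def intro: cong_trans)
      moreover have "(h (P i j) r1 t1, h (int (i * L)) r2 t2, h (int (j * L)) r3 t3) \<in> int_box (s * M)"
        using x hb unfolding xe by (auto simp: int_box_def L_def)
      ultimately have "?w \<in> T" using x T(2)[of i j] by (simp add: xe L_def)
      then show "\<Phi> x \<in> T" by (simp add: \<Phi>_def xe)
    qed
    show "inj_on \<Phi> ?D"
    proof (rule inj_onI)
      fix x x' assume x: "x \<in> ?D" "x' \<in> ?D" "\<Phi> x = \<Phi> x'"
      obtain i j t1 t2 t3 r1 r2 r3 where xe: "x = ((i, j), (t1, t2, t3), (r1, r2, r3))" by (metis surj_pair)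
      obtain i' j' t1' t2' t3' r1' r2' r3' where xe': "x' = ((i', j'), (t1', t2', t3'), (r1', r2', r3'))" by (metis surj_pair)
      have t: "0 \<le> t1 \<and> t1 < int s" "0 \<le> t2 \<and> t2 < int s" "0 \<le> t3 \<and> t3 < int s"
         "0 \<le> t1' \<and> t1' < int s" "0 \<le> t2' \<and> t2' < int s" "0 \<le> t3' \<and> t3' < int s"
         "0 \<le> r1 \<and> r1 < int M" "0 \<le> r2 \<and> r2 < int M" "0 \<le> r3 \<and> r3 < int M"
         "0 \<le> r1' \<and> r1' < int M" "0 \<le> r2' \<and> r2' < int M" "0 \<le> r3' \<and> r3' < int M"
        using x by (auto simp: xe xe' int_box_def solutions_def)
      have same: "a = a'" if "int (a * L) + u = int (a' * L) + u'" "0 \<le> u \<and> u < int L" "0 \<le> u' \<and> u' < int L" for a a' u u'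
      proof -
        have dv: "(int (c * L) + v) div int L = int c" if "0 \<le> v \<and> v < int L" for c v using that by simp
        have "(int (a * L) + u) div int L = int a" "(int (a' * L) + u') div int L = int a'"
          using dv[OF that(2)] dv[OF that(3)] by blast+
        then show ?thesis using that(1) by (metis of_nat_eq_iff)
      qed
      have hi: "t = t' \<and> r = r'" if "b + h b r t = b + h b r' t'" "0 \<le> r \<and> r < int M" "0 \<le> r' \<and> r' < int M" for b r t r' t'
      proof -
        have e: "(r - b) mod int M + int M * t = (r' - b) mod int M + int M * t'" using that(1) by (simp add: h_def)
        have "((r - b) mod int M + int M * t) div int M = t" "((r' - b) mod int M + int M * t') div int M = t'"
          using M by simp_all
        then have tt: "t = t'" using e by simp
        then have "(r - b) mod int M = (r' - b) mod int M" using e by simp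
        then have "int M dvd (r - b) - (r' - b)" by (simp add: mod_eq_dvd_iff)
        then have "r mod int M = r' mod int M" by (simp add: mod_eq_dvd_iff)
        then show ?thesis using tt that by simp
      qed
      have e: "P i j + h (P i j) r1 t1 = P i' j' + h (P i' j') r1' t1'"
        "int (i * L) + h (int (i * L)) r2 t2 = int (i' * L) + h (int (i' * L)) r2' t2'"
        "int (j * L) + h (int (j * L)) r3 t3 = int (j' * L) + h (int (j' * L)) r3' t3'"
        using x(3) by (auto simp: \<Phi>_def xe xe')
      have ii: "i = i'" by (rule same[OF e(2)]) (use hb t in auto)
      have jj: "j = j'" by (rule same[OF e(3)]) (use hb t in auto)
      show "x = x'" using e t hi[of "P i j" r1 t1 r1' t1'] hi[of "int (i * L)" r2 t2 r2' t2'] hi[of "int (j * L)" r3 t3 r3' t3']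
        by (simp add: xe xe' ii jj)
    qed
  qed (rule T(1))
  then show ?thesis by (simp add: card_cartesian_product int_box_def sol_count_def power2_eq_square power3_eq_cube mult.assoc)
qed

lemma form_eval_bound:
  fixes h :: "int \<times> int \<times> int"
  assumes "h \<in> {-int s..int s} \<times> {-int s..int s} \<times> {-int s..int s}"
  shows "\<bar>form_eval f h\<bar> \<le> int (coeff_bound f) * (int s)\<^sup>2"
proof -
  obtain x y z where h: "h = (x,y,z)" by (metis prod_cases3)
  have b: "\<bar>x\<bar> \<le> int s" "\<bar>y\<bar> \<le> int s" "\<bar>z\<bar> \<le> int s" using assms by (auto simp: h abs_le_iff)
  have pr: "\<bar>c * (u * v)\<bar> \<le> \<bar>c\<bar> * (int s)\<^sup>2" if "\<bar>u\<bar> \<le> int s" "\<bar>v\<bar> \<le> int s" for c u v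
    unfolding abs_mult power2_eq_square using that by (intro mult_left_mono mult_mono) auto
  have tri: "\<bar>a1 + a2 + a3 + a4 + a5 + a6\<bar> \<le> \<bar>a1\<bar> + \<bar>a2\<bar> + \<bar>a3\<bar> + \<bar>a4\<bar> + \<bar>a5\<bar> + \<bar>a6\<bar>"
    for a1 a2 a3 a4 a5 a6 :: int by linarith
  have "\<bar>form_eval f h\<bar> \<le> (\<bar>coeff_11 f\<bar> + \<bar>coeff_22 f\<bar> + \<bar>coeff_33 f\<bar> + \<bar>coeff_12 f\<bar> + \<bar>coeff_13 f\<bar> + \<bar>coeff_23 f\<bar>) * (int s)\<^sup>2"
    unfolding distrib_right h form_eval_def prod.case of_int_eq_id id_apply
    by (intro order_trans[OF tri] add_mono pr b)
  also have "\<dots> \<le> int (coeff_bound f) * (int s)\<^sup>2"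
    by (intro mult_right_mono) (auto simp: coeff_bound_def)
  finally show ?thesis .
qed

lemma form_eval_lipschitz:
  fixes w h :: "int \<times> int \<times> int"
  assumes "h \<in> {-int s..int s} \<times> {-int s..int s} \<times> {-int s..int s}" "w \<in> {-int X..int X} \<times> {-int X..int X} \<times> {-int X..int X}" "s \<le> X"
  shows "\<bar>form_eval f (w + h) - form_eval f w\<bar> \<le> 4 * int (coeff_bound f) * int s * int X"
proof -
  let ?B = "int (coeff_bound f)"
  obtain x y z where h: "h = (x,y,z)" by (metis prod_cases3)
  obtain a b c where w: "w = (a,b,c)" by (metis prod_cases3)
  obtain r1 r2 r3 where r: "gradient f h = (r1,r2,r3)" by (metis prod_cases3)
  have "gradient f h \<in> {-int (coeff_bound f * s)..int (coeff_bound f * s)} \<times>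
     {-int (coeff_bound f * s)..int (coeff_bound f * s)} \<times> {-int (coeff_bound f * s)..int (coeff_bound f * s)}"
    unfolding h by (rule gradient_bounded) (use assms(1) in \<open>auto simp: h\<close>)
  then have rb: "\<bar>r1\<bar> \<le> ?B * int s" "\<bar>r2\<bar> \<le> ?B * int s" "\<bar>r3\<bar> \<le> ?B * int s" by (auto simp: r abs_le_iff)
  have wb: "\<bar>a\<bar> \<le> int X" "\<bar>b\<bar> \<le> int X" "\<bar>c\<bar> \<le> int X" using assms(2) by (auto simp: w abs_le_iff)
  have m: "\<bar>u * v\<bar> \<le> ?B * int s * int X" if "\<bar>u\<bar> \<le> ?B * int s" "\<bar>v\<bar> \<le> int X" for u v
    unfolding abs_mult using that by (intro mult_mono) auto
  have "\<bar>form_eval f h\<bar> \<le> ?B * (int s)\<^sup>2" by (rule form_eval_bound[OF assms(1)])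
  also have "\<dots> \<le> ?B * int s * int X" using assms(3) by (simp add: power2_eq_square mult_left_mono mult.assoc)
  finally have fh: "\<bar>form_eval f h\<bar> \<le> ?B * int s * int X" .
  have "form_eval f (w + h) - form_eval f w = r1 * a + r2 * b + r3 * c + form_eval f h"
    unfolding form_eval_plus dot3_gradient_sym[of f w h] by (simp add: r w)
  then show ?thesis using m[OF rb(1) wb(1)] m[OF rb(2) wb(2)] m[OF rb(3) wb(3)] fh by linarith
qed

text \<open>Along the line through (0, y, z) in the first direction the form starts below
  \<open>N\<close> and exceeds \<open>N\<close> before the middle of the cube, while consecutive
  values differ by at most 4 B X, where B is the coefficient bound. The first point at which
  \<open>N\<close> is reached therefore overshoots by no more than that.\<close>

lemma shell_point:
  fixes X b :: nat and N :: int
  assumes pos: "coeff_11 f \<ge> 1" and X: "X \<ge> 4" and yz: "0 \<le> y" "y \<le> int b" "0 \<le> z" "z \<le> int b"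
    and b: "128 * coeff_bound f * b \<le> X" and lo: "int (coeff_bound f) * (int b)\<^sup>2 < N" and hi: "32 * N \<le> (int X)\<^sup>2"
  obtains x where "1 \<le> x" "2 * x \<le> int X" "N \<le> form_eval f (x, y, z)" "form_eval f (x, y, z) \<le> N + 4 * int (coeff_bound f) * int X"
proof -
  define x2 where "x2 = X div 2"
  have "b \<le> coeff_bound f * b" using coeff_bound_pos[of f] by simp
  then have bX: "b \<le> X" using b unfolding mult.assoc by linarith
  \<comment> \<open>At x2 \<ge> X/4 the square contributes at least X^2/16; the displacement by y
    and z costs at most X^2/32 because of the bound on \<open>b\<close>, and X^2/32 is still at
    least \<open>N\<close>.\<close>
  have "form_eval f (int x2, y, z) \<ge> N"
  proof -
    have "\<bar>form_eval f ((int x2, 0, 0) + (0, y, z)) - form_eval f (int x2, 0, 0)\<bar> \<le> 4 * int (coeff_bound f) * int b * int X"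
      using yz bX by (intro form_eval_lipschitz) (auto simp: x2_def)
    moreover have "form_eval f (int x2, 0, 0) = coeff_11 f * (int x2)\<^sup>2" by (simp add: form_eval_def power2_eq_square)
    moreover have "coeff_11 f * (int x2)\<^sup>2 \<ge> 1 * (int x2)\<^sup>2" using pos by (intro mult_right_mono) auto
    moreover have "16 * (int x2)\<^sup>2 \<ge> (int X)\<^sup>2"
    proof -
      have "4 * int x2 \<ge> int X" using X by (simp add: x2_def)
      then have "(4 * int x2)\<^sup>2 \<ge> (int X)\<^sup>2" by (intro power_mono) auto
      then show ?thesis by (simp add: power_mult_distrib)
    qed
    moreover have "128 * (int (coeff_bound f) * int b * int X) \<le> (int X)\<^sup>2"
    proof -
      have "int (128 * coeff_bound f * b) * int X \<le> int X * int X" using b by (intro mult_right_mono) (simp_all only: of_nat_le_iff of_nat_0_le_iff)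
      then show ?thesis by (simp add: power2_eq_square mult_ac)
    qed
    ultimately show ?thesis using hi by simp
  qed
  moreover have f0: "form_eval f (0, y, z) < N"
    using form_eval_bound[of "(0,y,z)" b f] yz lo by (simp add: abs_le_iff)
  ultimately have ex: "\<exists>k. form_eval f (int k, y, z) \<ge> N" by blast
  define k where "k = (LEAST k. form_eval f (int k, y, z) \<ge> N)"
  have k1: "form_eval f (int k, y, z) \<ge> N" unfolding k_def using ex by (rule LeastI_ex)
  have k2: "k \<le> x2" unfolding k_def using \<open>form_eval f (int x2, y, z) \<ge> N\<close> by (rule Least_le)
  have k0: "k \<noteq> 0" using k1 f0 by (metis not_le of_nat_0)
  then have "form_eval f (int (k - 1), y, z) < N" using not_less_Least[of "k - 1" "\<lambda>k. form_eval f (int k, y, z) \<ge> N"] unfolding k_def by simp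
  moreover have "\<bar>form_eval f ((int (k - 1), y, z) + (1, 0, 0)) - form_eval f (int (k - 1), y, z)\<bar> \<le> 4 * int (coeff_bound f) * int 1 * int X"
    using yz bX k2 X by (intro form_eval_lipschitz) (auto simp: x2_def)
  moreover have "(int (k - 1), y, z) + (1, 0, 0) = (int k, y, z)" using k0 by (simp add: of_nat_diff)
  ultimately have "form_eval f (int k, y, z) \<le> N + 4 * int (coeff_bound f) * int X" by simp
  moreover have "1 \<le> int k" "2 * int k \<le> int X" using k0 k2 by (auto simp: x2_def)
  ultimately show ?thesis using that k1 by blast
qed

text \<open>Over each point of a J by J grid in the last two coordinates, a shell point is chosen
  whose value is just above the middle of the window from \<open>n\<close> to
  \<open>n + K * M\<close>. The cube of side \<open>s * M\<close> attached to it stays inside the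
  window, since the overshoot and the variation over the cube together are at most a quarter of the
  window length. Each cube then contributes \<open>s ^ 3\<close> points for every solution modulo
  \<open>M\<close>.\<close>

lemma rep_average_lower:
  fixes X K M s J b :: nat and n :: int
  assumes pos: "coeff_11 f \<ge> 1" and X: "X \<ge> 4" and M: "M \<ge> 1" and K: "K \<ge> 1"
    and b: "128 * coeff_bound f * b \<le> X" and lo: "int (coeff_bound f) * (int b)\<^sup>2 < n"
    and hi: "32 * (n + int (K * M)) \<le> (int X)\<^sup>2"
    and Js: "J * (s * M) \<le> b" and sX: "2 * (s * M) \<le> X"
    and fit: "16 * coeff_bound f * (s * M + 1) * X \<le> K * M" "K * M \<ge> 2"
  shows "rep_average f X K M n \<ge> real (J ^ 2 * s ^ 3 * sol_count f M n) / real K"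
proof -
  define B where "B = int (coeff_bound f)"
  define L where "L = s * M"
  define N where "N = n + int (K * M) div 2"
  define g where "g i j = (SOME x. 1 \<le> x \<and> 2 * x \<le> int X \<and> N \<le> form_eval f (x, int (i * L), int (j * L)) \<and> form_eval f (x, int (i * L), int (j * L)) \<le> N + 4 * B * int X)" for i j
  define W where "W = int (K * M)"
  have "0 \<le> W" by (simp add: W_def)
  then have W: "0 \<le> W div 2" "W div 2 \<le> W" by linarith+
  define W2 where "W2 = W div 2"
  have N2: "N = n + W2" by (simp add: N_def W2_def W_def)
  have "32 * (n + W) \<le> (int X)\<^sup>2" using hi by (simp add: W_def)
  moreover have "32 * N \<le> 32 * (n + W)" using W by (simp add: N2 W2_def)
  ultimately have N': "32 * N \<le> (int X)\<^sup>2" by (rule order_trans[rotated])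
  have "n \<le> N" using W by (simp add: N2 W2_def)
  then have N'': "B * (int b)\<^sup>2 < N" using lo unfolding B_def by (rule order.strict_trans2[rotated])
  note N = N'' N'
  have iL: "i * L \<le> b" "i * L + L \<le> b" if "i < J" for i
  proof -
    have "(i + 1) * L \<le> J * L" using that by (intro mult_right_mono) auto
    then show "i * L \<le> b" "i * L + L \<le> b" using Js by (auto simp: L_def)
  qed
  have g: "1 \<le> g i j" "2 * g i j \<le> int X" "N \<le> form_eval f (g i j, int (i * L), int (j * L))"
     "form_eval f (g i j, int (i * L), int (j * L)) \<le> N + 4 * B * int X" if "i < J" "j < J" for i j
  proof -
    have "\<exists>x. 1 \<le> x \<and> 2 * x \<le> int X \<and> N \<le> form_eval f (x, int (i * L), int (j * L)) \<and> form_eval f (x, int (i * L), int (j * L)) \<le> N + 4 * B * int X"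
      using shell_point[OF pos X _ _ _ _ b N[unfolded B_def], of "int (i * L)" "int (j * L)"] iL(1)[OF that(1)] iL(1)[OF that(2)]
      unfolding B_def by (metis of_nat_0_le_iff of_nat_mono)
    then have "1 \<le> g i j \<and> 2 * g i j \<le> int X \<and> N \<le> form_eval f (g i j, int (i * L), int (j * L)) \<and> form_eval f (g i j, int (i * L), int (j * L)) \<le> N + 4 * B * int X"
      unfolding g_def by (rule someI_ex)
    then show "1 \<le> g i j" "2 * g i j \<le> int X" "N \<le> form_eval f (g i j, int (i * L), int (j * L))"
     "form_eval f (g i j, int (i * L), int (j * L)) \<le> N + 4 * B * int X" by blast+
  qed
  define T where "T = {w\<in>int_box X. n \<le> form_eval f w \<and> form_eval f w < n + int (K * M) \<and> [form_eval f w = n] (mod int M)}"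
  have fit': "16 * (B * (int L + 1) * int X) \<le> int (K * M)"
  proof -
    have "int (16 * coeff_bound f * (s * M + 1) * X) \<le> int (K * M)" using fit(1) by (simp only: of_nat_le_iff)
    then show ?thesis by (simp add: B_def L_def mult_ac add.commute)
  qed
  have "b \<le> coeff_bound f * b" using coeff_bound_pos[of f] by simp
  then have bX: "2 * b \<le> X" using b unfolding mult.assoc by linarith
  have "J ^ 2 * s ^ 3 * sol_count f M n \<le> card T"
  proof (rule card_cubes_ge[OF M, where P=g])
    show "finite T" by (simp add: T_def)
    fix i j h1 h2 h3
    assume ij: "i < J" "j < J" and h: "(h1, h2, h3) \<in> int_box (s * M)"
      and c: "[form_eval f (g i j + h1, int (i * (s * M)) + h2, int (j * (s * M)) + h3) = n] (mod int M)"
    let ?P = "(g i j, int (i * L), int (j * L))"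
    let ?w = "(g i j + h1, int (i * (s * M)) + h2, int (j * (s * M)) + h3)"
    have hL: "0 \<le> h1" "h1 < int L" "0 \<le> h2" "h2 < int L" "0 \<le> h3" "h3 < int L" using h by (auto simp: int_box_def L_def)
    have w: "?w = ?P + (h1, h2, h3)" by (simp add: L_def)
    have iLi: "int (i * L) + int L \<le> int b" "int (j * L) + int L \<le> int b"
      using iL(2)[OF ij(1)] iL(2)[OF ij(2)] by (metis of_nat_add of_nat_mono)+
    have "int (2 * L) \<le> int X" "int (2 * b) \<le> int X" using bX sX by (simp_all only: L_def of_nat_le_iff)
    then have bXi: "2 * int b \<le> int X" "2 * int L \<le> int X" by simp_all
    have nn: "0 \<le> int (i * L)" "0 \<le> int (j * L)" by (rule of_nat_0_le_iff)+
    have lt: "int (i * L) + int L \<le> int X" "int (j * L) + int L \<le> int X" "g i j + int L \<le> int X"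
      using iLi(1) bXi apply linarith using iLi(2) bXi apply linarith using g(2)[OF ij] bXi by linarith
    have mem: "- int X \<le> g i j" "g i j \<le> int X" "- int X \<le> int (i * L)" "int (i * L) \<le> int X" "- int X \<le> int (j * L)" "int (j * L) \<le> int X"
      using nn lt g(1)[OF ij] hL by linarith+
    have "\<bar>form_eval f (?P + (h1, h2, h3)) - form_eval f ?P\<bar> \<le> 4 * B * int L * int X"
      unfolding B_def
    proof (rule form_eval_lipschitz)
      show "(h1, h2, h3) \<in> {- int L..int L} \<times> {- int L..int L} \<times> {- int L..int L}" using hL by simp
      show "?P \<in> {- int X..int X} \<times> {- int X..int X} \<times> {- int X..int X}" using mem by (simp del: of_nat_mult)
      show "L \<le> X" using bXi by linarith
    qed
    then have d: "\<bar>form_eval f ?w - form_eval f ?P\<bar> \<le> 4 * (B * int L * int X)" unfolding w by simp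
    have BX: "B * (int L + 1) * int X = B * int L * int X + B * int X" by (simp add: algebra_simps)
    have B0: "B * int L * int X \<ge> 0" "B * int X \<ge> 0" by (auto simp: B_def)
    define P1 P2 where "P1 = B * int L * int X" and "P2 = B * int X"
    have fP: "16 * (P1 + P2) \<le> W" "0 \<le> P1" "0 \<le> P2" using fit' B0 unfolding BX P1_def P2_def W_def by auto
    have w2: "2 * W2 \<le> W" "W \<le> 2 * W2 + 1" "0 \<le> W2" "2 \<le> W"
      using W fit(2) unfolding W2_def by (auto simp: W_def simp del: of_nat_mult)
    define a b where "a = form_eval f ?w" and "b = form_eval f ?P"
    have ab: "\<bar>a - b\<bar> \<le> 4 * P1" "n + W2 \<le> b" "b \<le> n + W2 + 4 * P2"
      using d g(3)[OF ij] g(4)[OF ij] unfolding a_def b_def P1_def P2_def N2 by (simp_all del: of_nat_mult)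
    have "4 * P1 \<le> W2" using fP w2 by presburger
    then have "a \<ge> n" using ab by linarith
    then have "form_eval f ?w \<ge> n" by (simp only: a_def)
    moreover have "W2 + 4 * P1 + 4 * P2 < W" using fP w2 by presburger
    then have "a < n + W" using ab by linarith
    then have "form_eval f ?w < n + int (K * M)" by (simp only: a_def W_def)
    moreover have "?w \<in> int_box X"
    proof -
      have "0 \<le> g i j + h1" "g i j + h1 < int X" "0 \<le> int (i * L) + h2" "int (i * L) + h2 < int X"
        "0 \<le> int (j * L) + h3" "int (j * L) + h3 < int X" using nn lt hL g(1)[OF ij] by linarith+
      then show ?thesis unfolding w int_box_def by (simp del: of_nat_mult)
    qed
    ultimately show "?w \<in> T" using c by (simp add: T_def)
  qed
  then have "real (J ^ 2 * s ^ 3 * sol_count f M n) \<le> real (card T)" by (simp only: of_nat_le_iff)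
  then have "real (J ^ 2 * s ^ 3 * sol_count f M n) / real K \<le> real (card T) / real K" by (rule divide_right_mono) simp
  also have "\<dots> \<le> rep_average f X K M n" by (rule rep_average_ge[OF K M]) (auto simp: T_def)
  finally show ?thesis .
qed

section \<open>Positive definite forms and admissible integers\<close>

lemma positive_definite_int:
  assumes "positive_definite f" "w \<noteq> (0, 0, 0)"
  shows "form_eval f w > (0::int)"
proof -
  obtain x y z where w: "w = (x, y, z)" by (metis prod_cases3)
  have "form_eval f (real_of_int x, real_of_int y, real_of_int z) > 0"
    using assms by (auto simp: positive_definite_def w)
  moreover have "form_eval f (real_of_int x, real_of_int y, real_of_int z) = real_of_int (form_eval f (x, y, z))"
    by (simp add: form_eval_def)
  ultimately show ?thesis by (simp add: w)
qed

text \<open>Each minor is read off from the value at an integral vector for which all but one of the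
  squares in the diagonalised form vanish.\<close>

lemma positive_definite_minors:
  assumes "positive_definite f"
  shows "coeff_11 f > 0" "minor_12 f > 0" "gram_det f > 0"
proof -
  have "form_eval f (1, 0, 0) > (0::int)" by (rule positive_definite_int[OF assms]) simp
  then show a: "coeff_11 f > 0" by (simp add: form_eval_def)
  have "form_eval f (- coeff_12 f, 2 * coeff_11 f, 0) > (0::int)"
    by (rule positive_definite_int[OF assms]) (use a in auto)
  moreover have "form_eval f (- coeff_12 f, 2 * coeff_11 f, 0) = coeff_11 f * minor_12 f"
    by (simp add: form_eval_def minor_12_def power2_eq_square algebra_simps)
  ultimately show A: "minor_12 f > 0" using a by (simp add: zero_less_mult_iff)
  define x y z where "x = 2 * coeff_12 f * mixed_23 f - 4 * minor_12 f * coeff_13 f"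
    and "y = - 4 * coeff_11 f * mixed_23 f" and "z = 8 * coeff_11 f * minor_12 f"
  have z: "z \<noteq> 0" using a A by (simp add: z_def)
  have "form_eval f (x, y, z) > (0::int)" by (rule positive_definite_int[OF assms]) (use z in auto)
  moreover have "16 * coeff_11 f * minor_12 f * form_eval f (x, y, z) = 8 * coeff_11 f * gram_det f * z\<^sup>2"
  proof -
    have "2 * minor_12 f * y + mixed_23 f * z = 0" "2 * coeff_11 f * x + coeff_12 f * y + coeff_13 f * z = 0"
      by (simp_all add: x_def y_def z_def algebra_simps)
    then show ?thesis unfolding form_eval_diagonalize by simp
  qed
  moreover have "16 * coeff_11 f * minor_12 f > 0" using a A by simp
  ultimately have "8 * coeff_11 f * gram_det f * z\<^sup>2 > 0" by (metis mult_pos_pos)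
  then show "gram_det f > 0" using a by (simp add: zero_less_mult_iff)
qed

text \<open>The congruence is imposed to exactly the precision at which a solution lifts to all
  higher powers, given the bound \<open>V\<close> on the valuation of \<open>n\<close> at the primes
  dividing the determinant.\<close>

definition admissible :: "ternary_form \<Rightarrow> nat \<Rightarrow> int \<Rightarrow> bool" where
  "admissible f V n \<longleftrightarrow> (\<forall>p. prime p \<and> int p dvd gram_det f \<longrightarrow>
     \<not> int p ^ Suc V dvd n \<and> (\<exists>w. int p ^ (2 * V + 4) dvd form_eval f w - n))"

text \<open>Relative to the square of the modulus the bound does not depend on \<open>k\<close>, so
  making the modulus highly divisible costs nothing. It deteriorates with \<open>Q\<close> only
  through the product of \<open>1 - 1/p\<close>; a spare factor \<open>1 - 1/p\<close> is given away
  at bad primes so that this product runs over all primes up to \<open>Q\<close>.\<close>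

lemma sol_count_admissible:
  fixes Q k V :: nat
  assumes "gram_det f \<noteq> 0" and Q: "\<bar>gram_det f\<bar> \<le> int Q" and k: "k \<ge> 2 * V + 4" and n: "admissible f V n"
  defines "P \<equiv> {p. prime p \<and> p \<le> Q}"
  defines "D \<equiv> {p. prime p \<and> int p dvd gram_det f}"
  shows "real (sol_count f (\<Prod>p\<in>P. p ^ k) n) \<ge>
    real (\<Prod>p\<in>P. p ^ k) ^ 2 * ((\<Prod>p\<in>D. 1 / real p ^ (2 * (V + 2))) * (\<Prod>p\<in>P. 1 - 1 / real p))"
proof -
  have fP: "finite P" by (simp add: P_def)
  have DP: "D \<subseteq> P"
  proof
    fix p assume p: "p \<in> D"
    then have "int p \<le> \<bar>gram_det f\<bar>" using assms(1) by (simp add: D_def zdvd_imp_le)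
    then show "p \<in> P" using p Q by (simp add: P_def D_def)
  qed
  let ?c = "\<lambda>p. if p \<in> D then 1 / real p ^ (2 * (V + 2)) else 1"
  have one: "real (p ^ k) ^ 2 * (?c p * (1 - 1 / real p)) \<le> real (sol_count f (p ^ k) n)" if p: "p \<in> P" for p
  proof (cases "p \<in> D")
    case False
    then show ?thesis using sol_count_good_prime[of p f k n] p k by (simp add: D_def P_def)
  next
    case True
    then have pr: "prime p" by (simp add: D_def)
    have p0: "real p > 0" using pr by (simp add: prime_gt_0_nat)
    obtain w where w: "\<not> int p ^ Suc V dvd n" "int p ^ (2 * V + 4) dvd form_eval f w - n"
      using n True unfolding admissible_def D_def by blast
    have le: "p ^ (2 * (k - (V + 2))) \<le> sol_count f (p ^ k) n" by (rule sol_count_bad_prime[OF pr w k])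
    have "2 * k = 2 * (k - (V + 2)) + 2 * (V + 2)" using k by simp
    then have "real p ^ (2 * k) = real p ^ (2 * (k - (V + 2))) * real p ^ (2 * (V + 2))" by (metis power_add)
    then have "real (p ^ k) ^ 2 * (1 / real p ^ (2 * (V + 2))) = real p ^ (2 * (k - (V + 2)))"
      using p0 by (simp add: power_mult[symmetric] mult.commute)
    moreover have "real (p ^ k) ^ 2 * (1 / real p ^ (2 * (V + 2)) * (1 - 1 / real p)) \<le> real (p ^ k) ^ 2 * (1 / real p ^ (2 * (V + 2)))"
      using p0 by (intro mult_left_mono mult_left_le) auto
    moreover have "real (p ^ (2 * (k - (V + 2)))) \<le> real (sol_count f (p ^ k) n)" using le by (simp only: of_nat_le_iff)
    then have "real p ^ (2 * (k - (V + 2))) \<le> real (sol_count f (p ^ k) n)" by (simp only: of_nat_power)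
    ultimately have "real (p ^ k) ^ 2 * (1 / real p ^ (2 * (V + 2)) * (1 - 1 / real p)) \<le> real (sol_count f (p ^ k) n)"
      by linarith
    then show ?thesis using True by (simp only: if_True)
  qed
  have "real (\<Prod>p\<in>P. p ^ k) ^ 2 * ((\<Prod>p\<in>D. 1 / real p ^ (2 * (V + 2))) * (\<Prod>p\<in>P. 1 - 1 / real p)) =
     (\<Prod>p\<in>P. real (p ^ k) ^ 2 * (?c p * (1 - 1 / real p)))"
  proof -
    have "(\<Prod>p\<in>D. 1 / real p ^ (2 * (V + 2))) = (\<Prod>p\<in>P. ?c p)"
      using DP fP by (intro prod.mono_neutral_cong_left) auto
    then show ?thesis by (simp add: prod.distrib prod_power_distrib)
  qed
  also have "\<dots> \<le> (\<Prod>p\<in>P. real (sol_count f (p ^ k) n))"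
  proof (rule prod_mono, intro conjI one)
    fix p assume "p \<in> P"
    then have "real p \<ge> 1" by (simp add: P_def) (metis One_nat_def Suc_leI prime_gt_0_nat)
    then show "0 \<le> real (p ^ k) ^ 2 * (?c p * (1 - 1 / real p))" by (intro mult_nonneg_nonneg) auto
  qed
  also have "\<dots> = real (\<Prod>p\<in>P. sol_count f (p ^ k) n)" by simp
  also have "\<dots> \<le> real (sol_count f (\<Prod>p\<in>P. p ^ k) n)"
    using sol_count_prod[OF fP, of f k n] unfolding of_nat_le_iff by (auto simp: P_def)
  finally show ?thesis .
qed

lemma dvd_prod_prime_powers:
  assumes "1 \<le> q" "q \<le> Q" "Q \<le> k"
  shows "q dvd (\<Prod>p\<in>{p. prime p \<and> p \<le> Q}. p ^ k :: nat)"
proof -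
  have "q = (\<Prod>p\<in>prime_factors q. p ^ multiplicity p q)" using assms(1) by (simp add: prime_factorization_nat)
  also have "\<dots> dvd (\<Prod>p\<in>prime_factors q. p ^ k)"
  proof (rule prod_dvd_prod)
    fix p assume "p \<in> prime_factors q"
    then have p: "prime p" "p ^ multiplicity p q dvd q" by (auto simp: multiplicity_dvd)
    have "multiplicity p q < p ^ multiplicity p q" using p(1) prime_gt_1_nat by (simp add: power_gt_expt)
    also have "\<dots> \<le> q" using p(2) assms(1) by (simp add: dvd_imp_le)
    finally have "multiplicity p q \<le> k" using assms by simp
    then show "p ^ multiplicity p q dvd p ^ k" by (rule le_imp_power_dvd)
  qed
  also have "\<dots> dvd (\<Prod>p\<in>{p. prime p \<and> p \<le> Q}. p ^ k)"
  proof (rule prod_dvd_prod_subset)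
    show "prime_factors q \<subseteq> {p. prime p \<and> p \<le> Q}"
    proof
      fix p assume "p \<in> prime_factors q"
      then have "prime p" "p dvd q" by auto
      then show "p \<in> {p. prime p \<and> p \<le> Q}" using dvd_imp_le[of p q] assms by auto
    qed
  qed simp
  finally show ?thesis .
qed

lemma half_le_nat_floor:
  fixes t :: real assumes "t \<ge> 1" shows "t / 2 \<le> real (nat \<lfloor>t\<rfloor>)"
proof -
  have "\<lfloor>t\<rfloor> \<ge> 1" using assms by simp
  then have "real (nat \<lfloor>t\<rfloor>) = of_int \<lfloor>t\<rfloor>" "real_of_int \<lfloor>t\<rfloor> \<ge> 1" by auto
  then show ?thesis by linarith
qed

section \<open>Almost all admissible integers are represented\<close>

text \<open>The constant in front of \<open>X\<close> is independent of \<open>\<kappa>\<close>: a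
  shorter window forces smaller cubes, but it is also averaged over fewer terms, and the two effects
  cancel. Hence \<open>\<kappa>\<close> can be shrunk to make the mean square deviation small
  without weakening this lower bound.\<close>

lemma rep_average_lower_asymp:
  fixes M :: nat and \<delta> \<kappa> :: real
  assumes pos: "coeff_11 f \<ge> 1" and M: "M \<ge> 1" and d: "0 < \<delta>" "\<delta> \<le> 1" and k: "0 < \<kappa>" "\<kappa> \<le> 1 / 64" "\<kappa> \<le> \<delta> / 8"
  defines "B \<equiv> real (coeff_bound f)"
  shows "\<forall>\<^sub>F X in sequentially. nat \<lfloor>\<kappa> * real X ^ 2 / real M\<rfloor> \<ge> 1 \<and> (\<forall>n. \<delta> * real X ^ 2 \<le> of_int n \<and> of_int n \<le> real X ^ 2 / 64 \<longrightarrow>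
     rep_average f X (nat \<lfloor>\<kappa> * real X ^ 2 / real M\<rfloor>) M n \<ge>
       (\<delta> / (128 * B)) ^ 2 / (2048 * B) * real X * (real (sol_count f M n) / real M ^ 2))"
proof -
  \<comment> \<open>Small enough that the form stays below \<delta> X^2, and so below
    \<open>n\<close>, at all points (0, y, z) with y and z at most \<gamma> X.\<close>
  define \<gamma> where "\<gamma> = \<delta> / (128 * B)"
  have B1: "B \<ge> 1" using coeff_bound_pos[of f] by (simp add: B_def)
  have g0: "\<gamma> > 0" using d B1 by (simp add: \<gamma>_def)
  have M1: "real M \<ge> 1" using M by simp
  define Z where "Z = Max {64 * B / \<kappa>, 2 * real M / \<kappa>, 4 / \<kappa>, 64 * B * real M / \<kappa>, 2 / \<gamma>, 4, 2}"
  have Z: "64 * B / \<kappa> \<le> Z" "2 * real M / \<kappa> \<le> Z" "4 / \<kappa> \<le> Z" "64 * B * real M / \<kappa> \<le> Z" "2 / \<gamma> \<le> Z" "4 \<le> Z"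
    by (auto simp: Z_def)
  have "\<forall>\<^sub>F X in sequentially. real X \<ge> Z" by real_asymp
  then show ?thesis
  proof (rule eventually_mono)
    fix X :: nat assume XZ: "real X \<ge> Z"
    let ?x = "real X"
    have x: "64 * B \<le> \<kappa> * ?x" "2 * real M \<le> \<kappa> * ?x" "4 \<le> \<kappa> * ?x" "64 * B * real M \<le> \<kappa> * ?x" "2 \<le> \<gamma> * ?x" "4 \<le> ?x"
    proof -
      have "c \<le> e * ?x" if "c / e \<le> Z" "e > 0" for c e
        using that XZ by (simp add: pos_divide_le_eq mult.commute) (smt (verit) mult_left_mono mult.commute)
      then show "64 * B \<le> \<kappa> * ?x" "2 * real M \<le> \<kappa> * ?x" "4 \<le> \<kappa> * ?x" "64 * B * real M \<le> \<kappa> * ?x" "2 \<le> \<gamma> * ?x"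
        using Z k(1) g0 by blast+
      show "4 \<le> ?x" using Z XZ by linarith
    qed
    have x2: "?x \<le> ?x ^ 2" using x(6) by (simp add: power2_eq_square)
    define K where "K = nat \<lfloor>\<kappa> * ?x ^ 2 / real M\<rfloor>"
    define b where "b = nat \<lfloor>\<gamma> * ?x\<rfloor>"
    define s where "s = nat \<lfloor>\<kappa> * ?x / (64 * B * real M)\<rfloor>"
    define L where "L = s * M"
    define J where "J = b div L"
    have kx: "\<kappa> * ?x \<le> \<kappa> * ?x ^ 2" using x2 k(1) by (intro mult_left_mono) auto
    have "\<kappa> * ?x ^ 2 / real M \<ge> 2" using x(2) kx M1 by (simp add: field_simps)
    then have Kl: "real K \<le> \<kappa> * ?x ^ 2 / real M" "real K \<ge> \<kappa> * ?x ^ 2 / real M - 1" "K \<ge> 1"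
      unfolding K_def by (linarith+)
    have KMu: "real (K * M) \<le> \<kappa> * ?x ^ 2" using Kl(1) M1 by (simp add: field_simps)
    have KMl: "real (K * M) \<ge> \<kappa> * ?x ^ 2 / 2"
    proof -
      have "(\<kappa> * ?x ^ 2 / real M - 1) * real M \<le> real K * real M" using Kl(2) by (intro mult_right_mono) auto
      then have "\<kappa> * ?x ^ 2 - real M \<le> real (K * M)" using M1 by (simp add: left_diff_distrib)
      then show ?thesis using x(2) kx by linarith
    qed
    have bl: "real b \<le> \<gamma> * ?x" "real b \<ge> \<gamma> * ?x / 2" using x(5) unfolding b_def by linarith+
    have t1: "\<kappa> * ?x / (64 * B * real M) \<ge> 1" using x(4) B1 M1 by (simp add: le_divide_eq)
    have sl: "real s \<le> \<kappa> * ?x / (64 * B * real M)" "real s \<ge> \<kappa> * ?x / (64 * B * real M) / 2"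
      using of_nat_floor[of "\<kappa> * ?x / (64 * B * real M)"] t1 half_le_nat_floor[OF t1] unfolding s_def by auto
    have Ll: "real L \<le> \<kappa> * ?x / (64 * B)" "real L \<ge> \<kappa> * ?x / (128 * B)"
    proof -
      have "real s * real M \<le> \<kappa> * ?x / (64 * B * real M) * real M" using sl(1) by (intro mult_right_mono) auto
      then show "real L \<le> \<kappa> * ?x / (64 * B)" using M1 by (simp add: L_def)
      have "\<kappa> * ?x / (64 * B * real M) / 2 * real M \<le> real s * real M" using sl(2) by (intro mult_right_mono) auto
      then show "real L \<ge> \<kappa> * ?x / (128 * B)" using M1 by (simp add: L_def)
    qed
    have L0: "real L > 0" using Ll(2) k(1) x(6) B1 by (smt (verit) divide_pos_pos mult_pos_pos)
    have bL: "real b \<ge> 2 * real L"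
    proof -
      have "\<kappa> / (32 * B) \<le> \<gamma> / 2" using k(3) B1 by (simp add: \<gamma>_def field_simps)
      then have "\<kappa> / (32 * B) * ?x \<le> \<gamma> / 2 * ?x" by (intro mult_right_mono) auto
      then show ?thesis using Ll(1) bl(2) by simp
    qed
    have JL: "J * L \<le> b" by (simp add: J_def)
    have Jl: "real J \<ge> real b / (2 * real L)"
    proof -
      have "b < (J + 1) * L" using L0 by (simp add: J_def) (metis add.commute dividend_less_div_times of_nat_0_less_iff)
      then have "real b < real ((J + 1) * L)" by (simp only: of_nat_less_iff)
      then have "real b \<le> real J * real L + real L" by (simp add: algebra_simps)
      then have "real b / 2 \<le> real J * real L" using bL by linarith
      then show ?thesis using L0 by (simp add: divide_le_eq mult.commute)
    qed
    show "nat \<lfloor>\<kappa> * ?x ^ 2 / real M\<rfloor> \<ge> 1 \<and> (\<forall>n. \<delta> * ?x ^ 2 \<le> of_int n \<and> of_int n \<le> ?x ^ 2 / 64 \<longrightarrow>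
     rep_average f X (nat \<lfloor>\<kappa> * ?x ^ 2 / real M\<rfloor>) M n \<ge>
       (\<delta> / (128 * B)) ^ 2 / (2048 * B) * ?x * (real (sol_count f M n) / real M ^ 2))"
      unfolding K_def[symmetric] \<gamma>_def[symmetric]
    proof (intro conjI allI impI Kl(3))
      fix n :: int assume n: "\<delta> * ?x ^ 2 \<le> of_int n \<and> of_int n \<le> ?x ^ 2 / 64"
      have "rep_average f X K M n \<ge> real (J ^ 2 * s ^ 3 * sol_count f M n) / real K"
      proof (rule rep_average_lower[OF pos _ M Kl(3)])
        show "X \<ge> 4" using x(6) by simp
        have "128 * B * real b \<le> 128 * B * (\<gamma> * ?x)" using bl(1) B1 by (intro mult_left_mono) auto
        also have "\<dots> = \<delta> * ?x" using B1 by (simp add: \<gamma>_def)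
        also have "\<dots> \<le> 1 * ?x" using d by (intro mult_right_mono) auto
        finally have "real (128 * coeff_bound f * b) \<le> ?x" by (simp add: B_def)
        then show "128 * coeff_bound f * b \<le> X" by (simp only: of_nat_le_iff)
        have "B * real b ^ 2 \<le> B * (\<gamma> * ?x) ^ 2" using bl(1) B1 by (intro mult_left_mono power_mono) auto
        also have "\<dots> = (\<gamma> / 128) * (\<delta> * ?x ^ 2)" using B1 by (simp add: \<gamma>_def power2_eq_square)
        also have "\<dots> < 1 * (\<delta> * ?x ^ 2)"
        proof (rule mult_strict_right_mono)
          have "\<gamma> \<le> 1" using d B1 by (simp add: \<gamma>_def divide_le_eq)
          then show "\<gamma> / 128 < 1" by simp
          show "0 < \<delta> * ?x ^ 2" using d x(6) by simp
        qed
        also have "\<dots> \<le> of_int n" using n by simp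
        finally have "real_of_int (int (coeff_bound f) * (int b)\<^sup>2) < of_int n" by (simp add: B_def)
        then show "int (coeff_bound f) * (int b)\<^sup>2 < n" by (simp only: of_int_less_iff)
        have "real (K * M) \<le> ?x ^ 2 / 64" using KMu k(2) mult_right_mono[OF k(2), of "?x ^ 2"] by simp
        then have "real_of_int (32 * (n + int (K * M))) \<le> of_int ((int X)\<^sup>2)" using n by simp
        then show "32 * (n + int (K * M)) \<le> (int X)\<^sup>2" by (simp only: of_int_le_iff)
        show "J * (s * M) \<le> b" using JL by (simp add: L_def)
        have "\<kappa> * ?x / (64 * B) \<le> ?x / 2"
        proof -
          have "\<kappa> * ?x \<le> 1 * ?x" using k(2) by (intro mult_right_mono) auto
          moreover have "32 * ?x \<le> ?x * (B * 32)" using mult_left_mono[OF B1, of ?x] by simp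
          ultimately show ?thesis using B1 by (simp add: divide_le_eq)
        qed
        then have "real (2 * (s * M)) \<le> ?x" using Ll(1) by (simp add: L_def)
        then show "2 * (s * M) \<le> X" by (simp only: of_nat_le_iff)
        have "16 * B * (real L + 1) * ?x = 16 * B * real L * ?x + 16 * B * ?x" by (simp add: algebra_simps)
        also have "\<dots> \<le> 16 * B * (\<kappa> * ?x / (64 * B)) * ?x + (\<kappa> * ?x / 4) * ?x"
          using Ll(1) B1 x(1) by (intro add_mono mult_right_mono mult_left_mono) auto
        also have "\<dots> = \<kappa> * ?x ^ 2 / 2" using B1 by (simp add: power2_eq_square)
        also have "\<dots> \<le> real (K * M)" by (rule KMl)
        also have "16 * B * (real L + 1) * ?x = real (16 * coeff_bound f * (s * M + 1) * X)"
          unfolding B_def L_def by (simp add: distrib_left)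
        finally have "real (16 * coeff_bound f * (s * M + 1) * X) \<le> real (K * M)" .
        then show "16 * coeff_bound f * (s * M + 1) * X \<le> K * M" by (simp only: of_nat_le_iff)
        have "real (K * M) \<ge> 2" using KMl kx x(3) by linarith
        then show "2 \<le> K * M" by linarith
      qed
      moreover have "\<gamma> ^ 2 / (2048 * B) * ?x / real M ^ 2 \<le> real J ^ 2 * real s ^ 3 / real K"
      proof -
        have K0: "real K > 0" using Kl(3) by simp
        have "\<gamma> * ?x / 4 \<le> real J * real L" using Jl bl(2) L0 by (simp add: divide_le_eq mult.commute)
        then have "(\<gamma> * ?x / 4) ^ 2 \<le> (real J * real L) ^ 2" using g0 by (intro power_mono) auto
        then have "(\<gamma> * ?x / 4) ^ 2 * (\<kappa> * ?x / (128 * B)) \<le> (real J * real L) ^ 2 * real L"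
          using Ll(2) g0 k(1) B1 by (intro mult_mono) auto
        also have "\<dots> = real J ^ 2 * real s ^ 3 * real M ^ 3" by (simp add: L_def power2_eq_square power3_eq_cube)
        finally have "(\<gamma> * ?x / 4) ^ 2 * (\<kappa> * ?x / (128 * B)) / real M ^ 3 \<le> real J ^ 2 * real s ^ 3"
          using M1 by (subst pos_divide_le_eq) auto
        moreover have "(\<gamma> * ?x / 4) ^ 2 * (\<kappa> * ?x / (128 * B)) / real M ^ 3 = \<gamma> ^ 2 / (2048 * B) * ?x / real M ^ 2 * (\<kappa> * ?x ^ 2 / real M)"
          by (simp add: power2_eq_square power3_eq_cube mult_ac)
        moreover have "\<gamma> ^ 2 / (2048 * B) * ?x / real M ^ 2 * real K \<le> \<gamma> ^ 2 / (2048 * B) * ?x / real M ^ 2 * (\<kappa> * ?x ^ 2 / real M)"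
          using Kl(1) B1 by (intro mult_left_mono) auto
        ultimately have "\<gamma> ^ 2 / (2048 * B) * ?x / real M ^ 2 * real K \<le> real J ^ 2 * real s ^ 3" by linarith
        then show ?thesis using K0 by (simp add: le_divide_eq)
      qed
      then have "\<gamma> ^ 2 / (2048 * B) * ?x / real M ^ 2 * real (sol_count f M n) \<le> real J ^ 2 * real s ^ 3 / real K * real (sol_count f M n)"
        by (rule mult_right_mono) simp
      ultimately show "\<gamma> ^ 2 / (2048 * B) * ?x * (real (sol_count f M n) / real M ^ 2) \<le> rep_average f X K M n" by simp
    qed
  qed
qed

text \<open>Chebyshev's inequality: an integer that is not represented has count 0, so its deviation
  is at least the average, which has order \<open>pr Q * X\<close>. Dividing the mean square bound
  by the square of this lower bound leaves three terms, each of which is made at most a third of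
  \<open>\<epsilon>\<close>.\<close>

lemma card_unrepresented_admissible_le:
  fixes \<delta> \<epsilon> :: real and V :: nat
  assumes pd: "positive_definite f" and d: "0 < \<delta>" "\<delta> \<le> 1" and e: "0 < \<epsilon>"
  shows "\<forall>\<^sub>F X in sequentially. real (card {n. \<delta> * real X ^ 2 \<le> of_int n \<and> of_int n \<le> real X ^ 2 / 64
     \<and> admissible f V n \<and> n \<notin> range (form_eval f)}) \<le> \<epsilon> * real X ^ 2"
proof -
  note pos = positive_definite_minors[OF pd]
  define B where "B = real (coeff_bound f)"
  have B1: "B \<ge> 1" using coeff_bound_pos[of f] by (simp add: B_def)
  define D where "D = {p. prime p \<and> int p dvd gram_det f}"
  have fD: "finite D"
  proof (rule finite_subset)
    show "D \<subseteq> {..nat \<bar>gram_det f\<bar>}"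
    proof
      fix p assume "p \<in> D"
      then have "int p \<le> gram_det f" using pos(3) by (intro zdvd_imp_le) (auto simp: D_def)
      then show "p \<in> {..nat \<bar>gram_det f\<bar>}" by simp
    qed
  qed simp
  define c0 where "c0 = (\<Prod>p\<in>D. 1 / real p ^ (2 * (V + 2)))"
  have c0: "c0 > 0" unfolding c0_def by (intro prod_pos) (auto simp: D_def prime_gt_0_nat)
  define c1 where "c1 = (\<delta> / (128 * B)) ^ 2 / (2048 * B)"
  have c1: "c1 > 0" using d B1 by (simp add: c1_def)
  define C where "C = 128000 * B ^ 4 / (c1 * c0) ^ 2"
  have C: "C > 0" using B1 c0 c1 by (simp add: C_def)
  define pr where "pr Q = (\<Prod>p\<in>{p. prime p \<and> p \<le> Q}. 1 - 1 / real p)" for Q :: nat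
  \<comment> \<open>The product over primes satisfies pr^3 \<ge> 1/(100 Q), so (pr^2 Q)^3 \<ge>
    Q/10000; this is where 10000 and the exponent 3 come from.\<close>
  define Q where "Q = Max {nat \<bar>gram_det f\<bar>, 1, nat \<lceil>10000 * (3 * C / \<epsilon>) ^ 3\<rceil>}"
  have Qs: "nat \<bar>gram_det f\<bar> \<le> Q" "nat \<lceil>10000 * (3 * C / \<epsilon>) ^ 3\<rceil> \<le> Q" and Q1: "Q \<ge> 1"
    unfolding Q_def by (intro Max_ge; simp)+
  have QD: "\<bar>gram_det f\<bar> \<le> int Q" using Qs(1) by linarith
  have Qe: "10000 * (3 * C / \<epsilon>) ^ 3 \<le> real Q" using Qs(2) by linarith
  have pr0: "pr Q > 0" unfolding pr_def
  proof (rule prod_pos)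
    fix p assume "p \<in> {p. prime p \<and> p \<le> Q}"
    then have "real p > 1" using prime_gt_1_nat by force
    then show "0 < 1 - 1 / real p" by simp
  qed
  have Qpr: "C / (pr Q ^ 2 * real Q) \<le> \<epsilon> / 3"
  proof -
    have "1 / (100 * real Q) \<le> pr Q ^ 3" unfolding pr_def by (rule prod_one_minus_inverse_primes[OF Q1])
    then have "(1 / (100 * real Q)) ^ 2 \<le> (pr Q ^ 3) ^ 2" using Q1 by (intro power_mono) auto
    then have "(1 / (100 * real Q)) ^ 2 * real Q ^ 3 \<le> (pr Q ^ 3) ^ 2 * real Q ^ 3" by (intro mult_right_mono) auto
    moreover have "(1 / (100 * real Q)) ^ 2 * real Q ^ 3 = real Q / 10000" using Q1 by (simp add: power2_eq_square power3_eq_cube)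
    moreover have "(pr Q ^ 3) ^ 2 * real Q ^ 3 = (pr Q ^ 2 * real Q) ^ 3" by (simp add: power_mult_distrib flip: power_mult)
    ultimately have "(3 * C / \<epsilon>) ^ 3 \<le> (pr Q ^ 2 * real Q) ^ 3" using Qe by simp
    then have "3 * C / \<epsilon> \<le> pr Q ^ 2 * real Q" 
      using power_mono_iff[of "3 * C / \<epsilon>" "pr Q ^ 2 * real Q" 3] e C by simp
    then show ?thesis using e pr0 Q1 by (simp add: field_simps)
  qed
  \<comment> \<open>Chosen after \<open>Q\<close>, because it has to be small compared with a power
    of \<open>pr Q\<close>. The fourth power undoes the exponent 1/4, and the divisor 4 allows for
    \<open>pi < 4\<close>.\<close>
  define \<kappa> where "\<kappa> = Min {1 / 64, \<delta> / 8, (\<epsilon> * pr Q ^ 2 / (3 * C)) ^ 4 / 4}"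
  have k0: "\<kappa> > 0" using d e pr0 C by (simp add: \<kappa>_def)
  have k: "\<kappa> \<le> 1 / 64" "\<kappa> \<le> \<delta> / 8" "\<kappa> \<le> (\<epsilon> * pr Q ^ 2 / (3 * C)) ^ 4 / 4" by (auto simp: \<kappa>_def)
  have kpr: "C / pr Q ^ 2 * (4 * \<kappa>) powr (1/4) \<le> \<epsilon> / 3"
  proof -
    define y where "y = \<epsilon> * pr Q ^ 2 / (3 * C)"
    have y0: "y > 0" using e pr0 C by (simp add: y_def)
    have "4 * \<kappa> \<le> y ^ 4" using k(3) by (simp add: y_def)
    then have "(4 * \<kappa>) powr (1/4) \<le> (y ^ 4) powr (1/4)" using k0 by (intro powr_mono2) auto
    also have "(y ^ 4) powr (1/4) = y" using powr_powr[of y 4 "1/4"] y0 by simp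
    finally have "C / pr Q ^ 2 * (4 * \<kappa>) powr (1/4) \<le> C / pr Q ^ 2 * y" using C by (intro mult_left_mono) auto
    also have "\<dots> = \<epsilon> / 3" using C pr0 by (simp add: y_def)
    finally show ?thesis .
  qed
  \<comment> \<open>An exponent of at least \<open>Q\<close> makes every \<open>q\<close> up to
    \<open>Q\<close> divide \<open>M\<close>; an exponent of at least \<open>2 * V + 4\<close> is
    what Hensel's lemma asks for.\<close>
  define k' where "k' = Max {2 * V + 4, Q}"
  have k': "k' \<ge> 2 * V + 4" "k' \<ge> Q" by (auto simp: k'_def)
  define M where "M = (\<Prod>p\<in>{p. prime p \<and> p \<le> Q}. p ^ k')"
  have M1: "M \<ge> 1" unfolding M_def by (rule prod_ge_1) (auto simp: prime_gt_0_nat Suc_leI)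
  have Mq: "q dvd M" if "1 \<le> q" "q \<le> Q" for q unfolding M_def by (rule dvd_prod_prime_powers[OF that k'(2)])
  have "(\<lambda>H. (1 + ln (4 * real H)) ^ 3 / real H) \<longlonglongrightarrow> 0" by real_asymp
  moreover have "\<epsilon> * pr Q ^ 2 / (3 * C) > 0" using e pr0 C by simp
  ultimately have "\<forall>\<^sub>F H in sequentially. (1 + ln (4 * real H)) ^ 3 / real H < \<epsilon> * pr Q ^ 2 / (3 * C)"
    by (rule order_tendstoD(2))
  then obtain H0 where H0: "\<And>H. H \<ge> H0 \<Longrightarrow> (1 + ln (4 * real H)) ^ 3 / real H < \<epsilon> * pr Q ^ 2 / (3 * C)"
    unfolding eventually_sequentially by blast
  have c11: "coeff_11 f \<ge> 1" using pos(1) by simp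
  have gd: "gram_det f \<noteq> 0" using pos(3) by simp
  have "\<forall>\<^sub>F X in sequentially. X \<ge> Max {H0, 1}" by (rule eventually_ge_at_top)
  with rep_average_lower_asymp[OF c11 M1 d k0 k(1,2)] show ?thesis
  proof eventually_elim
    case (elim X)
    define K where "K = nat \<lfloor>\<kappa> * real X ^ 2 / real M\<rfloor>"
    have K1: "K \<ge> 1" using elim(1) by (simp add: K_def)
    have X1: "X \<ge> 1" "X \<ge> H0" using elim(2) by auto
    have Xp: "real X > 0" using X1 by simp
    have avg: "rep_average f X K M n \<ge> c1 * real X * (real (sol_count f M n) / real M ^ 2)"
      if "\<delta> * real X ^ 2 \<le> of_int n" "of_int n \<le> real X ^ 2 / 64" for n
      using elim(1) that unfolding K_def c1_def B_def by blast
    define A where "A = {n. \<delta> * real X ^ 2 \<le> of_int n \<and> of_int n \<le> real X ^ 2 / 64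
     \<and> admissible f V n \<and> n \<notin> range (form_eval f)}"
    have "A \<subseteq> {0..int (X ^ 2)}"
    proof
      fix n assume "n \<in> A"
      then have n: "\<delta> * real X ^ 2 \<le> of_int n" "of_int n \<le> real X ^ 2 / 64" by (auto simp: A_def)
      have "\<delta> * real X ^ 2 \<ge> 0" using d by simp
      then have "real_of_int n \<ge> 0" using n(1) by linarith
      moreover have "real X ^ 2 / 64 \<le> real X ^ 2" by simp
      then have "real_of_int n \<le> real X ^ 2" using n(2) by linarith
      then have "real_of_int n \<le> of_int (int (X ^ 2))" by simp
      ultimately show "n \<in> {0..int (X ^ 2)}" by (simp only: of_int_le_iff atLeastAtMost_iff of_int_0_le_iff)
    qed
    then have fA: "finite A" by (rule finite_subset) simp
    have low: "(c1 * c0 * pr Q * real X) ^ 2 \<le> (rep_count f X n - rep_average f X K M n)\<^sup>2" if "n \<in> A" for n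
    proof -
      have n: "\<delta> * real X ^ 2 \<le> of_int n" "of_int n \<le> real X ^ 2 / 64" "admissible f V n" "n \<notin> range (form_eval f)"
        using that by (auto simp: A_def)
      have "form_eval f w \<noteq> n" for w using n(4) by blast
      then have r0: "rep_count f X n = 0" by (simp add: rep_count_def)
      have "real M ^ 2 * (c0 * pr Q) \<le> real (sol_count f M n)"
        using sol_count_admissible[OF gd QD k'(1) n(3)] by (simp add: M_def c0_def pr_def D_def)
      then have "c0 * pr Q \<le> real (sol_count f M n) / real M ^ 2" using M1 by (simp add: le_divide_eq mult.commute)
      then have "c1 * real X * (c0 * pr Q) \<le> c1 * real X * (real (sol_count f M n) / real M ^ 2)"
        using c1 by (intro mult_left_mono) auto
      also have "\<dots> \<le> rep_average f X K M n" by (rule avg[OF n(1,2)])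
      finally have "(c1 * real X * (c0 * pr Q)) ^ 2 \<le> (rep_average f X K M n) ^ 2"
        using c1 c0 pr0 by (intro power_mono) auto
      then show ?thesis using r0 by (simp add: mult_ac)
    qed
    define H where "H = coeff_bound f * X"
    have HX: "real H = B * real X" by (simp add: H_def B_def)
    have HH0: "H \<ge> H0" using X1 coeff_bound_pos[of f] unfolding H_def by (metis le_trans mult_le_mono1 nat_mult_1)
    define \<kappa>' where "\<kappa>' = pi * real K * real M / real H ^ 2"
    have "\<kappa>' \<le> 4 * \<kappa>"
    proof -
      have "real K \<le> \<kappa> * real X ^ 2 / real M" unfolding K_def using k0 by (intro of_nat_floor) auto
      then have "real K * real M \<le> \<kappa> * real X ^ 2" using M1 by (simp add: le_divide_eq)
      then have "pi * (real K * real M) \<le> 4 * (\<kappa> * real X ^ 2)" using pi_less_4 k0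
        by (intro mult_mono[of pi 4 "real K * real M" "\<kappa> * real X ^ 2"]) auto
      also have "\<dots> \<le> 4 * \<kappa> * real H ^ 2"
      proof -
        have "real X \<le> real H" using mult_right_mono[OF B1, of "real X"] by (simp add: HX)
        then have "real X ^ 2 \<le> real H ^ 2" by (intro power_mono) auto
        then show ?thesis using k0 by simp
      qed
      finally show ?thesis unfolding \<kappa>'_def using Xp B1 HX by (simp add: divide_le_eq mult.assoc)
    qed
    then have kk: "\<kappa>' powr (1/4) \<le> (4 * \<kappa>) powr (1/4)" by (intro powr_mono2) (auto simp: \<kappa>'_def)
    have "real (card A) * (c1 * c0 * pr Q * real X) ^ 2 = (\<Sum>n\<in>A. (c1 * c0 * pr Q * real X) ^ 2)" by simp
    also have "\<dots> \<le> (\<Sum>n\<in>A. (rep_count f X n - rep_average f X K M n)\<^sup>2)" by (intro sum_mono low)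
    also have "\<dots> \<le> 128000 * real H ^ 4 * ((1 + ln (4 * real H)) ^ 3 / real H + \<kappa>' powr (1/4) + 1 / real Q)"
      unfolding H_def \<kappa>'_def by (rule deviation_bound[OF gd X1(1) K1 Q1 Mq fA])
    also have "\<dots> \<le> 128000 * real H ^ 4 * (\<epsilon> * pr Q ^ 2 / (3 * C) + (4 * \<kappa>) powr (1/4) + 1 / real Q)"
      using H0[OF HH0] kk by (intro mult_left_mono add_mono) auto
    also have "128000 * real H ^ 4 = C * (c1 * c0) ^ 2 * real X ^ 4"
      using c0 c1 by (simp add: HX C_def power_mult_distrib)
    finally have "real (card A) * (c1 * c0 * pr Q * real X) ^ 2 \<le> C * (c1 * c0) ^ 2 * real X ^ 4 * (\<epsilon> * pr Q ^ 2 / (3 * C) + (4 * \<kappa>) powr (1/4) + 1 / real Q)" .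
    also have "\<dots> = (C / pr Q ^ 2 * (\<epsilon> * pr Q ^ 2 / (3 * C)) + C / pr Q ^ 2 * (4 * \<kappa>) powr (1/4) + C / (pr Q ^ 2 * real Q)) * real X ^ 2 * (c1 * c0 * pr Q * real X) ^ 2"
    proof -
      define T where "T = \<epsilon> * pr Q ^ 2 / (3 * C) + (4 * \<kappa>) powr (1/4) + 1 / real Q"
      have "(c1 * c0 * pr Q * real X) ^ 2 = (c1 * c0) ^ 2 * pr Q ^ 2 * real X ^ 2" by (simp only: power_mult_distrib)
      moreover have "real X ^ 4 = real X ^ 2 * real X ^ 2" by (simp flip: power_add)
      ultimately have "C * (c1 * c0) ^ 2 * real X ^ 4 * T = (C / pr Q ^ 2 * T) * real X ^ 2 * (c1 * c0 * pr Q * real X) ^ 2"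
        using pr0 by simp
      moreover have "C / pr Q ^ 2 * T = C / pr Q ^ 2 * (\<epsilon> * pr Q ^ 2 / (3 * C)) + C / pr Q ^ 2 * (4 * \<kappa>) powr (1/4) + C / (pr Q ^ 2 * real Q)"
        unfolding T_def distrib_left by simp
      ultimately show ?thesis unfolding T_def by (simp only:)
    qed
    also have "\<dots> \<le> (\<epsilon> / 3 + \<epsilon> / 3 + \<epsilon> / 3) * real X ^ 2 * (c1 * c0 * pr Q * real X) ^ 2"
    proof (intro mult_right_mono add_mono kpr Qpr)
      show "C / pr Q ^ 2 * (\<epsilon> * pr Q ^ 2 / (3 * C)) \<le> \<epsilon> / 3" using C pr0 by simp
    qed auto
    finally have "real (card A) * (c1 * c0 * pr Q * real X) ^ 2 \<le> (\<epsilon> * real X ^ 2) * (c1 * c0 * pr Q * real X) ^ 2" by simp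
    moreover have "(c1 * c0 * pr Q * real X) ^ 2 > 0" using c0 c1 pr0 Xp by simp
    ultimately have "real (card A) \<le> \<epsilon> * real X ^ 2" by (metis mult_le_cancel_right_pos)
    then show ?case by (simp add: A_def)
  qed
qed

text \<open>The cube has side about 8 sqrt N, so that \<open>N\<close> is at most X^2/64 while X^2
  is at most 256 N. Integers below \<delta> X^2 escape the previous estimate but are few; each of
  the two parts accounts for half of \<open>\<epsilon>\<close>, hence 512.\<close>

theorem almost_all_admissible_represented:
  fixes \<epsilon> :: real and V :: nat
  assumes pd: "positive_definite f" and e: "0 < \<epsilon>"
  shows "\<forall>\<^sub>F N in sequentially. real (card {n\<in>{1..int N}. admissible f V n \<and> n \<notin> range (form_eval f)}) \<le> \<epsilon> * real N"
proof -
  define \<delta> where "\<delta> = min (\<epsilon> / 512) 1"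
  have d: "0 < \<delta>" "\<delta> \<le> 1" "\<delta> \<le> \<epsilon> / 512" using e by (auto simp: \<delta>_def)
  have e': "\<epsilon> / 512 > 0" using e by simp
  obtain X0 where X0: "\<And>X. X \<ge> X0 \<Longrightarrow> real (card {n. \<delta> * real X ^ 2 \<le> of_int n \<and> of_int n \<le> real X ^ 2 / 64
     \<and> admissible f V n \<and> n \<notin> range (form_eval f)}) \<le> \<epsilon> / 512 * real X ^ 2"
    using card_unrepresented_admissible_le[OF pd d(1,2) e', of V] unfolding eventually_sequentially by blast
  show ?thesis unfolding eventually_sequentially
  proof (intro exI[of _ "max 1 (X0 ^ 2)"] allI impI)
    fix N assume N: "max 1 (X0 ^ 2) \<le> N"
    then have N1: "N \<ge> 1" "X0 ^ 2 \<le> N" by auto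
    define X where "X = nat \<lceil>8 * sqrt (real N)\<rceil>"
    have s1: "sqrt (real N) \<ge> 1" using N1 by simp
    have Xl: "real X \<ge> 8 * sqrt (real N)" "real X \<le> 8 * sqrt (real N) + 1" unfolding X_def using s1 by linarith+
    have "(8 * sqrt (real N)) ^ 2 \<le> real X ^ 2" using Xl(1) s1 by (intro power_mono) auto
    then have NX: "real N \<le> real X ^ 2 / 64" by (simp add: power_mult_distrib)
    have "real X \<le> 16 * sqrt (real N)" using Xl(2) s1 by linarith
    then have "real X ^ 2 \<le> (16 * sqrt (real N)) ^ 2" by (intro power_mono) auto
    then have XN: "real X ^ 2 \<le> 256 * real N" by (simp add: power_mult_distrib)
    have "real X0 ^ 2 \<le> real X ^ 2"
    proof -
      have "real (X0 ^ 2) \<le> real N" using N1(2) by (simp only: of_nat_le_iff)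
      then have "real X0 ^ 2 \<le> real N" by simp
      moreover have "real X ^ 2 / 64 \<le> real X ^ 2" by simp
      ultimately show ?thesis using NX by linarith
    qed
    then have "X \<ge> X0" by (simp add: power_mono_iff)
    let ?A = "{n. \<delta> * real X ^ 2 \<le> of_int n \<and> of_int n \<le> real X ^ 2 / 64 \<and> admissible f V n \<and> n \<notin> range (form_eval f)}"
    let ?B = "{1..\<lfloor>\<delta> * real X ^ 2\<rfloor>}"
    have "finite ?A"
    proof (rule finite_subset)
      show "?A \<subseteq> {\<lfloor>\<delta> * real X ^ 2\<rfloor>..\<lceil>real X ^ 2 / 64\<rceil>}" by (auto, linarith+)
    qed simp
    moreover have "{n\<in>{1..int N}. admissible f V n \<and> n \<notin> range (form_eval f)} \<subseteq> ?A \<union> ?B"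
    proof
      fix n assume n: "n \<in> {n\<in>{1..int N}. admissible f V n \<and> n \<notin> range (form_eval f)}"
      then have "real_of_int n \<le> real N" by auto
      then have "real_of_int n \<le> real X ^ 2 / 64" using NX by linarith
      then show "n \<in> ?A \<union> ?B" using n by (cases "\<delta> * real X ^ 2 \<le> of_int n") (auto simp: le_floor_iff)
    qed
    ultimately have "card {n\<in>{1..int N}. admissible f V n \<and> n \<notin> range (form_eval f)} \<le> card ?A + card ?B"
      by (meson card_Un_le card_mono finite_UnI finite_atLeastAtMost_int le_trans)
    then have "real (card {n\<in>{1..int N}. admissible f V n \<and> n \<notin> range (form_eval f)}) \<le> real (card ?A + card ?B)"
      by (simp only: of_nat_le_iff)
    also have "\<dots> \<le> \<epsilon> / 512 * real X ^ 2 + \<delta> * real X ^ 2"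
    proof -
      have "real (card ?B) \<le> \<delta> * real X ^ 2" using d(1) by simp
      then show ?thesis using X0[OF \<open>X \<ge> X0\<close>] by simp
    qed
    also have "\<dots> \<le> \<epsilon> / 512 * real X ^ 2 + \<epsilon> / 512 * real X ^ 2" using d(3) by (intro add_left_mono mult_right_mono) auto
    also have "\<dots> = \<epsilon> / 256 * real X ^ 2" by simp
    also have "\<dots> \<le> \<epsilon> / 256 * (256 * real N)" using XN e by (intro mult_left_mono) auto
    finally show "real (card {n\<in>{1..int N}. admissible f V n \<and> n \<notin> range (form_eval f)}) \<le> \<epsilon> * real N" by simp
  qed
qed

section \<open>The density as a product of local densities\<close>

lemma finite_residue_interval: "finite {h\<in>{l..<u::int}. h mod q = r}"
  by (rule finite_subset[of _ "{l..<u}"]) auto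

lemma card_residue_interval_ge:
  fixes l q r :: int
  assumes "q > 0" "0 \<le> r" "r < q"
  shows "N div nat q \<le> card {h\<in>{l..<l + int N}. h mod q = r}"
proof -
  let ?g = "\<lambda>i. l + (r - l) mod q + q * int i"
  have inj: "inj_on ?g {..<N div nat q}" using assms(1) by (auto simp: inj_on_def)
  have "?g ` {..<N div nat q} \<subseteq> {h\<in>{l..<l + int N}. h mod q = r}"
  proof (rule image_subsetI)
    fix i assume "i \<in> {..<N div nat q}"
    then have i: "i + 1 \<le> N div nat q" by simp
    have "(i + 1) * nat q \<le> (N div nat q) * nat q" using i by (rule mult_le_mono1)
    then have "(i + 1) * nat q \<le> N" using div_times_less_eq_dividend le_trans by blast
    then have "int ((i + 1) * nat q) \<le> int N" by (simp only: of_nat_le_iff)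
    then have "q * int i + q \<le> int N" using assms(1) by (simp add: algebra_simps)
    moreover have "(r - l) mod q < q" "(r - l) mod q \<ge> 0" using assms(1) by auto
    moreover have "q * int i \<ge> 0" using assms(1) by simp
    moreover have "?g i mod q = r"
    proof -
      have "(r - l) mod q = (r - l) - q * ((r - l) div q)" by (simp add: minus_mult_div_eq_mod)
      then have "?g i - r = q * (int i - (r - l) div q)" by (simp add: algebra_simps)
      then have "?g i mod q = r mod q" by (metis dvd_triv_left mod_eq_dvd_iff)
      then show ?thesis using assms by simp
    qed
    ultimately show "?g i \<in> {h\<in>{l..<l + int N}. h mod q = r}" by simp
  qed
  then have "card (?g ` {..<N div nat q}) \<le> card {h\<in>{l..<l + int N}. h mod q = r}"
    by (intro card_mono finite_residue_interval)
  then show ?thesis by (simp add: card_image[OF inj])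
qed

lemma card_periodic_set:
  fixes S :: "int set" and m N :: nat
  assumes m: "m > 0" and S: "\<And>n. n \<in> S \<longleftrightarrow> n mod int m \<in> S"
  defines "c \<equiv> card (S \<inter> {0..<int m})"
  shows "\<bar>real (card (S \<inter> {1..int N})) - real N * (real c / real m)\<bar> \<le> real m"
proof -
  let ?R = "S \<inter> {0..<int m}"
  have I: "{1..int N} = {1..<1 + int N}" by auto
  have "card (S \<inter> {1..int N}) = (\<Sum>r\<in>?R. card {h\<in>{1..<1 + int N}. h mod int m = r})"
  proof -
    have "S \<inter> {1..int N} = (\<Union>r\<in>?R. {h\<in>{1..<1 + int N}. h mod int m = r})"
      using S m by (auto simp: I)
    moreover have "card (\<Union>r\<in>?R. {h\<in>{1..<1 + int N}. h mod int m = r}) = (\<Sum>r\<in>?R. card {h\<in>{1..<1 + int N}. h mod int m = r})"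
      by (rule card_UN_disjoint) (use finite_residue_interval in auto)
    ultimately show ?thesis by simp
  qed
  moreover have "(\<Sum>r\<in>?R. card {h\<in>{1..<1 + int N}. h mod int m = r}) \<le> (\<Sum>r\<in>?R. N div m + 1)"
    using card_residue_interval[of "int m" 1 N] m by (intro sum_mono) auto
  moreover have "(\<Sum>r\<in>?R. N div m) \<le> (\<Sum>r\<in>?R. card {h\<in>{1..<1 + int N}. h mod int m = r})"
    using card_residue_interval_ge[of "int m" _ N 1] m by (intro sum_mono) auto
  ultimately have b: "c * (N div m) \<le> card (S \<inter> {1..int N})" "card (S \<inter> {1..int N}) \<le> c * (N div m + 1)"
    by (auto simp: c_def)
  have cm: "c \<le> m" unfolding c_def using card_mono[of "{0..<int m}" ?R] by simp
  define q where "q = N div m"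
  have N: "q * m \<le> N" "N < (q + 1) * m"
    using m by (auto simp: q_def dividend_less_div_times add.commute)
  have "real (q * m) \<le> real N" "real N < real ((q + 1) * m)" using N by (simp_all only: of_nat_le_iff of_nat_less_iff)
  then have qN: "real q \<le> real N / real m" "real N / real m \<le> real q + 1" using m by (auto simp: field_simps)
  have "real (c * q) \<le> real (card (S \<inter> {1..int N}))" "real (card (S \<inter> {1..int N})) \<le> real (c * (q + 1))"
    using b unfolding q_def by (simp_all only: of_nat_le_iff)
  then have br: "real c * real q \<le> real (card (S \<inter> {1..int N}))" "real (card (S \<inter> {1..int N})) \<le> real c * (real q + 1)" by (simp_all add: distrib_left)
  have eq: "real N * (real c / real m) = real c * (real N / real m)" by simp
  have "real c * real q \<le> real c * (real N / real m)" "real c * (real N / real m) \<le> real c * (real q + 1)"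
    using qN by (intro mult_left_mono; simp)+
  then have "\<bar>real (card (S \<inter> {1..int N})) - real c * (real N / real m)\<bar> \<le> real c" using br by (simp add: distrib_left abs_le_iff)
  then show ?thesis unfolding eq using cm by linarith
qed

lemma card_crt:
  fixes m1 m2 :: nat and A1 A2 :: "int set"
  assumes "coprime m1 m2" "m1 > 0" "m2 > 0"
  shows "card {r\<in>{0..<int (m1 * m2)}. r mod int m1 \<in> A1 \<and> r mod int m2 \<in> A2} =
    card (A1 \<inter> {0..<int m1}) * card (A2 \<inter> {0..<int m2})"
proof -
  have cop: "coprime (int m1) (int m2)" using assms by simp
  have "bij_betw (\<lambda>r. (r mod int m1, r mod int m2)) {r\<in>{0..<int (m1 * m2)}. r mod int m1 \<in> A1 \<and> r mod int m2 \<in> A2}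
     ((A1 \<inter> {0..<int m1}) \<times> (A2 \<inter> {0..<int m2}))"
    unfolding bij_betw_def
  proof
    show "inj_on (\<lambda>r. (r mod int m1, r mod int m2)) {r\<in>{0..<int (m1 * m2)}. r mod int m1 \<in> A1 \<and> r mod int m2 \<in> A2}"
    proof (rule inj_onI)
      fix r s assume rs: "r \<in> {r\<in>{0..<int (m1 * m2)}. r mod int m1 \<in> A1 \<and> r mod int m2 \<in> A2}"
        "s \<in> {r\<in>{0..<int (m1 * m2)}. r mod int m1 \<in> A1 \<and> r mod int m2 \<in> A2}"
        "(r mod int m1, r mod int m2) = (s mod int m1, s mod int m2)"
      then have "int m1 dvd r - s" "int m2 dvd r - s" by (auto simp: mod_eq_dvd_iff)
      then have "int m1 * int m2 dvd r - s" using cop by (simp add: divides_mult)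
      then have "r mod int (m1 * m2) = s mod int (m1 * m2)" by (simp add: mod_eq_dvd_iff)
      then show "r = s" using rs(1,2) by (simp del: of_nat_mult)
    qed
    show "(\<lambda>r. (r mod int m1, r mod int m2)) ` {r\<in>{0..<int (m1 * m2)}. r mod int m1 \<in> A1 \<and> r mod int m2 \<in> A2} =
      (A1 \<inter> {0..<int m1}) \<times> (A2 \<inter> {0..<int m2})"
    proof (intro equalityI subsetI)
      fix x assume "x \<in> (A1 \<inter> {0..<int m1}) \<times> (A2 \<inter> {0..<int m2})"
      then obtain a b where x: "x = (a, b)" "a \<in> A1" "0 \<le> a" "a < int m1" "b \<in> A2" "0 \<le> b" "b < int m2" by auto
      obtain y where y: "[y = a] (mod int m1)" "[y = b] (mod int m2)" using binary_chinese_remainder_int[OF cop] by blast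
      define r where "r = y mod int (m1 * m2)"
      have "r mod int m1 = y mod int m1" "r mod int m2 = y mod int m2"
        unfolding r_def by (simp_all add: mod_mod_cancel)
      then have e: "r mod int m1 = a" "r mod int m2 = b" using y x by (simp_all add: cong_iff)
      have "0 \<le> r \<and> r < int (m1 * m2)" unfolding r_def using assms by (simp del: of_nat_mult)
      then show "x \<in> (\<lambda>r. (r mod int m1, r mod int m2)) ` {r\<in>{0..<int (m1 * m2)}. r mod int m1 \<in> A1 \<and> r mod int m2 \<in> A2}"
        using e x by (intro image_eqI[of _ _ r]) auto
    qed (use assms in auto)
  qed
  then show ?thesis by (simp add: bij_betw_same_card card_cartesian_product)
qed

section \<open>Local residues and the convergence of the density\<close>

definition local_residues :: "ternary_form \<Rightarrow> nat \<Rightarrow> int set" where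
  "local_residues f m = {n. \<exists>w. [form_eval f w = n] (mod int m)}"

definition local_ratio :: "ternary_form \<Rightarrow> nat \<Rightarrow> real" where
  "local_ratio f m = real (card (local_residues f m \<inter> {0..<int m})) / real m"

lemma local_residues_mod: "n mod int m \<in> local_residues f m \<longleftrightarrow> n \<in> local_residues f m"
  by (simp add: local_residues_def cong_iff)

lemma local_residues_mod_mult: "n mod int (m * k) \<in> local_residues f m \<longleftrightarrow> n \<in> local_residues f m"
  using local_residues_mod[of "n mod int (m * k)" m f] local_residues_mod[of n m f] by (simp add: mod_mod_cancel)

lemma card_local_residues_prod:
  fixes P :: "nat set"
  assumes "finite P" "\<And>p. p \<in> P \<Longrightarrow> prime p"
  shows "card ((\<Inter>p\<in>P. local_residues f (p ^ k)) \<inter> {0..<int (\<Prod>p\<in>P. p ^ k)}) =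
    (\<Prod>p\<in>P. card (local_residues f (p ^ k) \<inter> {0..<int (p ^ k)}))"
  using assms
proof (induction P rule: finite_induct)
  case empty
  have "{0..<1::int} = {0}" by auto
  then show ?case by simp
next
  case (insert p P)
  define m where "m = (\<Prod>p\<in>P. p ^ k)"
  define A where "A = (\<Inter>p\<in>P. local_residues f (p ^ k))"
  have cop: "coprime (p ^ k) m"
    unfolding m_def using insert by (intro prod_coprime_right) (metis coprime_power_left_iff coprime_power_right_iff insertCI primes_coprime)
  have pos: "p ^ k > 0" "m > 0" unfolding m_def using insert by (auto simp: prime_gt_0_nat intro!: prod_pos)
  have A: "r mod int m \<in> A \<longleftrightarrow> r \<in> A" for r
  proof -
    have "r mod int m \<in> local_residues f (q ^ k) \<longleftrightarrow> r \<in> local_residues f (q ^ k)" if "q \<in> P" for q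
    proof -
      have "q ^ k dvd m" unfolding m_def using insert(1) that by (rule dvd_prodI)
      then obtain j where "m = q ^ k * j" by auto
      then show ?thesis using local_residues_mod_mult by metis
    qed
    then show ?thesis by (simp add: A_def)
  qed
  have "card ((local_residues f (p ^ k) \<inter> A) \<inter> {0..<int (p ^ k * m)}) =
     card {r\<in>{0..<int (p ^ k * m)}. r mod int (p ^ k) \<in> local_residues f (p ^ k) \<and> r mod int m \<in> A}"
    by (rule arg_cong[where f=card]) (auto simp: A local_residues_mod simp del: of_nat_power)
  also have "\<dots> = card (local_residues f (p ^ k) \<inter> {0..<int (p ^ k)}) * card (A \<inter> {0..<int m})"
    by (rule card_crt[OF cop pos])
  also have "card (A \<inter> {0..<int m}) = (\<Prod>p\<in>P. card (local_residues f (p ^ k) \<inter> {0..<int (p ^ k)}))"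
    unfolding A_def m_def using insert by auto
  finally show ?case using insert(1,2) by (simp add: A_def m_def)
qed

lemma local_ratio_nonneg: "local_ratio f m \<ge> 0" by (simp add: local_ratio_def)

text \<open>A class modulo p^(k+1) that contains a value lies over a class modulo p^k that contains
  one, and each class has \<open>p\<close> such lifts, so the ratios decrease.\<close>

lemma local_ratio_convergent:
  assumes "prime p" shows "convergent (\<lambda>k. local_ratio f (p ^ k))"
proof (rule Bseq_monoseq_convergent)
  have p0: "p > 0" using assms by (simp add: prime_gt_0_nat)
  have dec: "local_ratio f (p ^ Suc k) \<le> local_ratio f (p ^ k)" for k
  proof -
    let ?A = "local_residues f (p ^ Suc k) \<inter> {0..<int (p ^ Suc k)}" and ?B = "local_residues f (p ^ k) \<inter> {0..<int (p ^ k)}"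
    have "card ?A \<le> card (?B \<times> {0..<int p})"
    proof (rule card_inj_on_le[of "\<lambda>n. (n mod int (p ^ k), n div int (p ^ k))"])
      show "inj_on (\<lambda>n. (n mod int (p ^ k), n div int (p ^ k))) ?A"
        by (rule inj_onI) (metis Pair_inject div_mult_mod_eq)
      show "(\<lambda>n. (n mod int (p ^ k), n div int (p ^ k))) ` ?A \<subseteq> ?B \<times> {0..<int p}"
      proof (rule image_subsetI)
        fix n assume n: "n \<in> ?A"
        then obtain w where "[form_eval f w = n] (mod int (p ^ Suc k))" by (auto simp: local_residues_def)
        then have "[form_eval f w = n] (mod int (p ^ k))" by (rule cong_dvd_modulus) simp
        then have "n mod int (p ^ k) \<in> local_residues f (p ^ k)" unfolding local_residues_mod unfolding local_residues_def by blast
        moreover have "n div int (p ^ k) < int p"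
        proof -
          define q where "q = int (p ^ k)"
          have q0: "q > 0" using p0 by (simp add: q_def)
          have "n div q * q \<le> n" using q0 div_mult_mod_eq[of n q] pos_mod_sign[of q n] by linarith
          also have "n < int p * q" using n by (simp add: q_def)
          finally show ?thesis using q0 by (simp add: q_def)
        qed
        ultimately show "(n mod int (p ^ k), n div int (p ^ k)) \<in> ?B \<times> {0..<int p}"
          using n p0 by (simp add: pos_imp_zdiv_nonneg_iff del: of_nat_power)
      qed
    qed simp
    then have "card ?A \<le> card ?B * p" by (simp add: card_cartesian_product)
    then have "real (card ?A) \<le> real (card ?B * p)" by (simp only: of_nat_le_iff)
    then show ?thesis using p0 unfolding local_ratio_def by (simp add: field_simps)
  qed
  then have "decseq (\<lambda>k. local_ratio f (p ^ k))" by (rule decseq_SucI)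
  then show "monoseq (\<lambda>k. local_ratio f (p ^ k))" by (simp add: decseq_imp_monoseq)
  have "local_ratio f (p ^ k) \<le> 1" for k
  proof -
    have "card (local_residues f (p ^ k) \<inter> {0..<int (p ^ k)}) \<le> card {0..<int (p ^ k)}" by (intro card_mono) auto
    then have "card (local_residues f (p ^ k) \<inter> {0..<int (p ^ k)}) \<le> p ^ k" by (simp add: nat_power_eq)
    then have "real (card (local_residues f (p ^ k) \<inter> {0..<int (p ^ k)})) \<le> real (p ^ k)" by (simp only: of_nat_le_iff)
    then show ?thesis using p0 by (simp add: local_ratio_def)
  qed
  then show "Bseq (\<lambda>k. local_ratio f (p ^ k))"
    by (intro BseqI'[of _ 1]) (simp add: local_ratio_nonneg)
qed

definition local_density :: "ternary_form \<Rightarrow> nat \<Rightarrow> real" where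
  "local_density f p = lim (\<lambda>k. local_ratio f (p ^ k))"

lemma local_density_tendsto:
  "prime p \<Longrightarrow> (\<lambda>k. local_ratio f (p ^ k)) \<longlonglongrightarrow> local_density f p"
  unfolding local_density_def using local_ratio_convergent convergent_LIMSEQ_iff by blast

text \<open>Represented integers lie in the periodic set \<open>S\<close>. What \<open>S\<close>
  contains beyond them is either admissible but not represented, which is rare, or divisible by
  p^(V+1) for a bad prime, which has density at most 2^(-V). The parameter \<open>V\<close> thus
  truncates the valuations at which Hensel's lemma becomes too weak.\<close>

lemma density_seq_approx:
  fixes V :: nat and \<epsilon> :: real
  assumes pd: "positive_definite f" and e: "\<epsilon> > 0"
  defines "P \<equiv> {p. prime p \<and> int p dvd gram_det f}"
  shows "\<forall>\<^sub>F N in sequentially. \<bar>density_seq f N - (\<Prod>p\<in>P. local_ratio f (p ^ (2 * V + 4)))\<bar> \<le> \<epsilon> + real (card P) / 2 ^ V"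
proof -
  note pos = positive_definite_minors[OF pd]
  have fP: "finite P"
  proof (rule finite_subset)
    show "P \<subseteq> {..nat (gram_det f)}"
    proof
      fix p assume "p \<in> P"
      then have "int p \<le> gram_det f" using pos(3) by (intro zdvd_imp_le) (auto simp: P_def)
      then show "p \<in> {..nat (gram_det f)}" by simp
    qed
  qed simp
  have pP: "prime p" if "p \<in> P" for p using that by (simp add: P_def)
  define k where "k = 2 * V + 4"
  define m where "m = (\<Prod>p\<in>P. p ^ k)"
  have m0: "m > 0" unfolding m_def using pP by (auto simp: prime_gt_0_nat intro!: prod_pos)
  define S where "S = (\<Inter>p\<in>P. local_residues f (p ^ k))"
  define a where "a = (\<Prod>p\<in>P. local_ratio f (p ^ k))"
  have S: "n \<in> S \<longleftrightarrow> n mod int m \<in> S" for n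
  proof -
    have "n mod int m \<in> local_residues f (q ^ k) \<longleftrightarrow> n \<in> local_residues f (q ^ k)" if "q \<in> P" for q
    proof -
      have "q ^ k dvd m" unfolding m_def using fP that by (rule dvd_prodI)
      then obtain j where "m = q ^ k * j" by auto
      then show ?thesis using local_residues_mod_mult by metis
    qed
    then show ?thesis by (simp add: S_def)
  qed
  have am: "real (card (S \<inter> {0..<int m})) / real m = a"
  proof -
    have "card (S \<inter> {0..<int m}) = (\<Prod>p\<in>P. card (local_residues f (p ^ k) \<inter> {0..<int (p ^ k)}))"
      unfolding S_def m_def by (rule card_local_residues_prod[OF fP pP])
    then show ?thesis by (simp add: a_def local_ratio_def prod_dividef m_def)
  qed
  have cS: "\<bar>real (card (S \<inter> {1..int N})) - real N * a\<bar> \<le> real m" for N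
    using card_periodic_set[OF m0 S, of N] am by simp
  have "\<forall>\<^sub>F N in sequentially. real m \<le> \<epsilon> / 2 * real N"
    using e by real_asymp
  moreover have "\<forall>\<^sub>F N in sequentially. real (card {n\<in>{1..int N}. admissible f V n \<and> n \<notin> range (form_eval f)}) \<le> \<epsilon> / 2 * real N"
    by (rule almost_all_admissible_represented[OF pd]) (use e in simp)
  moreover have "\<forall>\<^sub>F N in sequentially. N \<ge> (1::nat)" by (rule eventually_ge_at_top)
  ultimately show ?thesis
  proof eventually_elim
    case (elim N)
    have N0: "real N > 0" using elim(3) by simp
    let ?R = "represented f \<inter> {1..int N}"
    let ?E = "{n\<in>{1..int N}. admissible f V n \<and> n \<notin> range (form_eval f)}"
    let ?D = "\<lambda>p. {n\<in>{1..int N}. int p ^ Suc V dvd n}"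
    have sub1: "?R \<subseteq> S \<inter> {1..int N}"
    proof
      fix n assume "n \<in> ?R"
      then obtain w where "n = form_eval f w" "n \<in> {1..int N}" by (auto simp: represented_def)
      moreover have "form_eval f w \<in> local_residues f m'" for m' unfolding local_residues_def mem_Collect_eq by (metis cong_refl)
      ultimately show "n \<in> S \<inter> {1..int N}" by (auto simp: S_def)
    qed
    have sub2: "S \<inter> {1..int N} \<subseteq> ?R \<union> (?E \<union> (\<Union>p\<in>P. ?D p))"
    proof
      fix n assume n: "n \<in> S \<inter> {1..int N}"
      show "n \<in> ?R \<union> (?E \<union> (\<Union>p\<in>P. ?D p))"
      proof (cases "\<exists>p\<in>P. int p ^ Suc V dvd n")
        case True then show ?thesis using n by auto
      next
        case False
        have "admissible f V n" unfolding admissible_def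
        proof (intro allI impI conjI)
          fix p assume p: "prime p \<and> int p dvd gram_det f"
          then have pp: "p \<in> P" by (simp add: P_def)
          then show "\<not> int p ^ Suc V dvd n" using False by blast
          have "n \<in> local_residues f (p ^ k)" using n pp by (simp add: S_def)
          then show "\<exists>w. int p ^ (2 * V + 4) dvd form_eval f w - n"
            by (simp add: local_residues_def cong_iff_dvd_diff k_def)
        qed
        then show ?thesis using n by (cases "n \<in> range (form_eval f)") (auto simp: represented_def)
      qed
    qed
    have D: "real (card (?D p)) \<le> real N / 2 ^ V" if "p \<in> P" for p
    proof -
      have p2: "p \<ge> 2" using pP[OF that] by (rule prime_ge_2_nat)
      define q where "q = p ^ Suc V"
      have q0: "q > 0" using p2 by (simp add: q_def)
      have "?D p \<subseteq> (\<lambda>i. int q * int i) ` {1..N div q}"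
      proof
        fix n assume n: "n \<in> ?D p"
        then obtain j where j: "n = int q * j" by (auto simp: q_def elim!: dvdE)
        have j1: "j \<ge> 1" using n j q0 by (smt (verit) atLeastAtMost_iff mem_Collect_eq mult_nonneg_nonpos of_nat_0_le_iff)
        have "int q * j \<le> int N" using n j by simp
        then have "int (q * nat j) \<le> int N" using j1 by simp
        then have "q * nat j \<le> N" by (simp only: of_nat_le_iff)
        then have "nat j \<le> N div q" using q0 by (simp add: less_eq_div_iff_mult_less_eq mult.commute)
        then show "n \<in> (\<lambda>i. int q * int i) ` {1..N div q}" using j j1 by (intro image_eqI[of _ _ "nat j"]) auto
      qed
      then have "card (?D p) \<le> card {1..N div q}" by (rule surj_card_le[rotated]) simp
      then have "real (card (?D p)) \<le> real (N div q)" by simp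
      also have "\<dots> \<le> real N / real q" by (rule of_nat_div_le_of_nat)
      also have "\<dots> \<le> real N / 2 ^ V"
      proof (rule divide_left_mono)
        have "(2::real) ^ V \<le> real p ^ V" using p2 by (intro power_mono) auto
        also have "\<dots> \<le> real q" using p2 by (simp add: q_def mult_le_cancel_right1)
        finally show "2 ^ V \<le> real q" .
      qed (use q0 in auto)
      finally show ?thesis .
    qed
    have "card (S \<inter> {1..int N}) \<le> card ?R + (card ?E + card (\<Union>p\<in>P. ?D p))"
    proof -
      have "finite ?E" "finite (?D p)" for p by (rule finite_subset[of _ "{1..int N}"]; auto)+
      then have fin: "finite (?R \<union> (?E \<union> (\<Union>p\<in>P. ?D p)))" using fP by (intro finite_UnI finite_UN_I) simp_all
      have "card (S \<inter> {1..int N}) \<le> card (?R \<union> (?E \<union> (\<Union>p\<in>P. ?D p)))" by (rule card_mono[OF fin sub2])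
      also have "\<dots> \<le> card ?R + card (?E \<union> (\<Union>p\<in>P. ?D p))" by (rule card_Un_le)
      also have "\<dots> \<le> card ?R + (card ?E + card (\<Union>p\<in>P. ?D p))" by (intro add_left_mono card_Un_le)
      finally show ?thesis .
    qed
    also have "card (\<Union>p\<in>P. ?D p) \<le> (\<Sum>p\<in>P. card (?D p))" by (rule card_UN_le[OF fP])
    finally have "card (S \<inter> {1..int N}) \<le> card ?R + (card ?E + (\<Sum>p\<in>P. card (?D p)))" by simp
    then have "real (card (S \<inter> {1..int N})) \<le> real (card ?R + (card ?E + (\<Sum>p\<in>P. card (?D p))))" by (simp only: of_nat_le_iff)
    then have u: "real (card (S \<inter> {1..int N})) \<le> real (card ?R) + real (card ?E) + (\<Sum>p\<in>P. real (card (?D p)))" by simp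
    have "(\<Sum>p\<in>P. real (card (?D p))) \<le> real (card P) * (real N / 2 ^ V)" using sum_bounded_above[of P _ "real N / 2 ^ V"] D by simp
    then have u': "real (card (S \<inter> {1..int N})) \<le> real (card ?R) + \<epsilon> / 2 * real N + real (card P) / 2 ^ V * real N"
      using u elim(2) by simp
    have "card ?R \<le> card (S \<inter> {1..int N})" by (rule card_mono[OF _ sub1]) simp
    then have l: "real (card ?R) \<le> real (card (S \<inter> {1..int N}))" by simp
    have pc: "real (card P) / 2 ^ V * real N \<ge> 0" by simp
    have "\<bar>real (card ?R) - a * real N\<bar> \<le> \<epsilon> * real N + real (card P) / 2 ^ V * real N"
      using u' l pc cS[of N] elim(1) by (simp add: mult.commute[of a] abs_le_iff)
    then have "\<bar>real (card ?R) - a * real N\<bar> / real N \<le> (\<epsilon> * real N + real (card P) / 2 ^ V * real N) / real N"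
      using N0 by (intro divide_right_mono) auto
    moreover have "\<bar>real (card ?R) - a * real N\<bar> / real N = \<bar>(real (card ?R) - a * real N) / real N\<bar>" using N0 by simp
    moreover have "(real (card ?R) - a * real N) / real N = density_seq f N - a"
      using N0 by (simp add: density_seq_def diff_divide_distrib)
    moreover have "(\<epsilon> * real N + real (card P) / 2 ^ V * real N) / real N = \<epsilon> + real (card P) / 2 ^ V"
      using N0 by (simp add: add_divide_distrib)
    ultimately have "\<bar>density_seq f N - a\<bar> \<le> \<epsilon> + real (card P) / 2 ^ V" by metis
    then show ?case by (simp add: a_def k_def)
  qed
qed

text \<open>\<open>V\<close> is fixed first, so that the truncation error and the distance of the
  finite-level ratios from their limits are small; only then does \<open>N\<close> grow.\<close>

theorem density_seq_tendsto:
  assumes pd: "positive_definite f"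
  defines "P \<equiv> {p. prime p \<and> int p dvd gram_det f}"
  shows "density_seq f \<longlonglongrightarrow> (\<Prod>p\<in>P. local_density f p)"
proof (rule LIMSEQ_I)
  fix r :: real assume r: "r > 0"
  define a where "a = (\<Prod>p\<in>P. local_density f p)"
  have "(\<lambda>k. \<Prod>p\<in>P. local_ratio f (p ^ k)) \<longlonglongrightarrow> a"
    unfolding a_def by (intro tendsto_prod local_density_tendsto) (simp add: P_def)
  moreover have "filterlim (\<lambda>V::nat. 2 * V + 4) sequentially sequentially" by (rule filterlim_subseq) (auto simp: strict_mono_def)
  ultimately have "(\<lambda>V. \<Prod>p\<in>P. local_ratio f (p ^ (2 * V + 4))) \<longlonglongrightarrow> a" by (rule filterlim_compose)
  then have "\<forall>\<^sub>F V in sequentially. \<bar>(\<Prod>p\<in>P. local_ratio f (p ^ (2 * V + 4))) - a\<bar> < r / 4"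
    using r tendstoD[of _ a sequentially "r / 4"] by (simp add: dist_real_def)
  moreover have "(\<lambda>V. real (card P) / 2 ^ V) \<longlonglongrightarrow> 0" by real_asymp
  then have "\<forall>\<^sub>F V in sequentially. real (card P) / 2 ^ V < r / 4" using r by (intro order_tendstoD(2)) auto
  ultimately have "\<forall>\<^sub>F V in sequentially. \<bar>(\<Prod>p\<in>P. local_ratio f (p ^ (2 * V + 4))) - a\<bar> < r / 4 \<and> real (card P) / 2 ^ V < r / 4"
    by (rule eventually_conj)
  then obtain V where V: "\<bar>(\<Prod>p\<in>P. local_ratio f (p ^ (2 * V + 4))) - a\<bar> < r / 4" "real (card P) / 2 ^ V < r / 4"
    unfolding eventually_sequentially by blast
  obtain N0 where N0: "\<And>N. N \<ge> N0 \<Longrightarrow> \<bar>density_seq f N - (\<Prod>p\<in>P. local_ratio f (p ^ (2 * V + 4)))\<bar> \<le> r / 4 + real (card P) / 2 ^ V"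
    using density_seq_approx[OF pd, of "r / 4" V] r unfolding P_def eventually_sequentially by auto
  show "\<exists>no. \<forall>n\<ge>no. norm (density_seq f n - (\<Prod>p\<in>P. local_density f p)) < r"
  proof (intro exI[of _ N0] allI impI)
    fix n assume "n \<ge> N0"
    then have "\<bar>density_seq f n - (\<Prod>p\<in>P. local_ratio f (p ^ (2 * V + 4)))\<bar> \<le> r / 4 + real (card P) / 2 ^ V" by (rule N0)
    then show "norm (density_seq f n - (\<Prod>p\<in>P. local_density f p)) < r"
      using V r unfolding a_def[symmetric] real_norm_def by linarith
  qed
qed

section \<open>Local densities and square classes\<close>

text \<open>By compactness this is representability of \<open>n\<close> by \<open>f\<close> over the
  p-adic integers. Stating it through congruences keeps the counting free of the quotient
  construction.\<close>

definition padic_rep :: "ternary_form \<Rightarrow> nat \<Rightarrow> int \<Rightarrow> bool" where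
  "padic_rep f p n \<longleftrightarrow> (\<forall>k. \<exists>w. int p ^ k dvd form_eval f w - n)"

text \<open>Primitive vectors replace nonzero ones: a vanishing condition modulo a power of
  \<open>p\<close> alone would be met by the zero vector, and primitivity survives passage to the
  limit.\<close>

definition padic_isotropic :: "ternary_form \<Rightarrow> nat \<Rightarrow> bool" where
  "padic_isotropic f p \<longleftrightarrow> (\<forall>k. \<exists>w. \<not> vdvd (int p) w \<and> int p ^ k dvd form_eval f w)"

lemma padic_rep_of_large:
  assumes "\<And>k. k \<ge> k0 \<Longrightarrow> \<exists>w. int p ^ k dvd form_eval f w - n"
  shows "padic_rep f p n"
  unfolding padic_rep_def
proof
  fix k
  obtain w where "int p ^ (max k k0) dvd form_eval f w - n" using assms[of "max k k0"] by auto
  then have "int p ^ k dvd form_eval f w - n" by (meson dvd_trans le_imp_power_dvd max.cobounded1)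
  then show "\<exists>w. int p ^ k dvd form_eval f w - n" by blast
qed

lemma padic_rep_hensel:
  assumes p: "prime p" and n: "\<not> int p ^ Suc V dvd n" and w0: "int p ^ (2 * V + 4) dvd form_eval f w0 - n"
  shows "padic_rep f p n"
proof (rule padic_rep_of_large[of "2 * V + 4"])
  fix k assume k: "k \<ge> 2 * V + 4"
  have "0 < p ^ (2 * (k - (V + 2)))" using p by (simp add: prime_gt_0_nat)
  then have "0 < sol_count f (p ^ k) n" using sol_count_bad_prime[OF p n w0 k] by linarith
  then have "solutions f (p ^ k) n \<noteq> {}" unfolding sol_count_def by (metis card.empty less_irrefl)
  then show "\<exists>w. int p ^ k dvd form_eval f w - n" by (auto simp: solutions_def cong_iff_dvd_diff)
qed

text \<open>By Hensel's lemma, a residue that is hit modulo p^k without being represented must be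
  divisible by a power of \<open>p\<close> with exponent about k/2, and such residues have vanishing
  proportion.\<close>

lemma padic_rep_density:
  assumes p: "prime p"
  shows "(\<lambda>k. real (card {n\<in>{0..<int (p ^ k)}. padic_rep f p n}) / real (p ^ k)) \<longlonglongrightarrow> local_density f p"
proof -
  have p2: "p \<ge> 2" using p by (rule prime_ge_2_nat)
  define L where "L k = {n\<in>{0..<int (p ^ k)}. padic_rep f p n}" for k
  define A where "A k = local_residues f (p ^ k) \<inter> {0..<int (p ^ k)}" for k
  have LA: "L k \<subseteq> A k" for k
  proof
    fix n assume n: "n \<in> L k"
    then obtain w where "int p ^ k dvd form_eval f w - n" unfolding L_def padic_rep_def by blast
    then have "[form_eval f w = n] (mod int (p ^ k))" by (simp add: cong_iff_dvd_diff)
    then show "n \<in> A k" using n unfolding A_def L_def local_residues_def by blast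
  qed
  have bound: "real (card (A k)) / real (p ^ k) - real (card (L k)) / real (p ^ k) \<le> 1 / 2 ^ ((k - 4) div 2)" if k: "k \<ge> 4" for k
  proof -
    define V where "V = (k - 4) div 2"
    have kV: "k \<ge> 2 * V + 4" using k by (simp add: V_def)
    define q where "q = int p ^ Suc V"
    define s where "s = k - Suc V"
    have ks: "int (p ^ k) = q * int p ^ s" using kV by (simp add: q_def s_def flip: power_add power_Suc)
    have q0: "q > 0" using p2 by (simp add: q_def)
    have "A k \<subseteq> L k \<union> (\<lambda>i. q * i) ` {0..<int p ^ s}"
    proof
      fix n assume n: "n \<in> A k"
      then obtain w where "[form_eval f w = n] (mod int (p ^ k))" by (auto simp: A_def local_residues_def)
      then have w: "int p ^ k dvd form_eval f w - n" by (simp add: cong_iff_dvd_diff)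
      show "n \<in> L k \<union> (\<lambda>i. q * i) ` {0..<int p ^ s}"
      proof (cases "q dvd n")
        case True
        then obtain i where i: "n = q * i" by (auto elim!: dvdE)
        have "0 \<le> q * i" "q * i < q * int p ^ s" using n i ks by (auto simp: A_def simp del: of_nat_power)
        then have "i \<in> {0..<int p ^ s}" using q0 by (simp add: zero_le_mult_iff)
        then show ?thesis using i by blast
      next
        case False
        have "int p ^ (2 * V + 4) dvd form_eval f w - n" using kV by (intro dvd_trans[OF le_imp_power_dvd w])
        then have "padic_rep f p n" using padic_rep_hensel[OF p] False unfolding q_def by blast
        then show ?thesis using n by (simp add: L_def A_def)
      qed
    qed
    then have "card (A k) \<le> card (L k \<union> (\<lambda>i. q * i) ` {0..<int p ^ s})" 
    proof (rule card_mono[rotated])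
      have "finite (L k)" unfolding L_def by (rule finite_subset[of _ "{0..<int (p ^ k)}"]) auto
      then show "finite (L k \<union> (\<lambda>i. q * i) ` {0..<int p ^ s})" by simp
    qed
    also have "\<dots> \<le> card (L k) + card ((\<lambda>i. q * i) ` {0..<int p ^ s})" by (rule card_Un_le)
    also have "card ((\<lambda>i. q * i) ` {0..<int p ^ s}) \<le> card {0..<int p ^ s}" by (rule card_image_le) simp
    finally have "card (A k) \<le> card (L k) + p ^ s" by (simp add: nat_power_eq)
    then have "real (card (A k)) \<le> real (card (L k) + p ^ s)" by (simp only: of_nat_le_iff)
    then have "real (card (A k)) - real (card (L k)) \<le> real (p ^ s)" by simp
    then have "(real (card (A k)) - real (card (L k))) / real (p ^ k) \<le> real (p ^ s) / real (p ^ k)"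
      by (rule divide_right_mono) simp
    also have "real (p ^ s) / real (p ^ k) = 1 / real p ^ Suc V"
    proof -
      have "p ^ k = p ^ Suc V * p ^ s" using kV by (simp add: s_def flip: power_add power_Suc)
      then show ?thesis using p2 by simp
    qed
    also have "\<dots> \<le> 1 / 2 ^ V"
    proof (rule divide_left_mono)
      have "(2::real) ^ V \<le> real p ^ V" using p2 by (intro power_mono) auto
      also have "\<dots> \<le> real p ^ Suc V" using p2 by (intro power_increasing) auto
      finally show "(2::real) ^ V \<le> real p ^ Suc V" .
    qed (use p2 in auto)
    finally show ?thesis by (simp add: V_def diff_divide_distrib)
  qed
  have lim: "(\<lambda>k. real (card (A k)) / real (p ^ k)) \<longlonglongrightarrow> local_density f p"
    using local_density_tendsto[OF p, of f] by (simp add: local_ratio_def A_def)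
  have "(\<lambda>k. real (card (A k)) / real (p ^ k) - real (card (L k)) / real (p ^ k)) \<longlonglongrightarrow> 0"
  proof (rule tendsto_sandwich[of "\<lambda>_. 0" _ _ "\<lambda>k. 1 / 2 ^ ((k - 4) div 2)"])
    show "\<forall>\<^sub>F k in sequentially. 0 \<le> real (card (A k)) / real (p ^ k) - real (card (L k)) / real (p ^ k)"
    proof (rule always_eventually, rule allI)
      fix k
      have "card (L k) \<le> card (A k)" by (rule card_mono[OF _ LA]) (simp add: A_def)
      then show "0 \<le> real (card (A k)) / real (p ^ k) - real (card (L k)) / real (p ^ k)" by (simp add: divide_right_mono)
    qed
    show "\<forall>\<^sub>F k in sequentially. real (card (A k)) / real (p ^ k) - real (card (L k)) / real (p ^ k) \<le> 1 / 2 ^ ((k - 4) div 2)"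
      using bound unfolding eventually_sequentially by blast
    have "filterlim (\<lambda>k::nat. (k - 4) div 2) sequentially sequentially"
      unfolding filterlim_at_top
    proof
      fix Z :: nat
      show "\<forall>\<^sub>F k in sequentially. Z \<le> (k - 4) div 2"
        unfolding eventually_sequentially by (intro exI[of _ "2 * Z + 4"]) auto
    qed
    moreover have "(\<lambda>V. 1 / 2 ^ V :: real) \<longlonglongrightarrow> 0" by real_asymp
    ultimately show "(\<lambda>k. 1 / 2 ^ ((k - 4) div 2) :: real) \<longlonglongrightarrow> 0" by (rule filterlim_compose[rotated])
  qed simp
  from tendsto_diff[OF lim this] show ?thesis by (simp add: L_def)
qed

section \<open>Square classes of units and the density of stable sets\<close>

text \<open>The precision at which a unit determines its square class: modulo 8 for p = 2, modulo
  \<open>p\<close> otherwise.\<close>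

definition unit_exp :: "nat \<Rightarrow> nat" where "unit_exp p = (if p = 2 then 3 else 1)"

lemma unit_exp_pos: "unit_exp p \<ge> 1" by (simp add: unit_exp_def)

text \<open>The root is sought as 1 + 4\<tau> for p = 2 and as 1 + p\<tau> otherwise. After division
  by 8 or \<open>p\<close> the quadratic coefficient is still divisible by \<open>p\<close> while
  the linear one is a unit, which is the situation of \<open>quadratic_hensel\<close>.\<close>

lemma unit_square_class:
  assumes p: "prime p" and u: "\<not> int p dvd u" and uu: "int p ^ unit_exp p dvd u - u'"
  shows "\<exists>s. int p ^ k dvd u * s\<^sup>2 - u'"
proof (cases "p = 2")
  case True
  obtain a where a: "u - u' = 8 * a" using uu True by (auto simp: unit_exp_def elim!: dvdE)
  obtain \<tau> where t: "int p ^ k dvd a + u * \<tau> + (2 * u) * \<tau>\<^sup>2"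
    using quadratic_hensel[OF p, of u "2 * u" k a] u True by auto
  have "u * (1 + 4 * \<tau>)\<^sup>2 - u' = 8 * (a + u * \<tau> + (2 * u) * \<tau>\<^sup>2)"
    using a by (simp add: power2_eq_square algebra_simps)
  then show ?thesis using t by (metis dvd_mult)
next
  case False
  obtain a where a: "u - u' = int p * a" using uu False by (auto simp: unit_exp_def elim!: dvdE)
  have "\<not> int p dvd 2" using p False
    by (metis int_dvd_int_iff of_nat_numeral primes_dvd_imp_eq two_is_prime_nat)
  then have "\<not> int p dvd 2 * u" using u p by (simp add: prime_dvd_mult_iff)
  then obtain \<tau> where t: "int p ^ k dvd a + (2 * u) * \<tau> + (int p * u) * \<tau>\<^sup>2"
    using quadratic_hensel[OF p, of "2 * u" "int p * u" k a] by auto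
  have "u * (1 + int p * \<tau>)\<^sup>2 - u' = int p * (a + (2 * u) * \<tau> + (int p * u) * \<tau>\<^sup>2)"
    using a by (simp add: power2_eq_square algebra_simps)
  then show ?thesis using t by (metis dvd_mult)
qed

lemma padic_rep_square_class:
  assumes "prime p" "\<not> int p dvd u" "int p ^ unit_exp p dvd u - u'" "padic_rep f p (c * u)"
  shows "padic_rep f p (c * u')"
  unfolding padic_rep_def
proof
  fix k
  obtain w where w: "int p ^ k dvd form_eval f w - c * u" using assms(4) unfolding padic_rep_def by blast
  obtain s where s: "int p ^ k dvd u * s\<^sup>2 - u'" using unit_square_class[OF assms(1-3)] by blast
  have "form_eval f (smul s w) - c * u' = s\<^sup>2 * (form_eval f w - c * u) + c * (u * s\<^sup>2 - u')"
    by (simp add: form_eval_smul algebra_simps)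
  then show "\<exists>w. int p ^ k dvd form_eval f w - c * u'" using w s by (metis dvd_add dvd_mult)
qed

text \<open>Counts residue classes of units modulo 8 or \<open>p\<close>, not square classes,
  because at level \<open>j\<close> each residue class contributes the same measure, p to the power
  -(j + unit_exp p).\<close>

definition unit_count :: "(int \<Rightarrow> bool) \<Rightarrow> nat \<Rightarrow> nat \<Rightarrow> nat" where
  "unit_count A p j = card {u\<in>{0..<int p ^ unit_exp p}. \<not> int p dvd u \<and> A (int p ^ j * u)}"

definition square_class_closed :: "(int \<Rightarrow> bool) \<Rightarrow> nat \<Rightarrow> bool" where
  "square_class_closed A p \<longleftrightarrow> (\<forall>j u u'. \<not> int p dvd u \<longrightarrow> int p ^ unit_exp p dvd u - u' \<longrightarrow> A (int p ^ j * u) \<longrightarrow> A (int p ^ j * u'))"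

lemma square_class_closed_padic_rep: "prime p \<Longrightarrow> square_class_closed (padic_rep f p) p"
  unfolding square_class_closed_def using padic_rep_square_class by blast

lemma card_valuation_class:
  assumes p: "prime p" and A: "square_class_closed A p" and k: "k \<ge> j + unit_exp p"
  shows "card {n\<in>{0..<int p ^ k}. A n \<and> int p ^ j dvd n \<and> \<not> int p ^ Suc j dvd n} =
    unit_count A p j * p ^ (k - j - unit_exp p)"
proof -
  define e where "e = unit_exp p"
  define s where "s = k - j - e"
  have p0: "int p > 0" using p by (simp add: prime_gt_0_nat)
  have e1: "e \<ge> 1" using unit_exp_pos[of p] by (simp add: e_def)
  have pe: "int p dvd int p ^ e" using e1 by (simp add: dvd_power)
  have ks: "int p ^ k = int p ^ j * (int p ^ e * int p ^ s)"
    using k by (simp add: s_def e_def flip: power_add)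
  let ?U = "{u\<in>{0..<int p ^ e}. \<not> int p dvd u \<and> A (int p ^ j * u)}"
  let ?N = "{n\<in>{0..<int p ^ k}. A n \<and> int p ^ j dvd n \<and> \<not> int p ^ Suc j dvd n}"
  \<comment> \<open>Every residue of valuation exactly \<open>j\<close> is p^j times a unit, split
    into its class modulo p^e and a free higher part.\<close>
  let ?g = "\<lambda>(u, i). int p ^ j * (u + int p ^ e * i)"
  have dv: "int p dvd u + int p ^ e * i \<longleftrightarrow> int p dvd u" for u i using pe by (simp add: dvd_add_left_iff)
  have cl: "A (int p ^ j * (u + int p ^ e * i)) \<longleftrightarrow> A (int p ^ j * u)" if "\<not> int p dvd u" for u i
  proof
    assume "A (int p ^ j * u)"
    then show "A (int p ^ j * (u + int p ^ e * i))" using A that unfolding square_class_closed_def e_def by (metis add_diff_cancel_left' dvd_minus_iff dvd_triv_left minus_diff_eq)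
  next
    assume a: "A (int p ^ j * (u + int p ^ e * i))"
    have "\<not> int p dvd u + int p ^ e * i" using that dv by simp
    moreover have "int p ^ unit_exp p dvd (u + int p ^ e * i) - u" by (simp add: e_def)
    ultimately show "A (int p ^ j * u)" using A a unfolding square_class_closed_def by blast
  qed
  have "bij_betw ?g (?U \<times> {0..<int p ^ s}) ?N"
    unfolding bij_betw_def
  proof
    show "inj_on ?g (?U \<times> {0..<int p ^ s})"
    proof (rule inj_onI)
      fix x y assume xy: "x \<in> ?U \<times> {0..<int p ^ s}" "y \<in> ?U \<times> {0..<int p ^ s}" "?g x = ?g y"
      obtain u i u' i' where x: "x = (u, i)" "y = (u', i')" by (metis surj_pair)
      have e: "u + int p ^ e * i = u' + int p ^ e * i'" using xy(3) p0 by (simp add: x)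
      have "u = (u + int p ^ e * i) mod int p ^ e" "u' = (u' + int p ^ e * i') mod int p ^ e" using xy(1,2) by (auto simp: x)
      then have "u = u'" using e by simp
      then show "x = y" using e p0 by (simp add: x)
    qed
    show "?g ` (?U \<times> {0..<int p ^ s}) = ?N"
    proof (intro equalityI subsetI)
      fix n assume "n \<in> ?g ` (?U \<times> {0..<int p ^ s})"
      then obtain x where x: "x \<in> ?U \<times> {0..<int p ^ s}" "n = ?g x" by blast
      obtain u i where xu: "x = (u, i)" by (metis surj_pair)
      have ui: "n = int p ^ j * (u + int p ^ e * i)" "0 \<le> u" "u < int p ^ e" "\<not> int p dvd u" "A (int p ^ j * u)" "0 \<le> i" "i < int p ^ s"
        using x by (auto simp: xu)
      have "int p ^ e * i \<le> int p ^ e * (int p ^ s - 1)" using ui by (intro mult_left_mono) auto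
      then have lt: "u + int p ^ e * i < int p ^ e * int p ^ s" using ui(3) by (simp add: right_diff_distrib)
      then have "n < int p ^ k" unfolding ks ui(1) using p0 by simp
      moreover have "n \<ge> 0" using ui p0 by simp
      moreover have "\<not> int p ^ Suc j dvd n" using ui p0 dv by (simp add: mult.commute)
      ultimately show "n \<in> ?N" using ui cl by simp
    next
      fix n assume n: "n \<in> ?N"
      then obtain v where v: "n = int p ^ j * v" by (auto elim!: dvdE)
      have pv: "\<not> int p dvd v" using n v p0 by (auto simp: mult.commute)
      define u i where "u = v mod int p ^ e" and "i = v div int p ^ e"
      have vui: "v = u + int p ^ e * i" by (simp add: u_def i_def)
      have pu: "\<not> int p dvd u" using pv dv unfolding vui by simp
      have u: "0 \<le> u" "u < int p ^ e" using p0 by (auto simp: u_def)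
      have v0: "0 \<le> v" "v < int p ^ e * int p ^ s" 
      proof -
        have pj: "int p ^ j > 0" using p0 by simp
        have a: "0 \<le> int p ^ j * v" "int p ^ j * v < int p ^ j * (int p ^ e * int p ^ s)" using n v ks by auto
        show "0 \<le> v" using a(1) pj by (simp add: zero_le_mult_iff)
        show "v < int p ^ e * int p ^ s" using a(2) pj by (simp only: mult_less_cancel_left_pos)
      qed
      have "0 \<le> i" using v0 p0 by (simp add: i_def pos_imp_zdiv_nonneg_iff)
      moreover have "int p ^ e * i < int p ^ e * int p ^ s" using v0(2) u(1) unfolding vui by linarith
      then have "i < int p ^ s" using p0 by simp
      moreover have "A (int p ^ j * u)" using n cl[OF pu, of i] by (simp add: v vui)
      ultimately show "n \<in> ?g ` (?U \<times> {0..<int p ^ s})"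
        using pu u by (intro image_eqI[of _ _ "(u, i)"]) (auto simp: v vui)
    qed
  qed
  then have "card ?N = card (?U \<times> {0..<int p ^ s})" by (simp add: bij_betw_same_card)
  also have "\<dots> = unit_count A p j * p ^ s"
    by (simp add: card_cartesian_product unit_count_def e_def nat_power_eq)
  finally show ?thesis by (simp add: s_def e_def)
qed

text \<open>The density of a set that is stable under unit squares and, far out, under multiplication
  and division by \<open>p\<^sup>2\<close> is a geometric series in the numbers of unit classes.\<close>

lemma square_class_density:
  fixes A :: "int \<Rightarrow> bool"
  assumes p: "prime p" and A: "square_class_closed A p"
    and lim: "(\<lambda>k. real (card {n\<in>{0..<int (p ^ k)}. A n}) / real (p ^ k)) \<longlonglongrightarrow> \<delta>"
    and K: "\<And>n. int p ^ (K + 2) dvd n \<Longrightarrow> A n \<longleftrightarrow> A (n div (int p)\<^sup>2)"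
  defines "t \<equiv> \<lambda>j. real (unit_count A p j) / real p ^ (j + unit_exp p)"
  shows "\<delta> = (\<Sum>j<K. t j) + (t K + t (K + 1)) / (1 - 1 / (real p)\<^sup>2)"
proof -
  define e where "e = unit_exp p"
  \<comment> \<open>The proportion, modulo p^k, of elements of \<open>A\<close> divisible by p^j.
    Passing from \<open>j\<close> to \<open>j + 1\<close> removes one valuation level and so
    subtracts \<open>t j\<close>.\<close>
  define x where "x j k = real (card {n\<in>{0..<int p ^ k}. A n \<and> int p ^ j dvd n}) / real p ^ k" for j k
  have p1: "real p > 1" using p prime_gt_1_nat by simp
  have p0: "int p > 0" using p by (simp add: prime_gt_0_nat)
  have step: "x j k = x (Suc j) k + t j" if "k \<ge> j + e" for j k
  proof -
    let ?N = "{n\<in>{0..<int p ^ k}. A n \<and> int p ^ j dvd n \<and> \<not> int p ^ Suc j dvd n}"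
    let ?M = "{n\<in>{0..<int p ^ k}. A n \<and> int p ^ Suc j dvd n}"
    have fin: "finite {n\<in>{0..<int p ^ k}. P n}" for P by (rule finite_subset[of _ "{0..<int p ^ k}"]) auto
    have "{n\<in>{0..<int p ^ k}. A n \<and> int p ^ j dvd n} = ?M \<union> ?N"
      by (auto intro: dvd_trans[OF le_imp_power_dvd[of j "Suc j"]] dvd_mult_right)
    moreover have "card (?M \<union> ?N) = card ?M + card ?N" by (rule card_Un_disjoint) (use fin in auto)
    ultimately have "card {n\<in>{0..<int p ^ k}. A n \<and> int p ^ j dvd n} = card ?M + unit_count A p j * p ^ (k - j - e)"
      using card_valuation_class[OF p A, of j k] that by (simp only: e_def)
    then have "x j k = x (Suc j) k + real (unit_count A p j) * real p ^ (k - j - e) / real p ^ k"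
      unfolding x_def by (simp only: of_nat_add of_nat_mult of_nat_power add_divide_distrib)
    moreover have "real p ^ k = real p ^ (j + e) * real p ^ (k - j - e)" using that by (simp flip: power_add)
    ultimately show ?thesis using p1 by (simp add: t_def e_def)
  qed
  have xlim: "(\<lambda>k. x j k) \<longlonglongrightarrow> \<delta> - (\<Sum>i<j. t i)" for j
  proof (induction j)
    case 0
    show ?case using lim by (simp add: x_def)
  next
    case (Suc j)
    have "(\<lambda>k. x j k - t j) \<longlonglongrightarrow> \<delta> - (\<Sum>i<j. t i) - t j" by (intro tendsto_diff Suc tendsto_const)
    moreover have "\<forall>\<^sub>F k in sequentially. x j k - t j = x (Suc j) k"
      unfolding eventually_sequentially using step by (intro exI[of _ "j + e"]) auto
    ultimately show ?case by (simp add: tendsto_cong algebra_simps)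
  qed
  \<comment> \<open>Multiplication by p^2 carries the part divisible by p^K onto the part divisible
    by p^(K+2). In the limit the remaining measure \<open>d\<close> satisfies d - t K - t (K + 1) =
    d/p^2, which sums the geometric series.\<close>
  have shift: "x (K + 2) (k + 2) = x K k / (real p)\<^sup>2" for k
  proof -
    have "bij_betw (\<lambda>n. (int p)\<^sup>2 * n) {n\<in>{0..<int p ^ k}. A n \<and> int p ^ K dvd n} {n\<in>{0..<int p ^ (k + 2)}. A n \<and> int p ^ (K + 2) dvd n}"
      unfolding bij_betw_def
    proof
      show "inj_on (\<lambda>n. (int p)\<^sup>2 * n) {n\<in>{0..<int p ^ k}. A n \<and> int p ^ K dvd n}" using p0 by (auto simp: inj_on_def)
      have eK: "int p ^ (K + 2) = (int p)\<^sup>2 * int p ^ K" by (simp add: power2_eq_square)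
      have d: "int p ^ (K + 2) dvd (int p)\<^sup>2 * n \<longleftrightarrow> int p ^ K dvd n" for n
        unfolding eK using p0 by simp
      have iff: "A ((int p)\<^sup>2 * n) \<longleftrightarrow> A n" if "int p ^ K dvd n" for n
        using K[of "(int p)\<^sup>2 * n"] that p0 unfolding d by simp
      show "(\<lambda>n. (int p)\<^sup>2 * n) ` {n\<in>{0..<int p ^ k}. A n \<and> int p ^ K dvd n} = {n\<in>{0..<int p ^ (k + 2)}. A n \<and> int p ^ (K + 2) dvd n}"
      proof (intro equalityI subsetI)
        fix m assume "m \<in> (\<lambda>n. (int p)\<^sup>2 * n) ` {n\<in>{0..<int p ^ k}. A n \<and> int p ^ K dvd n}"
        then obtain n where n: "m = (int p)\<^sup>2 * n" "0 \<le> n" "n < int p ^ k" "A n" "int p ^ K dvd n" by auto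
        have e: "int p ^ (k + 2) = (int p)\<^sup>2 * int p ^ k" by (simp add: power2_eq_square)
        have "m < int p ^ (k + 2)" unfolding e n(1) using n p0 by (intro mult_strict_left_mono) auto
        then show "m \<in> {n\<in>{0..<int p ^ (k + 2)}. A n \<and> int p ^ (K + 2) dvd n}" using n iff d by simp
      next
        fix m assume m: "m \<in> {n\<in>{0..<int p ^ (k + 2)}. A n \<and> int p ^ (K + 2) dvd n}"
        have "(int p)\<^sup>2 dvd int p ^ (K + 2)" by (rule le_imp_power_dvd) simp
        then have "(int p)\<^sup>2 dvd m" using m dvd_trans by blast
        then obtain n where n: "m = (int p)\<^sup>2 * n" by (auto elim!: dvdE)
        have e: "int p ^ (k + 2) = (int p)\<^sup>2 * int p ^ k" by (simp add: power2_eq_square)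
        have "m < int p ^ (k + 2)" "0 \<le> m" using m by (simp_all only: mem_Collect_eq atLeastLessThan_iff)
        then have "(int p)\<^sup>2 * n < (int p)\<^sup>2 * int p ^ k" "0 \<le> (int p)\<^sup>2 * n" unfolding e n by blast+
        then have "0 \<le> n" "n < int p ^ k" using p0 by (simp_all add: zero_le_mult_iff)
        moreover have "int p ^ K dvd n" "A n" using m iff d n by auto
        ultimately show "m \<in> (\<lambda>n. (int p)\<^sup>2 * n) ` {n\<in>{0..<int p ^ k}. A n \<and> int p ^ K dvd n}"
          using n by (intro image_eqI[of _ _ n]) simp_all
      qed
    qed
    then have "card {n\<in>{0..<int p ^ k}. A n \<and> int p ^ K dvd n} = card {n\<in>{0..<int p ^ (k + 2)}. A n \<and> int p ^ (K + 2) dvd n}"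
      by (rule bij_betw_same_card)
    then show ?thesis unfolding x_def by (simp add: power2_eq_square mult.assoc)
  qed
  define d where "d = \<delta> - (\<Sum>i<K. t i)"
  have "(\<lambda>k. x (K + 2) (k + 2)) \<longlonglongrightarrow> \<delta> - (\<Sum>i<K + 2. t i)" using xlim[of "K + 2"] by (rule LIMSEQ_ignore_initial_segment)
  moreover have "(\<lambda>k. x (K + 2) (k + 2)) \<longlonglongrightarrow> d / (real p)\<^sup>2"
    unfolding shift d_def by (intro tendsto_divide xlim tendsto_const) (use p1 in auto)
  ultimately have "\<delta> - (\<Sum>i<K + 2. t i) = d / (real p)\<^sup>2" by (rule LIMSEQ_unique)
  then have "d * (1 - 1 / (real p)\<^sup>2) = t K + t (K + 1)"
  proof -
    have "(\<Sum>i<K + 2. t i) = (\<Sum>i<K. t i) + t K + t (K + 1)" by (simp add: numeral_2_eq_2)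
    then show ?thesis using \<open>\<delta> - (\<Sum>i<K + 2. t i) = d / (real p)\<^sup>2\<close> by (simp add: d_def right_diff_distrib)
  qed
  moreover have "1 - 1 / (real p)\<^sup>2 \<noteq> 0" using one_less_power[OF p1, of 2] by simp
  ultimately have "d = (t K + t (K + 1)) / (1 - 1 / (real p)\<^sup>2)" by (simp add: eq_divide_eq)
  then show ?thesis by (simp add: d_def)
qed

section \<open>Isotropy and representation up to denominators\<close>

lemma prime_power_split:
  fixes M :: int
  assumes p: "prime (p::nat)" and "M \<noteq> 0"
  obtains \<mu> m where "M = int p ^ \<mu> * m" "\<not> int p dvd m"
proof -
  have "\<not> is_unit (int p)" using p by (metis not_prime_unit prime_nat_int_transfer)
  with assms(2) obtain m where m: "M = int p ^ multiplicity (int p) M * m" "\<not> int p dvd m"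
    by (rule multiplicity_decompose')
  then show ?thesis by (rule that)
qed

lemma dvd_cancel_bounded:
  fixes M :: int
  assumes p: "prime (p::nat)" and "M \<noteq> 0"
  obtains \<mu> where "\<And>k x. int p ^ (k + \<mu>) dvd M * x \<Longrightarrow> int p ^ k dvd x"
proof -
  obtain \<mu> m where m: "M = int p ^ \<mu> * m" "\<not> int p dvd m" using prime_power_split[OF assms] by blast
  have cop: "coprime (int p ^ k) m" for k
    using m(2) p by (metis coprime_power_left_iff prime_imp_coprime prime_nat_int_transfer)
  have "int p ^ k dvd x" if "int p ^ (k + \<mu>) dvd M * x" for k x
  proof -
    have "int p ^ \<mu> * int p ^ k dvd int p ^ \<mu> * (m * x)" using that m(1) by (simp add: power_add mult_ac)
    then have "int p ^ k dvd m * x" using p by (simp add: prime_gt_0_nat)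
    then show ?thesis using cop coprime_dvd_mult_right_iff by blast
  qed
  then show ?thesis by (rule that)
qed

lemma vdvd_smul_cancel:
  "(\<And>x. a dvd c * x \<Longrightarrow> b dvd x) \<Longrightarrow> vdvd a (smul c w) \<Longrightarrow> vdvd b w"
  by (cases w) auto

text \<open>Bounded content is as good as primitivity: dividing out a content p^e with e \<le> C
  lowers the precision by at most 2C, and the precision is unbounded.\<close>

lemma padic_isotropicI:
  assumes p: "prime p" and w: "\<And>k. \<exists>w. \<not> vdvd (int p ^ Suc C) w \<and> int p ^ k dvd form_eval f w"
  shows "padic_isotropic f p"
  unfolding padic_isotropic_def
proof
  fix k
  obtain w where w: "\<not> vdvd (int p ^ Suc C) w" "int p ^ (k + 2 * C) dvd form_eval f w" using assms(2) by blast
  obtain e where e: "e \<le> C" "vdvd (int p ^ e) w" "\<not> vdvd (int p ^ Suc e) w"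
    using w(1) by (rule max_power_dividing_vector)
  obtain u where u: "w = smul (int p ^ e) u" using e(2) unfolding vdvd_iff_smul by blast
  have "\<not> vdvd (int p) u"
  proof
    assume "vdvd (int p) u"
    then have "vdvd (int p ^ Suc e) w" unfolding u by (cases u) (simp add: mult.commute mult_dvd_mono)
    then show False using e(3) by blast
  qed
  moreover have "int p ^ k dvd form_eval f u"
  proof -
    have p0: "int p > 0" using p by (simp add: prime_gt_0_nat)
    have "int p ^ (2 * e + k) dvd int p ^ (k + 2 * C)" using e(1) by (intro le_imp_power_dvd) simp
    moreover have "(int p ^ e)\<^sup>2 = int p ^ (2 * e)" by (simp add: power_mult[symmetric] mult.commute)
    then have "int p ^ (k + 2 * C) dvd int p ^ (2 * e) * form_eval f u" using w(2) by (simp only: u form_eval_smul)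
    ultimately have "int p ^ (2 * e + k) dvd int p ^ (2 * e) * form_eval f u" by (rule dvd_trans)
    then show ?thesis using p0 by (simp add: power_add)
  qed
  ultimately show "\<exists>w. \<not> vdvd (int p) w \<and> int p ^ k dvd form_eval f w" by blast
qed

text \<open>Representability over the p-adic field: \<open>s\<close> is a common denominator of a
  representing vector, and \<open>s^2\<close> is what it contributes to the value.\<close>

definition padic_rep_rat :: "ternary_form \<Rightarrow> nat \<Rightarrow> int \<Rightarrow> bool" where
  "padic_rep_rat f p n \<longleftrightarrow> (\<exists>s. s \<noteq> 0 \<and> padic_rep f p (n * s\<^sup>2))"

lemma padic_rep_imp_rat: "padic_rep f p n \<Longrightarrow> padic_rep_rat f p n"
  unfolding padic_rep_rat_def by (intro exI[of _ 1]) simp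

lemma padic_rep_scale: "padic_rep f p n \<Longrightarrow> padic_rep f p (n * r\<^sup>2)"
  unfolding padic_rep_def
proof
  fix k assume "\<forall>k. \<exists>w. int p ^ k dvd form_eval f w - n"
  then obtain w where "int p ^ k dvd form_eval f w - n" by blast
  then have "int p ^ k dvd r\<^sup>2 * (form_eval f w - n)" by simp
  then have "int p ^ k dvd form_eval f (smul r w) - n * r\<^sup>2" by (simp add: form_eval_smul algebra_simps)
  then show "\<exists>w. int p ^ k dvd form_eval f w - n * r\<^sup>2" by blast
qed

lemma padic_rep_rat_square_iff:
  assumes "r \<noteq> 0" shows "padic_rep_rat f p (n * r\<^sup>2) \<longleftrightarrow> padic_rep_rat f p n"
proof
  assume "padic_rep_rat f p (n * r\<^sup>2)"
  then obtain s where "s \<noteq> 0" "padic_rep f p (n * r\<^sup>2 * s\<^sup>2)" unfolding padic_rep_rat_def by blast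
  then show "padic_rep_rat f p n" unfolding padic_rep_rat_def using assms
    by (intro exI[of _ "r * s"]) (simp add: power_mult_distrib mult.assoc)
next
  assume "padic_rep_rat f p n"
  then obtain s where "s \<noteq> 0" "padic_rep f p (n * s\<^sup>2)" unfolding padic_rep_rat_def by blast
  then have "padic_rep f p (n * r\<^sup>2 * s\<^sup>2)" using padic_rep_scale[of f p "n * s\<^sup>2" r] by (simp add: mult_ac)
  then show "padic_rep_rat f p (n * r\<^sup>2)" unfolding padic_rep_rat_def using \<open>s \<noteq> 0\<close> by blast
qed

lemma padic_rep_rat_square_class:
  assumes "prime p" "\<not> int p dvd u" "int p ^ unit_exp p dvd u - u'" "padic_rep_rat f p (c * u)"
  shows "padic_rep_rat f p (c * u')"
proof -
  obtain s where s: "s \<noteq> 0" "padic_rep f p (c * u * s\<^sup>2)" using assms(4) unfolding padic_rep_rat_def by blast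
  then have "padic_rep f p (c * s\<^sup>2 * u)" by (simp add: mult_ac)
  then have "padic_rep f p (c * s\<^sup>2 * u')" by (rule padic_rep_square_class[OF assms(1-3)])
  then show ?thesis unfolding padic_rep_rat_def using s(1) by (intro exI[of _ s]) (simp add: mult_ac)
qed

text \<open>\<open>T\<close> maps the quadratic space of \<open>f\<close>, scaled by \<open>M\<close>, into that of \<open>g\<close>; \<open>U\<close> inverts it up to
  the scalar \<open>d\<close>.\<close>

definition form_embeds :: "ternary_form \<Rightarrow> ternary_form \<Rightarrow> int \<Rightarrow> bool" where
  "form_embeds f g M \<longleftrightarrow> (\<exists>T U d. d \<noteq> 0 \<and> (\<forall>w. form_eval g (T w) = M * form_eval f w)
     \<and> (\<forall>w. U (T w) = smul d w) \<and> (\<forall>m v. vdvd m v \<longrightarrow> vdvd m (U v)))"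

lemma padic_rep_embeds: "form_embeds f g M \<Longrightarrow> padic_rep f p n \<Longrightarrow> padic_rep g p (M * n)"
  unfolding padic_rep_def
proof
  fix k assume fg: "form_embeds f g M" and n: "\<forall>k. \<exists>w. int p ^ k dvd form_eval f w - n"
  obtain T where T: "\<And>w. form_eval g (T w) = M * form_eval f w" using fg unfolding form_embeds_def by blast
  obtain w where "int p ^ k dvd form_eval f w - n" using n by blast
  then have "int p ^ k dvd M * (form_eval f w - n)" by simp
  then have "int p ^ k dvd form_eval g (T w) - M * n" by (simp add: T right_diff_distrib)
  then show "\<exists>w. int p ^ k dvd form_eval g w - M * n" by blast
qed

lemma padic_rep_rat_embeds: "form_embeds f g M \<Longrightarrow> padic_rep_rat f p n \<Longrightarrow> padic_rep_rat g p (M * n)"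
  unfolding padic_rep_rat_def using padic_rep_embeds by (metis mult.assoc)

text \<open>The near-inverse \<open>U\<close> controls the content of the image: a high power of
  \<open>p\<close> dividing \<open>T w\<close> would divide \<open>d\<close> times \<open>w\<close>,
  and only a bounded part of it can come from \<open>d\<close>.\<close>

lemma padic_isotropic_embeds:
  assumes p: "prime p" and fg: "form_embeds f g M" and iso: "padic_isotropic f p"
  shows "padic_isotropic g p"
proof -
  obtain T U d where d: "d \<noteq> 0" and T: "\<And>w. form_eval g (T w) = M * form_eval f w"
    and U: "\<And>w. U (T w) = smul d w" "\<And>m v. vdvd m v \<Longrightarrow> vdvd m (U v)"
    using fg unfolding form_embeds_def by blast
  obtain \<mu> where \<mu>: "\<And>k x. int p ^ (k + \<mu>) dvd d * x \<Longrightarrow> int p ^ k dvd x" using dvd_cancel_bounded[OF p d] by blast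
  show ?thesis
  proof (rule padic_isotropicI[OF p, of \<mu>])
    fix k
    obtain w where w: "\<not> vdvd (int p) w" "int p ^ k dvd form_eval f w" using iso unfolding padic_isotropic_def by blast
    have "\<not> vdvd (int p ^ Suc \<mu>) (T w)"
    proof
      assume "vdvd (int p ^ Suc \<mu>) (T w)"
      then have "vdvd (int p ^ (1 + \<mu>)) (smul d w)" using U(2)[of "int p ^ Suc \<mu>" "T w"] by (simp add: U(1))
      then have "vdvd (int p ^ 1) w" using \<mu>[of 1] by (rule vdvd_smul_cancel[rotated])
      then show False using w(1) by simp
    qed
    moreover have "int p ^ k dvd form_eval g (T w)" using w(2) by (simp add: T)
    ultimately show "\<exists>w. \<not> vdvd (int p ^ Suc \<mu>) w \<and> int p ^ k dvd form_eval g w" by blast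
  qed
qed

lemma form_embedsI:
  assumes "d \<noteq> 0" "\<And>x y z. form_eval g (T (x, y, z)) = M * form_eval f (x, y, z)"
    "\<And>x y z. U (T (x, y, z)) = (d * x, d * y, d * z)"
    "\<And>m x y z. m dvd x \<Longrightarrow> m dvd y \<Longrightarrow> m dvd z \<Longrightarrow> vdvd m (U (x, y, z))"
  shows "form_embeds f g M"
  unfolding form_embeds_def using assms by (intro exI[of _ T] exI[of _ U] exI[of _ d]) auto

abbreviation diag :: "int \<Rightarrow> int \<Rightarrow> int \<Rightarrow> ternary_form" where
  "diag a b c \<equiv> Ternary_Form a b c 0 0 0"

lemma form_eval_diag: "form_eval (diag a b c) (x, y, z) = a * x\<^sup>2 + b * y\<^sup>2 + c * z\<^sup>2"
  for x :: int by (simp add: form_eval_def power2_eq_square)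

lemma gram_det_diag: "gram_det (diag a b c) = 8 * a * b * c" by (simp add: gram_det_def)

text \<open>\<open>T\<close> consists of the linear forms squared in the diagonalisation, and
  \<open>U\<close> is its inverse times the scalar 8aA. Backwards, \<open>U\<close> is multiplied
  once more by the multiplier \<open>M\<close>, so that the similarity factor becomes an integer;
  the product of the two factors is a square.\<close>

lemma embeds_diagonal:
  assumes "coeff_11 f \<noteq> 0" "minor_12 f \<noteq> 0"
  shows "form_embeds f (diag 1 (minor_12 f) (8 * coeff_11 f * gram_det f)) (16 * coeff_11 f * minor_12 f)"
    and "form_embeds (diag 1 (minor_12 f) (8 * coeff_11 f * gram_det f)) f (16 * coeff_11 f * minor_12 f * (8 * coeff_11 f * minor_12 f)\<^sup>2)"
proof -
  define a A B b12 b13 where "a = coeff_11 f" and "A = minor_12 f" and "B = mixed_23 f" and "b12 = coeff_12 f" and "b13 = coeff_13 f"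
  note defs = a_def A_def B_def b12_def b13_def
  define T where "T = (\<lambda>(x, y, z). (2 * A * y + B * z, 2 * (2 * a * x + b12 * y + b13 * z), z))"
  define U where "U = (\<lambda>(Y, X, Z). (2 * A * X - 2 * b12 * (Y - B * Z) - 4 * A * b13 * Z, 4 * a * (Y - B * Z), 8 * a * A * Z))"
  have UT: "U (T (x, y, z)) = (8 * a * A * x, 8 * a * A * y, 8 * a * A * z)" for x y z
    by (simp add: U_def T_def algebra_simps)
  have TU: "T (U (x, y, z)) = (8 * a * A * x, 8 * a * A * y, 8 * a * A * z)" for x y z
    by (simp add: U_def T_def algebra_simps)
  have gT: "form_eval (diag 1 A (8 * a * gram_det f)) (T (x, y, z)) = 16 * a * A * form_eval f (x, y, z)" for x y z
    unfolding a_def A_def form_eval_diagonalize T_def prod.case form_eval_diag defs by simp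
  have nz: "8 * a * A \<noteq> 0" using assms by (simp add: defs)
  show "form_embeds f (diag 1 (minor_12 f) (8 * coeff_11 f * gram_det f)) (16 * coeff_11 f * minor_12 f)"
  proof (rule form_embedsI[of "8 * a * A" _ T _ _ U, OF nz _ UT])
    show "form_eval (diag 1 (minor_12 f) (8 * coeff_11 f * gram_det f)) (T (x, y, z)) = 16 * coeff_11 f * minor_12 f * form_eval f (x, y, z)" for x y z
      using gT by (simp add: a_def A_def)
    show "vdvd m (U (x, y, z))" if "m dvd x" "m dvd y" "m dvd z" for m x y z using that by (simp add: U_def)
  qed
  define M where "M = 16 * a * A"
  have Mnz: "M \<noteq> 0" using assms by (simp add: M_def defs)
  have fU: "M * form_eval f (U (x, y, z)) = (8 * a * A)\<^sup>2 * form_eval (diag 1 A (8 * a * gram_det f)) (x, y, z)" for x y z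
  proof -
    obtain x' y' z' where u: "U (x, y, z) = (x', y', z')" by (metis prod_cases3)
    have "M * form_eval f (U (x, y, z)) = form_eval (diag 1 A (8 * a * gram_det f)) (T (U (x, y, z)))"
      unfolding u gT M_def by simp
    then show ?thesis unfolding TU by (simp add: form_eval_diag power_mult_distrib algebra_simps)
  qed
  show "form_embeds (diag 1 (minor_12 f) (8 * coeff_11 f * gram_det f)) f (16 * coeff_11 f * minor_12 f * (8 * coeff_11 f * minor_12 f)\<^sup>2)"
  proof (rule form_embedsI[of "M * (8 * a * A)" _ "\<lambda>v. smul M (U v)" _ _ T])
    show "M * (8 * a * A) \<noteq> 0" using Mnz nz by simp
    show "form_eval f (smul M (U (x, y, z))) = 16 * coeff_11 f * minor_12 f * (8 * coeff_11 f * minor_12 f)\<^sup>2 * form_eval (diag 1 (minor_12 f) (8 * coeff_11 f * gram_det f)) (x, y, z)" for x y z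
    proof -
      have "form_eval f (smul M (U (x, y, z))) = M * (M * form_eval f (U (x, y, z)))"
        by (simp add: form_eval_smul power2_eq_square)
      then show ?thesis unfolding fU by (simp add: M_def a_def A_def)
    qed
    show "T (smul M (U (x, y, z))) = (M * (8 * a * A) * x, M * (8 * a * A) * y, M * (8 * a * A) * z)" for x y z
    proof -
      have "T (smul M v) = smul M (T v)" for v by (cases v) (simp add: T_def algebra_simps)
      then show ?thesis by (simp add: TU mult.assoc)
    qed
    show "vdvd m (T (x, y, z))" if "m dvd x" "m dvd y" "m dvd z" for m x y z using that by (simp add: T_def)
  qed
qed

lemma embeds_square_2: assumes "s \<noteq> 0"
  shows "form_embeds (diag a (b * s\<^sup>2) c) (diag a b c) 1" "form_embeds (diag a b c) (diag a (b * s\<^sup>2) c) (s\<^sup>2)"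
proof -
  show "form_embeds (diag a (b * s\<^sup>2) c) (diag a b c) 1"
    by (rule form_embedsI[of s _ "\<lambda>(x, y, z). (x, s * y, z)" _ _ "\<lambda>(x, y, z). (s * x, y, s * z)"])
       (use assms in \<open>auto simp: form_eval_diag power_mult_distrib\<close>)
  show "form_embeds (diag a b c) (diag a (b * s\<^sup>2) c) (s\<^sup>2)"
    by (rule form_embedsI[of s _ "\<lambda>(x, y, z). (s * x, y, s * z)" _ _ "\<lambda>(x, y, z). (x, s * y, z)"])
       (use assms in \<open>auto simp: form_eval_diag power_mult_distrib algebra_simps\<close>)
qed

lemma embeds_swap_23: "form_embeds (diag a b c) (diag a c b) 1"
  by (rule form_embedsI[of 1 _ "\<lambda>(x, y, z). (x, z, y)" _ _ "\<lambda>(x, y, z). (x, z, y)"])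
     (auto simp: form_eval_diag)

text \<open>Brahmagupta's identity: multiplying by t + sqrt(-a) scales z^2 + a x^2 by t^2 + a, which
  is b b', and b b' times b y^2 equals b' (b y)^2. So \<open>b\<close> may be replaced by
  \<open>b'\<close> up to a similarity factor.\<close>

lemma embeds_descent:
  assumes "b * b' = t\<^sup>2 + a" "b \<noteq> 0" "b' \<noteq> 0"
  shows "form_embeds (diag 1 a b) (diag 1 a b') (b * b')"
proof (rule form_embedsI[of "b * (t\<^sup>2 + a)" _ "\<lambda>(z, x, y). (z * t - a * x, z + t * x, b * y)" _ _
      "\<lambda>(Z, X, Y). (b * (t * Z + a * X), b * (t * X - Z), (t\<^sup>2 + a) * Y)"])
  show "b * (t\<^sup>2 + a) \<noteq> 0" using assms by (metis mult_eq_0_iff)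
  show "form_eval (diag 1 a b') (case (x, y, z) of (z, x, y) \<Rightarrow> (z * t - a * x, z + t * x, b * y)) = b * b' * form_eval (diag 1 a b) (x, y, z)" for x y z
  proof -
    have "form_eval (diag 1 a b') (x * t - a * y, x + t * y, b * z) = (t\<^sup>2 + a) * (x\<^sup>2 + a * y\<^sup>2) + b' * b * b * z\<^sup>2"
      by (simp add: form_eval_diag power2_eq_square algebra_simps)
    then show ?thesis unfolding assms(1)[symmetric] by (simp add: form_eval_diag algebra_simps)
  qed
qed (auto simp: power2_eq_square algebra_simps)

section \<open>Values of isotropic and of anisotropic forms\<close>

lemma padic_isotropic_good:
  "prime p \<Longrightarrow> \<not> int p dvd gram_det f \<Longrightarrow> padic_isotropic f p"
  unfolding padic_isotropic_def using good_prime_zero_mod_power by blast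

text \<open>An isotropic vector \<open>v\<close> makes \<open>f\<close> affine linear on the lines \<open>p\<^sup>e y + l v\<close>, where \<open>p\<^sup>e\<close> is
  the content of \<open>gradient f v\<close>.\<close>

lemma isotropic_padic_rep:
  assumes p: "prime p" and iso: "padic_isotropic f p" and D: "gram_det f \<noteq> 0"
  obtains K where "\<And>n. int p ^ K dvd n \<Longrightarrow> padic_rep f p n"
proof -
  obtain \<mu> where \<mu>: "\<And>k x. int p ^ (k + \<mu>) dvd gram_det f * x \<Longrightarrow> int p ^ k dvd x"
    using dvd_cancel_bounded[OF p D] by blast
  have p0: "int p > 0" using p by (simp add: prime_gt_0_nat)
  have "padic_rep f p n" if n: "int p ^ (2 * \<mu>) dvd n" for n
    unfolding padic_rep_def
  proof
    fix k
    obtain v where v: "\<not> vdvd (int p) v" "int p ^ k dvd form_eval f v" using iso unfolding padic_isotropic_def by blast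
    have "\<not> vdvd (int p ^ Suc \<mu>) (gradient f v)"
    proof
      assume "vdvd (int p ^ Suc \<mu>) (gradient f v)"
      then have "vdvd (int p ^ (1 + \<mu>)) (smul (gram_det f) v)" using gradient_vdvd by simp
      then have "vdvd (int p ^ 1) v" using \<mu>[of 1] by (rule vdvd_smul_cancel[rotated])
      then show False using v(1) by simp
    qed
    then obtain e where e: "e \<le> \<mu>" "vdvd (int p ^ e) (gradient f v)" "\<not> vdvd (int p ^ Suc e) (gradient f v)"
      by (rule max_power_dividing_vector)
    obtain g where g: "gradient f v = smul (int p ^ e) g" using e(2) unfolding vdvd_iff_smul by blast
    have "\<not> vdvd (int p) g"
    proof
      assume "vdvd (int p) g"
      then have "vdvd (int p ^ Suc e) (gradient f v)" unfolding g by (cases g) (simp add: mult.commute mult_dvd_mono)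
      then show False using e(3) by blast
    qed
    then obtain y where y: "\<not> int p dvd dot3 g y" using not_vdvd_dot3_unit by blast
    have "int p ^ (2 * e) dvd int p ^ (2 * \<mu>)" using e(1) by (intro le_imp_power_dvd) simp
    then have "int p ^ (2 * e) dvd n" using n dvd_trans by blast
    then obtain n' where n': "n = int p ^ (2 * e) * n'" by (auto elim!: dvdE)
    have "coprime (dot3 g y) (int p ^ k)"
      using y p by (metis coprime_commute coprime_power_left_iff prime_imp_coprime prime_nat_int_transfer)
    then obtain l where l: "int p ^ k dvd dot3 g y * l - (n' - form_eval f y)" using exists_inverse_mod by blast
    have "form_eval f (smul l v + smul (int p ^ e) y) - n =
       l\<^sup>2 * form_eval f v + int p ^ (2 * e) * (dot3 g y * l - (n' - form_eval f y))"
    proof -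
      have "gradient f (smul l v) = smul l (gradient f v)" by (cases v) (simp add: algebra_simps)
      moreover have "int p ^ (2 * e) = int p ^ e * int p ^ e" by (simp add: mult_2 power_add)
      ultimately show ?thesis unfolding form_eval_plus form_eval_smul n'
        by (simp add: dot3_smul g power2_eq_square algebra_simps)
    qed
    then have "int p ^ k dvd form_eval f (smul l v + smul (int p ^ e) y) - n" using v(2) l by (metis dvd_add dvd_mult)
    then show "\<exists>w. int p ^ k dvd form_eval f w - n" by blast
  qed
  then show ?thesis by (rule that)
qed

text \<open>Multiplication by the square of a high power of \<open>p\<close> moves any integer into
  the ideal all of whose elements are represented.\<close>

lemma isotropic_padic_rep_rat:
  assumes p: "prime p" and iso: "padic_isotropic f p" and D: "gram_det f \<noteq> 0"
  shows "padic_rep_rat f p n"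
proof -
  obtain K where K: "\<And>n. int p ^ K dvd n \<Longrightarrow> padic_rep f p n" using isotropic_padic_rep[OF assms] by blast
  have "int p ^ K dvd n * (int p ^ K)\<^sup>2" by (simp add: power2_eq_square)
  then have "padic_rep f p (n * (int p ^ K)\<^sup>2)" by (rule K)
  then show ?thesis unfolding padic_rep_rat_def using p by (intro exI[of _ "int p ^ K"]) (simp add: prime_gt_0_nat)
qed

lemma anisotropic_bound:
  assumes "\<not> padic_isotropic f p"
  obtains K where "\<And>w. int p ^ K dvd form_eval f w \<Longrightarrow> vdvd (int p) w"
  using assms unfolding padic_isotropic_def by blast

text \<open>Once the value is divisible by p^K, every representing vector is divisible by
  \<open>p\<close>, and dividing it by \<open>p\<close> divides the value by p^2. This is why far
  from the units an anisotropic form represents the same integers as over the field.\<close>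

lemma anisotropic_descent:
  assumes p: "prime p" and K: "\<And>w. int p ^ K dvd form_eval f w \<Longrightarrow> vdvd (int p) w"
    and n: "int p ^ K dvd n * (int p)\<^sup>2" and rep: "padic_rep f p (n * (int p)\<^sup>2)"
  shows "padic_rep f p n"
  unfolding padic_rep_def
proof
  fix k
  have p0: "int p > 0" using p by (simp add: prime_gt_0_nat)
  obtain w where w: "int p ^ (k + 2 + K) dvd form_eval f w - n * (int p)\<^sup>2" using rep unfolding padic_rep_def by blast
  have "int p ^ K dvd int p ^ (k + 2 + K)" by (rule le_imp_power_dvd) simp
  then have "int p ^ K dvd form_eval f w - n * (int p)\<^sup>2" using w dvd_trans by blast
  then have "int p ^ K dvd form_eval f w" using n by (metis diff_add_cancel dvd_add)
  then obtain u where u: "w = smul (int p) u" using K unfolding vdvd_iff_smul by blast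
  have "int p ^ (k + 2) dvd int p ^ (k + 2 + K)" by (rule le_imp_power_dvd) simp
  then have "int p ^ (k + 2) dvd form_eval f w - n * (int p)\<^sup>2" using w dvd_trans by blast
  moreover have "form_eval f w - n * (int p)\<^sup>2 = (int p)\<^sup>2 * (form_eval f u - n)" by (simp add: u form_eval_smul algebra_simps)
  moreover have "int p ^ (k + 2) = (int p)\<^sup>2 * int p ^ k" by (simp add: power2_eq_square)
  ultimately have "(int p)\<^sup>2 * int p ^ k dvd (int p)\<^sup>2 * (form_eval f u - n)" by (simp only:)
  then have "int p ^ k dvd form_eval f u - n" using p0 by simp
  then show "\<exists>w. int p ^ k dvd form_eval f w - n" by blast
qed

lemma padic_rep_coprime_square:
  assumes p: "prime p" and r: "\<not> int p dvd r" and rep: "padic_rep f p (n * r\<^sup>2)"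
  shows "padic_rep f p n"
  unfolding padic_rep_def
proof
  fix k
  have "coprime r (int p ^ k)" using r p by (metis coprime_commute coprime_power_left_iff prime_imp_coprime prime_nat_int_transfer)
  then obtain t where "int p ^ k dvd r * t - 1" using exists_inverse_mod by blast
  then obtain c where c: "r * t = 1 + int p ^ k * c" by (metis dvdE diff_add_cancel add.commute)
  obtain w where "int p ^ k dvd form_eval f w - n * r\<^sup>2" using rep unfolding padic_rep_def by blast
  then have "int p ^ k dvd t\<^sup>2 * (form_eval f w - n * r\<^sup>2)" by simp
  moreover have "form_eval f (smul t w) - n = t\<^sup>2 * (form_eval f w - n * r\<^sup>2) + n * ((r * t)\<^sup>2 - 1)"
    by (simp add: form_eval_smul power2_eq_square algebra_simps)
  moreover have "(r * t)\<^sup>2 - 1 = int p ^ k * (2 * c + int p ^ k * c\<^sup>2)" unfolding c by (simp add: power2_eq_square algebra_simps)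
  then have "int p ^ k dvd (r * t)\<^sup>2 - 1" by (metis dvd_triv_left)
  ultimately have "int p ^ k dvd form_eval f (smul t w) - n" by (simp add: dvd_add)
  then show "\<exists>w. int p ^ k dvd form_eval f w - n" by blast
qed

lemma padic_rep_rat_prime_power:
  assumes p: "prime p" and "padic_rep_rat f p n"
  obtains m where "padic_rep f p (n * (int p ^ m)\<^sup>2)"
proof -
  obtain s where s: "s \<noteq> 0" "padic_rep f p (n * s\<^sup>2)" using assms(2) unfolding padic_rep_rat_def by blast
  obtain m r where m: "s = int p ^ m * r" "\<not> int p dvd r" using prime_power_split[OF p s(1)] by blast
  have "padic_rep f p (n * (int p ^ m)\<^sup>2 * r\<^sup>2)" using s(2) by (simp add: m(1) power_mult_distrib mult_ac)
  then show ?thesis using padic_rep_coprime_square[OF p m(2)] that by blast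
qed

lemma anisotropic_rep_iff_rat:
  assumes p: "prime p" and K: "\<And>w. int p ^ K dvd form_eval f w \<Longrightarrow> vdvd (int p) w"
    and n: "int p ^ K dvd n"
  shows "padic_rep f p n \<longleftrightarrow> padic_rep_rat f p n"
proof
  assume "padic_rep_rat f p n"
  then obtain m where m: "padic_rep f p (n * (int p ^ m)\<^sup>2)" using padic_rep_rat_prime_power[OF p] by blast
  show "padic_rep f p n" using m
  proof (induction m)
    case 0 then show ?case by simp
  next
    case (Suc m)
    have "n * (int p ^ Suc m)\<^sup>2 = n * (int p ^ m)\<^sup>2 * (int p)\<^sup>2" by (simp add: power_mult_distrib mult_ac)
    then have "padic_rep f p (n * (int p ^ m)\<^sup>2 * (int p)\<^sup>2)" using Suc(2) by (simp only:)
    moreover have "int p ^ K dvd n * (int p ^ m)\<^sup>2 * (int p)\<^sup>2" using n by (simp add: dvd_mult2)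
    ultimately have "padic_rep f p (n * (int p ^ m)\<^sup>2)" using anisotropic_descent[OF p K] by blast
    then show ?case by (rule Suc(1))
  qed
qed (rule padic_rep_imp_rat)

section \<open>Existence of an anisotropic prime\<close>

text \<open>Stands for a similarity over the rationals with multiplier \<open>M\<close>, recorded
  through its two local consequences: isotropy is shared, and the represented square classes
  correspond under multiplication by \<open>M\<close>.\<close>

definition rat_similar :: "ternary_form \<Rightarrow> ternary_form \<Rightarrow> int \<Rightarrow> bool" where
  "rat_similar f g M \<longleftrightarrow> M \<noteq> 0 \<and> (\<forall>p. prime p \<longrightarrow> (padic_isotropic f p \<longleftrightarrow> padic_isotropic g p)
     \<and> (\<forall>n. padic_rep_rat f p n \<longleftrightarrow> padic_rep_rat g p (M * n)))"

text \<open>Going forth and back multiplies values by \<open>M * M'\<close>; being a nonzero square,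
  this factor does not affect representability over the p-adic field.\<close>

lemma rat_similarI:
  assumes "form_embeds f g M" "form_embeds g f M'" "M * M' = r\<^sup>2" "r \<noteq> 0"
  shows "rat_similar f g M"
  unfolding rat_similar_def
proof (intro conjI allI impI)
  show "M \<noteq> 0" using assms(3,4) by auto
  fix p :: nat assume p: "prime p"
  show "padic_isotropic f p \<longleftrightarrow> padic_isotropic g p"
    using padic_isotropic_embeds[OF p assms(1)] padic_isotropic_embeds[OF p assms(2)] by blast
  fix n
  show "padic_rep_rat f p n \<longleftrightarrow> padic_rep_rat g p (M * n)"
  proof
    assume "padic_rep_rat g p (M * n)"
    then have "padic_rep_rat f p (M' * (M * n))" by (rule padic_rep_rat_embeds[OF assms(2)])
    moreover have "M' * (M * n) = n * r\<^sup>2" by (simp add: assms(3)[symmetric] mult_ac)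
    ultimately show "padic_rep_rat f p n" using padic_rep_rat_square_iff[OF assms(4)] by simp
  qed (rule padic_rep_rat_embeds[OF assms(1)])
qed

lemma rat_similar_trans:
  assumes "rat_similar f g M" "rat_similar g h N" shows "rat_similar f h (N * M)"
  using assms unfolding rat_similar_def by (simp add: mult.assoc)

lemma squarefree_decomposition:
  fixes n :: int assumes "n > 0"
  obtains m s where "n = m * s\<^sup>2" "m > 0" "s > 0" "squarefree m"
proof -
  have "\<exists>m s. n = m * s\<^sup>2 \<and> m > 0 \<and> s > 0 \<and> squarefree m"
    using assms
  proof (induction "nat n" arbitrary: n rule: less_induct)
    case less
    show ?case
    proof (cases "squarefree n")
      case True then show ?thesis using less(2) by (intro exI[of _ n] exI[of _ 1]) simp
    next
      case False
      then obtain x where x: "x\<^sup>2 dvd n" "\<not> x dvd 1" by (rule not_squarefreeE)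
      then obtain k where k: "n = x\<^sup>2 * k" by (auto elim!: dvdE)
      have x0: "x \<noteq> 0" using k less(2) by auto
      have k0: "k > 0" using k less(2) x0 by (simp add: zero_less_mult_iff)
      have "\<bar>x\<bar> \<ge> 2" using x(2) x0 by (simp add: zdvd1_eq)
      then have "\<bar>x\<bar>\<^sup>2 \<ge> 2\<^sup>2" by (intro power_mono) auto
      then have "x\<^sup>2 \<ge> 4" by simp
      then have "4 * k \<le> x\<^sup>2 * k" using k0 by (intro mult_right_mono) auto
      then have "nat k < nat n" using k k0 by linarith
      then obtain m s where ms: "k = m * s\<^sup>2" "m > 0" "s > 0" "squarefree m" using less(1)[of k] k0 by blast
      then have "n = m * (\<bar>x\<bar> * s)\<^sup>2" using k by (simp add: power_mult_distrib)
      moreover have "\<bar>x\<bar> * s > 0" using x0 ms by simp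
      ultimately show ?thesis using ms by blast
    qed
  qed
  then show ?thesis using that by blast
qed

lemma diagonal_normal_form:
  assumes "positive_definite f"
  obtains A B M where "A > 0" "B > 0" "squarefree A" "squarefree B" "rat_similar f (diag 1 A B) M"
proof -
  note pos = positive_definite_minors[OF assms]
  define A0 B0 where "A0 = minor_12 f" and "B0 = 8 * coeff_11 f * gram_det f"
  have A0: "A0 > 0" "B0 > 0" using pos by (auto simp: A0_def B0_def)
  obtain A s where A: "A0 = A * s\<^sup>2" "A > 0" "s > 0" "squarefree A" using squarefree_decomposition[OF A0(1)] by blast
  obtain B t where B: "B0 = B * t\<^sup>2" "B > 0" "t > 0" "squarefree B" using squarefree_decomposition[OF A0(2)] by blast
  define M where "M = 16 * coeff_11 f * minor_12 f"
  define d where "d = 8 * coeff_11 f * minor_12 f"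
  have 1: "rat_similar f (diag 1 A0 B0) M"
  proof (rule rat_similarI[of _ _ _ "M * d\<^sup>2" "M * d"])
    show "form_embeds f (diag 1 A0 B0) M" "form_embeds (diag 1 A0 B0) f (M * d\<^sup>2)"
      unfolding A0_def B0_def M_def d_def using embeds_diagonal[of f] pos by auto
    show "M * (M * d\<^sup>2) = (M * d)\<^sup>2" by (simp add: power2_eq_square)
    show "M * d \<noteq> 0" using pos by (simp add: M_def d_def)
  qed
  have 2: "rat_similar (diag 1 A0 B0) (diag 1 A B0) 1"
    unfolding A(1) by (rule rat_similarI[OF embeds_square_2(1) embeds_square_2(2), where r=s]) (use A in auto)
  have sw: "rat_similar (diag 1 a b) (diag 1 b a) 1" for a b
    by (rule rat_similarI[OF embeds_swap_23 embeds_swap_23, where r=1]) auto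
  have 3: "rat_similar (diag 1 B0 A) (diag 1 B A) 1"
    unfolding B(1) by (rule rat_similarI[OF embeds_square_2(1) embeds_square_2(2), where r=t]) (use B in auto)
  have "rat_similar f (diag 1 A B) (1 * (1 * (1 * (1 * M))))"
    by (rule rat_similar_trans[OF rat_similar_trans[OF rat_similar_trans[OF rat_similar_trans[OF 1 2] sw] 3] sw])
  then show ?thesis using that A B by blast
qed

section \<open>Legendre's descent\<close>

lemma sqrt_mod_prime_product:
  fixes P :: "nat set" and A :: int
  assumes "finite P" "\<And>p. p \<in> P \<Longrightarrow> prime p" "\<And>p. p \<in> P \<Longrightarrow> \<exists>t. int p dvd t\<^sup>2 + A"
  shows "\<exists>t. int (\<Prod>P) dvd t\<^sup>2 + A"
  using assms
proof (induction P rule: finite_induct)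
  case empty then show ?case by simp
next
  case (insert p P)
  obtain t1 where t1: "int (\<Prod>P) dvd t1\<^sup>2 + A" using insert by auto
  obtain t2 where t2: "int p dvd t2\<^sup>2 + A" using insert by auto
  have cop: "coprime (int p) (int (\<Prod>P))"
    unfolding coprime_int_iff using insert by (intro prod_coprime_right) (metis insertCI primes_coprime)
  obtain t where t: "[t = t2] (mod int p)" "[t = t1] (mod int (\<Prod>P))" using binary_chinese_remainder_int[OF cop] by blast
  have "int p dvd t\<^sup>2 + A" "int (\<Prod>P) dvd t\<^sup>2 + A"
    using t1 t2 cong_add[OF cong_pow[OF t(1), of 2] cong_refl[of A]] cong_add[OF cong_pow[OF t(2), of 2] cong_refl[of A]]
    by (meson cong_dvd_iff dvd_refl cong_sym)+
  then have "int p * int (\<Prod>P) dvd t\<^sup>2 + A" using cop by (rule divides_mult)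
  then show ?case using insert(1,2) by auto
qed

text \<open>A primitive zero modulo p^2 is enough. If \<open>p\<close> divided x, it would divide z,
  so p^2 would divide B y^2; as \<open>p\<close> divides \<open>B\<close> exactly once, it would
  divide y too. Hence x is a unit and -A is the square of z/x modulo \<open>p\<close>.\<close>

lemma isotropic_imp_square_mod:
  fixes A B :: int
  assumes p: "prime p" and iso: "padic_isotropic (diag 1 A B) p" and B: "int p dvd B" "squarefree B"
  shows "\<exists>t. int p dvd t\<^sup>2 + A"
proof -
  have pp: "prime (int p)" using p by simp
  obtain w where w: "\<not> vdvd (int p) w" "int p ^ 2 dvd form_eval (diag 1 A B) w" using iso unfolding padic_isotropic_def by blast
  obtain z x y where wz: "w = (z, x, y)" by (metis prod_cases3)
  have d2: "(int p)\<^sup>2 dvd z\<^sup>2 + A * x\<^sup>2 + B * y\<^sup>2" using w(2) by (simp add: wz form_eval_diag)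
  have "int p dvd (int p)\<^sup>2" by (simp add: power2_eq_square)
  then have "int p dvd z\<^sup>2 + A * x\<^sup>2 + B * y\<^sup>2" using d2 dvd_trans by blast
  then have d: "int p dvd z\<^sup>2 + A * x\<^sup>2" using B(1) by (metis dvd_add_left_iff dvd_mult2)
  have "\<not> int p dvd x"
  proof
    assume x: "int p dvd x"
    then have "int p dvd z\<^sup>2" using d by (metis dvd_add_left_iff dvd_mult power2_eq_square)
    then have z: "int p dvd z" using pp prime_dvd_power by blast
    have "(int p)\<^sup>2 dvd z\<^sup>2 + A * x\<^sup>2" using x z by (simp add: dvd_add dvd_mult dvd_power_same)
    then have By: "(int p)\<^sup>2 dvd B * y\<^sup>2" using d2 by (metis dvd_add_right_iff)
    obtain b where b: "B = int p * b" using B(1) by (auto elim!: dvdE)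
    have "\<not> int p dvd b"
    proof
      assume "int p dvd b"
      then have "(int p)\<^sup>2 dvd B" unfolding b power2_eq_square by (simp add: mult_dvd_mono)
      then have "is_unit (int p)" using B(2) squarefreeD by blast
      then show False using pp by (simp add: not_prime_unit)
    qed
    have "int p * int p dvd int p * (b * y\<^sup>2)" using By by (simp add: b power2_eq_square mult.assoc)
    then have "int p dvd b * y\<^sup>2" using p by (simp add: prime_gt_0_nat)
    then have "int p dvd y" using pp \<open>\<not> int p dvd b\<close> by (simp add: prime_dvd_mult_iff prime_dvd_power_iff)
    then show False using w(1) x z by (simp add: wz)
  qed
  then have "coprime x (int p)" using pp by (metis coprime_commute prime_imp_coprime)
  then obtain u where u: "int p dvd x * u - 1" using exists_inverse_mod by blast
  have "(z * u)\<^sup>2 + A = u\<^sup>2 * (z\<^sup>2 + A * x\<^sup>2) - A * (x * u + 1) * (x * u - 1)"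
    by (simp add: power2_eq_square algebra_simps)
  then have "int p dvd (z * u)\<^sup>2 + A" using d u by (metis dvd_diff dvd_mult)
  then show ?thesis by blast
qed

lemma prime_factors_squarefree_int:
  fixes B :: int assumes "B > 0" "squarefree B"
  shows "int (\<Prod>{p. prime p \<and> int p dvd B}) = B"
proof -
  define b where "b = nat B"
  have b: "B = int b" "b > 0" using assms by (auto simp: b_def)
  have "\<not> p\<^sup>2 dvd b" if "prime p" for p
  proof
    assume "p\<^sup>2 dvd b"
    then have "(int p)\<^sup>2 dvd B" unfolding b(1) by (metis int_dvd_int_iff of_nat_power)
    then have "int p dvd 1" using assms(2) squarefreeD by blast
    then show False using that by simp
  qed
  then have sf: "squarefree b" using b(2) by (simp add: squarefree_factorial_semiring)
  have "{p. prime p \<and> int p dvd B} = prime_factors b" using b by (auto simp: prime_factors_dvd)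
  moreover have "(\<Prod>p\<in>prime_factors b. p ^ multiplicity p b) = b" using b(2) by (simp add: prime_factorization_nat[symmetric])
  moreover have "(\<Prod>p\<in>prime_factors b. p ^ multiplicity p b) = \<Prod>(prime_factors b)"
  proof (rule prod.cong[OF refl])
    fix p assume p: "p \<in> prime_factors b"
    have "multiplicity p b = 1"
      using sf p b(2) by (simp add: squarefree_factorial_semiring')
    then show "p ^ multiplicity p b = p" by simp
  qed
  ultimately show ?thesis using b by simp
qed

text \<open>Isotropy at the primes dividing the larger coefficient makes minus the smaller one a
  square modulo it, and \<open>embeds_descent\<close> exchanges the larger coefficient for a smaller
  one. Positivity keeps the new coefficient positive, so the descent can stop only at 1, 1,
  1.\<close>

theorem exists_anisotropic_diag:
  fixes A B :: int
  assumes "A > 0" "B > 0"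
  shows "\<exists>p. prime p \<and> \<not> padic_isotropic (diag 1 A B) p"
  using assms
proof (induction "nat (A + B)" arbitrary: A B rule: less_induct)
  case less
  have main: "\<exists>p. prime p \<and> \<not> padic_isotropic (diag 1 a b) p"
    if ab: "a > 0" "b > 0" "a \<le> b" "nat (a + b) = nat (A + B)" for a b
  proof (rule ccontr)
    assume "\<not> (\<exists>p. prime p \<and> \<not> padic_isotropic (diag 1 a b) p)"
    then have iso: "padic_isotropic (diag 1 a b) p" if "prime p" for p using that by blast
    have IH: False if "form_embeds (diag 1 a b) (diag 1 a' b') M" "a' > 0" "b' > 0" "a' + b' < a + b" for a' b' M
    proof -
      have "nat (a' + b') < nat (A + B)" using that ab by linarith
      from less(1)[OF this that(2,3)]
      obtain p where "prime p" "\<not> padic_isotropic (diag 1 a' b') p" by blast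
      then show False using padic_isotropic_embeds[OF _ that(1)] iso by blast
    qed
    obtain b0 s where b0: "b = b0 * s\<^sup>2" "b0 > 0" "s > 0" "squarefree b0" using squarefree_decomposition[OF ab(2)] by blast
    \<comment> \<open>A square factor of \<open>b\<close> could be removed by a similarity, lowering
      the sum of the coefficients.\<close>
    have sfb: "squarefree b"
    proof (rule ccontr)
      assume "\<not> squarefree b"
      then have "s \<noteq> 1" using b0 by auto
      then have "s\<^sup>2 > 1" using b0(3) by (simp add: one_less_power)
      then have lt: "b0 < b" using b0 by simp
      have emb: "form_embeds (diag 1 b a) (diag 1 b0 a) 1" unfolding b0(1) by (rule embeds_square_2) (use b0 in simp)
      have "nat (b0 + a) < nat (A + B)" using lt ab b0(2) by linarith
      from less(1)[OF this b0(2) ab(1)]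
      obtain p where p: "prime p" "\<not> padic_isotropic (diag 1 b0 a) p" by blast
      have "padic_isotropic (diag 1 b a) p" using padic_isotropic_embeds[OF p(1) embeds_swap_23] iso[OF p(1)] by blast
      then show False using padic_isotropic_embeds[OF p(1) emb] p(2) by blast
    qed
    show False
    proof (cases "b = 1")
      case True
      then have a1: "a = 1" using ab by simp
      \<comment> \<open>A sum of three squares is divisible by 4 only if all three are even, so
        there is no primitive zero modulo 4.\<close>
      have "padic_isotropic (diag 1 1 1) 2" using iso[of 2] True a1 by simp
      from this[unfolded padic_isotropic_def, rule_format, of 2]
      obtain w where w: "\<not> vdvd (int 2) w" "int 2 ^ 2 dvd form_eval (diag 1 1 1) w" by blast
      obtain x y z where wx: "w = (x, y, z)" by (metis prod_cases3)
      have 4: "4 dvd x\<^sup>2 + y\<^sup>2 + z\<^sup>2" using w(2) by (simp add: wx form_eval_diag)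
      have sq: "u\<^sup>2 mod 4 = (if even u then 0 else 1)" for u :: int
      proof (cases "even u")
        case True then obtain k where "u = 2 * k" by blast
        then show ?thesis by (simp add: power_mult_distrib)
      next
        case False then obtain k where "u = 2 * k + 1" using oddE by blast
        then have "u\<^sup>2 = 4 * (k\<^sup>2 + k) + 1" by (simp add: power2_eq_square algebra_simps)
        then obtain m where "u\<^sup>2 = 4 * m + 1" by blast
        then show ?thesis using False by simp
      qed
      have "x\<^sup>2 mod 4 + y\<^sup>2 mod 4 + z\<^sup>2 mod 4 = (x\<^sup>2 + y\<^sup>2 + z\<^sup>2) - 4 * (x\<^sup>2 div 4 + y\<^sup>2 div 4 + z\<^sup>2 div 4)"
        by (simp only: minus_mult_div_eq_mod[symmetric] distrib_left)
      then have "4 dvd x\<^sup>2 mod 4 + y\<^sup>2 mod 4 + z\<^sup>2 mod 4" using 4 by simp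
      then have "even x" "even y" "even z" unfolding sq by (auto split: if_splits)
      then show False using w(1) by (simp add: wx)
    next
      case False
      then have b2: "b \<ge> 2" using ab by simp
      define P where "P = {p. prime p \<and> int p dvd b}"
      have fP: "finite P"
      proof (rule finite_subset)
        show "P \<subseteq> {..nat b}"
        proof
          fix p assume "p \<in> P"
          then have "int p \<le> b" using ab by (intro zdvd_imp_le) (auto simp: P_def)
          then show "p \<in> {..nat b}" by simp
        qed
      qed simp
      have "\<exists>t. int (\<Prod>P) dvd t\<^sup>2 + a"
      proof (rule sqrt_mod_prime_product[OF fP])
        fix p assume "p \<in> P"
        then have q: "prime p" "int p dvd b" by (auto simp: P_def)
        then show "prime p" "\<exists>t. int p dvd t\<^sup>2 + a" using isotropic_imp_square_mod[OF q(1) iso[OF q(1)] q(2) sfb] by blast+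
      qed
      then obtain t0 where t0: "b dvd t0\<^sup>2 + a" using prime_factors_squarefree_int[OF ab(2) sfb] by (auto simp: P_def)
      \<comment> \<open>The root of least absolute value, so that |t| \<le> b/2.\<close>
      define t where "t = (if 2 * (t0 mod b) \<le> b then t0 mod b else t0 mod b - b)"
      have "0 \<le> t0 mod b" "t0 mod b < b" using ab(2) by simp_all
      then have tb: "2 * \<bar>t\<bar> \<le> b" unfolding t_def by (auto simp: abs_if)
      have "b dvd t - t0"
      proof -
        have "b dvd (t0 mod b) - t0" by (metis dvd_minus_iff minus_diff_eq dvd_minus_mod)
        then have "b dvd (t0 mod b) - t0" "b dvd ((t0 mod b) - t0) - b" by (auto intro: dvd_diff)
        moreover have "((t0 mod b) - t0) - b = ((t0 mod b) - b) - t0" by simp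
        ultimately show ?thesis unfolding t_def by (metis (full_types))
      qed
      then have "b dvd (t - t0) * (t + t0)" by simp
      then have "b dvd (t - t0) * (t + t0) + (t0\<^sup>2 + a)" using t0 by (rule dvd_add)
      then have "b dvd t\<^sup>2 + a" by (simp add: power2_eq_square algebra_simps)
      then obtain b' where b': "t\<^sup>2 + a = b * b'" by (auto elim!: dvdE)
      have "b * b' > 0" using ab(1) b' by (metis add_nonneg_pos zero_le_power2)
      then have b'0: "b' > 0" using ab(2) by (simp add: zero_less_mult_iff)
      \<comment> \<open>From b b' = t^2 + a with |t| \<le> b/2 and a \<le> b one gets 4 b' \<le> b +
        4, which is less than 4b as soon as b \<ge> 2.\<close>
      have "b' < b"
      proof -
        have "(2 * \<bar>t\<bar>)\<^sup>2 \<le> b\<^sup>2" using tb by (intro power_mono) auto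
        then have "4 * t\<^sup>2 \<le> b\<^sup>2" by (simp add: power_mult_distrib)
        then have "4 * (b * b') \<le> b\<^sup>2 + 4 * b" using b' ab(3) by linarith
        then have "b * (4 * b') \<le> b * (b + 4)" by (simp add: power2_eq_square algebra_simps)
        then have "4 * b' \<le> b + 4" using ab(2) by simp
        then show ?thesis using b2 by linarith
      qed
      moreover have "form_embeds (diag 1 a b) (diag 1 a b') (b * b')"
        by (rule embeds_descent[OF b'[symmetric]]) (use ab b'0 in auto)
      ultimately show False using IH[of a b'] ab b'0 by auto
    qed
  qed
  show ?case
  proof (cases "A \<le> B")
    case True then show ?thesis using main[of A B] less by blast
  next
    case False
    then obtain p where p: "prime p" "\<not> padic_isotropic (diag 1 B A) p" using main[of B A] less by (auto simp: add.commute)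
    then show ?thesis using padic_isotropic_embeds[OF p(1) embeds_swap_23] by blast
  qed
qed

corollary exists_anisotropic_prime:
  assumes "positive_definite f" shows "\<exists>p. prime p \<and> \<not> padic_isotropic f p"
proof -
  obtain A B M where "A > 0" "B > 0" and s: "rat_similar f (diag 1 A B) M" using diagonal_normal_form[OF assms] by blast
  then obtain p where "prime p" "\<not> padic_isotropic (diag 1 A B) p" using exists_anisotropic_diag by blast
  then show ?thesis using s unfolding rat_similar_def by blast
qed

section \<open>Local densities at odd primes\<close>

text \<open>Says that \<open>x\<close> is a nonzero rational of 2-adic valuation -i. The natural
  index builds in that the valuation is not positive, which is what makes a product of such numbers
  controllable.\<close>

definition dyadic_order :: "nat \<Rightarrow> real \<Rightarrow> bool" where
  "dyadic_order i x \<longleftrightarrow> (\<exists>a b :: int. odd a \<and> odd b \<and> x = of_int a / (2 ^ i * of_int b))"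

lemma density_sum_integral:
  fixes p :: nat
  assumes "p > 0"
  obtains I :: int where "(\<Sum>j<K. real (c j) / real p ^ (j + 1)) = of_int I / real p ^ K"
    "(\<forall>j<K. even (c j)) \<longrightarrow> even I"
proof -
  define I where "I = (\<Sum>j<K. int (c j) * int p ^ (K - (j + 1)))"
  have "(\<Sum>j<K. real (c j) / real p ^ (j + 1)) = (\<Sum>j<K. (real (c j) * real p ^ (K - (j + 1))) / real p ^ K)"
  proof (rule sum.cong[OF refl])
    fix j assume "j \<in> {..<K}"
    then have "K = (j + 1) + (K - (j + 1))" by simp
    then have "real p ^ K = real p ^ (j + 1) * real p ^ (K - (j + 1))" by (metis power_add)
    then show "real (c j) / real p ^ (j + 1) = real (c j) * real p ^ (K - (j + 1)) / real p ^ K" using assms by simp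
  qed
  also have "\<dots> = of_int I / real p ^ K" by (simp add: I_def sum_divide_distrib)
  finally have "(\<Sum>j<K. real (c j) / real p ^ (j + 1)) = of_int I / real p ^ K" .
  moreover have "even I" if "\<forall>j<K. even (c j)" unfolding I_def using that by (intro dvd_sum) auto
  ultimately show ?thesis using that by blast
qed

lemma odd_prime_not_2: "prime p \<Longrightarrow> odd p \<Longrightarrow> p \<noteq> 2" by auto

lemma unit_exp_odd: "odd p \<Longrightarrow> unit_exp p = 1" by (auto simp: unit_exp_def)

section \<open>Isotropic forms at primes congruent to 1 modulo 4\<close>

lemma sqrt_minus_one_mod:
  fixes p :: nat
  assumes p: "prime p" "[p = 1] (mod 4)"
  shows "\<exists>s. int p dvd s\<^sup>2 + 1"
proof -
  have p1: "p mod 4 = 1" using p(2) by (simp add: cong_iff)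
  have p2: "p > 2" using p1 p(1) prime_ge_2_nat[of p] by (metis le_neq_implies_less mod_less numeral_eq_one_iff numeral_less_iff semiring_norm(76) semiring_norm(85) semiring_norm(78))
  have "even ((p - 1) div 2)" using p1 by presburger
  moreover have "nat ((int p - 1) div 2) = (p - 1) div 2" using p2 by (simp add: nat_div_distrib nat_diff_distrib)
  ultimately have e: "(-1::int) ^ nat ((int p - 1) div 2) = 1" by simp
  have "[Legendre (-1) (int p) = (-1) ^ ((p - 1) div 2)] (mod int p)"
    using euler_criterion[of p "-1"] p p2 by simp
  then have L: "[Legendre (-1) (int p) = 1] (mod int p)" using \<open>even ((p - 1) div 2)\<close> by simp
  have "QuadRes (int p) (-1)"
  proof (rule ccontr)
    assume nq: "\<not> QuadRes (int p) (-1)"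
    have "\<not> [-1 = 0] (mod int p)" using p2 by (simp add: cong_iff_dvd_diff) 
    then have "Legendre (-1) (int p) = -1" using nq by (simp add: Legendre_def)
    then have "int p dvd 2" using L by (simp add: cong_iff_dvd_diff)
    then show False using p2 zdvd_imp_le[of "int p" 2] by simp
  qed
  then obtain y where "[y\<^sup>2 = -1] (mod int p)" unfolding QuadRes_def by blast
  then have "int p dvd y\<^sup>2 + 1" by (simp add: cong_iff_dvd_diff)
  then show ?thesis by blast
qed

lemma card_units_mod_prime:
  fixes p :: nat assumes "prime p"
  shows "card {u\<in>{0..<int p ^ 1}. \<not> int p dvd u \<and> True} = p - 1"
proof -
  have "{u\<in>{0..<int p ^ 1}. \<not> int p dvd u \<and> True} = {1..<int p}"
    by (auto simp: zdvd_not_zless) (metis dvd_0_right less_le not_less zle_diff1_eq int_one_le_iff_zero_less)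
  then show ?thesis by simp
qed

text \<open>From level \<open>K\<close> on everything is represented and the geometric tail is
  exactly 1/p^K. The earlier levels contain even numbers of unit classes, so over the denominator
  p^K they give an even numerator, and the tail makes it odd.\<close>

theorem local_density_isotropic_1_mod_4:
  assumes p: "prime p" "[p = 1] (mod 4)" and iso: "padic_isotropic f p" and D: "gram_det f \<noteq> 0"
  shows "dyadic_order 0 (local_density f p)"
proof -
  have p1: "p mod 4 = 1" using p(2) by (simp add: cong_iff)
  then have odd: "odd p" by presburger
  have e: "unit_exp p = 1" using odd by (rule unit_exp_odd)
  have p0: "real p > 1" using p prime_gt_1_nat by simp
  obtain K where K: "\<And>n. int p ^ K dvd n \<Longrightarrow> padic_rep f p n" using isotropic_padic_rep[OF p(1) iso D] by blast
  let ?A = "padic_rep f p"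
  obtain s where s: "int p dvd s\<^sup>2 + 1" using sqrt_minus_one_mod[OF p] by blast
  have all: "unit_count ?A p j = p - 1" if "j \<ge> K" for j
  proof -
    have "?A (int p ^ j * u)" for u using that by (intro K dvd_mult2 le_imp_power_dvd)
    then show ?thesis unfolding unit_count_def e using card_units_mod_prime[OF p(1)] by simp
  qed
  have ev: "even (unit_count ?A p j)" for j
  proof -
    define S where "S = {u\<in>{0..<int p}. \<not> int p dvd u \<and> ?A (int p ^ j * u)}"
    have fS: "finite S" unfolding S_def by (rule finite_subset[of _ "{0..<int p}"]) auto
    have refl: "int p - u \<in> S" if u: "u \<in> S" for u
    proof -
      have u': "0 \<le> u" "u < int p" "\<not> int p dvd u" "?A (int p ^ j * u)" using u by (auto simp: S_def)
      have u0: "u \<noteq> 0" using u'(3) by auto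
      have ns: "\<not> int p dvd s"
      proof
        assume "int p dvd s"
        then have "int p dvd s\<^sup>2" by (simp add: power2_eq_square)
        then have "int p dvd 1" using s by (metis dvd_add_right_iff)
        then show False using p(1) by simp
      qed
      have "?A (int p ^ j * u * s\<^sup>2)" using u'(4) by (rule padic_rep_scale)
      then have "?A (int p ^ j * (u * s\<^sup>2))" by (simp add: mult.assoc)
      moreover have "\<not> int p dvd u * s\<^sup>2" using u'(3) ns p(1) by (simp add: prime_dvd_mult_iff prime_dvd_power_iff)
      moreover have "int p ^ unit_exp p dvd u * s\<^sup>2 - (int p - u)"
      proof -
        have "u * s\<^sup>2 - (int p - u) = u * (s\<^sup>2 + 1) - int p" by (simp add: algebra_simps)
        moreover have "int p dvd u * (s\<^sup>2 + 1) - int p" using s by (simp add: dvd_diff dvd_mult)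
        ultimately show ?thesis by (simp only: e power_one_right)
      qed
      ultimately have "?A (int p ^ j * (int p - u))"
        using padic_rep_square_class[OF p(1), of "u * s\<^sup>2" "int p - u" f "int p ^ j"] by blast
      moreover have "\<not> int p dvd int p - u" using u'(3) by (simp add: dvd_diff_right_iff)
      ultimately show ?thesis using u' u0 by (simp add: S_def)
    qed
    \<comment> \<open>The reflection u to p - u interchanges the halves below and above p/2, and
      \<open>p\<close> being odd it has no fixed point.\<close>
    define S1 S2 where "S1 = {u\<in>S. 2 * u < int p}" and "S2 = {u\<in>S. 2 * u > int p}"
    have "S = S1 \<union> S2"
    proof -
      have "2 * u \<noteq> int p" for u using odd by (metis dvd_triv_left even_of_nat)
      then show ?thesis unfolding S1_def S2_def by (auto simp: neq_iff)
    qed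
    moreover have "S1 \<inter> S2 = {}" by (auto simp: S1_def S2_def)
    moreover have "card S2 = card S1"
    proof (rule bij_betw_same_card[symmetric])
      show "bij_betw (\<lambda>u. int p - u) S1 S2"
        by (rule bij_betw_byWitness[of _ "\<lambda>u. int p - u"]) (use refl in \<open>auto simp: S1_def S2_def\<close>)
    qed
    ultimately have "card S = 2 * card S1" using fS by (simp add: card_Un_disjoint)
    then show ?thesis unfolding unit_count_def e S_def by simp
  qed
  have "local_density f p = (\<Sum>j<K. real (unit_count ?A p j) / real p ^ (j + unit_exp p))
     + (real (unit_count ?A p K) / real p ^ (K + unit_exp p) + real (unit_count ?A p (K + 1)) / real p ^ (K + 1 + unit_exp p)) / (1 - 1 / (real p)\<^sup>2)"
  proof (rule square_class_density[OF p(1) square_class_closed_padic_rep[OF p(1)] padic_rep_density[OF p(1)]])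
    fix n assume n: "int p ^ (K + 2) dvd n"
    then obtain c where c: "n = int p ^ (K + 2) * c" by (auto elim!: dvdE)
    have "n div (int p)\<^sup>2 = int p ^ K * c"
    proof -
      have "n = (int p)\<^sup>2 * (int p ^ K * c)" by (simp add: c power2_eq_square mult_ac)
      then show ?thesis using p0 by simp
    qed
    then have "?A (n div (int p)\<^sup>2)" by (intro K) simp
    moreover have "int p ^ K dvd n" unfolding c by (intro dvd_mult2 le_imp_power_dvd) simp
    then have "?A n" by (rule K)
    ultimately show "?A n \<longleftrightarrow> ?A (n div (int p)\<^sup>2)" by blast
  qed
  also have "(real (unit_count ?A p K) / real p ^ (K + unit_exp p) + real (unit_count ?A p (K + 1)) / real p ^ (K + 1 + unit_exp p)) / (1 - 1 / (real p)\<^sup>2) = 1 / real p ^ K"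
  proof -
    have r: "real (p - 1) = real p - 1" using p0 by (simp add: of_nat_diff)
    define x where "x = real p"
    have x: "x > 1" using p0 by (simp add: x_def)
    have "((x - 1) / (x ^ K * x) + (x - 1) / (x ^ K * x * x)) / (1 - 1 / x\<^sup>2) = 1 / x ^ K"
    proof -
      have "(x - 1) / (x ^ K * x) + (x - 1) / (x ^ K * x * x) = (1 / x ^ K) * (1 - 1 / x\<^sup>2)"
        using x by (simp add: field_simps power2_eq_square)
      moreover have "1 - 1 / x\<^sup>2 \<noteq> 0" using one_less_power[OF x, of 2] by simp
      ultimately show ?thesis by simp
    qed
    then show ?thesis unfolding e using all[of K] all[of "K + 1"] r by (simp add: x_def mult_ac)
  qed
  finally have ld: "local_density f p = (\<Sum>j<K. real (unit_count ?A p j) / real p ^ (j + 1)) + 1 / real p ^ K" by (simp add: e)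
  obtain I where I: "(\<Sum>j<K. real (unit_count ?A p j) / real p ^ (j + 1)) = of_int I / real p ^ K" "(\<forall>j<K. even (unit_count ?A p j)) \<longrightarrow> even I"
    using density_sum_integral[of p "unit_count ?A p" K] p0 by auto
  have "local_density f p = of_int (I + 1) / (2 ^ 0 * of_int (int p ^ K))" unfolding ld I(1) by (simp add: add_divide_distrib)
  moreover have "odd (I + 1)" using I(2) ev by simp
  moreover have "odd (int p ^ K)" using odd by simp
  ultimately show ?thesis unfolding dyadic_order_def by blast
qed

section \<open>Anisotropic forms at odd primes\<close>

text \<open>The binary part with unit coefficients takes every value modulo \<open>p\<close>. A unit
  value forces one of its variables, hence the gradient, to be nonzero modulo \<open>p\<close>, so
  the solution lifts.\<close>

lemma odd_diag_unit_rep: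
  fixes a b c :: int
  assumes p: "prime p" "odd p" and u: "\<not> int p dvd a" "\<not> int p dvd b" and \<nu>: "\<not> int p dvd \<nu>"
  shows "padic_rep (diag a b c) p \<nu>"
proof -
  have pp: "prime (int p)" using p by simp
  obtain x y where xy: "int p dvd a * x\<^sup>2 + b * y\<^sup>2 - \<nu>" using binary_diagonal_surj_mod_prime[OF p u] by blast
  have n2: "\<not> int p dvd 2" using p by (metis int_dvd_int_iff of_nat_numeral primes_dvd_imp_eq two_is_prime_nat odd_prime_not_2)
  have "\<not> vdvd (int p) (gradient (diag a b c) (x, y, 0))"
  proof
    assume "vdvd (int p) (gradient (diag a b c) (x, y, 0))"
    then have "int p dvd x" "int p dvd y" using u n2 pp by (simp_all add: prime_dvd_mult_iff)
    then have "int p dvd a * x\<^sup>2 + b * y\<^sup>2" by (simp add: power2_eq_square)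
    then show False using xy \<nu> by (metis dvd_diff_right_iff)
  qed
  moreover have "int p dvd form_eval (diag a b c) (x, y, 0) - \<nu>" using xy by (simp add: form_eval_diag)
  ultimately have "\<exists>w. int p ^ k dvd form_eval (diag a b c) w - \<nu>" if "k \<ge> 1" for k
    using nonsingular_zero_lift[OF p(1), of "diag a b c" "(x, y, 0)" \<nu> k] that by blast
  then show ?thesis by (rule padic_rep_of_large)
qed

text \<open>A nontrivial zero of the unit part modulo \<open>p\<close> is nonsingular and would lift
  to a zero modulo every power of \<open>p\<close>.\<close>

lemma odd_diag_anisotropic_binary:
  fixes a b c :: int
  assumes p: "prime p" "odd p" and u: "\<not> int p dvd a" "\<not> int p dvd b"
    and an: "\<not> padic_isotropic (diag a b c) p" and d: "int p dvd a * x\<^sup>2 + b * y\<^sup>2"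
  shows "int p dvd x \<and> int p dvd y"
proof (rule ccontr)
  assume nxy: "\<not> (int p dvd x \<and> int p dvd y)"
  have pp: "prime (int p)" using p by simp
  have n2: "\<not> int p dvd 2" using p by (metis int_dvd_int_iff of_nat_numeral primes_dvd_imp_eq two_is_prime_nat odd_prime_not_2)
  have g: "\<not> vdvd (int p) (gradient (diag a b c) (x, y, 0))" using nxy u n2 pp by (simp add: prime_dvd_mult_iff)
  have z: "int p dvd form_eval (diag a b c) (x, y, 0) - 0" using d by (simp add: form_eval_diag)
  have "\<exists>w. \<not> vdvd (int p) w \<and> int p ^ k dvd form_eval (diag a b c) w" for k
  proof (cases "k = 0")
    case True
    then show ?thesis using nxy by (intro exI[of _ "(x, y, 0)"]) simp
  next
    case False
    then have "k \<ge> 1" by simp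
    from nonsingular_zero_lift[OF p(1) z g this]
    obtain w where w: "vmod w (int p) = vmod (x, y, 0) (int p)" "int p ^ k dvd form_eval (diag a b c) w"
      unfolding diff_0_right by blast
    have "\<not> vdvd (int p) w"
      using w(1) nxy by (cases w) (auto simp: mod_eq_0_iff_dvd[symmetric])
    then show ?thesis using w(2) by blast
  qed
  then show False using an unfolding padic_isotropic_def by blast
qed

text \<open>A value divisible by \<open>p\<close> forces the first two variables to be divisible by
  \<open>p\<close>, so modulo p^2 only the last summand remains. For valuation above 1 the last
  variable is divisible by \<open>p\<close> as well, and division by p^2 leads down to valuation 1,
  where the class of c z^2 is visible.\<close>

lemma odd_diag_odd_valuation:
  fixes a b c :: int
  assumes p: "prime p" "odd p" and u: "\<not> int p dvd a" "\<not> int p dvd b"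
    and an: "\<not> padic_isotropic (diag a b (int p * c)) p" and uc: "\<not> int p dvd c"
    and d: "int p ^ (2 * i + 2) dvd form_eval (diag a b (int p * c)) w - int p ^ (2 * i + 1) * \<nu>"
  shows "\<exists>z. int p dvd c * z\<^sup>2 - \<nu>"
  using d
proof (induction i arbitrary: w)
  have p0: "int p > 0" using p by (simp add: prime_gt_0_nat)
  have pp: "prime (int p)" using p by simp
  have red: "\<exists>x' y' z. w = (int p * x', int p * y', z) \<and> int p dvd (c * z\<^sup>2) - int p ^ (2 * i) * \<nu> \<and>
      form_eval (diag a b (int p * c)) w = (int p)\<^sup>2 * (a * x'\<^sup>2 + b * y'\<^sup>2) + int p * c * z\<^sup>2"
    if d: "int p ^ (2 * i + 2) dvd form_eval (diag a b (int p * c)) w - int p ^ (2 * i + 1) * \<nu>" for i w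
  proof -
    obtain x y z where w: "w = (x, y, z)" by (metis prod_cases3)
    have d2: "(int p)\<^sup>2 dvd a * x\<^sup>2 + b * y\<^sup>2 + int p * c * z\<^sup>2 - int p ^ (2 * i + 1) * \<nu>"
    proof -
      have "(int p)\<^sup>2 dvd int p ^ (2 * i + 2)" by (rule le_imp_power_dvd) simp
      then show ?thesis using d dvd_trans unfolding w form_eval_diag by blast
    qed
    have "int p dvd (int p)\<^sup>2" by (simp add: power2_eq_square)
    then have "int p dvd a * x\<^sup>2 + b * y\<^sup>2 + int p * c * z\<^sup>2 - int p ^ (2 * i + 1) * \<nu>" using d2 dvd_trans by blast
    moreover have "a * x\<^sup>2 + b * y\<^sup>2 + int p * c * z\<^sup>2 - int p ^ (2 * i + 1) * \<nu> = (a * x\<^sup>2 + b * y\<^sup>2) + int p * (c * z\<^sup>2 - int p ^ (2 * i) * \<nu>)"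
      by (simp add: algebra_simps)
    ultimately have "int p dvd a * x\<^sup>2 + b * y\<^sup>2" by (metis dvd_add_left_iff dvd_triv_left)
    then have "int p dvd x \<and> int p dvd y" by (rule odd_diag_anisotropic_binary[OF p u an])
    then obtain x' y' where xy: "x = int p * x'" "y = int p * y'" by (auto elim!: dvdE)
    have "a * x\<^sup>2 + b * y\<^sup>2 + int p * c * z\<^sup>2 - int p ^ (2 * i + 1) * \<nu> = (int p)\<^sup>2 * (a * x'\<^sup>2 + b * y'\<^sup>2) + int p * (c * z\<^sup>2 - int p ^ (2 * i) * \<nu>)"
      by (simp add: xy power_mult_distrib algebra_simps)
    then have "(int p)\<^sup>2 dvd int p * (c * z\<^sup>2 - int p ^ (2 * i) * \<nu>)" using d2 by (metis dvd_add_right_iff dvd_triv_left)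
    then have "int p dvd c * z\<^sup>2 - int p ^ (2 * i) * \<nu>" using p0 by (simp add: power2_eq_square)
    moreover have "form_eval (diag a b (int p * c)) w = (int p)\<^sup>2 * (a * x'\<^sup>2 + b * y'\<^sup>2) + int p * c * z\<^sup>2"
      by (simp add: w xy form_eval_diag power_mult_distrib algebra_simps)
    ultimately show ?thesis using w xy by blast
  qed
  {
    case 0
    then show ?case using red[of 0 w] by auto
  next
    case (Suc i)
    obtain x' y' z where w: "w = (int p * x', int p * y', z)" "int p dvd c * z\<^sup>2 - int p ^ (2 * Suc i) * \<nu>"
      "form_eval (diag a b (int p * c)) w = (int p)\<^sup>2 * (a * x'\<^sup>2 + b * y'\<^sup>2) + int p * c * z\<^sup>2"
      using red[of "Suc i" w] Suc(2) by blast
    have "int p dvd int p ^ (2 * Suc i) * \<nu>" by simp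
    then have cz: "int p dvd c * z\<^sup>2" using w(2) by (metis dvd_diff_left_iff)
    show ?case
    proof (cases "int p dvd z")
      case False
      then have "int p dvd c" using cz pp by (simp add: prime_dvd_mult_iff prime_dvd_power_iff)
      then show ?thesis using uc by blast
    next
      case True
      then obtain z' where z: "z = int p * z'" by (auto elim!: dvdE)
      have w': "w = smul (int p) (x', y', z')" by (simp add: w(1) z)
      have "int p ^ (2 * Suc i + 2) = (int p)\<^sup>2 * int p ^ (2 * i + 2)" by (simp add: power2_eq_square)
      moreover have "form_eval (diag a b (int p * c)) w - int p ^ (2 * Suc i + 1) * \<nu> = (int p)\<^sup>2 * (form_eval (diag a b (int p * c)) (x', y', z') - int p ^ (2 * i + 1) * \<nu>)"
        unfolding w' form_eval_smul by (simp add: power2_eq_square algebra_simps)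
      ultimately have "(int p)\<^sup>2 * int p ^ (2 * i + 2) dvd (int p)\<^sup>2 * (form_eval (diag a b (int p * c)) (x', y', z') - int p ^ (2 * i + 1) * \<nu>)"
        using Suc(2) by (simp only:)
      then have "int p ^ (2 * i + 2) dvd form_eval (diag a b (int p * c)) (x', y', z') - int p ^ (2 * i + 1) * \<nu>" using p0 by simp
      then show ?thesis by (rule Suc(1))
    qed
  }
qed

text \<open>In the squarefree diagonal form, two unit coefficients are excluded because the form
  would then be isotropic. If both are divisible by \<open>p\<close>, scaling by \<open>p\<close>
  turns their quotients by \<open>p\<close> into unit coefficients and the leading 1 into
  \<open>p\<close>.\<close>

lemma odd_normal_form:
  assumes pd: "positive_definite f" and p: "prime p" "odd p" and an: "\<not> padic_isotropic f p"
  obtains a b c m where "\<not> int p dvd a" "\<not> int p dvd b" "\<not> int p dvd c" "rat_similar f (diag a b (int p * c)) m"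
proof -
  have pp: "prime (int p)" using p by simp
  have p0: "int p > 0" using p by (simp add: prime_gt_0_nat)
  have n1: "\<not> int p dvd 1" using pp by (simp add: prime_int_iff)
  have n2: "\<not> int p dvd 2" using p by (metis int_dvd_int_iff of_nat_numeral primes_dvd_imp_eq two_is_prime_nat odd_prime_not_2)
  have n8: "\<not> int p dvd 8" using n2 pp prime_dvd_power[of "int p" 2 3] by auto
  obtain A B M where AB: "A > 0" "B > 0" "squarefree A" "squarefree B" and sim: "rat_similar f (diag 1 A B) M"
    using diagonal_normal_form[OF pd] by blast
  have an': "\<not> padic_isotropic (diag 1 A B) p" using sim an p unfolding rat_similar_def by blast
  have sf: "\<exists>y. x = int p * y \<and> \<not> int p dvd y" if sx: "squarefree x" "int p dvd x" for x
  proof -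
    obtain y where y: "x = int p * y" using sx(2) by (auto elim!: dvdE)
    have "\<not> int p dvd y"
    proof
      assume "int p dvd y"
      then have "(int p)\<^sup>2 dvd x" unfolding y power2_eq_square by (simp add: mult_dvd_mono)
      then have "int p dvd 1" using sx(1) squarefreeD by blast
      then show False using n1 by blast
    qed
    then show ?thesis using y by blast
  qed
  consider "\<not> int p dvd A" "\<not> int p dvd B" | "\<not> int p dvd A" "int p dvd B" | "int p dvd A" "\<not> int p dvd B" | "int p dvd A" "int p dvd B" by blast
  then show ?thesis
  proof cases
    case 1
    then have "\<not> int p dvd gram_det (diag 1 A B)" using n8 pp by (simp add: gram_det_diag prime_dvd_mult_iff)
    then show ?thesis using padic_isotropic_good[OF p(1)] an' by blast
  next
    case 2
    then obtain C where "B = int p * C" "\<not> int p dvd C" using sf AB by blast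
    then show ?thesis using that[of 1 A C M] sim 2 n1 by blast
  next
    case 3
    then obtain C where C: "A = int p * C" "\<not> int p dvd C" using sf AB by blast
    have "rat_similar (diag 1 A B) (diag 1 B A) 1"
      by (rule rat_similarI[OF embeds_swap_23 embeds_swap_23, where r=1]) auto
    from rat_similar_trans[OF sim this] show ?thesis using that[of 1 B C] C 3 n1 by blast
  next
    case 4
    obtain A' B' where A': "A = int p * A'" "\<not> int p dvd A'" "B = int p * B'" "\<not> int p dvd B'" using sf AB 4 by blast
    have "rat_similar (diag 1 A B) (diag A' B' (int p * 1)) (int p)"
    proof (rule rat_similarI[where r="int p" and M'="int p"])
      show "form_embeds (diag 1 A B) (diag A' B' (int p * 1)) (int p)"
        by (rule form_embedsI[of "int p" _ "\<lambda>(x, y, z). (int p * y, int p * z, x)" _ _ "\<lambda>(y, z, x). (int p * x, y, z)"])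
           (use p0 in \<open>auto simp: form_eval_diag A' power2_eq_square algebra_simps\<close>)
      show "form_embeds (diag A' B' (int p * 1)) (diag 1 A B) (int p)"
        by (rule form_embedsI[of "int p" _ "\<lambda>(y, z, x). (int p * x, y, z)" _ _ "\<lambda>(x, y, z). (int p * y, int p * z, x)"])
           (use p0 in \<open>auto simp: form_eval_diag A' power2_eq_square algebra_simps\<close>)
    qed (use p0 in \<open>auto simp: power2_eq_square\<close>)
    from rat_similar_trans[OF sim this] show ?thesis using that[of A' B' 1] A' n1 by blast
  qed
qed

lemma odd_rat_even_valuation:
  fixes a b c :: int
  assumes p: "prime p" "odd p" and u: "\<not> int p dvd a" "\<not> int p dvd b" and \<nu>: "\<not> int p dvd \<nu>"
  shows "padic_rep_rat (diag a b c) p (int p ^ (2 * i) * \<nu>)"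
proof -
  have "padic_rep (diag a b c) p (\<nu> * (int p ^ i)\<^sup>2)" by (rule padic_rep_scale[OF odd_diag_unit_rep[OF p u \<nu>]])
  moreover have "\<nu> * (int p ^ i)\<^sup>2 = int p ^ (2 * i) * \<nu>" by (simp add: power_mult[symmetric] mult.commute)
  ultimately show ?thesis using padic_rep_imp_rat by simp
qed

text \<open>Odd valuations are reached only through the coefficient divisible by \<open>p\<close>,
  so half of the unit classes are missed there; this missing half is the source of the denominator
  of the local measure.\<close>

lemma odd_rat_odd_valuation:
  fixes a b c :: int
  assumes p: "prime p" "odd p" and u: "\<not> int p dvd a" "\<not> int p dvd b" "\<not> int p dvd c" and \<nu>: "\<not> int p dvd \<nu>"
    and an: "\<not> padic_isotropic (diag a b (int p * c)) p"
  shows "padic_rep_rat (diag a b (int p * c)) p (int p ^ (2 * i + 1) * \<nu>) \<longleftrightarrow> (\<exists>z. int p dvd c * z\<^sup>2 - \<nu>)"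
proof
  assume "padic_rep_rat (diag a b (int p * c)) p (int p ^ (2 * i + 1) * \<nu>)"
  then obtain m where m: "padic_rep (diag a b (int p * c)) p (int p ^ (2 * i + 1) * \<nu> * (int p ^ m)\<^sup>2)"
    using padic_rep_rat_prime_power[OF p(1)] by blast
  have e: "int p ^ (2 * i + 1) * \<nu> * (int p ^ m)\<^sup>2 = int p ^ (2 * (i + m) + 1) * \<nu>"
  proof -
    have "(int p ^ m)\<^sup>2 = int p ^ (2 * m)" by (simp add: power_mult[symmetric] mult.commute)
    then show ?thesis by (simp add: power_add distrib_left)
  qed
  obtain w where "int p ^ (2 * (i + m) + 2) dvd form_eval (diag a b (int p * c)) w - int p ^ (2 * (i + m) + 1) * \<nu>"
    using m unfolding e padic_rep_def by blast
  then show "\<exists>z. int p dvd c * z\<^sup>2 - \<nu>" by (rule odd_diag_odd_valuation[OF p u(1,2) an u(3)])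
next
  assume "\<exists>z. int p dvd c * z\<^sup>2 - \<nu>"
  then obtain z where z: "int p dvd c * z\<^sup>2 - \<nu>" by blast
  have "padic_rep (diag a b (int p * c)) p (int p * (c * z\<^sup>2))" unfolding padic_rep_def
    by (intro allI exI[of _ "(0, 0, z)"]) (simp add: form_eval_diag mult.assoc)
  moreover have "\<not> int p dvd c * z\<^sup>2" using z \<nu> by (metis dvd_diff_right_iff)
  moreover have "int p ^ unit_exp p dvd c * z\<^sup>2 - \<nu>" using z unit_exp_odd[OF p(2)] by simp
  ultimately have "padic_rep (diag a b (int p * c)) p (int p * \<nu>)"
    using padic_rep_square_class[OF p(1), of "c * z\<^sup>2" \<nu> "diag a b (int p * c)" "int p"] by blast
  then have "padic_rep (diag a b (int p * c)) p (int p * \<nu> * (int p ^ i)\<^sup>2)" by (rule padic_rep_scale)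
  moreover have "int p * \<nu> * (int p ^ i)\<^sup>2 = int p ^ (2 * i + 1) * \<nu>"
  proof -
    have "(int p ^ i)\<^sup>2 = int p ^ (2 * i)" by (simp add: power_mult[symmetric] mult.commute)
    then show ?thesis by simp
  qed
  ultimately show "padic_rep_rat (diag a b (int p * c)) p (int p ^ (2 * i + 1) * \<nu>)" using padic_rep_imp_rat by simp
qed

lemma card_square_classes_mod_prime:
  fixes c m :: int
  assumes p: "prime p" "odd p" and u: "\<not> int p dvd c" "\<not> int p dvd m"
  shows "card {u\<in>{0..<int p ^ 1}. \<not> int p dvd u \<and> (\<exists>x. int p dvd c * x\<^sup>2 - m * u)} = (p - 1) div 2"
proof -
  define h where "h = int ((p - 1) div 2)"
  have ph: "int p = 2 * h + 1" using p(2) by (auto simp: h_def elim!: oddE)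
  have pp: "prime (int p)" using p by simp
  have p0: "int p > 0" using p by (simp add: prime_gt_0_nat)
  have "coprime m (int p)" using u(2) pp by (metis coprime_commute prime_imp_coprime)
  then obtain m1 where m1: "int p dvd m * m1 - 1" using exists_inverse_mod by blast
  have um1: "\<not> int p dvd m1"
  proof
    assume "int p dvd m1"
    then have "int p dvd m * m1" by simp
    then have "int p dvd 1" using m1 by (metis dvd_diff_right_iff)
    then show False using pp by (simp add: prime_int_iff)
  qed
  define g where "g = m1 * c"
  have ug: "\<not> int p dvd g" using um1 u pp by (simp add: g_def prime_dvd_mult_iff)
  have small: "\<not> int p dvd x" if "0 < x" "x < int p" for x using that by (simp add: zdvd_not_zless)
  let ?S = "{u\<in>{0..<int p ^ 1}. \<not> int p dvd u \<and> (\<exists>x. int p dvd c * x\<^sup>2 - m * u)}"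
  have "bij_betw (\<lambda>x. (g * x\<^sup>2) mod int p) {1..h} ?S"
    unfolding bij_betw_def
  proof
    show "inj_on (\<lambda>x. (g * x\<^sup>2) mod int p) {1..h}"
    proof (rule inj_onI)
      fix x y assume xy: "x \<in> {1..h}" "y \<in> {1..h}" "(g * x\<^sup>2) mod int p = (g * y\<^sup>2) mod int p"
      have "int p dvd g * x\<^sup>2 - g * y\<^sup>2" using xy(3) by (simp add: mod_eq_dvd_iff)
      also have "g * x\<^sup>2 - g * y\<^sup>2 = g * ((x - y) * (x + y))" by (simp add: power2_eq_square algebra_simps)
      finally have "int p dvd x - y \<or> int p dvd x + y" using ug pp by (simp add: prime_dvd_mult_iff)
      moreover have "\<not> int p dvd x + y" using xy ph by (intro small) auto
      ultimately have d: "int p dvd x - y" by blast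
      have "x mod int p = y mod int p" using d by (simp add: mod_eq_dvd_iff)
      then show "x = y" using xy ph by simp
    qed
    show "(\<lambda>x. (g * x\<^sup>2) mod int p) ` {1..h} = ?S"
    proof (intro equalityI subsetI)
      fix u' assume "u' \<in> (\<lambda>x. (g * x\<^sup>2) mod int p) ` {1..h}"
      then obtain x where x: "u' = (g * x\<^sup>2) mod int p" "1 \<le> x" "x \<le> h" by auto
      have "\<not> int p dvd x" using x ph by (intro small) auto
      then have "\<not> int p dvd g * x\<^sup>2" using ug pp by (simp add: prime_dvd_mult_iff prime_dvd_power_iff)
      then have nu: "\<not> int p dvd u'" unfolding x(1) by (simp add: dvd_mod_iff)
      have "int p dvd g * x\<^sup>2 - u'" unfolding x(1) by (rule dvd_minus_mod)
      then have "int p dvd m * (g * x\<^sup>2 - u')" by simp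
      moreover have "int p dvd c * x\<^sup>2 * (m * m1 - 1)" using m1 by simp
      ultimately have "int p dvd m * (g * x\<^sup>2 - u') - c * x\<^sup>2 * (m * m1 - 1)" by (rule dvd_diff)
      moreover have "m * (g * x\<^sup>2 - u') - c * x\<^sup>2 * (m * m1 - 1) = c * x\<^sup>2 - m * u'" by (simp add: g_def algebra_simps)
      ultimately have "int p dvd c * x\<^sup>2 - m * u'" by simp
      then show "u' \<in> ?S" using nu p0 x(1) by auto
    next
      fix u' assume "u' \<in> ?S"
      then obtain x where x: "0 \<le> u'" "u' < int p" "\<not> int p dvd u'" "int p dvd c * x\<^sup>2 - m * u'" by auto
      have nx: "\<not> int p dvd x"
      proof
        assume "int p dvd x"
        then have "int p dvd c * x\<^sup>2" by (simp add: power2_eq_square)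
        then have "int p dvd m * u'" using x(4) by (metis dvd_diff_right_iff)
        then show False using u(2) x(3) pp by (simp add: prime_dvd_mult_iff)
      qed
      define r where "r = x mod int p"
      have r: "0 \<le> r" "r < int p" using p0 by (auto simp: r_def)
      have "r \<noteq> 0" using nx by (auto simp: r_def dvd_eq_mod_eq_0)
      define y where "y = (if r \<le> h then r else int p - r)"
      have y: "1 \<le> y" "y \<le> h" using r \<open>r \<noteq> 0\<close> ph by (auto simp: y_def)
      have xr: "int p dvd x - r" unfolding r_def by (rule dvd_minus_mod)
      have "int p dvd x\<^sup>2 - y\<^sup>2"
      proof (cases "r \<le> h")
        case True
        have "x\<^sup>2 - y\<^sup>2 = (x - r) * (x + r)" using True by (simp add: y_def power2_eq_square algebra_simps)
        then show ?thesis using xr by simp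
      next
        case False
        have "x\<^sup>2 - y\<^sup>2 = (x - r) * (x + r) - int p * (int p - 2 * r)" using False by (simp add: y_def power2_eq_square algebra_simps)
        then show ?thesis using xr by (simp add: dvd_diff)
      qed
      then have "int p dvd g * (x\<^sup>2 - y\<^sup>2)" by simp
      moreover have "int p dvd m1 * (c * x\<^sup>2 - m * u')" using x(4) by simp
      moreover have "int p dvd u' * (m * m1 - 1)" using m1 by simp
      ultimately have "int p dvd m1 * (c * x\<^sup>2 - m * u') + u' * (m * m1 - 1) - g * (x\<^sup>2 - y\<^sup>2)" by (intro dvd_diff dvd_add)
      moreover have "m1 * (c * x\<^sup>2 - m * u') + u' * (m * m1 - 1) - g * (x\<^sup>2 - y\<^sup>2) = g * y\<^sup>2 - u'" by (simp add: g_def algebra_simps)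
      ultimately have "(g * y\<^sup>2) mod int p = u' mod int p" by (simp add: mod_eq_dvd_iff)
      then have "u' = (g * y\<^sup>2) mod int p" using x(1,2) by simp
      then show "u' \<in> (\<lambda>x. (g * x\<^sup>2) mod int p) ` {1..h}" using y by auto
    qed
  qed
  then have "card {1..h} = card ?S" by (rule bij_betw_same_card)
  then show ?thesis by (simp add: h_def)
qed

text \<open>Far out the levels alternate between p - 1 and (p - 1)/2 unit classes, and the tail sums
  to an odd integer over 2(p + 1)p^K. The first \<open>K\<close> levels add an integer over p^K,
  which changes the numerator over the common denominator by an even number. So the numerator stays
  odd and the even number 2(p + 1) remains below.\<close>

theorem local_density_odd_anisotropic:
  assumes pd: "positive_definite f" and p: "prime p" "odd p" and an: "\<not> padic_isotropic f p"
  shows "\<exists>i\<ge>1. dyadic_order i (local_density f p)"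
proof -
  have e: "unit_exp p = 1" using p(2) by (rule unit_exp_odd)
  have p1: "real p > 1" using p prime_gt_1_nat by simp
  have p0: "int p > 0" using p by (simp add: prime_gt_0_nat)
  have pp: "prime (int p)" using p by simp
  let ?A = "padic_rep f p"
  obtain K where K: "\<And>w. int p ^ K dvd form_eval f w \<Longrightarrow> vdvd (int p) w" using anisotropic_bound[OF an] by blast
  obtain a b c m where u: "\<not> int p dvd a" "\<not> int p dvd b" "\<not> int p dvd c" and sim: "rat_similar f (diag a b (int p * c)) m"
    using odd_normal_form[OF pd p an] by blast
  have an': "\<not> padic_isotropic (diag a b (int p * c)) p" using sim an p unfolding rat_similar_def by blast
  have m0: "m \<noteq> 0" using sim by (simp add: rat_similar_def)
  obtain \<mu> m' where m: "m = int p ^ \<mu> * m'" "\<not> int p dvd m'" using prime_power_split[OF p(1) m0] by blast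
  \<comment> \<open>Passing to the normal form multiplies by \<open>m\<close>, which shifts the
    level by the valuation \<open>\<mu>\<close> and twists the unit by \<open>m'\<close>; only the
    parity of the shifted level matters.\<close>
  have rep: "?A (int p ^ j * v) \<longleftrightarrow> (if even (j + \<mu>) then True else \<exists>z. int p dvd c * z\<^sup>2 - m' * v)"
    if j: "j \<ge> K" and v: "\<not> int p dvd v" for j v
  proof -
    have mv: "\<not> int p dvd m' * v" using v m(2) pp by (simp add: prime_dvd_mult_iff)
    have "?A (int p ^ j * v) \<longleftrightarrow> padic_rep_rat f p (int p ^ j * v)"
      by (rule anisotropic_rep_iff_rat[OF p(1) K]) (use j in \<open>auto intro: dvd_mult2 le_imp_power_dvd\<close>)
    also have "\<dots> \<longleftrightarrow> padic_rep_rat (diag a b (int p * c)) p (m * (int p ^ j * v))"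
      using sim p unfolding rat_similar_def by blast
    also have "m * (int p ^ j * v) = int p ^ (j + \<mu>) * (m' * v)" by (simp add: m(1) power_add mult_ac)
    also have "padic_rep_rat (diag a b (int p * c)) p (int p ^ (j + \<mu>) * (m' * v)) \<longleftrightarrow> (if even (j + \<mu>) then True else \<exists>z. int p dvd c * z\<^sup>2 - m' * v)"
    proof (cases "even (j + \<mu>)")
      case True
      then obtain i where "j + \<mu> = 2 * i" by blast
      then show ?thesis using odd_rat_even_valuation[OF p u(1,2) mv, of "int p * c" i] True by simp
    next
      case False
      then obtain i where "j + \<mu> = 2 * i + 1" using oddE by blast
      then show ?thesis using odd_rat_odd_valuation[OF p u mv an', of i] False by simp
    qed
    finally show ?thesis .
  qed
  have cnt: "unit_count ?A p j = (if even (j + \<mu>) then p - 1 else (p - 1) div 2)" if "j \<ge> K" for j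
  proof -
    have "unit_count ?A p j = card {v\<in>{0..<int p ^ 1}. \<not> int p dvd v \<and> (if even (j + \<mu>) then True else \<exists>z. int p dvd c * z\<^sup>2 - m' * v)}"
      unfolding unit_count_def e using rep[OF that] by (intro arg_cong[where f=card]) blast
    then show ?thesis using card_units_mod_prime[OF p(1)] card_square_classes_mod_prime[OF p u(3) m(2)] by simp
  qed
  have ld: "local_density f p = (\<Sum>j<K. real (unit_count ?A p j) / real p ^ (j + unit_exp p))
     + (real (unit_count ?A p K) / real p ^ (K + unit_exp p) + real (unit_count ?A p (K + 1)) / real p ^ (K + 1 + unit_exp p)) / (1 - 1 / (real p)\<^sup>2)"
  proof (rule square_class_density[OF p(1) square_class_closed_padic_rep[OF p(1)] padic_rep_density[OF p(1)]])
    fix n assume n: "int p ^ (K + 2) dvd n"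
    then obtain d where d: "n = int p ^ (K + 2) * d" by (auto elim!: dvdE)
    have n': "n = (int p ^ K * d) * (int p)\<^sup>2" by (simp add: d power2_eq_square mult_ac)
    then have dv: "n div (int p)\<^sup>2 = int p ^ K * d" using p0 by simp
    show "?A n \<longleftrightarrow> ?A (n div (int p)\<^sup>2)"
    proof
      assume "?A n"
      moreover have "int p ^ K dvd (int p ^ K * d) * (int p)\<^sup>2" by (simp add: mult.assoc)
      ultimately show "?A (n div (int p)\<^sup>2)" unfolding dv using anisotropic_descent[OF p(1) K] n' by metis
    next
      assume "?A (n div (int p)\<^sup>2)"
      then have "?A (int p ^ K * d)" by (simp only: dv)
      then have "?A ((int p ^ K * d) * (int p)\<^sup>2)" by (rule padic_rep_scale)
      then show "?A n" by (simp only: n'[symmetric])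
    qed
  qed
  obtain h where h: "p = 2 * h + 1" using p(2) by (auto elim!: oddE)
  \<comment> \<open>The cofactor of (p - 1)/2 in the weighted sum of two consecutive levels: p(p -
    1) + (p - 1)/2 or p(p - 1)/2 + (p - 1), according to which level comes first.\<close>
  define o' where "o' = (if even (K + \<mu>) then 2 * int p + 1 else int p + 2)"
  have oo: "odd o'" using p(2) by (simp add: o'_def)
  have tail: "(real (unit_count ?A p K) / real p ^ (K + 1) + real (unit_count ?A p (K + 1)) / real p ^ (K + 1 + 1)) / (1 - 1 / (real p)\<^sup>2) = of_int o' / (2 * (real p + 1) * real p ^ K)"
  proof -
    define x where "x = real p"
    have x: "x > 1" using p1 by (simp add: x_def)
    have xh: "x = 2 * real h + 1" by (simp add: x_def h)
    have cs: "real (unit_count ?A p K) * x + real (unit_count ?A p (K + 1)) = (x - 1) / 2 * of_int o'"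
    proof (cases "even (K + \<mu>)")
      case True
      then have "unit_count ?A p K = 2 * h" "unit_count ?A p (K + 1) = h" using cnt[of K] cnt[of "K + 1"] by (auto simp: h)
      then show ?thesis using True by (simp add: xh o'_def h algebra_simps)
    next
      case False
      then have "unit_count ?A p K = h" "unit_count ?A p (K + 1) = 2 * h" using cnt[of K] cnt[of "K + 1"] by (auto simp: h)
      then show ?thesis using False by (simp add: xh o'_def h algebra_simps)
    qed
    have "real (unit_count ?A p K) / x ^ (K + 1) + real (unit_count ?A p (K + 1)) / x ^ (K + 1 + 1) = (real (unit_count ?A p K) * x + real (unit_count ?A p (K + 1))) / (x ^ K * x\<^sup>2)"
      using x by (simp add: field_simps power2_eq_square)
    also have "\<dots> = (x - 1) / 2 * of_int o' / (x ^ K * x\<^sup>2)" by (simp only: cs)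
    also have "\<dots> = of_int o' / (2 * (x + 1) * x ^ K) * (1 - 1 / x\<^sup>2)"
    proof -
      have "1 - 1 / x\<^sup>2 = (x - 1) * (x + 1) / x\<^sup>2" using x by (simp add: field_simps power2_eq_square)
      moreover have "of_int o' / (2 * (x + 1) * x ^ K) * ((x - 1) * (x + 1) / x\<^sup>2) = (x + 1) * (of_int o' * (x - 1)) / ((x + 1) * (2 * x ^ K * x\<^sup>2))"
        by (simp only: times_divide_times_eq) (simp only: mult_ac)
      moreover have "\<dots> = of_int o' * (x - 1) / (2 * x ^ K * x\<^sup>2)" using x by (subst mult_divide_mult_cancel_left) auto
      ultimately show ?thesis by (simp add: mult_ac)
    qed
    finally have "(real (unit_count ?A p K) / x ^ (K + 1) + real (unit_count ?A p (K + 1)) / x ^ (K + 1 + 1)) / (1 - 1 / x\<^sup>2) = of_int o' / (2 * (x + 1) * x ^ K)"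
      using one_less_power[OF x, of 2] by (simp add: divide_eq_eq)
    then show ?thesis by (simp only: x_def)
  qed
  obtain I where I: "(\<Sum>j<K. real (unit_count ?A p j) / real p ^ (j + 1)) = of_int I / real p ^ K"
    using density_sum_integral[of p "unit_count ?A p" K] p1 by auto
  have "local_density f p = of_int I / real p ^ K + of_int o' / (2 * (real p + 1) * real p ^ K)"
    using ld tail I by (simp only: e)
  also have "\<dots> = of_int (2 * (int p + 1) * I + o') / (of_int (2 * (int p + 1)) * of_int (int p ^ K))"
  proof -
    have "a / c + b / (d * c) = (d * a + b) / (d * c)" if "c \<noteq> 0" "d \<noteq> 0" for a b c d :: real
      using that by (simp add: add_divide_distrib)
    from this[of "real p ^ K" "2 * (real p + 1)" "of_int I" "of_int o'"] show ?thesis using p1 by simp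
  qed
  finally have ld': "local_density f p = of_int (2 * (int p + 1) * I + o') / (of_int (2 * (int p + 1)) * of_int (int p ^ K))" .
  have "2 * (int p + 1) \<noteq> 0" using p0 by simp
  then obtain i r where ir: "2 * (int p + 1) = int 2 ^ i * r" "\<not> int 2 dvd r" using prime_power_split[of 2 "2 * (int p + 1)"] by auto
  have i1: "i \<ge> 1"
  proof (rule ccontr)
    assume "\<not> i \<ge> 1"
    then have "2 * (int p + 1) = r" using ir by simp
    then show False using ir(2) by auto
  qed
  have "odd (2 * (int p + 1) * I + o')" using oo by simp
  moreover have "odd (r * int p ^ K)" using ir(2) p(2) by simp
  moreover have "local_density f p = of_int (2 * (int p + 1) * I + o') / (2 ^ i * of_int (r * int p ^ K))"
  proof -
    have "real_of_int (2 * (int p + 1)) = 2 ^ i * of_int r" unfolding ir(1) by simp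
    then show ?thesis unfolding ld' by (simp only: of_int_mult mult.assoc)
  qed
  ultimately have "dyadic_order i (local_density f p)" unfolding dyadic_order_def by blast
  then show ?thesis using i1 by blast
qed

section \<open>The prime 2\<close>

text \<open>Since \<open>(x\<^sup>2 + A y\<^sup>2) (z\<^sup>2 + A s\<^sup>2) = (x z - A y s)\<^sup>2 + A (x s + y z)\<^sup>2\<close>, a zero of the norm form
  \<open>x\<^sup>2 + A y\<^sup>2 + B z\<^sup>2 + A B s\<^sup>2\<close> produces a zero of its ternary subform.\<close>

lemma rep_minus_det_imp_isotropic:
  assumes p: "prime p" and rep: "padic_rep_rat (diag 1 A B) p (- (A * B))"
  shows "padic_isotropic (diag 1 A B) p"
proof -
  obtain s where s: "s \<noteq> 0" "padic_rep (diag 1 A B) p (- (A * B) * s\<^sup>2)" using rep unfolding padic_rep_rat_def by blast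
  show ?thesis
  \<comment> \<open>If z^2 + A s^2 can be made divisible by arbitrarily high powers, (z, s, 0) is
    already a zero. Otherwise its divisibility is bounded, and this bounds the content of the
    composed vector, whose last coordinate it is.\<close>
  proof (cases "\<forall>k. \<exists>z. int p ^ k dvd z\<^sup>2 + A * s\<^sup>2")
    case True
    obtain \<sigma> s' where ss: "s = int p ^ \<sigma> * s'" "\<not> int p dvd s'" using prime_power_split[OF p s(1)] by blast
    show ?thesis
    proof (rule padic_isotropicI[OF p, of \<sigma>])
      fix k
      obtain z where z: "int p ^ k dvd z\<^sup>2 + A * s\<^sup>2" using True by blast
      have "\<not> int p ^ Suc \<sigma> dvd s"
      proof
        assume "int p ^ Suc \<sigma> dvd s"
        then have "int p ^ \<sigma> * int p dvd int p ^ \<sigma> * s'" by (simp add: ss(1) mult.commute)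
        moreover have "int p ^ \<sigma> \<noteq> 0" using p by (simp add: prime_gt_0_nat)
        ultimately show False using ss(2) by simp
      qed
      then show "\<exists>w. \<not> vdvd (int p ^ Suc \<sigma>) w \<and> int p ^ k dvd form_eval (diag 1 A B) w"
        using z by (intro exI[of _ "(z, s, 0)"]) (simp add: form_eval_diag)
    qed
  next
    case False
    then obtain C where C: "\<not> int p ^ C dvd z\<^sup>2 + A * s\<^sup>2" for z by blast
    show ?thesis
    proof (rule padic_isotropicI[OF p, of C])
      fix k
      obtain w where w: "int p ^ k dvd form_eval (diag 1 A B) w - (- (A * B) * s\<^sup>2)" using s(2) unfolding padic_rep_def by blast
      obtain x y z where wx: "w = (x, y, z)" by (metis prod_cases3)
      define v where "v = (x * z - A * y * s, x * s + y * z, z\<^sup>2 + A * s\<^sup>2)"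
      have "form_eval (diag 1 A B) v = (z\<^sup>2 + A * s\<^sup>2) * (form_eval (diag 1 A B) w - (- (A * B) * s\<^sup>2))"
        by (simp add: v_def wx form_eval_diag power2_eq_square algebra_simps)
      then have "int p ^ k dvd form_eval (diag 1 A B) v" using w by simp
      moreover have "\<not> vdvd (int p ^ Suc C) v" using C dvd_trans[OF le_imp_power_dvd[of C "Suc C" "int p"]] by (auto simp: v_def)
      ultimately show "\<exists>w. \<not> vdvd (int p ^ Suc C) w \<and> int p ^ k dvd form_eval (diag 1 A B) w" by blast
    qed
  qed
qed

section \<open>Lifting dyadic solutions from moduli 8 and 16\<close>

lemma dyadic_unit_lift:
  fixes u t m :: int
  assumes "odd u" "odd t" "8 dvd u * t\<^sup>2 - m"
  shows "\<exists>y. odd y \<and> 2 ^ k dvd u * y\<^sup>2 - m"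
proof -
  have "\<exists>s. int 2 ^ Suc k dvd (u * t\<^sup>2) * s\<^sup>2 - m"
    by (rule unit_square_class) (use assms in \<open>auto simp: unit_exp_def\<close>)
  then obtain s where s: "2 ^ Suc k dvd (u * t\<^sup>2) * s\<^sup>2 - m" by auto
  have "2 dvd (u * t\<^sup>2) * s\<^sup>2 - m" using s by (rule dvd_trans[rotated]) simp
  moreover have "odd m"
  proof -
    have "even (u * t\<^sup>2 - m)" using assms(3) by (rule dvd_trans[rotated]) simp
    then show ?thesis using assms(1,2) by simp
  qed
  ultimately have "odd s" by auto
  moreover have "2 ^ k dvd u * (t * s)\<^sup>2 - m"
  proof -
    have "2 ^ k dvd (2::int) ^ Suc k" by simp
    then have "2 ^ k dvd (u * t\<^sup>2) * s\<^sup>2 - m" using s dvd_trans by blast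
    then show ?thesis by (simp add: power_mult_distrib mult.assoc)
  qed
  ultimately show ?thesis using assms(2) by (intro exI[of _ "t * s"]) simp
qed

text \<open>A square class is determined modulo 8 for a unit, hence modulo 16 after multiplication
  by 2: an odd variable with odd coefficient lifts from modulus 8, one with coefficient 2 mod 4 from
  modulus 16.\<close>

lemma dyadic_lift:
  fixes c t m :: int
  assumes t: "odd t" and c: "odd c \<and> 8 dvd c * t\<^sup>2 - m \<or> c mod 4 = 2 \<and> 16 dvd c * t\<^sup>2 - m"
  shows "\<exists>y. odd y \<and> 2 ^ k dvd c * y\<^sup>2 - m"
  using c
proof
  assume "odd c \<and> 8 dvd c * t\<^sup>2 - m"
  then show ?thesis using dyadic_unit_lift t by blast
next
  assume a: "c mod 4 = 2 \<and> 16 dvd c * t\<^sup>2 - m"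
  then have "even c" by presburger
  then obtain u where u: "c = 2 * u" by blast
  have "odd u" using a unfolding u by presburger
  have "even (c * t\<^sup>2 - m)" using a by (meson dvd_trans even_numeral)
  then have "even m" using u by simp
  then obtain m' where m: "m = 2 * m'" by blast
  have "2 * 8 dvd 2 * (u * t\<^sup>2 - m')" using a by (simp add: u m algebra_simps)
  then have "8 dvd u * t\<^sup>2 - m'" unfolding dvd_mult_cancel_left by simp
  then obtain y where y: "odd y" "2 ^ k dvd u * y\<^sup>2 - m'" using dyadic_unit_lift[OF \<open>odd u\<close> t] by blast
  have "c * y\<^sup>2 - m = 2 * (u * y\<^sup>2 - m')" by (simp add: u m algebra_simps)
  then have "2 ^ k dvd c * y\<^sup>2 - m" using y(2) by (simp only: dvd_mult)
  then show ?thesis using y(1) by blast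
qed

section \<open>The finite table of dyadic square classes\<close>

text \<open>Holds if \<open>A\<close> and \<open>r\<close> agree to the precision that fixes the
  square class, for units and for twice units; a squarefree integer is always one of these.\<close>

definition dyadic_residue :: "int \<Rightarrow> int \<Rightarrow> bool" where
  "dyadic_residue A r \<longleftrightarrow> (if odd r then 8 dvd A - r else r mod 4 = 2 \<and> 16 dvd A - r)"

text \<open>Representatives of the eight square classes of the nonzero 2-adic numbers: the odd
  residues modulo 8 and their doubles.\<close>

definition dyadic_classes :: "int list" where "dyadic_classes = [1, 3, 5, 7, 2, 6, 10, 14]"

text \<open>A solution in which some variable can absorb the lifting. If an odd variable has an odd
  coefficient, the modulus 8 suffices; otherwise an odd variable with even coefficient has to be
  used, and the modulus is 16.\<close>

definition dyadic_witness :: "int \<Rightarrow> int \<Rightarrow> int \<Rightarrow> int \<times> int \<times> int \<Rightarrow> bool" where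
  "dyadic_witness A B m = (\<lambda>(x, y, z).
     if odd x \<or> odd A \<and> odd y \<or> odd B \<and> odd z then (x * x + A * (y * y) + B * (z * z) - m) mod 8 = 0
     else (odd y \<or> odd z) \<and> (x * x + A * (y * y) + B * (z * z) - m) mod 16 = 0)"

definition dyadic_solvable :: "int \<Rightarrow> int \<Rightarrow> int \<Rightarrow> bool" where
  "dyadic_solvable A B m \<longleftrightarrow>
     list_ex (\<lambda>x. list_ex (\<lambda>y. list_ex (\<lambda>z. dyadic_witness A B m (x, y, z)) [0, 1, 2]) [0, 1, 2]) [0, 1, 2]"

text \<open>Each branch says that \<open>c\<close> has the square class of -AB, to the precision
  that fixes it. If both coefficients are even, AB carries the square factor 4, hence the factor 4
  and the modulus 32.\<close>

definition dyadic_exceptional :: "int \<Rightarrow> int \<Rightarrow> int \<Rightarrow> bool" where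
  "dyadic_exceptional A B c \<longleftrightarrow>
     (if odd A \<and> odd B then odd c \<and> (A * B + c) mod 8 = 0
      else if even A \<and> even B then odd c \<and> (A * B + 4 * c) mod 32 = 0
      else even c \<and> (A * B + c) mod 16 = 0)"

text \<open>A finite check over the 64 pairs of classes: either the form has a zero that lifts, or
  every square class apart from that of -AB is represented. Coordinates 0, 1 and 2 are enough in all
  cases.\<close>

lemma dyadic_table:
  "list_all (\<lambda>A. list_all (\<lambda>B. dyadic_solvable A B 0 \<or>
     list_ex (\<lambda>c. dyadic_exceptional A B c \<and> list_all (\<lambda>n. n = c \<or> dyadic_solvable A B n) dyadic_classes)
       dyadic_classes) dyadic_classes) dyadic_classes"
  by code_simp

lemma dyadic_residue_even: "dyadic_residue A r \<Longrightarrow> even A \<longleftrightarrow> even r"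
  unfolding dyadic_residue_def by (auto split: if_splits) presburger+

lemma dyadic_residue_mod_4: "dyadic_residue A r \<Longrightarrow> even A \<Longrightarrow> A mod 4 = 2"
  unfolding dyadic_residue_def by (auto split: if_splits) presburger+

lemma dyadic_witness_lift:
  assumes A: "dyadic_residue A a" and B: "dyadic_residue B b" and w: "dyadic_witness a b m w"
  shows "\<exists>v. \<not> vdvd 2 v \<and> 2 ^ k dvd form_eval (diag 1 A B) v - m"
proof -
  obtain x y z where wx: "w = (x, y, z)" by (metis prod_cases3)
  note ev = dyadic_residue_even[OF A] dyadic_residue_even[OF B]
  have d8: "8 dvd A - a" "8 dvd B - b" using A B unfolding dyadic_residue_def by (auto split: if_splits intro: dvd_trans[of 8 16])
  have eq: "x\<^sup>2 + A * y\<^sup>2 + B * z\<^sup>2 - m = (x * x + a * (y * y) + b * (z * z) - m) + ((A - a) * y\<^sup>2 + (B - b) * z\<^sup>2)"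
    by (simp add: power2_eq_square algebra_simps)
  have fin1: ?thesis if q: "odd x" "8 dvd x\<^sup>2 + A * y\<^sup>2 + B * z\<^sup>2 - m"
  proof -
    obtain t where "odd t" "2 ^ k dvd 1 * t\<^sup>2 - (m - A * y\<^sup>2 - B * z\<^sup>2)"
      using dyadic_lift[of x 1 "m - A * y\<^sup>2 - B * z\<^sup>2" k] q by (auto simp: algebra_simps)
    then show ?thesis by (intro exI[of _ "(t, y, z)"]) (simp add: form_eval_diag algebra_simps)
  qed
  have fin2: ?thesis if q: "odd y" "odd A \<and> 8 dvd x\<^sup>2 + A * y\<^sup>2 + B * z\<^sup>2 - m \<or> even A \<and> 16 dvd x\<^sup>2 + A * y\<^sup>2 + B * z\<^sup>2 - m"
  proof -
    have "x\<^sup>2 + A * y\<^sup>2 + B * z\<^sup>2 - m = A * y\<^sup>2 - (m - x\<^sup>2 - B * z\<^sup>2)" by simp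
    then obtain t where "odd t" "2 ^ k dvd A * t\<^sup>2 - (m - x\<^sup>2 - B * z\<^sup>2)"
      using dyadic_lift[of y A "m - x\<^sup>2 - B * z\<^sup>2" k] q dyadic_residue_mod_4[OF A] by metis
    then show ?thesis by (intro exI[of _ "(x, t, z)"]) (simp add: form_eval_diag algebra_simps)
  qed
  have fin3: ?thesis if q: "odd z" "odd B \<and> 8 dvd x\<^sup>2 + A * y\<^sup>2 + B * z\<^sup>2 - m \<or> even B \<and> 16 dvd x\<^sup>2 + A * y\<^sup>2 + B * z\<^sup>2 - m"
  proof -
    have "x\<^sup>2 + A * y\<^sup>2 + B * z\<^sup>2 - m = B * z\<^sup>2 - (m - x\<^sup>2 - A * y\<^sup>2)" by simp
    then obtain t where "odd t" "2 ^ k dvd B * t\<^sup>2 - (m - x\<^sup>2 - A * y\<^sup>2)"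
      using dyadic_lift[of z B "m - x\<^sup>2 - A * y\<^sup>2" k] q dyadic_residue_mod_4[OF B] by metis
    then show ?thesis by (intro exI[of _ "(x, y, t)"]) (simp add: form_eval_diag algebra_simps)
  qed
  show ?thesis
  proof (cases "odd x \<or> odd a \<and> odd y \<or> odd b \<and> odd z")
    case True
    then have "(x * x + a * (y * y) + b * (z * z) - m) mod 8 = 0" using w unfolding wx dyadic_witness_def prod.case by (simp only: if_True)
    then have "8 dvd x * x + a * (y * y) + b * (z * z) - m" by (simp only: mod_0_imp_dvd)
    moreover have "8 dvd (A - a) * y\<^sup>2 + (B - b) * z\<^sup>2" using d8 by (intro dvd_add dvd_mult2)
    ultimately have "8 dvd x\<^sup>2 + A * y\<^sup>2 + B * z\<^sup>2 - m" unfolding eq by (rule dvd_add)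
    then show ?thesis using True fin1 fin2 fin3 ev by blast
  next
    case False
    then have "(odd y \<or> odd z) \<and> (x * x + a * (y * y) + b * (z * z) - m) mod 16 = 0" using w unfolding wx dyadic_witness_def prod.case by (simp only: if_False)
    then have yz: "odd y \<or> odd z" and m16: "16 dvd x * x + a * (y * y) + b * (z * z) - m" by (simp_all only: mod_0_imp_dvd)
    \<comment> \<open>An odd coefficient is known only modulo 8, but the variable is then even and
      its square supplies the missing factor; an even coefficient is known modulo 16.\<close>
    have key: "16 dvd (C - c) * t\<^sup>2" if "dyadic_residue C c" "\<not> (odd c \<and> odd t)" for C c t
    proof (cases "odd c")
      case True
      then have "even t" "8 dvd C - c" using that by (auto simp: dyadic_residue_def)
      then have "8 * 2 dvd (C - c) * t\<^sup>2" by (intro mult_dvd_mono) auto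
      then show ?thesis by simp
    next
      case False
      then show ?thesis using that by (auto simp: dyadic_residue_def)
    qed
    have "16 dvd (A - a) * y\<^sup>2 + (B - b) * z\<^sup>2" using key[OF A] key[OF B] False by (intro dvd_add) auto
    then have "16 dvd x\<^sup>2 + A * y\<^sup>2 + B * z\<^sup>2 - m" unfolding eq using m16 by (rule dvd_add[rotated])
    then show ?thesis using yz False fin2 fin3 ev by blast
  qed
qed

lemma dyadic_solvable_lift:
  assumes "dyadic_residue A a" "dyadic_residue B b" "dyadic_solvable a b m"
  shows "\<exists>v. \<not> vdvd 2 v \<and> 2 ^ k dvd form_eval (diag 1 A B) v - m"
proof -
  obtain w where "dyadic_witness a b m w" using assms(3) unfolding dyadic_solvable_def list_ex_iff by blast
  then show ?thesis using dyadic_witness_lift assms(1,2) by blast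
qed

text \<open>The element of \<open>dyadic_classes\<close> in the square class of 2^j u for odd
  \<open>u\<close>.\<close>

definition dyadic_class :: "nat \<Rightarrow> int \<Rightarrow> int" where
  "dyadic_class j u = (if even j then u mod 8 else 2 * (u mod 8))"

lemma odd_mod_8: "odd (u::int) \<Longrightarrow> u mod 8 \<in> {1, 3, 5, 7}" by (auto simp: even_iff_mod_2_eq_zero) presburger

lemma dyadic_class_in: "odd u \<Longrightarrow> dyadic_class j u \<in> set dyadic_classes"
  using odd_mod_8[of u] by (auto simp: dyadic_class_def dyadic_classes_def)

lemma squarefree_dyadic_residue:
  fixes A :: int
  assumes "squarefree A"
  obtains r where "r \<in> set dyadic_classes" "dyadic_residue A r"
proof (cases "odd A")
  case True
  then have "odd (A mod 8)" by (simp add: odd_iff_mod_2_eq_one mod_mod_cancel)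
  then have "dyadic_residue A (A mod 8)" by (simp add: dyadic_residue_def dvd_minus_mod)
  then show ?thesis using that[of "A mod 8"] odd_mod_8[OF True] by (auto simp: dyadic_classes_def)
next
  case False
  then obtain u where u: "A = 2 * u" by blast
  have "odd u"
  proof
    assume "even u"
    then have "2\<^sup>2 dvd A" by (auto simp: u)
    then have "is_unit (2::int)" using assms squarefreeD by blast
    then show False by simp
  qed
  then have m: "u mod 8 \<in> {1, 3, 5, 7}" by (rule odd_mod_8)
  have "2 * 8 dvd 2 * (u - u mod 8)" using dvd_minus_mod[of 8 u] by (intro mult_dvd_mono) auto
  then have "dyadic_residue A (2 * (u mod 8))" using m by (auto simp: dyadic_residue_def u)
  then show ?thesis using that[of "2 * (u mod 8)"] m by (auto simp: dyadic_classes_def)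
qed

lemma padic_rep_rat_dyadic_class:
  assumes "odd u"
  shows "padic_rep_rat g 2 (2 ^ j * u) \<longleftrightarrow> padic_rep_rat g 2 (dyadic_class j u)"
proof -
  have sc: "padic_rep_rat g 2 (c * v) \<longleftrightarrow> padic_rep_rat g 2 (c * v')" if "odd v" "8 dvd v - v'" for c v v'
  proof -
    have "odd v'" using that by presburger
    moreover have "8 dvd v' - v" using that(2) by (metis dvd_minus_iff minus_diff_eq)
    ultimately show ?thesis using that padic_rep_rat_square_class[of 2 v v' g c] padic_rep_rat_square_class[of 2 v' v g c]
      by (auto simp: unit_exp_def)
  qed
  have d: "8 dvd u - u mod 8" by (rule dvd_minus_mod)
  show ?thesis
  proof (cases "even j")
    case True
    then obtain i where "j = 2 * i" by blast
    then have "(2::int) ^ j * u = 1 * u * (2 ^ i)\<^sup>2" by (simp add: power_mult power2_eq_square power_mult_distrib[symmetric])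
    then show ?thesis using sc[OF assms d, of 1] padic_rep_rat_square_iff[of "2 ^ i" g 2 "1 * u"] True by (simp only: dyadic_class_def if_True) simp
  next
    case False
    then obtain i where "j = 2 * i + 1" using oddE by blast
    then have "(2::int) ^ j * u = 2 * u * (2 ^ i)\<^sup>2" by (simp add: power_mult power2_eq_square power_mult_distrib[symmetric])
    then show ?thesis using sc[OF assms d, of 2] padic_rep_rat_square_iff[of "2 ^ i" g 2 "2 * u"] False by (simp only: dyadic_class_def if_False) simp
  qed
qed

section \<open>Densities of anisotropic forms at 2\<close>

text \<open>The table shows that all classes except that of -AB are represented; representing -AB as
  well would produce a zero by \<open>rep_minus_det_imp_isotropic\<close>. So exactly one class is
  missed.\<close>

lemma dyadic_anisotropic_diag:
  assumes sf: "squarefree A" "squarefree B" and an: "\<not> padic_isotropic (diag 1 A B) 2"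
  obtains c where "c \<in> set dyadic_classes"
    "\<And>n. n \<in> set dyadic_classes \<Longrightarrow> padic_rep_rat (diag 1 A B) 2 n \<longleftrightarrow> n \<noteq> c"
proof -
  obtain a where a: "a \<in> set dyadic_classes" "dyadic_residue A a" using squarefree_dyadic_residue[OF sf(1)] by blast
  obtain b where b: "b \<in> set dyadic_classes" "dyadic_residue B b" using squarefree_dyadic_residue[OF sf(2)] by blast
  have "\<not> dyadic_solvable a b 0"
  proof
    assume "dyadic_solvable a b 0"
    then have "\<exists>v. \<not> vdvd 2 v \<and> 2 ^ k dvd form_eval (diag 1 A B) v - 0" for k by (rule dyadic_solvable_lift[OF a(2) b(2)])
    then have "padic_isotropic (diag 1 A B) 2" unfolding padic_isotropic_def by simp
    then show False using an by blast
  qed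
  then obtain c where c: "c \<in> set dyadic_classes" "dyadic_exceptional a b c"
    "\<And>n. n \<in> set dyadic_classes \<Longrightarrow> n \<noteq> c \<Longrightarrow> dyadic_solvable a b n"
    using dyadic_table a(1) b(1) unfolding list_all_iff list_ex_iff by blast
  have rep: "padic_rep_rat (diag 1 A B) 2 n" if "n \<in> set dyadic_classes" "n \<noteq> c" for n
  proof -
    have "\<exists>v. 2 ^ k dvd form_eval (diag 1 A B) v - n" for k using dyadic_solvable_lift[OF a(2) b(2) c(3)[OF that]] by blast
    then show ?thesis by (intro padic_rep_imp_rat) (simp add: padic_rep_def)
  qed
  have norep: "\<not> padic_rep_rat (diag 1 A B) 2 c"
  proof
    assume r: "padic_rep_rat (diag 1 A B) 2 c"
    note ev = dyadic_residue_even[OF a(2)] dyadic_residue_even[OF b(2)]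
    have sc: "padic_rep_rat (diag 1 A B) 2 (d * v')" if "padic_rep_rat (diag 1 A B) 2 (d * v)" "odd v" "8 dvd v - v'" for d v v'
      using that padic_rep_rat_square_class[of 2 v v' "diag 1 A B" d] by (auto simp: unit_exp_def)
    have AB: "A * B - a * b = (A - a) * b + A * (B - b)" by (simp add: algebra_simps)
    have "padic_rep_rat (diag 1 A B) 2 (- (A * B))"
    proof (cases "odd A \<and> odd B")
      case True
      then have o: "odd a" "odd b" using ev by auto
      then have ce: "odd c" "8 dvd a * b + c" using c(2) by (auto simp: dyadic_exceptional_def)
      have "8 dvd A - a" "8 dvd B - b" using a(2) b(2) o by (auto simp: dyadic_residue_def)
      then have "8 dvd A * B - a * b" unfolding AB by simp
      then have "8 dvd (A * B - a * b) + (a * b + c)" using ce(2) by (rule dvd_add)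
      then have "8 dvd c - (- (A * B))" by (simp add: add.commute)
      then show ?thesis using sc[of 1 c "- (A * B)"] r ce(1) by simp
    next
      case no: False
      show ?thesis
      proof (cases "even A \<and> even B")
        case True
        then have o: "even a" "even b" using ev by auto
        then have ce: "odd c" "32 dvd a * b + 4 * c" using c(2) by (auto simp: dyadic_exceptional_def)
        have "16 dvd A - a" "16 dvd B - b" using a(2) b(2) o by (auto simp: dyadic_residue_def)
        then have "16 * 2 dvd (A - a) * b" "2 * 16 dvd A * (B - b)" using mult_dvd_mono[of 16 "A - a" 2 b] mult_dvd_mono[of 2 A 16 "B - b"] True o by blast+
        then have "32 dvd A * B - a * b" unfolding AB by simp
        then have d: "32 dvd (A * B - a * b) + (a * b + 4 * c)" using ce(2) by (rule dvd_add)
        \<comment> \<open>Halving both coefficients divides AB by the square 4, which does not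
          change its class over the 2-adic field.\<close>
        obtain A' B' where AB': "A = 2 * A'" "B = 2 * B'" using True by (auto elim!: evenE)
        have "4 * 8 dvd 4 * (c - (- (A' * B')))" using d by (simp add: AB' add.commute)
        then have "8 dvd c - (- (A' * B'))" unfolding dvd_mult_cancel_left by simp
        then have "padic_rep_rat (diag 1 A B) 2 (- (A' * B'))" using sc[of 1 c "- (A' * B')"] r ce(1) by simp
        then have "padic_rep_rat (diag 1 A B) 2 (- (A' * B') * 2\<^sup>2)" by (simp only: padic_rep_rat_square_iff)
        moreover have "- (A' * B') * 2\<^sup>2 = - (A * B)" by (simp add: AB')
        ultimately show ?thesis by (simp only:)
      next
        case False
        then have o: "\<not> (odd a \<and> odd b)" "\<not> (even a \<and> even b)" using no ev by auto
        then have ce: "even c" "16 dvd a * b + c" using c(2) unfolding dyadic_exceptional_def by (auto split: if_splits)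
        have "16 dvd A * B - a * b"
        proof (cases "even a")
          case True
          then have "odd b" "even A" using o ev by auto
          then have "16 dvd A - a" "8 dvd B - b" using a(2) b(2) True by (auto simp: dyadic_residue_def)
          then have "16 dvd (A - a) * b" "2 * 8 dvd A * (B - b)" using mult_dvd_mono[of 2 A 8 "B - b"] \<open>even A\<close> by (blast intro: dvd_mult2)+
          then show ?thesis unfolding AB by simp
        next
          case False
          then have "even b" using o by auto
          then have "8 dvd A - a" "16 dvd B - b" using a(2) b(2) False by (auto simp: dyadic_residue_def)
          then have "8 * 2 dvd (A - a) * b" "16 dvd A * (B - b)" using mult_dvd_mono[of 8 "A - a" 2 b] \<open>even b\<close> by (blast intro: dvd_mult)+
          then show ?thesis unfolding AB by simp
        qed
        then have d: "16 dvd (A * B - a * b) + (a * b + c)" using ce(2) by (rule dvd_add)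
        obtain c' where c': "c = 2 * c'" "odd c'" using ce(1) c(1) by (auto simp: dyadic_classes_def)
        have "even (A * B)" using no by auto
        then obtain m where m: "A * B = 2 * m" by blast
        have "2 * 8 dvd 2 * (c' - (- m))" using d by (simp add: m c' add.commute)
        then have "8 dvd c' - (- m)" unfolding dvd_mult_cancel_left by simp
        then show ?thesis using sc[of 2 c' "- m"] r c' by (simp add: m)
      qed
    qed
    then have "padic_isotropic (diag 1 A B) 2" by (rule rep_minus_det_imp_isotropic[OF two_is_prime_nat])
    then show False using an by blast
  qed
  show ?thesis using that[OF c(1)] rep norep by blast
qed

text \<open>The eight pairs of a unit class and one of two consecutive levels correspond to the
  eight square classes. One class is missed, so one level has 3 unit classes and the other
  4.\<close>

lemma dyadic_count_table:
  "list_all (\<lambda>e. list_all (\<lambda>m. list_all (\<lambda>c.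
     let l0 = length (filter (\<lambda>u. dyadic_class e (m * u) \<noteq> c) [1, 3, 5, 7]);
         l1 = length (filter (\<lambda>u. dyadic_class (Suc e) (m * u) \<noteq> c) [1, 3, 5, 7])
     in l0 = 3 \<and> l1 = 4 \<or> l0 = 4 \<and> l1 = 3) dyadic_classes) [1, 3, 5, 7]) [0, 1]"
  unfolding dyadic_class_def dyadic_classes_def by simp

text \<open>The ADC property makes the represented set stable under multiplication and division by 4
  from level 0 on, so no initial terms occur. With l0 and l1 unit classes on levels 0 and 1 the
  series sums to (2 l0 + l1)/12, and (l0, l1) is (3, 4) or (4, 3).\<close>

theorem local_density_dyadic_anisotropic:
  assumes pd: "positive_definite f" and an: "\<not> padic_isotropic f 2"
    and adc: "\<And>n. padic_rep_rat f 2 n \<Longrightarrow> padic_rep f 2 n"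
  shows "\<exists>i\<ge>1. dyadic_order i (local_density f 2)"
proof -
  let ?A = "padic_rep f 2"
  have rr: "?A n \<longleftrightarrow> padic_rep_rat f 2 n" for n using adc padic_rep_imp_rat by blast
  obtain A B M where sf: "squarefree A" "squarefree B" and sim: "rat_similar f (diag 1 A B) M"
    using diagonal_normal_form[OF pd] by blast
  have an': "\<not> padic_isotropic (diag 1 A B) 2" using sim an unfolding rat_similar_def by auto
  obtain c where c: "c \<in> set dyadic_classes"
    "\<And>n. n \<in> set dyadic_classes \<Longrightarrow> padic_rep_rat (diag 1 A B) 2 n \<longleftrightarrow> n \<noteq> c"
    using dyadic_anisotropic_diag[OF sf an'] by blast
  have "M \<noteq> 0" using sim by (simp add: rat_similar_def)
  then obtain \<mu> m where m: "M = 2 ^ \<mu> * m" "odd m" using prime_power_split[of 2 M] by auto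
  \<comment> \<open>The multiplier \<open>M\<close> shifts the level by \<open>\<mu>\<close> and
    multiplies the unit by \<open>m\<close>; only the parity of \<open>\<mu>\<close> and the residue
    of \<open>m\<close> modulo 8 are visible, which leaves the finitely many cases of the
    table.\<close>
  have rep: "?A (2 ^ j * u) \<longleftrightarrow> dyadic_class (\<mu> mod 2 + j) (m mod 8 * u) \<noteq> c" if "odd u" for j u
  proof -
    have "?A (2 ^ j * u) \<longleftrightarrow> padic_rep_rat (diag 1 A B) 2 (M * (2 ^ j * u))" unfolding rr using sim unfolding rat_similar_def by auto
    also have "M * (2 ^ j * u) = 2 ^ (\<mu> + j) * (m * u)" by (simp add: m power_add mult_ac)
    also have "padic_rep_rat (diag 1 A B) 2 \<dots> \<longleftrightarrow> dyadic_class (\<mu> + j) (m * u) \<noteq> c"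
      using padic_rep_rat_dyadic_class[of "m * u" "diag 1 A B" "\<mu> + j"] c(2) dyadic_class_in[of "m * u" "\<mu> + j"] that m by simp
    also have "dyadic_class (\<mu> + j) (m * u) = dyadic_class (\<mu> mod 2 + j) (m mod 8 * u)"
      unfolding dyadic_class_def by (simp add: mod_mult_left_eq)
    finally show ?thesis .
  qed
  have cnt: "unit_count ?A 2 j = length (filter (\<lambda>u. dyadic_class (\<mu> mod 2 + j) (m mod 8 * u) \<noteq> c) [1, 3, 5, 7])" for j
  proof -
    have "{u\<in>{0..<int 2 ^ unit_exp 2}. \<not> int 2 dvd u \<and> ?A (int 2 ^ j * u)} = {u\<in>set [1, 3, 5, 7]. dyadic_class (\<mu> mod 2 + j) (m mod 8 * u) \<noteq> c}"
    proof (intro equalityI subsetI)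
      fix u :: int assume "u \<in> {u\<in>{0..<int 2 ^ unit_exp 2}. \<not> int 2 dvd u \<and> ?A (int 2 ^ j * u)}"
      then have u: "0 \<le> u" "u < 8" "odd u" "?A (2 ^ j * u)" by (auto simp: unit_exp_def)
      then have "u \<in> {1, 3, 5, 7}" using odd_mod_8[of u] by simp
      then show "u \<in> {u\<in>set [1, 3, 5, 7]. dyadic_class (\<mu> mod 2 + j) (m mod 8 * u) \<noteq> c}" using rep[OF u(3)] u(4) by simp
    next
      fix u :: int assume u: "u \<in> {u\<in>set [1, 3, 5, 7]. dyadic_class (\<mu> mod 2 + j) (m mod 8 * u) \<noteq> c}"
      then have "odd u" "0 \<le> u" "u < 8" by auto
      then show "u \<in> {u\<in>{0..<int 2 ^ unit_exp 2}. \<not> int 2 dvd u \<and> ?A (int 2 ^ j * u)}" using rep[of u j] u by (simp add: unit_exp_def)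
    qed
    also have "\<dots> = set (filter (\<lambda>u. dyadic_class (\<mu> mod 2 + j) (m mod 8 * u) \<noteq> c) [1, 3, 5, 7])" by (simp only: set_filter)
    finally have "unit_count ?A 2 j = card (set (filter (\<lambda>u. dyadic_class (\<mu> mod 2 + j) (m mod 8 * u) \<noteq> c) [1, 3, 5, 7]))"
      unfolding unit_count_def by (rule arg_cong)
    also have "\<dots> = length (filter (\<lambda>u. dyadic_class (\<mu> mod 2 + j) (m mod 8 * u) \<noteq> c) [1, 3, 5, 7])"
      by (rule distinct_card) (rule distinct_filter, simp)
    finally show ?thesis .
  qed
  have "\<mu> mod 2 \<in> set [0, 1]" "m mod 8 \<in> set [1, 3, 5, 7]" using odd_mod_8[OF m(2)] by auto
  then have tab: "unit_count ?A 2 0 = 3 \<and> unit_count ?A 2 1 = 4 \<or> unit_count ?A 2 0 = 4 \<and> unit_count ?A 2 1 = 3"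
    using dyadic_count_table c(1) unfolding list_all_iff Let_def cnt add_0_right One_nat_def add_Suc_right by blast
  have "local_density f 2 = (\<Sum>j<0. real (unit_count ?A 2 j) / real 2 ^ (j + unit_exp 2))
     + (real (unit_count ?A 2 0) / real 2 ^ (0 + unit_exp 2) + real (unit_count ?A 2 (0 + 1)) / real 2 ^ (0 + 1 + unit_exp 2)) / (1 - 1 / (real 2)\<^sup>2)"
  proof (rule square_class_density[OF two_is_prime_nat square_class_closed_padic_rep[OF two_is_prime_nat] padic_rep_density[OF two_is_prime_nat]])
    fix n assume "int 2 ^ (0 + 2) dvd n"
    then obtain d where d: "n = d * 2\<^sup>2" by (auto elim!: dvdE)
    then have "n div (int 2)\<^sup>2 = d" by simp
    moreover have "?A (d * 2\<^sup>2) \<longleftrightarrow> ?A d" unfolding rr by (rule padic_rep_rat_square_iff) simp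
    ultimately show "?A n \<longleftrightarrow> ?A (n div (int 2)\<^sup>2)" unfolding d by simp
  qed
  then have ld: "local_density f 2 = (2 * real (unit_count ?A 2 0) + real (unit_count ?A 2 1)) / 12" by (simp add: unit_exp_def field_simps)
  from tab show ?thesis
  proof
    assume "unit_count ?A 2 0 = 3 \<and> unit_count ?A 2 1 = 4"
    then have "local_density f 2 = of_int 5 / (2 ^ 1 * of_int 3)" using ld by simp
    then have "dyadic_order 1 (local_density f 2)" unfolding dyadic_order_def by (intro exI[of _ 5] exI[of _ 3]) simp
    then show ?thesis by blast
  next
    assume "unit_count ?A 2 0 = 4 \<and> unit_count ?A 2 1 = 3"
    then have "local_density f 2 = of_int 11 / (2 ^ 2 * of_int 3)" using ld by simp
    then have "dyadic_order 2 (local_density f 2)" unfolding dyadic_order_def by (intro exI[of _ 11] exI[of _ 3]) simp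
    then show ?thesis by (intro exI[of _ 2]) simp
  qed
qed

section \<open>Passage to the completions\<close>

text \<open>Membership in p^k times the localisation of the integers at \<open>p\<close>. It
  replaces inequalities between real absolute values by divisibility, for which sums and products
  are algebraic.\<close>

definition padic_dvd :: "nat \<Rightarrow> nat \<Rightarrow> rat \<Rightarrow> bool" where
  "padic_dvd p k x \<longleftrightarrow> (\<exists>a b :: int. \<not> int p dvd b \<and> x = of_int (int p ^ k * a) / of_int b)"

lemma padic_dvdI: "\<not> int p dvd b \<Longrightarrow> x = of_int (int p ^ k * a) / of_int b \<Longrightarrow> padic_dvd p k x"
  unfolding padic_dvd_def by blast

lemma padic_dvd_of_int: "int p ^ k dvd z \<Longrightarrow> prime p \<Longrightarrow> padic_dvd p k (of_int z)"
  by (rule padic_dvdI[of _ 1 _ _ "z div int p ^ k"]) auto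

lemma padic_dvd_of_int_iff:
  assumes p: "prime p" shows "padic_dvd p k (of_int z) \<longleftrightarrow> int p ^ k dvd z"
proof
  assume "padic_dvd p k (of_int z)"
  then obtain a b where b: "\<not> int p dvd b" "of_int z = (of_int (int p ^ k * a) / of_int b :: rat)" unfolding padic_dvd_def by blast
  have "b \<noteq> 0" using b(1) by auto
  then have "of_int (z * b) = (of_int (int p ^ k * a) :: rat)" using b(2) by (simp add: field_simps)
  then have "z * b = int p ^ k * a" by (simp only: of_int_eq_iff)
  then have "int p ^ k dvd z * b" by simp
  moreover have "coprime (int p ^ k) b" using p b(1) by (simp add: prime_imp_coprime)
  ultimately show "int p ^ k dvd z" by (simp add: coprime_dvd_mult_left_iff)
qed (use p padic_dvd_of_int in blast)

lemma padic_dvd_0 [simp]: "prime p \<Longrightarrow> padic_dvd p k 0"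
  by (rule padic_dvdI[of _ 1 _ _ 0]) auto

lemma padic_dvd_add:
  assumes p: "prime p" and x: "padic_dvd p k x" and y: "padic_dvd p k y" shows "padic_dvd p k (x + y)"
proof -
  obtain a b c d where b: "\<not> int p dvd b" "x = of_int (int p ^ k * a) / of_int b"
    and d: "\<not> int p dvd d" "y = of_int (int p ^ k * c) / of_int d" using x y unfolding padic_dvd_def by blast
  have nz: "b \<noteq> 0" "d \<noteq> 0" using b d by auto
  show ?thesis
  proof (rule padic_dvdI)
    show "\<not> int p dvd b * d" using b d p by (simp add: prime_dvd_mult_iff)
    show "x + y = of_int (int p ^ k * (a * d + c * b)) / of_int (b * d)"
      using nz unfolding b(2) d(2) by (simp add: field_simps)
  qed
qed

lemma padic_dvd_mult:
  assumes p: "prime p" and x: "padic_dvd p k x" and y: "padic_dvd p l y" shows "padic_dvd p (k + l) (x * y)"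
proof -
  obtain a b c d where b: "\<not> int p dvd b" "x = of_int (int p ^ k * a) / of_int b"
    and d: "\<not> int p dvd d" "y = of_int (int p ^ l * c) / of_int d" using x y unfolding padic_dvd_def by blast
  show ?thesis
  proof (rule padic_dvdI)
    show "\<not> int p dvd b * d" using b d p by (simp add: prime_dvd_mult_iff)
    show "x * y = of_int (int p ^ (k + l) * (a * c)) / of_int (b * d)"
      unfolding b(2) d(2) by (simp add: power_add mult_ac)
  qed
qed

lemma padic_dvd_minus: "padic_dvd p k x \<Longrightarrow> padic_dvd p k (- x)"
  unfolding padic_dvd_def by (metis minus_divide_left mult_minus_right of_int_minus)

lemma padic_dvd_diff: "prime p \<Longrightarrow> padic_dvd p k x \<Longrightarrow> padic_dvd p k y \<Longrightarrow> padic_dvd p k (x - y)"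
  using padic_dvd_add[of p k x "- y"] padic_dvd_minus by simp

lemma padic_dvd_cancel:
  assumes p: "prime p" and x: "padic_dvd p (k + m) (of_nat p ^ m * x)" shows "padic_dvd p k x"
proof -
  obtain a b where b: "\<not> int p dvd b" "of_nat p ^ m * x = of_int (int p ^ (k + m) * a) / of_int b" using x unfolding padic_dvd_def by blast
  have "(of_nat p :: rat) ^ m \<noteq> 0" using p by (simp add: prime_gt_0_nat)
  moreover have "of_nat p ^ m * x = of_nat p ^ m * (of_int (int p ^ k * a) / of_int b)" unfolding b(2) by (simp add: power_add mult_ac)
  ultimately have "x = of_int (int p ^ k * a) / of_int b" by (simp only: mult_cancel_left) blast
  then show ?thesis using b(1) padic_dvdI by blast
qed

lemma padic_val_fraction:
  assumes p: "prime p" and "a \<noteq> 0" "b \<noteq> 0"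
  shows "padic_val p (of_int a / of_int b) = int (multiplicity (int p) a) - int (multiplicity (int p) b)"
proof -
  obtain c d where cd: "quotient_of (of_int a / of_int b) = (c, d)" by (metis surj_pair)
  have d0: "d > 0" using cd by (rule quotient_of_denom_pos)
  have "(of_int a / of_int b :: rat) = of_int c / of_int d" using cd by (rule quotient_of_div)
  then have "of_int (a * d) = (of_int (c * b) :: rat)" using assms d0 by (simp add: field_simps)
  then have e: "a * d = c * b" by (simp only: of_int_eq_iff)
  then have "c \<noteq> 0" using assms d0 by auto
  moreover have "prime_elem (int p)" using p by (simp add: prime_imp_prime_elem)
  ultimately have "multiplicity (int p) a + multiplicity (int p) d = multiplicity (int p) c + multiplicity (int p) b"
    using e assms d0 prime_elem_multiplicity_mult_distrib[of "int p"] by (metis less_irrefl)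
  then show ?thesis by (simp add: padic_val_def cd)
qed

text \<open>Balls around 0 of radius p^(-k) are exactly these submodules; one direction reads the
  valuation off the reduced fraction, whose denominator must then be prime to
  \<open>p\<close>.\<close>

lemma padic_abs_le_iff:
  assumes p: "prime p" shows "padic_abs p x \<le> 1 / real p ^ k \<longleftrightarrow> padic_dvd p k x"
proof (cases "x = 0")
  case True
  then show ?thesis using p by (simp add: padic_abs_def)
next
  case False
  have p1: "real p > 1" using p prime_gt_1_nat by simp
  have pe: "prime_elem (int p)" using p by (simp add: prime_imp_prime_elem)
  have "1 / real p ^ k = real p powi (- int k)" by (simp add: power_int_minus inverse_eq_divide)
  then have "padic_abs p x \<le> 1 / real p ^ k \<longleftrightarrow> int k \<le> padic_val p x"
    using False power_int_increasing[of "- padic_val p x" "- int k" "real p"] power_int_strict_increasing[of "- int k" "- padic_val p x" "real p"] p1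
    by (auto simp: padic_abs_def not_le[symmetric])
  also have "\<dots> \<longleftrightarrow> padic_dvd p k x"
  proof
    assume v: "int k \<le> padic_val p x"
    obtain c d where cd: "quotient_of x = (c, d)" by (metis surj_pair)
    have d0: "d > 0" using cd by (rule quotient_of_denom_pos)
    have xe: "x = of_int c / of_int d" using cd by (rule quotient_of_div)
    have cop: "coprime c d" using cd by (rule quotient_of_coprime)
    have le: "k + multiplicity (int p) d \<le> multiplicity (int p) c" using v by (simp add: padic_val_def cd)
    have "\<not> int p dvd d"
    proof
      assume d: "int p dvd d"
      then have "\<not> int p dvd c" using cop p by (metis coprime_common_divisor not_prime_unit prime_int_nat_transfer nat_int of_nat_0_le_iff prime_nat_int_transfer)
      then have "multiplicity (int p) c = 0" by (rule not_dvd_imp_multiplicity_0)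
      moreover have "multiplicity (int p) d > 0" using d d0 p
        by (metis multiplicity_eq_zero_iff not_prime_unit prime_nat_int_transfer gr_zeroI less_irrefl)
      ultimately show False using le by simp
    qed
    moreover have "int p ^ k dvd c" using le by (intro multiplicity_dvd') simp
    then obtain a where "c = int p ^ k * a" by (auto elim!: dvdE)
    ultimately show "padic_dvd p k x" using xe padic_dvdI by blast
  next
    assume "padic_dvd p k x"
    then obtain a b where b: "\<not> int p dvd b" "x = of_int (int p ^ k * a) / of_int b" unfolding padic_dvd_def by blast
    have nz: "int p ^ k * a \<noteq> 0" "b \<noteq> 0" using False b by auto
    have "multiplicity (int p) b = 0" using b(1) by (rule not_dvd_imp_multiplicity_0)
    moreover have "k \<le> multiplicity (int p) (int p ^ k * a)"
      using nz p by (intro multiplicity_geI) auto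
    ultimately show "int k \<le> padic_val p x" unfolding b(2) using padic_val_fraction[OF p nz] by simp
  qed
  finally show ?thesis .
qed

lemma padic_abs_nonneg: "padic_abs p x \<ge> 0" by (simp add: padic_abs_def)

lemma small_prime_power:
  assumes p: "prime p" and "e > 0" obtains k where "1 / real p ^ k < e"
proof -
  have "1 / real p < 1" using prime_gt_1_nat[OF p] by simp
  then obtain k where "(1 / real p) ^ k < e" using real_arch_pow_inv[OF assms(2)] by blast
  then show ?thesis using that[of k] by (simp add: power_one_over)
qed

section \<open>Cauchy sequences and null sequences\<close>

lemma padic_Cauchy_iff:
  assumes p: "prime p"
  shows "padic_Cauchy p s \<longleftrightarrow> (\<forall>k. \<exists>N. \<forall>m\<ge>N. \<forall>n\<ge>N. padic_dvd p k (s m - s n))"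
proof
  assume c: "padic_Cauchy p s"
  show "\<forall>k. \<exists>N. \<forall>m\<ge>N. \<forall>n\<ge>N. padic_dvd p k (s m - s n)"
  proof
    fix k
    have "1 / real p ^ k > 0" using p by (simp add: prime_gt_0_nat)
    then obtain N where "\<And>m n. m \<ge> N \<Longrightarrow> n \<ge> N \<Longrightarrow> padic_abs p (s m - s n) < 1 / real p ^ k" using c unfolding padic_Cauchy_def by blast
    then show "\<exists>N. \<forall>m\<ge>N. \<forall>n\<ge>N. padic_dvd p k (s m - s n)" using padic_abs_le_iff[OF p] by (meson less_imp_le)
  qed
next
  assume c: "\<forall>k. \<exists>N. \<forall>m\<ge>N. \<forall>n\<ge>N. padic_dvd p k (s m - s n)"
  show "padic_Cauchy p s" unfolding padic_Cauchy_def
  proof (intro allI impI)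
    fix e :: real assume "e > 0"
    then obtain k where k: "1 / real p ^ k < e" using small_prime_power[OF p] by blast
    obtain N where "\<forall>m\<ge>N. \<forall>n\<ge>N. padic_dvd p k (s m - s n)" using c by blast
    then show "\<exists>N. \<forall>m\<ge>N. \<forall>n\<ge>N. padic_abs p (s m - s n) < e" using padic_abs_le_iff[OF p] k by (meson le_less_trans)
  qed
qed

lemma padic_null_iff:
  assumes p: "prime p"
  shows "padic_null p s \<longleftrightarrow> (\<forall>k. \<exists>N. \<forall>n\<ge>N. padic_dvd p k (s n))"
proof
  assume c: "padic_null p s"
  show "\<forall>k. \<exists>N. \<forall>n\<ge>N. padic_dvd p k (s n)"
  proof
    fix k
    have "1 / real p ^ k > 0" using p by (simp add: prime_gt_0_nat)
    then obtain N where "\<And>n. n \<ge> N \<Longrightarrow> norm (padic_abs p (s n) - 0) < 1 / real p ^ k" using c LIMSEQ_D unfolding padic_null_def by blast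
    then have "padic_abs p (s n) \<le> 1 / real p ^ k" if "n \<ge> N" for n using that padic_abs_nonneg[of p "s n"] by fastforce
    then show "\<exists>N. \<forall>n\<ge>N. padic_dvd p k (s n)" using padic_abs_le_iff[OF p] by blast
  qed
next
  assume c: "\<forall>k. \<exists>N. \<forall>n\<ge>N. padic_dvd p k (s n)"
  show "padic_null p s" unfolding padic_null_def
  proof (rule LIMSEQ_I)
    fix e :: real assume "e > 0"
    then obtain k where k: "1 / real p ^ k < e" using small_prime_power[OF p] by blast
    obtain N where "\<forall>n\<ge>N. padic_dvd p k (s n)" using c by blast
    then have "norm (padic_abs p (s n) - 0) < e" if "n \<ge> N" for n
      using that k padic_abs_le_iff[OF p, of "s n" k] padic_abs_nonneg[of p "s n"] by auto
    then show "\<exists>N. \<forall>n\<ge>N. norm (padic_abs p (s n) - 0) < e" by blast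
  qed
qed

lemma padic_Cauchy_const: "prime p \<Longrightarrow> padic_Cauchy p (\<lambda>n. c)"
  by (simp add: padic_Cauchy_iff)

lemma padic_null_Cauchy:
  assumes p: "prime p" and "padic_null p s" shows "padic_Cauchy p s"
  unfolding padic_Cauchy_iff[OF p] using assms(2)[unfolded padic_null_iff[OF p]] padic_dvd_diff[OF p] by meson

lemma padic_Cauchy_add:
  assumes p: "prime p" and s: "padic_Cauchy p s" and t: "padic_Cauchy p t"
  shows "padic_Cauchy p (\<lambda>n. s n + t n)"
  unfolding padic_Cauchy_iff[OF p]
proof
  fix k
  obtain N M where N: "\<forall>m\<ge>N. \<forall>n\<ge>N. padic_dvd p k (s m - s n)" and M: "\<forall>m\<ge>M. \<forall>n\<ge>M. padic_dvd p k (t m - t n)"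
    using s t unfolding padic_Cauchy_iff[OF p] by blast
  have "padic_dvd p k (s m + t m - (s n + t n))" if "m \<ge> max N M" "n \<ge> max N M" for m n
  proof -
    have "padic_dvd p k ((s m - s n) + (t m - t n))" using that N M by (intro padic_dvd_add[OF p]) auto
    then show ?thesis by (simp add: algebra_simps)
  qed
  then show "\<exists>N. \<forall>m\<ge>N. \<forall>n\<ge>N. padic_dvd p k (s m + t m - (s n + t n))" by blast
qed

lemma padic_Cauchy_uminus:
  assumes p: "prime p" and s: "padic_Cauchy p s" shows "padic_Cauchy p (\<lambda>n. - s n)"
proof -
  have e: "- s m - - s n = s n - s m" for m n by simp
  show ?thesis unfolding padic_Cauchy_iff[OF p] e
  proof
    fix k
    obtain N where "\<forall>m\<ge>N. \<forall>n\<ge>N. padic_dvd p k (s m - s n)" using s unfolding padic_Cauchy_iff[OF p] by blast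
    then show "\<exists>N. \<forall>m\<ge>N. \<forall>n\<ge>N. padic_dvd p k (s n - s m)" by blast
  qed
qed

lemma padic_bounded_denominator:
  assumes p: "prime p" shows "\<exists>m. padic_dvd p 0 (of_nat p ^ m * x)"
proof -
  obtain c d where cd: "quotient_of x = (c, d)" by (metis surj_pair)
  have d0: "d > 0" using cd by (rule quotient_of_denom_pos)
  have xe: "x = of_int c / of_int d" using cd by (rule quotient_of_div)
  obtain m e where d: "d = int p ^ m * e" "\<not> int p dvd e" using prime_power_split[OF p, of d] d0 by auto
  have "p > 0" using p by (rule prime_gt_0_nat)
  then have "of_nat p ^ m * x = of_int (int p ^ 0 * c) / of_int e" unfolding xe d(1) by simp
  then show ?thesis using d(2) padic_dvdI by blast
qed

lemma padic_Cauchy_bounded: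
  assumes p: "prime p" and s: "padic_Cauchy p s"
  obtains m where "\<And>n. padic_dvd p 0 (of_nat p ^ m * s n)"
proof -
  obtain N where N: "\<And>m n. m \<ge> N \<Longrightarrow> n \<ge> N \<Longrightarrow> padic_dvd p 0 (s m - s n)" using s unfolding padic_Cauchy_iff[OF p] by blast
  have pint: "padic_dvd p 0 (of_nat p ^ j)" for j using padic_dvd_of_int[of p 0 "int p ^ j"] p by simp
  have up: "padic_dvd p 0 (of_nat p ^ j * x)" if "padic_dvd p 0 (of_nat p ^ i * x)" "i \<le> j" for i j x
  proof -
    have "padic_dvd p (0 + 0) (of_nat p ^ (j - i) * (of_nat p ^ i * x))" using pint that(1) by (rule padic_dvd_mult[OF p])
    moreover have "of_nat p ^ (j - i) * (of_nat p ^ i * x) = of_nat p ^ j * x" using that(2) by (simp add: mult.assoc[symmetric] power_add[symmetric])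
    ultimately show ?thesis by simp
  qed
  define M where "M n = (SOME m. padic_dvd p 0 (of_nat p ^ m * s n))" for n
  have M: "padic_dvd p 0 (of_nat p ^ M n * s n)" for n unfolding M_def using padic_bounded_denominator[OF p] by (rule someI_ex)
  define m where "m = Max (M ` {..N})"
  have small: "padic_dvd p 0 (of_nat p ^ m * s n)" if "n \<le> N" for n
    using M by (rule up) (use that in \<open>auto simp: m_def\<close>)
  have "padic_dvd p 0 (of_nat p ^ m * s n)" for n
  proof (cases "n \<le> N")
    case False
    then have "padic_dvd p (0 + 0) (of_nat p ^ m * (s n - s N))" using pint N[of n N] by (intro padic_dvd_mult[OF p]) auto
    then have "padic_dvd p 0 (of_nat p ^ m * (s n - s N) + of_nat p ^ m * s N)" using small[of N] by (intro padic_dvd_add[OF p]) auto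
    then show ?thesis by (simp add: algebra_simps)
  qed (use small in blast)
  then show ?thesis using that by blast
qed

text \<open>A denominator bounded by p^m in one factor costs \<open>m\<close> in the precision of
  the other; this is the estimate behind closure of Cauchy and null sequences under
  products.\<close>

lemma padic_bounded_mult:
  assumes p: "prime p" and s: "padic_dvd p 0 (of_nat p ^ m * x)" and t: "padic_dvd p (k + m) y"
  shows "padic_dvd p k (x * y)"
proof -
  have "padic_dvd p (0 + (k + m)) ((of_nat p ^ m * x) * y)" using s t by (rule padic_dvd_mult[OF p])
  then have "padic_dvd p (k + m) (of_nat p ^ m * (x * y))" by (simp add: mult.assoc)
  then show ?thesis by (rule padic_dvd_cancel[OF p])
qed

lemma padic_Cauchy_mult:
  assumes p: "prime p" and s: "padic_Cauchy p s" and t: "padic_Cauchy p t"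
  shows "padic_Cauchy p (\<lambda>n. s n * t n)"
  unfolding padic_Cauchy_iff[OF p]
proof
  fix k
  obtain a where a: "\<And>n. padic_dvd p 0 (of_nat p ^ a * s n)" using padic_Cauchy_bounded[OF p s] by blast
  obtain b where b: "\<And>n. padic_dvd p 0 (of_nat p ^ b * t n)" using padic_Cauchy_bounded[OF p t] by blast
  obtain N M where N: "\<forall>m\<ge>N. \<forall>n\<ge>N. padic_dvd p (k + b) (s m - s n)" and M: "\<forall>m\<ge>M. \<forall>n\<ge>M. padic_dvd p (k + a) (t m - t n)"
    using s t unfolding padic_Cauchy_iff[OF p] by blast
  have "padic_dvd p k (s m * t m - s n * t n)" if "m \<ge> max N M" "n \<ge> max N M" for m n
  proof -
    have "padic_dvd p k (s m * (t m - t n))" using that M by (intro padic_bounded_mult[OF p a]) auto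
    moreover have "padic_dvd p k (t n * (s m - s n))" using that N by (intro padic_bounded_mult[OF p b]) auto
    ultimately have "padic_dvd p k (s m * (t m - t n) + t n * (s m - s n))" by (rule padic_dvd_add[OF p])
    then show ?thesis by (simp add: algebra_simps)
  qed
  then show "\<exists>N. \<forall>m\<ge>N. \<forall>n\<ge>N. padic_dvd p k (s m * t m - s n * t n)" by blast
qed

lemma padic_null_mult:
  assumes p: "prime p" and s: "padic_Cauchy p s" and t: "padic_null p t"
  shows "padic_null p (\<lambda>n. s n * t n)"
proof -
  obtain a where a: "\<And>n. padic_dvd p 0 (of_nat p ^ a * s n)" using padic_Cauchy_bounded[OF p s] by blast
  show ?thesis using t padic_bounded_mult[OF p a] unfolding padic_null_iff[OF p] by meson
qed

lemma padic_null_add: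
  assumes p: "prime p" and s: "padic_null p s" and t: "padic_null p t"
  shows "padic_null p (\<lambda>n. s n + t n)"
  unfolding padic_null_iff[OF p]
proof
  fix k
  obtain N M where "\<forall>n\<ge>N. padic_dvd p k (s n)" "\<forall>n\<ge>M. padic_dvd p k (t n)" using s t unfolding padic_null_iff[OF p] by blast
  then have "\<forall>n\<ge>max N M. padic_dvd p k (s n + t n)" using padic_dvd_add[OF p] by simp
  then show "\<exists>N. \<forall>n\<ge>N. padic_dvd p k (s n + t n)" by blast
qed

lemma padic_null_uminus:
  assumes p: "prime p" and s: "padic_null p s" shows "padic_null p (\<lambda>n. - s n)"
  using s padic_dvd_minus unfolding padic_null_iff[OF p] by meson

section \<open>The ring of Cauchy sequences and its quotient\<close>

lemma padic_Cauchy_ring_simps [simp]: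
  "carrier (padic_Cauchy_ring p) = {s. padic_Cauchy p s}"
  "s \<otimes>\<^bsub>padic_Cauchy_ring p\<^esub> t = (\<lambda>n. s n * t n)" "\<one>\<^bsub>padic_Cauchy_ring p\<^esub> = (\<lambda>n. 1)"
  "s \<oplus>\<^bsub>padic_Cauchy_ring p\<^esub> t = (\<lambda>n. s n + t n)" "\<zero>\<^bsub>padic_Cauchy_ring p\<^esub> = (\<lambda>n. 0)"
  by (simp_all add: padic_Cauchy_ring_def)

lemma padic_Cauchy_ring_cring: assumes p: "prime p" shows "cring (padic_Cauchy_ring p)"
proof (rule cringI)
  show "abelian_group (padic_Cauchy_ring p)"
  proof (rule abelian_groupI)
    fix x assume "x \<in> carrier (padic_Cauchy_ring p)"
    then show "\<exists>y\<in>carrier (padic_Cauchy_ring p). y \<oplus>\<^bsub>padic_Cauchy_ring p\<^esub> x = \<zero>\<^bsub>padic_Cauchy_ring p\<^esub>"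
      using padic_Cauchy_uminus[OF p] by (intro bexI[of _ "\<lambda>n. - x n"]) auto
  qed (auto simp: padic_Cauchy_add[OF p] padic_Cauchy_const[OF p] add_ac)
  show "comm_monoid (padic_Cauchy_ring p)"
    by (rule comm_monoidI) (auto simp: padic_Cauchy_mult[OF p] padic_Cauchy_const[OF p] mult_ac)
qed (auto simp: algebra_simps)

lemma padic_Cauchy_ring_uminus:
  assumes p: "prime p" and s: "padic_Cauchy p s" shows "\<ominus>\<^bsub>padic_Cauchy_ring p\<^esub> s = (\<lambda>n. - s n)"
proof -
  interpret cring "padic_Cauchy_ring p" by (rule padic_Cauchy_ring_cring[OF p])
  show ?thesis using s padic_Cauchy_uminus[OF p s] by (intro minus_equality) auto
qed

lemma padic_null_ideal: assumes p: "prime p" shows "ideal {s. padic_null p s} (padic_Cauchy_ring p)"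
proof (rule idealI)
  interpret cring "padic_Cauchy_ring p" by (rule padic_Cauchy_ring_cring[OF p])
  show "ring (padic_Cauchy_ring p)" by (rule ring_axioms)
  show "subgroup {s. padic_null p s} (add_monoid (padic_Cauchy_ring p))"
  proof (rule add.subgroupI)
    show "{s. padic_null p s} \<subseteq> carrier (padic_Cauchy_ring p)" using padic_null_Cauchy[OF p] by auto
    have "padic_null p (\<lambda>n. 0)" using p by (simp add: padic_null_iff)
    then show "{s. padic_null p s} \<noteq> {}" by blast
  qed (auto simp: padic_null_add[OF p] padic_Cauchy_ring_uminus[OF p] padic_null_Cauchy[OF p] padic_null_uminus[OF p])
  show "x \<otimes>\<^bsub>padic_Cauchy_ring p\<^esub> a \<in> {s. padic_null p s}" if "a \<in> {s. padic_null p s}" "x \<in> carrier (padic_Cauchy_ring p)" for a x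
    using that padic_null_mult[OF p] by auto
  then show "a \<otimes>\<^bsub>padic_Cauchy_ring p\<^esub> x \<in> {s. padic_null p s}" if "a \<in> {s. padic_null p s}" "x \<in> carrier (padic_Cauchy_ring p)" for a x
    using that by (simp add: mult.commute)
qed

definition padic_class :: "nat \<Rightarrow> (nat \<Rightarrow> rat) \<Rightarrow> (nat \<Rightarrow> rat) set" where
  "padic_class p s = {s. padic_null p s} +>\<^bsub>padic_Cauchy_ring p\<^esub> s"

lemma padic_class_hom: assumes "prime p" shows "ring_hom_ring (padic_Cauchy_ring p) (Qp p) (padic_class p)"
proof -
  have "padic_class p = (+>\<^bsub>padic_Cauchy_ring p\<^esub>) {s. padic_null p s}" by (rule ext) (simp add: padic_class_def)
  then show ?thesis using ideal.rcos_ring_hom_ring[OF padic_null_ideal[OF assms]] unfolding Qp_def by simp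
qed

lemma add_pow_padic_Cauchy_ring:
  assumes p: "prime p" and s: "padic_Cauchy p s"
  shows "[(k::int)] \<cdot>\<^bsub>padic_Cauchy_ring p\<^esub> s = (\<lambda>n. of_int k * s n)"
proof -
  interpret cring "padic_Cauchy_ring p" by (rule padic_Cauchy_ring_cring[OF p])
  have nat: "[(j::nat)] \<cdot>\<^bsub>padic_Cauchy_ring p\<^esub> s = (\<lambda>n. of_nat j * s n)" for j
    by (induction j) (simp_all add: add.nat_pow_Suc algebra_simps)
  have c: "padic_Cauchy p (\<lambda>n. of_nat j * s n)" for j using padic_Cauchy_mult[OF p padic_Cauchy_const[OF p] s] .
  show ?thesis
  proof (cases "k \<ge> 0")
    case True
    then show ?thesis by (simp add: add_pow_int_ge nat)
  next
    case False
    then have "k < 0" by simp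
    then show ?thesis unfolding add_pow_int_lt[OF \<open>k < 0\<close>] nat padic_Cauchy_ring_uminus[OF p c] by (intro ext) simp
  qed
qed

lemma form_eval_in_Qp:
  assumes p: "prime p" and c: "padic_Cauchy p a" "padic_Cauchy p b" "padic_Cauchy p c"
  shows "form_eval_in (Qp p) f (padic_class p a, padic_class p b, padic_class p c) =
    padic_class p (\<lambda>n. form_eval f (a n, b n, c n))"
    and "padic_Cauchy p (\<lambda>n. form_eval f (a n, b n, c n))"
proof -
  interpret ring_hom_ring "padic_Cauchy_ring p" "Qp p" "padic_class p" by (rule padic_class_hom[OF p])
  have pow: "[(k::int)] \<cdot>\<^bsub>Qp p\<^esub> padic_class p s = padic_class p (\<lambda>n. of_int k * s n)" if "padic_Cauchy p s" for k s
  proof -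
    have "padic_class p ([k] \<cdot>\<^bsub>padic_Cauchy_ring p\<^esub> s) = [k] \<cdot>\<^bsub>Qp p\<^esub> padic_class p s"
      unfolding add_pow_def
    proof (rule Group.hom_int_pow[OF _ _ R.a_group S.a_group])
      show "padic_class p \<in> hom (add_monoid (padic_Cauchy_ring p)) (add_monoid (Qp p))"
        unfolding hom_def by (simp del: padic_Cauchy_ring_simps)
    qed (use that in simp)
    then show ?thesis using add_pow_padic_Cauchy_ring[OF p that] by simp
  qed
  have mul: "padic_class p s \<otimes>\<^bsub>Qp p\<^esub> padic_class p t = padic_class p (\<lambda>n. s n * t n)" if "padic_Cauchy p s" "padic_Cauchy p t" for s t
    using hom_mult[of s t] that by simp
  have ad: "padic_class p s \<oplus>\<^bsub>Qp p\<^esub> padic_class p t = padic_class p (\<lambda>n. s n + t n)" if "padic_Cauchy p s" "padic_Cauchy p t" for s t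
    using hom_add[of s t] that by simp
  note C = padic_Cauchy_mult[OF p] padic_Cauchy_add[OF p] padic_Cauchy_const[OF p] c
  show "form_eval_in (Qp p) f (padic_class p a, padic_class p b, padic_class p c) =
    padic_class p (\<lambda>n. form_eval f (a n, b n, c n))"
    unfolding form_eval_in_def form_eval_def prod.case by (simp only: mul ad pow C)
  show "padic_Cauchy p (\<lambda>n. form_eval f (a n, b n, c n))"
    unfolding form_eval_def prod.case by (intro C)
qed

lemma padic_class_eq_iff:
  assumes p: "prime p" and c: "padic_Cauchy p s" "padic_Cauchy p t"
  shows "padic_class p s = padic_class p t \<longleftrightarrow> padic_null p (\<lambda>n. s n - t n)"
proof -
  interpret I: ideal "{s. padic_null p s}" "padic_Cauchy_ring p" by (rule padic_null_ideal[OF p])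
  have "s \<ominus>\<^bsub>padic_Cauchy_ring p\<^esub> t = (\<lambda>n. s n - t n)" using padic_Cauchy_ring_uminus[OF p c(2)] by (simp add: a_minus_def)
  then show ?thesis using I.quotient_eq_iff_same_a_r_cos[OF padic_null_ideal[OF p], of s t] c by (simp add: padic_class_def)
qed

lemma padic_class_zero: assumes p: "prime p" shows "\<zero>\<^bsub>Qp p\<^esub> = padic_class p (\<lambda>n. 0)"
proof -
  interpret ring_hom_ring "padic_Cauchy_ring p" "Qp p" "padic_class p" by (rule padic_class_hom[OF p])
  show ?thesis using hom_zero by simp
qed

lemma padic_class_carrier: assumes p: "prime p" and "padic_Cauchy p s" shows "padic_class p s \<in> carrier (Qp p)"
proof -
  interpret ring_hom_ring "padic_Cauchy_ring p" "Qp p" "padic_class p" by (rule padic_class_hom[OF p])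
  show ?thesis using hom_closed assms by simp
qed

text \<open>A single integral member of a coset represents the whole coset, so p-adic integers may
  be handled as integer sequences.\<close>

lemma Zp_iff:
  assumes p: "prime p"
  shows "X \<in> Zp p \<longleftrightarrow> (\<exists>s :: nat \<Rightarrow> int. padic_Cauchy p (\<lambda>n. of_int (s n)) \<and> X = padic_class p (\<lambda>n. of_int (s n)))"
proof -
  interpret I: ideal "{s. padic_null p s}" "padic_Cauchy_ring p" by (rule padic_null_ideal[OF p])
  show ?thesis
  proof
    assume "X \<in> Zp p"
    then obtain s where X: "X \<in> carrier (Qp p)" and s: "s \<in> X" "\<And>n. s n \<in> \<int>" unfolding Zp_def by blast
    obtain t where t: "padic_Cauchy p t" "X = padic_class p t" using X unfolding Qp_def FactRing_def A_RCOSETS_def' padic_class_def by auto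
    have sc: "padic_Cauchy p s" using s(1) t I.a_r_coset_subset_G[OF I.a_subset, of t] by (auto simp: padic_class_def)
    have "X = padic_class p s" using I.a_repr_independence'[of s t] s(1) t by (simp add: padic_class_def)
    moreover have "s n = of_int \<lfloor>s n\<rfloor>" for n using s(2)[of n] by (auto elim: Ints_cases)
    then have "s = (\<lambda>n. of_int \<lfloor>s n\<rfloor>)" by blast
    ultimately show "\<exists>s :: nat \<Rightarrow> int. padic_Cauchy p (\<lambda>n. of_int (s n)) \<and> X = padic_class p (\<lambda>n. of_int (s n))" using sc by metis
  next
    assume "\<exists>s :: nat \<Rightarrow> int. padic_Cauchy p (\<lambda>n. of_int (s n)) \<and> X = padic_class p (\<lambda>n. of_int (s n))"
    then obtain s :: "nat \<Rightarrow> int" where s: "padic_Cauchy p (\<lambda>n. of_int (s n))" "X = padic_class p (\<lambda>n. of_int (s n))" by blast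
    have "(\<lambda>n. of_int (s n)) \<in> X" using I.a_rcos_self[of "\<lambda>n. of_int (s n)"] s by (simp add: padic_class_def)
    moreover have "\<forall>n. (of_int (s n) :: rat) \<in> \<int>" by simp
    ultimately have "\<exists>s\<in>X. \<forall>n. s n \<in> \<int>" by (intro bexI[of _ "\<lambda>n. of_int (s n)"])
    then show "X \<in> Zp p" using padic_class_carrier[OF p s(1)] s(2) unfolding Zp_def by simp
  qed
qed

section \<open>Compactness and the translation of the hypotheses\<close>

text \<open>Koenig's lemma on residue classes, that is, compactness of the triples of p-adic
  integers: solutions at every finite level can be chosen so that they converge.\<close>

lemma coherent_sequence:
  assumes p: "p > 0" and anti: "\<forall>k l w. k \<le> l \<longrightarrow> Q l w \<longrightarrow> Q k w" and ex: "\<forall>k. \<exists>w. Q k w"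
  shows "\<exists>W. (\<forall>k. Q k (W k)) \<and> (\<forall>k. vdvd (int p ^ k) (W (Suc k) - W k))"
proof -
  \<comment> \<open>The class of \<open>v\<close> modulo p^k contains solutions of every
    level.\<close>
  define good where "good k v \<longleftrightarrow> (\<forall>j. \<exists>w. Q j w \<and> vmod w (int p ^ k) = vmod v (int p ^ k))" for k v
  have step: "\<exists>v'. good (Suc k) v' \<and> vmod v' (int p ^ k) = vmod v (int p ^ k)" if g: "good k v" for k v
  proof (rule ccontr)
    assume no: "\<not> (\<exists>v'. good (Suc k) v' \<and> vmod v' (int p ^ k) = vmod v (int p ^ k))"
    \<comment> \<open>A level at which the class of \<open>r\<close> contains no solution. A level
      above all of these would have no solution in any of the finitely many refinements, yet the
      given class has one.\<close>
    define J where "J r = (SOME j. \<not> (\<exists>w. Q j w \<and> vmod w (int p ^ Suc k) = vmod r (int p ^ Suc k)))" for r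
    define m where "m = Max (J ` int_box (p ^ Suc k))"
    obtain w where w: "Q m w" "vmod w (int p ^ k) = vmod v (int p ^ k)" using g unfolding good_def by blast
    define r where "r = vmod w (int p ^ Suc k)"
    have rb: "r \<in> int_box (p ^ Suc k)" unfolding r_def using vmod_in_box[of "p ^ Suc k" w] p by simp
    have wr: "vmod w (int p ^ Suc k) = vmod r (int p ^ Suc k)" by (simp add: r_def)
    have "vmod r (int p ^ k) = vmod w (int p ^ k)"
    proof -
      have "vdvd (int p ^ Suc k) (r - w)" using wr by (simp only: vmod_eq_iff[symmetric])
      then have "vdvd (int p ^ k) (r - w)" by (cases "r - w") (auto intro: dvd_trans[of "int p ^ k" "int p ^ Suc k"])
      then show ?thesis by (simp only: vmod_eq_iff)
    qed
    then have "\<not> good (Suc k) r" using no w(2) by metis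
    then have "\<exists>j. \<not> (\<exists>w. Q j w \<and> vmod w (int p ^ Suc k) = vmod r (int p ^ Suc k))" unfolding good_def by blast
    then have "\<not> (\<exists>w. Q (J r) w \<and> vmod w (int p ^ Suc k) = vmod r (int p ^ Suc k))" unfolding J_def by (rule someI_ex)
    moreover have "J r \<le> m" unfolding m_def using rb by simp
    ultimately show False using anti w(1) wr by blast
  qed
  have "good 0 (0, 0, 0)" unfolding good_def using ex by (auto simp: vmod_eq_iff split_paired_all)
  then obtain V where V: "\<And>k. good k (V k)" "\<And>k. vmod (V (Suc k)) (int p ^ k) = vmod (V k) (int p ^ k)"
    using dependent_nat_choice[of good "\<lambda>k v v'. vmod v' (int p ^ k) = vmod v (int p ^ k)"] step by blast
  have "\<forall>k. \<exists>w. Q k w \<and> vmod w (int p ^ k) = vmod (V k) (int p ^ k)" using V(1) unfolding good_def by blast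
  from choice[OF this] obtain W where W: "\<And>k. Q k (W k)" "\<And>k. vmod (W k) (int p ^ k) = vmod (V k) (int p ^ k)" by blast
  have "vdvd (int p ^ k) (W (Suc k) - W k)" for k
  proof -
    have "vdvd (int p ^ Suc k) (W (Suc k) - V (Suc k))" using W(2)[of "Suc k"] by (simp only: vmod_eq_iff)
    then have "vdvd (int p ^ k) (W (Suc k) - V (Suc k))" by (cases "W (Suc k) - V (Suc k)") (auto intro: dvd_trans[of "int p ^ k" "int p ^ Suc k"])
    then have "vmod (W (Suc k)) (int p ^ k) = vmod (V (Suc k)) (int p ^ k)" by (simp only: vmod_eq_iff)
    then show ?thesis using V(2)[of k] W(2)[of k] by (simp only: vmod_eq_iff[symmetric])
  qed
  then show ?thesis using W(1) by blast
qed

lemma coherent_Cauchy: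
  fixes s :: "nat \<Rightarrow> int"
  assumes p: "prime p" and s: "\<And>k. int p ^ k dvd s (Suc k) - s k"
  shows "padic_Cauchy p (\<lambda>n. of_int (s n))"
proof -
  have N: "int p ^ k dvd s (k + i) - s k" for k i
  proof (induction i)
    case (Suc i)
    have "int p ^ k dvd int p ^ (k + i)" by (rule le_imp_power_dvd) simp
    then have "int p ^ k dvd s (Suc (k + i)) - s (k + i)" using s[of "k + i"] dvd_trans by blast
    then have "int p ^ k dvd (s (Suc (k + i)) - s (k + i)) + (s (k + i) - s k)" using Suc by (rule dvd_add)
    then show ?case by simp
  qed simp
  have "padic_dvd p k (of_int (s m) - of_int (s n))" if "m \<ge> k" "n \<ge> k" for k m n
  proof -
    have "int p ^ k dvd s m - s k" "int p ^ k dvd s n - s k" using N[of k "m - k"] N[of k "n - k"] that by auto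
    then have "int p ^ k dvd (s m - s k) - (s n - s k)" by (rule dvd_diff)
    then have "int p ^ k dvd s m - s n" by simp
    then have "padic_dvd p k (of_int (s m - s n))" by (rule padic_dvd_of_int[OF _ p])
    then show ?thesis by simp
  qed
  then show ?thesis unfolding padic_Cauchy_iff[OF p] by blast
qed

lemma form_eval_of_int: "form_eval f (of_int x, of_int y, of_int z) = of_int (form_eval f (x, y, z :: int))"
  by (simp add: form_eval_def)

text \<open>Primitivity at each level keeps the limit away from 0: if all three coordinates were
  null sequences, \<open>p\<close> would divide some vector of the sequence.\<close>

lemma padic_isotropic_imp_Zp:
  assumes p: "prime p" and iso: "padic_isotropic f p" shows "isotropic_Zp p f"
proof -
  have p0: "p > 0" using p by (rule prime_gt_0_nat)
  have anti: "\<forall>k l w. k \<le> l \<longrightarrow> \<not> vdvd (int p) w \<and> int p ^ l dvd form_eval f w \<longrightarrow> \<not> vdvd (int p) w \<and> int p ^ k dvd form_eval f w"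
    by (intro allI impI conjI; elim conjE; (assumption | rule dvd_trans[OF le_imp_power_dvd]; assumption))
  have ex: "\<forall>k. \<exists>w. \<not> vdvd (int p) w \<and> int p ^ k dvd form_eval f w" using iso unfolding padic_isotropic_def by blast
  obtain W where W: "\<And>k. \<not> vdvd (int p) (W k) \<and> int p ^ k dvd form_eval f (W k)" "\<And>k. vdvd (int p ^ k) (W (Suc k) - W k)"
    using coherent_sequence[of p "\<lambda>k w. \<not> vdvd (int p) w \<and> int p ^ k dvd form_eval f w", OF p0 anti ex] by blast
  define a b c where "a k = fst (W k)" and "b k = fst (snd (W k))" and "c k = snd (snd (W k))" for k
  then have abc: "W k = (a k, b k, c k)" for k by simp
  have co: "padic_Cauchy p (\<lambda>n. of_int (a n))" "padic_Cauchy p (\<lambda>n. of_int (b n))" "padic_Cauchy p (\<lambda>n. of_int (c n))"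
    using W(2) by (auto intro!: coherent_Cauchy[OF p] simp: abc)
  let ?w = "(padic_class p (\<lambda>n. of_int (a n)), padic_class p (\<lambda>n. of_int (b n)), padic_class p (\<lambda>n. of_int (c n)))"
  have z: "padic_Cauchy p (\<lambda>n. 0)" using padic_Cauchy_const[OF p] .
  have "?w \<in> Zp p \<times> Zp p \<times> Zp p" using co Zp_iff[OF p] by blast
  moreover have "form_eval_in (Qp p) f ?w = \<zero>\<^bsub>Qp p\<^esub>"
  proof -
    have "padic_dvd p k (form_eval f (of_int (a n), of_int (b n), of_int (c n)))" if "n \<ge> k" for k n
    proof -
      have "int p ^ k dvd form_eval f (W n)" using W(1)[of n] that by (metis dvd_trans le_imp_power_dvd)
      then show ?thesis unfolding form_eval_of_int abc by (rule padic_dvd_of_int[OF _ p])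
    qed
    then have "padic_null p (\<lambda>n. form_eval f (of_int (a n), of_int (b n), of_int (c n)) - 0)" unfolding padic_null_iff[OF p] diff_0_right by blast
    then show ?thesis unfolding form_eval_in_Qp(1)[OF p co] padic_class_zero[OF p] padic_class_eq_iff[OF p form_eval_in_Qp(2)[OF p co] z] .
  qed
  moreover have "?w \<noteq> (\<zero>\<^bsub>Qp p\<^esub>, \<zero>\<^bsub>Qp p\<^esub>, \<zero>\<^bsub>Qp p\<^esub>)"
  proof
    assume "?w = (\<zero>\<^bsub>Qp p\<^esub>, \<zero>\<^bsub>Qp p\<^esub>, \<zero>\<^bsub>Qp p\<^esub>)"
    then have n: "padic_null p (\<lambda>n. of_int (a n))" "padic_null p (\<lambda>n. of_int (b n))" "padic_null p (\<lambda>n. of_int (c n))"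
      using padic_class_eq_iff[OF p co(1) z] padic_class_eq_iff[OF p co(2) z] padic_class_eq_iff[OF p co(3) z] by (simp_all add: padic_class_zero[OF p])
    obtain N1 where N1: "\<forall>n\<ge>N1. padic_dvd p 1 (of_int (a n))" using n(1) unfolding padic_null_iff[OF p] by blast
    obtain N2 where N2: "\<forall>n\<ge>N2. padic_dvd p 1 (of_int (b n))" using n(2) unfolding padic_null_iff[OF p] by blast
    obtain N3 where N3: "\<forall>n\<ge>N3. padic_dvd p 1 (of_int (c n))" using n(3) unfolding padic_null_iff[OF p] by blast
    have "vdvd (int p) (W (N1 + N2 + N3))" using N1 N2 N3 by (simp add: abc padic_dvd_of_int_iff[OF p])
    then show False using W(1) by blast
  qed
  ultimately show ?thesis unfolding isotropic_Zp_def by (intro bexI[of _ ?w] conjI)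
qed

text \<open>Compactness turns the congruences for n p^(2m) into a convergent vector, and division by
  p^m gives a representation of \<open>n\<close> over the field. The ADC property replaces it by an
  integral one, which is then read modulo p^k.\<close>

lemma ADC_Zp_padic_rep:
  assumes p: "prime p" and adc: "ADC_Zp p f" and rep: "padic_rep_rat f p n" shows "padic_rep f p n"
proof -
  obtain m where m: "padic_rep f p (n * (int p ^ m)\<^sup>2)" using padic_rep_rat_prime_power[OF p rep] by blast
  have p0: "p > 0" using p by (rule prime_gt_0_nat)
  have anti: "\<forall>k l w. k \<le> l \<longrightarrow> int p ^ l dvd form_eval f w - n * (int p ^ m)\<^sup>2 \<longrightarrow> int p ^ k dvd form_eval f w - n * (int p ^ m)\<^sup>2"
    by (intro allI impI) (rule dvd_trans[OF le_imp_power_dvd])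
  have ex: "\<forall>k. \<exists>w. int p ^ k dvd form_eval f w - n * (int p ^ m)\<^sup>2" using m unfolding padic_rep_def by blast
  obtain W where W: "\<And>k. int p ^ k dvd form_eval f (W k) - n * (int p ^ m)\<^sup>2" "\<And>k. vdvd (int p ^ k) (W (Suc k) - W k)"
    using coherent_sequence[of p "\<lambda>k w. int p ^ k dvd form_eval f w - n * (int p ^ m)\<^sup>2", OF p0 anti ex] by blast
  define a b c where "a k = fst (W k)" and "b k = fst (snd (W k))" and "c k = snd (snd (W k))" for k
  then have abc: "W k = (a k, b k, c k)" for k by simp
  \<comment> \<open>The scalar that divides the limit vector by p^m; it is what makes the vector
    only rational and the ADC property applicable.\<close>
  define q :: rat where "q = 1 / of_nat p ^ m"
  have co: "padic_Cauchy p (\<lambda>n. q * of_int (a n))" "padic_Cauchy p (\<lambda>n. q * of_int (b n))" "padic_Cauchy p (\<lambda>n. q * of_int (c n))"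
    using W(2) by (auto intro!: padic_Cauchy_mult[OF p] padic_Cauchy_const[OF p] coherent_Cauchy[OF p] simp: abc)
  let ?w = "(padic_class p (\<lambda>n. q * of_int (a n)), padic_class p (\<lambda>n. q * of_int (b n)), padic_class p (\<lambda>n. q * of_int (c n)))"
  let ?x = "padic_class p (\<lambda>k. of_int n)"
  have nc: "padic_Cauchy p (\<lambda>k. of_int n)" by (rule padic_Cauchy_const[OF p])
  have xZ: "?x \<in> Zp p" unfolding Zp_iff[OF p] using nc by (intro exI[of _ "\<lambda>_. n"]) simp
  have wQ: "?w \<in> carrier (Qp p) \<times> carrier (Qp p) \<times> carrier (Qp p)" using padic_class_carrier[OF p] co by blast
  have "?x = form_eval_in (Qp p) f ?w"
  proof -
    have p0: "(of_nat p :: rat) \<noteq> 0" using p0 by simp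
    have "padic_dvd p k (of_int n - form_eval f (q * of_int (a i), q * of_int (b i), q * of_int (c i)))" if "i \<ge> k + 2 * m" for k i
    proof (rule padic_dvd_cancel[OF p])
      have "int p ^ (k + 2 * m) dvd form_eval f (W i) - n * (int p ^ m)\<^sup>2" using W(1)[of i] that by (metis dvd_trans le_imp_power_dvd)
      then have "int p ^ (k + 2 * m) dvd n * (int p ^ m)\<^sup>2 - form_eval f (W i)" by (metis dvd_minus_iff minus_diff_eq)
      then have "padic_dvd p (k + 2 * m) (of_int (n * (int p ^ m)\<^sup>2 - form_eval f (W i)))" by (rule padic_dvd_of_int[OF _ p])
      moreover have "of_int (n * (int p ^ m)\<^sup>2 - form_eval f (W i)) = of_nat p ^ (2 * m) * (of_int n - form_eval f (q * of_int (a i), q * of_int (b i), q * of_int (c i)))"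
      proof -
        have "form_eval f (q * of_int (a i), q * of_int (b i), q * of_int (c i)) = q\<^sup>2 * of_int (form_eval f (W i))"
          by (simp add: abc form_eval_def power2_eq_square algebra_simps)
        moreover have "of_nat p ^ (2 * m) * q\<^sup>2 = (1 :: rat)" using p0 by (simp add: q_def power_mult[symmetric] power_one_over mult.commute[of 2])
        ultimately have "of_nat p ^ (2 * m) * form_eval f (q * of_int (a i), q * of_int (b i), q * of_int (c i)) = of_int (form_eval f (W i))"
          by (simp add: mult.assoc[symmetric])
        then show ?thesis by (simp add: right_diff_distrib power_mult[symmetric] mult.commute[of 2])
      qed
      ultimately show "padic_dvd p (k + 2 * m) (of_nat p ^ (2 * m) * (of_int n - form_eval f (q * of_int (a i), q * of_int (b i), q * of_int (c i))))" by simp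
    qed
    then have "padic_null p (\<lambda>i. of_int n - form_eval f (q * of_int (a i), q * of_int (b i), q * of_int (c i)))" unfolding padic_null_iff[OF p] by blast
    then show ?thesis unfolding form_eval_in_Qp(1)[OF p co] padic_class_eq_iff[OF p nc form_eval_in_Qp(2)[OF p co]] .
  qed
  then have "\<exists>w\<in>carrier (Qp p) \<times> carrier (Qp p) \<times> carrier (Qp p). ?x = form_eval_in (Qp p) f w" using wQ by (rule bexI)
  with bspec[OF adc[unfolded ADC_Zp_def] xZ] have "\<exists>w'\<in>Zp p \<times> Zp p \<times> Zp p. ?x = form_eval_in (Qp p) f w'" by (rule mp)
  then obtain w' where w': "w' \<in> Zp p \<times> Zp p \<times> Zp p" "?x = form_eval_in (Qp p) f w'" by (rule bexE)
  obtain X Y Z where X: "w' = (X, Y, Z)" by (metis prod_cases3)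
  have XYZ: "w' = (X, Y, Z)" "X \<in> Zp p" "Y \<in> Zp p" "Z \<in> Zp p" using w'(1) X by simp_all
  obtain x y z :: "nat \<Rightarrow> int" where x: "padic_Cauchy p (\<lambda>n. of_int (x n))" "X = padic_class p (\<lambda>n. of_int (x n))"
    and y: "padic_Cauchy p (\<lambda>n. of_int (y n))" "Y = padic_class p (\<lambda>n. of_int (y n))"
    and z: "padic_Cauchy p (\<lambda>n. of_int (z n))" "Z = padic_class p (\<lambda>n. of_int (z n))" using XYZ(2-4) unfolding Zp_iff[OF p] by blast
  have "padic_null p (\<lambda>i. of_int n - form_eval f (of_int (x i), of_int (y i), of_int (z i)))"
    using w'(2) unfolding XYZ(1) x(2) y(2) z(2) form_eval_in_Qp(1)[OF p x(1) y(1) z(1)] padic_class_eq_iff[OF p nc form_eval_in_Qp(2)[OF p x(1) y(1) z(1)]] .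
  then have nul: "padic_null p (\<lambda>i. of_int (n - form_eval f (x i, y i, z i)))" by (simp add: form_eval_of_int)
  show ?thesis unfolding padic_rep_def
  proof
    fix k
    obtain N where "padic_dvd p k (of_int (n - form_eval f (x N, y N, z N)))" using nul unfolding padic_null_iff[OF p] by blast
    then have "int p ^ k dvd n - form_eval f (x N, y N, z N)" unfolding padic_dvd_of_int_iff[OF p] .
    then have "int p ^ k dvd form_eval f (x N, y N, z N) - n" by (metis dvd_minus_iff minus_diff_eq)
    then show "\<exists>w. int p ^ k dvd form_eval f w - n" by blast
  qed
qed

section \<open>The 2-adic valuation of the density\<close>

lemma dyadic_order_mult: "dyadic_order i x \<Longrightarrow> dyadic_order j y \<Longrightarrow> dyadic_order (i + j) (x * y)"
proof -
  assume "dyadic_order i x" "dyadic_order j y"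
  then obtain a b c d where 1: "odd a" "odd b" "x = of_int a / (2 ^ i * of_int b)" and 2: "odd c" "odd d" "y = of_int c / (2 ^ j * of_int d)"
    unfolding dyadic_order_def by blast
  have "x * y = of_int (a * c) / (2 ^ (i + j) * of_int (b * d))" unfolding 1(3) 2(3) by (simp add: power_add mult_ac)
  moreover have "odd (a * c)" "odd (b * d)" using 1 2 by simp_all
  ultimately show ?thesis unfolding dyadic_order_def by blast
qed

lemma dyadic_order_prod:
  assumes "finite S" "\<And>s. s \<in> S \<Longrightarrow> dyadic_order (i s) (x s)"
  shows "dyadic_order (\<Sum>s\<in>S. i s) (\<Prod>s\<in>S. x s)"
  using assms
proof (induction S rule: finite_induct)
  case empty
  have "(1::real) = of_int 1 / (2 ^ 0 * of_int 1)" by simp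
  then show ?case unfolding dyadic_order_def sum.empty prod.empty by (intro exI[of _ 1]) simp
next
  case (insert s S)
  then show ?case by (simp add: dyadic_order_mult)
qed

lemma dyadic_order_padic_val:
  assumes "dyadic_order i x" obtains q where "x = of_rat q" "padic_val 2 q = - int i"
proof -
  obtain a b where ab: "odd a" "odd b" "x = of_int a / (2 ^ i * of_int b)" using assms unfolding dyadic_order_def by blast
  have nz: "a \<noteq> 0" "2 ^ i * b \<noteq> 0" using ab by auto
  have "multiplicity 2 a = 0" "multiplicity 2 b = 0" using ab by (simp_all add: not_dvd_imp_multiplicity_0)
  moreover have "multiplicity 2 (2 ^ i * b) = multiplicity 2 (2 ^ i :: int) + multiplicity 2 b"
    using nz by (intro prime_elem_multiplicity_mult_distrib) (auto simp: prime_imp_prime_elem)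
  moreover have "multiplicity 2 (2 ^ i :: int) = i" by (intro multiplicity_same_power) auto
  ultimately have "padic_val 2 (of_int a / of_int (2 ^ i * b)) = - int i"
    using padic_val_fraction[OF two_is_prime_nat nz] by simp
  moreover have "x = of_rat (of_int a / of_int (2 ^ i * b))" unfolding ab(3) by (simp add: of_rat_divide of_rat_mult of_rat_power)
  ultimately show ?thesis using that by blast
qed

text \<open>An isotropic form represents everything over the p-adic field, and the ADC property
  brings every integer down to an integral representation.\<close>

lemma local_density_isotropic_ADC:
  assumes p: "prime p" and iso: "padic_isotropic f p" and D: "gram_det f \<noteq> 0" and adc: "ADC_Zp p f"
  shows "local_density f p = 1"
proof -
  have "padic_rep f p n" for n using ADC_Zp_padic_rep[OF p adc] isotropic_padic_rep_rat[OF p iso D] by blast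
  then have all: "{n\<in>{0..<int (p ^ k)}. padic_rep f p n} = {0..<int (p ^ k)}" for k by auto
  have "(\<lambda>k. real (card {n\<in>{0..<int (p ^ k)}. padic_rep f p n}) / real (p ^ k)) = (\<lambda>k. 1)"
    unfolding all using prime_gt_0_nat[OF p] by (simp del: of_nat_power)
  then have "(\<lambda>k. 1) \<longlonglongrightarrow> local_density f p" using padic_rep_density[OF p, of f] by (simp only:)
  then show ?thesis by (simp add: LIMSEQ_const_iff)
qed

lemma local_density_dyadic_order:
  assumes pd: "positive_definite f" and p: "prime p" and adc2: "ADC_Zp 2 f"
    and adc: "[p = 3] (mod 4) \<Longrightarrow> isotropic_Zp p f \<Longrightarrow> ADC_Zp p f"
  shows "\<exists>i. dyadic_order i (local_density f p) \<and> (\<not> padic_isotropic f p \<longrightarrow> i \<ge> 1)"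
proof -
  have D: "gram_det f \<noteq> 0" using positive_definite_minors[OF pd] by simp
  have one: "dyadic_order 0 1" unfolding dyadic_order_def by (intro exI[of _ 1]) simp
  show ?thesis
  proof (cases "padic_isotropic f p")
    case iso: True
    have "dyadic_order 0 (local_density f p)"
    proof (cases "[p = 1] (mod 4)")
      case True
      then show ?thesis using local_density_isotropic_1_mod_4[OF p _ iso D] by blast
    next
      case False
      have "ADC_Zp p f"
      proof (cases "p = 2")
        case True
        then show ?thesis using adc2 by simp
      next
        case p2: False
        have "odd p" using p p2 primes_dvd_imp_eq two_is_prime_nat by blast
        then have "p mod 4 = 1 \<or> p mod 4 = 3" by presburger
        then have "[p = 3] (mod 4)" using False by (simp add: cong_iff)
        then show ?thesis using adc padic_isotropic_imp_Zp[OF p iso] by blast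
      qed
      then show ?thesis using local_density_isotropic_ADC[OF p iso D] one by simp
    qed
    then show ?thesis using iso by blast
  next
    case an: False
    have "\<exists>i\<ge>1. dyadic_order i (local_density f p)"
    proof (cases "p = 2")
      case True
      then show ?thesis using local_density_dyadic_anisotropic[OF pd] an ADC_Zp_padic_rep[OF two_is_prime_nat adc2] by blast
    next
      case p2: False
      have "odd p" using p p2 primes_dvd_imp_eq two_is_prime_nat by blast
      then show ?thesis using local_density_odd_anisotropic[OF pd p _ an] by blast
    qed
    then show ?thesis by blast
  qed
qed

text \<open>Convergence is asserted together with the valuation because \<open>lim\<close> has no
  specified value on a divergent sequence.\<close>

theorem theorem6p3:
  fixes f :: ternary_form and U :: "nat set"
  assumes "positive_definite f"
    and "U = {p. prime p \<and> [p = 3] (mod 4) \<and> isotropic_Zp p f}"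
    and "ADC_Zp 2 f"
    and "\<forall>p\<in>U. ADC_Zp p f"
  shows "convergent (density_seq f) \<and> (\<exists>q. density f = of_rat q \<and> padic_val 2 q < 0)"
proof -
  define S where "S = {p. prime p \<and> int p dvd gram_det f}"
  have D: "gram_det f > 0" using positive_definite_minors[OF assms(1)] by simp
  have fin: "finite S"
  proof (rule finite_subset)
    show "S \<subseteq> {..nat (gram_det f)}"
    proof
      fix p assume "p \<in> S"
      then have "int p \<le> gram_det f" using D by (intro zdvd_imp_le) (auto simp: S_def)
      then show "p \<in> {..nat (gram_det f)}" by simp
    qed
  qed simp
  have lim: "density_seq f \<longlonglongrightarrow> (\<Prod>p\<in>S. local_density f p)" unfolding S_def by (rule density_seq_tendsto[OF assms(1)])
  have "\<exists>i. dyadic_order i (local_density f p) \<and> (\<not> padic_isotropic f p \<longrightarrow> i \<ge> 1)" if "p \<in> S" for p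
  proof (rule local_density_dyadic_order[OF assms(1) _ assms(3)])
    show "prime p" using that by (simp add: S_def)
    then show "[p = 3] (mod 4) \<Longrightarrow> isotropic_Zp p f \<Longrightarrow> ADC_Zp p f" using assms(2,4) by blast
  qed
  then obtain i where i: "\<And>p. p \<in> S \<Longrightarrow> dyadic_order (i p) (local_density f p) \<and> (\<not> padic_isotropic f p \<longrightarrow> i p \<ge> 1)" by metis
  have ord: "dyadic_order (\<Sum>p\<in>S. i p) (\<Prod>p\<in>S. local_density f p)" using dyadic_order_prod[OF fin] i by blast
  obtain r where r: "prime r" "\<not> padic_isotropic f r" using exists_anisotropic_prime[OF assms(1)] by blast
  \<comment> \<open>A form is isotropic at every prime not dividing its determinant, so the
    anisotropic prime is one of the finitely many factors of the product.\<close>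
  then have rS: "r \<in> S" using padic_isotropic_good by (auto simp: S_def)
  then have "1 \<le> i r" using i r(2) by blast
  also have "i r \<le> (\<Sum>p\<in>S. i p)" using rS fin by (intro member_le_sum) auto
  finally have pos: "(\<Sum>p\<in>S. i p) \<ge> 1" .
  have "density f = (\<Prod>p\<in>S. local_density f p)" unfolding Defs.density_def using lim by (rule limI)
  moreover obtain q where q: "(\<Prod>p\<in>S. local_density f p) = of_rat q" "padic_val 2 q = - int (\<Sum>p\<in>S. i p)" using dyadic_order_padic_val[OF ord] by blast
  moreover have "padic_val 2 q < 0" unfolding q(2) using pos by (simp only: neg_less_0_iff_less of_nat_0_less_iff)
  ultimately have "density f = of_rat q" "padic_val 2 q < 0" by simp_all
  then show ?thesis using lim convergentI by blast
qed

end
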